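(* Let $Z$ be an irreducible normal affine variety with an uncontracting action of a quasitorus $Q$, and let $\pi\colon Z\to Z/\!/Q$ be the quotient morphism. Suppose that the $Q$-variety $Z$ is factorially graded and that the quotient space $X=Z/\!/Q$ has the Cox realization $q\colon\overline{X}\to X$. Let $N$ be the Neron-Severi quasitorus of $X$. Then there exist a surjective homomorphism $\mu\colon Q\to N$ and a dominant morphism $\nu\colon Z\to\overline{X}$ such that $\nu(gz)=\mu(g)\nu(z)$ for all $g\in Q$, $z\in Z$, and $q\circ\nu=\pi$. Moreover, the homomorphism $\mu$ is unique, and the morphism $\nu$ is determined up to composition with the automorphism of $Z$ defined by an element of $Q$ (that is, if $\nu,\nu'$ are two such morphisms, then there is $g\in Q$ with $\nu'(z)=\nu(gz)$ for all $z\in Z$).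
   Context: $\mathbb{K}$ is an algebraically closed field of characteristic zero. A quasitorus is an algebraic group isomorphic to the direct product of a torus and a finite abelian group. For a quasitorus $Q$ acting on an affine variety $Z$, $Z/\!/Q:=\mathrm{Spec}\,\mathbb{K}[Z]^Q$. The action is called uncontracting if for any prime divisor $D\subset Z$ the closure $\overline{\pi(D)}$ of its image under the quotient morphism $\pi\colon Z\to Z/\!/Q$ has codimension $\le 1$ in $Z/\!/Q$. Graded factoriality. Let $M$ be a finitely generated abelian group and $R=\bigoplus_{u\in M}R_u$ an $M$-graded algebra. A nonzero homogeneous noninvertible element $a\in R$ is $M$-irreducible if $a=bc$ with $b,c$ homogeneous implies that $b$ or $c$ is invertible. $R$ is factorially graded if it contains no nonconstant homogeneous invertible elements and each nonconstant (nonzero) homogeneous element is a product of $M$-irreducible elements, uniquely up to association and order of factors. The $Q$-variety $Z$ is factorially graded if $\mathbb{K}[Z]$, graded by the character group $\mathfrak{X}(Q)$ via weight subspaces, is factorially graded. Cox ring. Let $X$ be an irreducible normal variety with finitely generated divisor class group $\mathrm{Cl}(X)$ and $\mathbb{K}[X]^\times=\mathbb{K}^\times$. For a Weil divisor $D$ put $\mathcal{O}(X,D)=\{f\in\mathbb{K}(X)\mid \mathrm{div}(f)+D\ge 0\}$ (with $f=0$ included). Let $K\subset\mathrm{WDiv}(X)$ be a finitely generated subgroup projecting surjectively onto $\mathrm{Cl}(X)$, $K^0$ the kernel of $K\to\mathrm{Cl}(X)$, and $T_K(X)=\bigoplus_{D\in K}\mathcal{O}(X,D)$ with multiplication induced by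 that of rational functions. Choose a coherent set $\mathcal{F}=\{F_D\in\mathbb{K}(X)^\times : D\in K^0\}$, i.e. $\mathrm{div}(F_D)=D$ and $F_{D+D'}=F_DF_{D'}$. Let $I(K,\mathcal{F})$ be the ideal of $T_K(X)$ spanned by all $f-F_{D_1-D_2}f$ with $D_1,D_2\in K$, $D_1-D_2\in K^0$, $f\in\mathcal{O}(X,D_1)$ (where $F_{D_1-D_2}f$ is taken in $\mathcal{O}(X,D_2)$). The Cox ring is $R(X)=T_K(X)/I(K,\mathcal{F})$; it is naturally graded by $K/K^0\cong\mathrm{Cl}(X)$, $R(X)_0=\mathbb{K}[X]$, and it does not depend on $K,\mathcal{F}$ up to isomorphism. Cox realization. The Neron-Severi quasitorus $N$ of $X$ is the quasitorus with character group identified with $\mathrm{Cl}(X)$; it acts on $R(X)$ so that $R(X)_u$ is the weight subspace of weight $u$. If $X$ is affine and $R(X)$ is finitely generated, put $\overline{X}=\mathrm{Spec}\,R(X)$; the quotient morphism $q\colon\overline{X}\to\overline{X}/\!/N=\mathrm{Spec}\,R(X)_0=X$ is called the Cox realization of $X$. "$X$ has the Cox realization" means that these conditions hold: $X$ is normal and affine, $\mathbb{K}[X]^\times=\mathbb{K}^\times$, $\mathrm{Cl}(X)$ is finitely generated, and $R(X)$ is a finitely generated algebra. *)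

theory Defs
  imports
    "HOL-Computational_Algebra.Polynomial"
    "HOL-Analysis.Abstract_Topology"
    "HOL-Library.Extended_Nat"
    "HOL-Algebra.Algebra"
    "HOL-Algebra.Algebraic_Closure_Type"
    "HOL-Algebra.Free_Abelian_Groups"
begin

text \<open>
  The ground field is a type of class \<open>alg_closed_field\<close> and \<open>field_char_0\<close>; as a ring record it is
  \<open>ring_of_type_algebra\<close>. Algebras over it are records of type \<open>('k, 'a) module\<close>. Functions
  on a set are represented by functions that are extensional on that set.
\<close>

definition scalars :: "('k, 'a) module \<Rightarrow> 'a set" where
  "scalars A = range (\<lambda>c. c \<odot>\<^bsub>A\<^esub> \<one>\<^bsub>A\<^esub>)"

definition finitely_generated_algebra :: "('k, 'a) module \<Rightarrow> bool" where
  "finitely_generated_algebra A \<longleftrightarrow>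
     (\<exists>S. finite S \<and> S \<subseteq> carrier A \<and> generate_ring A (S \<union> scalars A) = carrier A)"

definition finitely_generated_group :: "'a monoid \<Rightarrow> bool" where
  "finitely_generated_group G \<longleftrightarrow>
     (\<exists>S. finite S \<and> S \<subseteq> carrier G \<and> generate G S = carrier G)"

definition alg_homs :: "('k::field, 'a) module \<Rightarrow> ('a \<Rightarrow> 'k) set" where
  "alg_homs A = {x \<in> ring_hom A ring_of_type_algebra \<inter> extensional (carrier A).
                   \<forall>c. \<forall>a\<in>carrier A. x (c \<odot>\<^bsub>A\<^esub> a) = c * x a}"

definition quotient_algebra :: "('k, 'a) module \<Rightarrow> 'a set \<Rightarrow> ('k, 'a set) module" where
  "quotient_algebra A I =
     \<lparr>carrier = carrier (A Quot I), monoid.mult = monoid.mult (A Quot I), one = one (A Quot I),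
      ring.zero = ring.zero (A Quot I), add = add (A Quot I),
      module.smult = (\<lambda>c x. \<Union>a\<in>x. I +>\<^bsub>A\<^esub> (c \<odot>\<^bsub>A\<^esub> a))\<rparr>"

text \<open>
  Varieties are taken in the classical sense, by their sets of closed points. An affine variety
  is a set of points with a finitely generated algebra of functions such that the points
  correspond, by evaluation, to the algebra homomorphisms to the ground field.
\<close>

record ('p, 'k) variety =
  points :: "'p set"
  regs :: "('p \<Rightarrow> 'k) set"

definition coordinate_algebra :: "('p, 'k::field) variety \<Rightarrow> ('k, 'p \<Rightarrow> 'k) module" where
  "coordinate_algebra V =
     \<lparr>carrier = regs V,
      monoid.mult = (\<lambda>f g. \<lambda>p\<in>points V. f p * g p), one = (\<lambda>p\<in>points V. 1),
      ring.zero = (\<lambda>p\<in>points V. 0), add = (\<lambda>f g. \<lambda>p\<in>points V. f p + g p),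
      module.smult = (\<lambda>c f. \<lambda>p\<in>points V. c * f p)\<rparr>"

definition eval_at :: "('p, 'k) variety \<Rightarrow> 'p \<Rightarrow> ('p \<Rightarrow> 'k) \<Rightarrow> 'k" where
  "eval_at V p = (\<lambda>f\<in>regs V. f p)"

definition affine_variety :: "('p, 'k::field) variety \<Rightarrow> bool" where
  "affine_variety V \<longleftrightarrow>
     regs V \<subseteq> extensional (points V) \<and>
     algebra ring_of_type_algebra (coordinate_algebra V) \<and>
     finitely_generated_algebra (coordinate_algebra V) \<and>
     bij_betw (eval_at V) (points V) (alg_homs (coordinate_algebra V))"

definition spec_function :: "('k::field, 'a) module \<Rightarrow> 'a \<Rightarrow> ('a \<Rightarrow> 'k) \<Rightarrow> 'k" where
  "spec_function A a = (\<lambda>x\<in>alg_homs A. x a)"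

text \<open>
  The variety \<open>Spec A\<close>. Over an algebraically closed field the closed points of a finitely
  generated algebra are its homomorphisms to the field (Nullstellensatz).
\<close>

definition spec :: "('k::field, 'a) module \<Rightarrow> ('a \<Rightarrow> 'k, 'k) variety" where
  "spec A = \<lparr>points = alg_homs A, regs = spec_function A ` carrier A\<rparr>"

definition morphism :: "('p, 'k) variety \<Rightarrow> ('q, 'k) variety \<Rightarrow> ('p \<Rightarrow> 'q) \<Rightarrow> bool" where
  "morphism V W \<phi> \<longleftrightarrow>
     \<phi> \<in> points V \<rightarrow> points W \<and> (\<forall>f\<in>regs W. (\<lambda>p\<in>points V. f (\<phi> p)) \<in> regs V)"

definition product_variety ::
    "('p, 'k::field) variety \<Rightarrow> ('q, 'k) variety \<Rightarrow> ('p \<times> 'q, 'k) variety" where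
  "product_variety V W =
     \<lparr>points = points V \<times> points W,
      regs = {\<lambda>p\<in>points V \<times> points W. \<Sum>i<n. f i (fst p) * g i (snd p) | (n::nat) f g.
                (\<forall>i<n. f i \<in> regs V \<and> g i \<in> regs W)}\<rparr>"

definition zariski :: "('p, 'k::zero) variety \<Rightarrow> 'p topology" where
  "zariski V = topology (\<lambda>U. \<exists>S\<subseteq>regs V. U = {p \<in> points V. \<exists>f\<in>S. f p \<noteq> 0})"

definition irreducible_closed :: "('p, 'k::zero) variety \<Rightarrow> 'p set \<Rightarrow> bool" where
  "irreducible_closed V Y \<longleftrightarrow>
     closedin (zariski V) Y \<and> Y \<noteq> {} \<and>
     (\<forall>A B. closedin (zariski V) A \<and> closedin (zariski V) B \<and> Y \<subseteq> A \<union> B \<longrightarrow> Y \<subseteq> A \<or> Y \<subseteq> B)"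

definition irreducible_variety :: "('p, 'k::zero) variety \<Rightarrow> bool" where
  "irreducible_variety V \<longleftrightarrow> irreducible_closed V (points V)"

text \<open>The codimension is only meaningful for irreducible closed subsets of an irreducible variety.\<close>

definition codim :: "('p, 'k::zero) variety \<Rightarrow> 'p set \<Rightarrow> enat" where
  "codim V Y = Sup {enat n | n. \<exists>C. C 0 = Y \<and> (\<forall>i\<le>n. irreducible_closed V (C i)) \<and>
                                     (\<forall>i<n. C i \<subset> C (Suc i))}"

definition prime_divisors :: "('p, 'k::zero) variety \<Rightarrow> 'p set set" where
  "prime_divisors V = {D. irreducible_closed V D \<and> codim V D = 1}"

definition dominant :: "('p, 'k) variety \<Rightarrow> ('q, 'k::zero) variety \<Rightarrow> ('p \<Rightarrow> 'q) \<Rightarrow> bool" where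
  "dominant V W \<phi> \<longleftrightarrow> zariski W closure_of (\<phi> ` points V) = points W"

record ('g, 'k) alg_group = "'g monoid" +
  regular :: "('g \<Rightarrow> 'k) set"

definition group_variety :: "('g, 'k) alg_group \<Rightarrow> ('g, 'k) variety" where
  "group_variety G = \<lparr>points = carrier G, regs = regular G\<rparr>"

definition algebraic_group :: "('g, 'k::field) alg_group \<Rightarrow> bool" where
  "algebraic_group G \<longleftrightarrow>
     group G \<and> affine_variety (group_variety G) \<and>
     morphism (product_variety (group_variety G) (group_variety G)) (group_variety G)
       (\<lambda>(g, h). g \<otimes>\<^bsub>G\<^esub> h) \<and>
     morphism (group_variety G) (group_variety G) (\<lambda>g. inv\<^bsub>G\<^esub> g)"

definition alg_group_hom :: "('g, 'k) alg_group \<Rightarrow> ('h, 'k) alg_group \<Rightarrow> ('g \<Rightarrow> 'h) \<Rightarrow> bool" where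
  "alg_group_hom G H \<phi> \<longleftrightarrow> \<phi> \<in> hom G H \<and> morphism (group_variety G) (group_variety H) \<phi>"

definition alg_group_iso :: "('g, 'k) alg_group \<Rightarrow> ('h, 'k) alg_group \<Rightarrow> ('g \<Rightarrow> 'h) \<Rightarrow> bool" where
  "alg_group_iso G H \<phi> \<longleftrightarrow>
     alg_group_hom G H \<phi> \<and> bij_betw \<phi> (carrier G) (carrier H) \<and>
     alg_group_hom H G (inv_into (carrier G) \<phi>)"

text \<open>The regular functions on the torus are the Laurent polynomials in \<open>n\<close> variables.\<close>

definition torus :: "nat \<Rightarrow> (nat \<Rightarrow> 'k, 'k::field) alg_group" where
  "torus n =
     \<lparr>carrier = {..<n} \<rightarrow>\<^sub>E {c. c \<noteq> 0},
      monoid.mult = (\<lambda>x y. \<lambda>i\<in>{..<n}. x i * y i), one = (\<lambda>i\<in>{..<n}. 1),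
      regular = {\<lambda>x \<in> {..<n} \<rightarrow>\<^sub>E {c. c \<noteq> 0}. \<Sum>j<r. c j * (\<Prod>i<n. x i powi m j i)
                 | (r::nat) (c :: nat \<Rightarrow> 'k) (m :: nat \<Rightarrow> nat \<Rightarrow> int). True}\<rparr>"

definition finite_alg_group :: "'g monoid \<Rightarrow> ('g, 'k) alg_group" where
  "finite_alg_group F =
     \<lparr>carrier = carrier F, monoid.mult = monoid.mult F, one = one F,
      regular = carrier F \<rightarrow>\<^sub>E UNIV\<rparr>"

definition product_alg_group ::
    "('g, 'k::field) alg_group \<Rightarrow> ('h, 'k) alg_group \<Rightarrow> ('g \<times> 'h, 'k) alg_group" where
  "product_alg_group G H =
     \<lparr>carrier = carrier (G \<times>\<times> H), monoid.mult = monoid.mult (G \<times>\<times> H), one = one (G \<times>\<times> H),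
      regular = regs (product_variety (group_variety G) (group_variety H))\<rparr>"

text \<open>Every finite group has an isomorphic copy on a set of natural numbers.\<close>

definition quasitorus :: "('g, 'k::field) alg_group \<Rightarrow> bool" where
  "quasitorus Q \<longleftrightarrow>
     algebraic_group Q \<and>
     (\<exists>n (F :: nat monoid) \<phi>. comm_group F \<and> finite (carrier F) \<and>
        alg_group_iso Q (product_alg_group (torus n) (finite_alg_group F)) \<phi>)"

definition character_group :: "('g, 'k::field) alg_group \<Rightarrow> ('g \<Rightarrow> 'k) monoid" where
  "character_group G =
     \<lparr>carrier = {\<chi> \<in> regular G. \<chi> \<in> hom G (units_of ring_of_type_algebra)},
      monoid.mult = (\<lambda>\<chi> \<psi>. \<lambda>g\<in>carrier G. \<chi> g * \<psi> g), one = (\<lambda>g\<in>carrier G. 1)\<rparr>"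

definition regular_action ::
    "('g, 'k::field) alg_group \<Rightarrow> ('p, 'k) variety \<Rightarrow> ('g \<Rightarrow> 'p \<Rightarrow> 'p) \<Rightarrow> bool" where
  "regular_action G V \<rho> \<longleftrightarrow>
     group_action G (points V) \<rho> \<and>
     morphism (product_variety (group_variety G) V) V (\<lambda>(g, p). \<rho> g p)"

definition weight_space ::
    "('g, 'k::field) alg_group \<Rightarrow> ('p, 'k) variety \<Rightarrow> ('g \<Rightarrow> 'p \<Rightarrow> 'p) \<Rightarrow> ('g \<Rightarrow> 'k) \<Rightarrow> ('p \<Rightarrow> 'k) set"
  where
  "weight_space G V \<rho> \<chi> =
     {f \<in> regs V. \<forall>g\<in>carrier G. \<forall>p\<in>points V. f (\<rho> g p) = \<chi> g * f p}"

definition invariants ::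
    "('g, 'k::field) alg_group \<Rightarrow> ('p, 'k) variety \<Rightarrow> ('g \<Rightarrow> 'p \<Rightarrow> 'p) \<Rightarrow> ('p \<Rightarrow> 'k) set" where
  "invariants G V \<rho> = {f \<in> regs V. \<forall>g\<in>carrier G. \<forall>p\<in>points V. f (\<rho> g p) = f p}"

definition affine_quotient ::
    "('g, 'k::field) alg_group \<Rightarrow> ('p, 'k) variety \<Rightarrow> ('g \<Rightarrow> 'p \<Rightarrow> 'p) \<Rightarrow> (('p \<Rightarrow> 'k) \<Rightarrow> 'k, 'k) variety"
  where
  "affine_quotient G V \<rho> = spec ((coordinate_algebra V)\<lparr>carrier := invariants G V \<rho>\<rparr>)"

definition quotient_morphism ::
    "('g, 'k::field) alg_group \<Rightarrow> ('p, 'k) variety \<Rightarrow> ('g \<Rightarrow> 'p \<Rightarrow> 'p) \<Rightarrow> 'p \<Rightarrow> ('p \<Rightarrow> 'k) \<Rightarrow> 'k" where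
  "quotient_morphism G V \<rho> p = (\<lambda>f\<in>invariants G V \<rho>. f p)"

definition uncontracting ::
    "('g, 'k::field) alg_group \<Rightarrow> ('p, 'k) variety \<Rightarrow> ('g \<Rightarrow> 'p \<Rightarrow> 'p) \<Rightarrow> bool" where
  "uncontracting G V \<rho> \<longleftrightarrow>
     (\<forall>D\<in>prime_divisors V.
        codim (affine_quotient G V \<rho>)
          (zariski (affine_quotient G V \<rho>) closure_of (quotient_morphism G V \<rho> ` D)) \<le> 1)"

definition homogeneous :: "'m monoid \<Rightarrow> ('m \<Rightarrow> 'a set) \<Rightarrow> 'a set" where
  "homogeneous M gr = (\<Union>u\<in>carrier M. gr u)"

definition graded_irreducible :: "('k, 'a) module \<Rightarrow> 'm monoid \<Rightarrow> ('m \<Rightarrow> 'a set) \<Rightarrow> 'a \<Rightarrow> bool" where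
  "graded_irreducible A M gr a \<longleftrightarrow>
     a \<in> homogeneous M gr \<and> a \<noteq> \<zero>\<^bsub>A\<^esub> \<and> a \<notin> Units A \<and>
     (\<forall>b\<in>homogeneous M gr. \<forall>c\<in>homogeneous M gr.
        a = b \<otimes>\<^bsub>A\<^esub> c \<longrightarrow> b \<in> Units A \<or> c \<in> Units A)"

definition graded_factorization ::
    "('k, 'a) module \<Rightarrow> 'm monoid \<Rightarrow> ('m \<Rightarrow> 'a set) \<Rightarrow> 'a list \<Rightarrow> 'a \<Rightarrow> bool" where
  "graded_factorization A M gr as a \<longleftrightarrow>
     (\<forall>b\<in>set as. graded_irreducible A M gr b) \<and> foldr (\<otimes>\<^bsub>A\<^esub>) as \<one>\<^bsub>A\<^esub> = a"

definition factorially_graded :: "('k, 'a) module \<Rightarrow> 'm monoid \<Rightarrow> ('m \<Rightarrow> 'a set) \<Rightarrow> bool" where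
  "factorially_graded A M gr \<longleftrightarrow>
     homogeneous M gr \<inter> Units A \<subseteq> scalars A \<and>
     (\<forall>a \<in> homogeneous M gr - scalars A.
        (\<exists>as. graded_factorization A M gr as a) \<and>
        (\<forall>as bs. graded_factorization A M gr as a \<and> graded_factorization A M gr bs a \<longrightarrow>
                 essentially_equal A as bs))"

definition factorially_graded_variety ::
    "('g, 'k::field) alg_group \<Rightarrow> ('p, 'k) variety \<Rightarrow> ('g \<Rightarrow> 'p \<Rightarrow> 'p) \<Rightarrow> bool" where
  "factorially_graded_variety Q V \<rho> \<longleftrightarrow>
     factorially_graded (coordinate_algebra V) (character_group Q) (weight_space Q V \<rho>)"

definition fraction_rel :: "('k, 'a) module \<Rightarrow> (('a \<times> 'a) \<times> ('a \<times> 'a)) set" where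
  "fraction_rel A = {((a, b), (c, d)) | a b c d.
     a \<in> carrier A \<and> b \<in> carrier A - {\<zero>\<^bsub>A\<^esub>} \<and> c \<in> carrier A \<and> d \<in> carrier A - {\<zero>\<^bsub>A\<^esub>} \<and>
     a \<otimes>\<^bsub>A\<^esub> d = c \<otimes>\<^bsub>A\<^esub> b}"

definition fraction :: "('k, 'a) module \<Rightarrow> 'a \<Rightarrow> 'a \<Rightarrow> ('a \<times> 'a) set" where
  "fraction A a b = fraction_rel A `` {(a, b)}"

definition fraction_field :: "('k, 'a) module \<Rightarrow> ('k, ('a \<times> 'a) set) module" where
  "fraction_field A =
     \<lparr>carrier = {fraction A a b | a b. a \<in> carrier A \<and> b \<in> carrier A - {\<zero>\<^bsub>A\<^esub>}},
      monoid.mult = (\<lambda>x y. \<Union>(a, b)\<in>x. \<Union>(c, d)\<in>y. fraction A (a \<otimes>\<^bsub>A\<^esub> c) (b \<otimes>\<^bsub>A\<^esub> d)),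
      one = fraction A \<one>\<^bsub>A\<^esub> \<one>\<^bsub>A\<^esub>,
      ring.zero = fraction A \<zero>\<^bsub>A\<^esub> \<one>\<^bsub>A\<^esub>,
      add = (\<lambda>x y. \<Union>(a, b)\<in>x. \<Union>(c, d)\<in>y.
               fraction A (a \<otimes>\<^bsub>A\<^esub> d \<oplus>\<^bsub>A\<^esub> c \<otimes>\<^bsub>A\<^esub> b) (b \<otimes>\<^bsub>A\<^esub> d)),
      module.smult = (\<lambda>k x. \<Union>(a, b)\<in>x. fraction A (k \<odot>\<^bsub>A\<^esub> a) b)\<rparr>"

type_synonym ('p, 'k) rat_fun = "(('p \<Rightarrow> 'k) \<times> ('p \<Rightarrow> 'k)) set"

definition rat_funs :: "('p, 'k::field) variety \<Rightarrow> ('k, ('p, 'k) rat_fun) module" where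
  "rat_funs V = fraction_field (coordinate_algebra V)"

definition quot_fun :: "('p, 'k::field) variety \<Rightarrow> ('p \<Rightarrow> 'k) \<Rightarrow> ('p \<Rightarrow> 'k) \<Rightarrow> ('p, 'k) rat_fun" where
  "quot_fun V a b = fraction (coordinate_algebra V) a b"

definition rat_of_reg :: "('p, 'k::field) variety \<Rightarrow> ('p \<Rightarrow> 'k) \<Rightarrow> ('p, 'k) rat_fun" where
  "rat_of_reg V a = quot_fun V a \<one>\<^bsub>coordinate_algebra V\<^esub>"

text \<open>An irreducible affine variety is normal iff its coordinate algebra is integrally closed.\<close>

definition normal_variety :: "('p, 'k::field) variety \<Rightarrow> bool" where
  "normal_variety V \<longleftrightarrow>
     irreducible_variety V \<and>
     (\<forall>x\<in>carrier (rat_funs V).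
        (\<exists>(n::nat) c. (\<forall>i<n. c i \<in> regs V) \<and>
           x [^]\<^bsub>rat_funs V\<^esub> n \<oplus>\<^bsub>rat_funs V\<^esub>
             (\<Oplus>\<^bsub>rat_funs V\<^esub>i\<in>{..<n}. rat_of_reg V (c i) \<otimes>\<^bsub>rat_funs V\<^esub> x [^]\<^bsub>rat_funs V\<^esub> i)
           = \<zero>\<^bsub>rat_funs V\<^esub>) \<longrightarrow>
        x \<in> rat_of_reg V ` regs V)"

text \<open>
  The local ring of \<open>V\<close> along an irreducible closed subset \<open>D\<close> and its maximal ideal. For a prime
  divisor on a normal variety it is a discrete valuation ring, and the order of \<open>f\<close> along \<open>D\<close> is
  the exponent of a generator \<open>t\<close> of the maximal ideal in \<open>f\<close>.
\<close>

definition local_ring :: "('p, 'k::field) variety \<Rightarrow> 'p set \<Rightarrow> ('p, 'k) rat_fun set" where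
  "local_ring V D = {quot_fun V a b | a b. a \<in> regs V \<and> b \<in> regs V \<and> (\<exists>p\<in>D. b p \<noteq> 0)}"

definition local_max_ideal :: "('p, 'k::field) variety \<Rightarrow> 'p set \<Rightarrow> ('p, 'k) rat_fun set" where
  "local_max_ideal V D =
     {quot_fun V a b | a b. a \<in> regs V \<and> (\<forall>p\<in>D. a p = 0) \<and> b \<in> regs V \<and> (\<exists>p\<in>D. b p \<noteq> 0)}"

definition ord_along :: "('p, 'k::field) variety \<Rightarrow> 'p set \<Rightarrow> ('p, 'k) rat_fun \<Rightarrow> int" where
  "ord_along V D f =
     (THE n::int. \<exists>t u.
        t \<in> local_max_ideal V D \<and>
        local_max_ideal V D = (\<lambda>s. s \<otimes>\<^bsub>rat_funs V\<^esub> t) ` local_ring V D \<and>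
        u \<in> local_ring V D - local_max_ideal V D \<and>
        f = u \<otimes>\<^bsub>rat_funs V\<^esub> t [^]\<^bsub>rat_funs V\<^esub> n)"

type_synonym 'p divisor = "'p set \<Rightarrow>\<^sub>0 int"

definition weil_divisors :: "('p, 'k::field) variety \<Rightarrow> 'p divisor monoid" where
  "weil_divisors V = free_Abelian_group (prime_divisors V)"

definition div_of :: "('p, 'k::field) variety \<Rightarrow> ('p, 'k) rat_fun \<Rightarrow> 'p divisor" where
  "div_of V f = Abs_poly_mapping (\<lambda>D. if D \<in> prime_divisors V then ord_along V D f else 0)"

definition principal_divisors :: "('p, 'k::field) variety \<Rightarrow> 'p divisor set" where
  "principal_divisors V = div_of V ` (carrier (rat_funs V) - {\<zero>\<^bsub>rat_funs V\<^esub>})"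

definition class_group :: "('p, 'k::field) variety \<Rightarrow> 'p divisor set monoid" where
  "class_group V = weil_divisors V Mod principal_divisors V"

text \<open>Effectivity is tested with \<open>lookup\<close>: the order on \<open>\<Rightarrow>\<^sub>0\<close> is not the pointwise one.\<close>

definition divisor_sections :: "('p, 'k::field) variety \<Rightarrow> 'p divisor \<Rightarrow> ('p, 'k) rat_fun set" where
  "divisor_sections V D =
     {f \<in> carrier (rat_funs V).
        f = \<zero>\<^bsub>rat_funs V\<^esub> \<or> (\<forall>P\<in>prime_divisors V. 0 \<le> Poly_Mapping.lookup (div_of V f + D) P)}"

definition presenting_subgroup :: "('p, 'k::field) variety \<Rightarrow> 'p divisor set \<Rightarrow> bool" where
  "presenting_subgroup V L \<longleftrightarrow>
     subgroup L (weil_divisors V) \<and>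
     finitely_generated_group ((weil_divisors V)\<lparr>carrier := L\<rparr>) \<and>
     (\<lambda>D. principal_divisors V #>\<^bsub>weil_divisors V\<^esub> D) ` L = carrier (class_group V)"

definition coherent :: "('p, 'k::field) variety \<Rightarrow> 'p divisor set \<Rightarrow> ('p divisor \<Rightarrow> ('p, 'k) rat_fun) \<Rightarrow> bool"
  where
  "coherent V L F \<longleftrightarrow>
     (\<forall>D \<in> L \<inter> principal_divisors V.
        F D \<in> carrier (rat_funs V) - {\<zero>\<^bsub>rat_funs V\<^esub>} \<and> div_of V (F D) = D) \<and>
     (\<forall>D \<in> L \<inter> principal_divisors V. \<forall>D' \<in> L \<inter> principal_divisors V.
        F (D + D') = F D \<otimes>\<^bsub>rat_funs V\<^esub> F D')"

text \<open>
  The elements of \<open>\<Oplus>D\<in>L. O(V, D)\<close> are families with finite support; they are zero outside \<open>L\<close>.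
\<close>

definition divisor_algebra ::
    "('p, 'k::field) variety \<Rightarrow> 'p divisor set \<Rightarrow> ('k, 'p divisor \<Rightarrow> ('p, 'k) rat_fun) module" where
  "divisor_algebra V L =
     \<lparr>carrier = {s. (\<forall>D\<in>L. s D \<in> divisor_sections V D) \<and> (\<forall>D. D \<notin> L \<longrightarrow> s D = \<zero>\<^bsub>rat_funs V\<^esub>) \<and>
                    finite {D. s D \<noteq> \<zero>\<^bsub>rat_funs V\<^esub>}},
      monoid.mult = (\<lambda>s t D. \<Oplus>\<^bsub>rat_funs V\<^esub>E\<in>{E. s E \<noteq> \<zero>\<^bsub>rat_funs V\<^esub> \<and> t (D - E) \<noteq> \<zero>\<^bsub>rat_funs V\<^esub>}.
                 s E \<otimes>\<^bsub>rat_funs V\<^esub> t (D - E)),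
      one = (\<lambda>D. if D = 0 then \<one>\<^bsub>rat_funs V\<^esub> else \<zero>\<^bsub>rat_funs V\<^esub>),
      ring.zero = (\<lambda>D. \<zero>\<^bsub>rat_funs V\<^esub>),
      add = (\<lambda>s t D. s D \<oplus>\<^bsub>rat_funs V\<^esub> t D),
      module.smult = (\<lambda>c s D. c \<odot>\<^bsub>rat_funs V\<^esub> s D)\<rparr>"

definition in_degree ::
    "('p, 'k::field) variety \<Rightarrow> 'p divisor \<Rightarrow> ('p, 'k) rat_fun \<Rightarrow> 'p divisor \<Rightarrow> ('p, 'k) rat_fun" where
  "in_degree V D f = (\<lambda>E. if E = D then f else \<zero>\<^bsub>rat_funs V\<^esub>)"

definition cox_ideal ::
    "('p, 'k::field) variety \<Rightarrow> 'p divisor set \<Rightarrow> ('p divisor \<Rightarrow> ('p, 'k) rat_fun) \<Rightarrow>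
     ('p divisor \<Rightarrow> ('p, 'k) rat_fun) set" where
  "cox_ideal V L F =
     Idl\<^bsub>divisor_algebra V L\<^esub>
       {in_degree V D1 f \<ominus>\<^bsub>divisor_algebra V L\<^esub> in_degree V D2 (F (D1 - D2) \<otimes>\<^bsub>rat_funs V\<^esub> f)
        | D1 D2 f. D1 \<in> L \<and> D2 \<in> L \<and> D1 - D2 \<in> principal_divisors V \<and> f \<in> divisor_sections V D1}"

definition cox_ring ::
    "('p, 'k::field) variety \<Rightarrow> 'p divisor set \<Rightarrow> ('p divisor \<Rightarrow> ('p, 'k) rat_fun) \<Rightarrow>
     ('k, ('p divisor \<Rightarrow> ('p, 'k) rat_fun) set) module" where
  "cox_ring V L F = quotient_algebra (divisor_algebra V L) (cox_ideal V L F)"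

text \<open>The component of degree \<open>u\<close>, where the divisor class \<open>u\<close> is a coset of divisors.\<close>

definition cox_component ::
    "('p, 'k::field) variety \<Rightarrow> 'p divisor set \<Rightarrow> ('p divisor \<Rightarrow> ('p, 'k) rat_fun) \<Rightarrow> 'p divisor set \<Rightarrow>
     ('p divisor \<Rightarrow> ('p, 'k) rat_fun) set set" where
  "cox_component V L F u =
     {cox_ideal V L F +>\<^bsub>divisor_algebra V L\<^esub> s | s.
        s \<in> carrier (divisor_algebra V L) \<and> {D. s D \<noteq> \<zero>\<^bsub>rat_funs V\<^esub>} \<subseteq> u}"

definition cox_of_reg ::
    "('p, 'k::field) variety \<Rightarrow> 'p divisor set \<Rightarrow> ('p divisor \<Rightarrow> ('p, 'k) rat_fun) \<Rightarrow> ('p \<Rightarrow> 'k) \<Rightarrow>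
     ('p divisor \<Rightarrow> ('p, 'k) rat_fun) set" where
  "cox_of_reg V L F f =
     cox_ideal V L F +>\<^bsub>divisor_algebra V L\<^esub> in_degree V 0 (rat_of_reg V f)"

type_synonym ('p, 'k) cox_point = "('p divisor \<Rightarrow> ('p, 'k) rat_fun) set \<Rightarrow> 'k"

definition has_cox_realization ::
    "('p, 'k::field) variety \<Rightarrow> 'p divisor set \<Rightarrow> ('p divisor \<Rightarrow> ('p, 'k) rat_fun) \<Rightarrow> bool" where
  "has_cox_realization V L F \<longleftrightarrow>
     affine_variety V \<and> normal_variety V \<and>
     Units (coordinate_algebra V) \<subseteq> scalars (coordinate_algebra V) \<and>
     finitely_generated_group (class_group V) \<and>
     finitely_generated_algebra (cox_ring V L F)"

definition cox_space ::
    "('p, 'k::field) variety \<Rightarrow> 'p divisor set \<Rightarrow> ('p divisor \<Rightarrow> ('p, 'k) rat_fun) \<Rightarrow>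
     (('p, 'k) cox_point, 'k) variety" where
  "cox_space V L F = spec (cox_ring V L F)"

text \<open>
  The morphism \<open>Spec R(V) \<rightarrow> V\<close> given by \<open>K[V] = R(V)\<^sub>0 \<subseteq> R(V)\<close>: a point \<open>x\<close> restricts to a
  homomorphism on \<open>K[V]\<close>, and this is the evaluation at a unique point of \<open>V\<close>.
\<close>

definition cox_realization ::
    "('p, 'k::field) variety \<Rightarrow> 'p divisor set \<Rightarrow> ('p divisor \<Rightarrow> ('p, 'k) rat_fun) \<Rightarrow>
     ('p, 'k) cox_point \<Rightarrow> 'p" where
  "cox_realization V L F x =
     inv_into (points V) (eval_at V) (\<lambda>f\<in>regs V. x (cox_of_reg V L F f))"

text \<open>
  \<open>\<iota>\<close> identifies the class group with the character group of \<open>N\<close>, and \<open>\<tau>\<close> is the action of \<open>N\<close> on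
  \<open>Spec R(V)\<close>.
\<close>

definition neron_severi_quasitorus ::
    "('p, 'k::field) variety \<Rightarrow> 'p divisor set \<Rightarrow> ('p divisor \<Rightarrow> ('p, 'k) rat_fun) \<Rightarrow>
     ('n, 'k) alg_group \<Rightarrow> ('p divisor set \<Rightarrow> 'n \<Rightarrow> 'k) \<Rightarrow>
     ('n \<Rightarrow> ('p, 'k) cox_point \<Rightarrow> ('p, 'k) cox_point) \<Rightarrow> bool" where
  "neron_severi_quasitorus V L F N \<iota> \<tau> \<longleftrightarrow>
     quasitorus N \<and>
     \<iota> \<in> iso (class_group V) (character_group N) \<and>
     regular_action N (cox_space V L F) \<tau> \<and>
     (\<forall>u\<in>carrier (class_group V).
        weight_space N (cox_space V L F) \<tau> (\<iota> u) =
          spec_function (cox_ring V L F) ` cox_component V L F u)"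

definition cox_lift ::
    "('z, 'k::field) variety \<Rightarrow> ('g, 'k) alg_group \<Rightarrow> ('g \<Rightarrow> 'z \<Rightarrow> 'z) \<Rightarrow> ('z \<Rightarrow> 'p) \<Rightarrow>
     ('p, 'k) variety \<Rightarrow> 'p divisor set \<Rightarrow> ('p divisor \<Rightarrow> ('p, 'k) rat_fun) \<Rightarrow>
     ('n, 'k) alg_group \<Rightarrow> ('n \<Rightarrow> ('p, 'k) cox_point \<Rightarrow> ('p, 'k) cox_point) \<Rightarrow>
     ('g \<Rightarrow> 'n) \<Rightarrow> ('z \<Rightarrow> ('p, 'k) cox_point) \<Rightarrow> bool" where
  "cox_lift Z Q \<rho> \<pi> V L F N \<tau> \<mu> \<nu> \<longleftrightarrow>
     alg_group_hom Q N \<mu> \<and> \<mu> ` carrier Q = carrier N \<and>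
     morphism Z (cox_space V L F) \<nu> \<and> dominant Z (cox_space V L F) \<nu> \<and>
     (\<forall>g\<in>carrier Q. \<forall>z\<in>points Z. \<nu> (\<rho> g z) = \<tau> (\<mu> g) (\<nu> z)) \<and>
     (\<forall>z\<in>points Z. cox_realization V L F (\<nu> z) = \<pi> z)"

end

theory Submission
	imports Defs "HOL-Library.Function_Algebras"
begin

text \<open>
	Let \<open>X\<close> be the quotient of \<open>Z\<close>. Its Cox ring is assembled from the sections of the divisors on \<open>X\<close>, and
	a lift to its spectrum has to send a section of a divisor \<open>D\<close> to a homogeneous function on \<open>Z\<close>. The pullback of a
	section to \<open>Z\<close> is only a rational function. The idea is to correct all sections of \<open>D\<close> at once by a \<^emph>\<open>multiplier\<close>:
	a homogeneous fraction \<open>h\<close> such that multiplication by \<open>h\<close> makes the sections of \<open>D\<close> regular and division by \<open>h\<close>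
	makes the sections of \<open>- D\<close> regular.

	Multipliers exist because \<open>Z\<close> is factorially graded: divide a common denominator of the sections by the greatest
	common divisor of the resulting numerators (\<open>multiplier_exists\<close>). They are unique up to constants
	(\<open>multipliers_unique\<close>). Indeed, suppose that \<open>y\<close> becomes regular after multiplication with every product of a
	section of \<open>D\<close> and a section of \<open>- D\<close>. If \<open>y\<close> had a pole along a prime divisor \<open>E\<close> of \<open>Z\<close>, then the closure of the
	image of \<open>E\<close> would be \<open>X\<close> or a prime divisor, since the action is uncontracting. At the generic point of this closure
	\<open>D\<close> is principal, since \<open>X\<close> is normal, so some product of sections does not vanish along \<open>E\<close>: a contradiction
	(\<open>complementary_sections\<close>, \<open>regular_if_locally_regular\<close>). So the quotient of two multipliers of \<open>D\<close> is a homogeneous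
	unit, that is, a constant.

	Thus the multipliers form an extension of the group of divisors by the group of nonzero constants. The latter is
	divisible, so the extension splits, even with prescribed values on the principal divisors
	(\<open>divisible_complement\<close>, \<open>multiplicative_choice\<close>). A multiplicative choice of multipliers defines a homomorphism from
	the divisor algebra to the functions on \<open>Z\<close>. It maps the sections of \<open>D\<close> to functions of one weight, and this weight is
	trivial only if \<open>D\<close> is principal, because an invariant multiplier comes from a rational function on \<open>X\<close>. Hence
	different divisor classes have different weights, the kernel is the ideal that defines the Cox ring (\<open>kernel_I\<close>), and
	the Cox ring embeds into the functions on \<open>Z\<close>. This is the dominant morphism. The embedding of the class group into
	the characters of \<open>Q\<close> is dual to the surjective homomorphism of quasitori (\<open>point_of_characters\<close>,
	\<open>extend_multiplicative\<close>). Finally, any other lift consists of multipliers as well, so it differs on the sections of \<open>D\<close>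
	by a constant. These constants are multiplicative in \<open>D\<close> and trivial on principal divisors, so they are the values of
	the weights at an element of \<open>Q\<close> (\<open>cox_lift_unique\<close>).

	Divisors are defined by closed points, chains of closed sets and local rings. The commutative algebra that makes them
	accessible comes first: Hilbert's basis theorem, the Nullstellensatz, and the discrete valuations of a normal
	noetherian domain at its primes of height one.
\<close>

hide_const (open) UnivPoly.coeff UnivPoly.monom

abbreviation "lkp == Poly_Mapping.lookup"
abbreviation "pkeys == Poly_Mapping.keys"
abbreviation "psingle == Poly_Mapping.single"

section \<open>Noetherian subrings\<close>

text \<open>Rings are represented by their carriers inside a type of rings, so that polynomials over them are
	polynomials over the type.\<close>

locale carrier_ring =
	fixes S :: "'r::comm_ring_1 set"
	assumes one_mem: "1 : S"
		and add_mem: "a : S ==> b : S ==> a + b : S"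
		and mult_mem: "a : S ==> b : S ==> a * b : S"
		and uminus_mem: "a : S ==> - a : S"
begin

lemma zero_mem: "0 : S" using add_mem[OF one_mem uminus_mem[OF one_mem]] by simp

lemma diff_mem: "a : S ==> b : S ==> a - b : S" using add_mem[OF _ uminus_mem, of a b] by simp

lemma power_mem: "a : S ==> a ^ n : S" by (induction n) (auto simp: one_mem mult_mem)

lemma sum_mem: "(!!i. i : A ==> f i : S) ==> sum f A : S"
	by (induction A rule: infinite_finite_induct) (auto simp: zero_mem add_mem)

lemmas ring_mem = one_mem zero_mem add_mem mult_mem uminus_mem diff_mem power_mem

end

definition ideal_in :: "'r::comm_ring_1 set => 'r set => bool" where
	"ideal_in S I \<longleftrightarrow> I \<subseteq> S & 0 : I & (ALL a:I. ALL b:I. a + b : I) & (ALL s:S. ALL a:I. s * a : I)"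

definition prime_in :: "'r::comm_ring_1 set => 'r set => bool" where
	"prime_in S P \<longleftrightarrow> ideal_in S P & 1 \<notin> P & (ALL a:S. ALL b:S. a * b : P --> a : P | b : P)"

text \<open>Finite generation of an ideal is expressed by minimality among the ideals that contain the
	generators, which avoids the linear combinations.\<close>

definition noetherian_in :: "'r::comm_ring_1 set => bool" where
	"noetherian_in S \<longleftrightarrow>
		 (ALL I. ideal_in S I -->
				(EX G. finite G & G \<subseteq> I & (ALL J. ideal_in S J & G \<subseteq> J --> I \<subseteq> J)))"

definition ideal_gen :: "'r::comm_ring_1 set => 'r set => 'r set" where
	"ideal_gen S G = \<Inter>{J. ideal_in S J & G \<subseteq> J}"

lemma ideal_inD:
	assumes "ideal_in S I"
	shows "a : I ==> a : S" "0 : I" "a : I ==> b : I ==> a + b : I" "s : S ==> a : I ==> s * a : I"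
	using assms by (auto simp: ideal_in_def)

context carrier_ring begin

lemma ideal_uminus: "ideal_in S I ==> a : I ==> - a : I"
	using ideal_inD(4)[of S I "- 1" a] uminus_mem[OF one_mem] by simp

lemma ideal_diff: "ideal_in S I ==> a : I ==> b : I ==> a - b : I"
	using ideal_inD(3)[of S I a "- b"] ideal_uminus[of I b] by simp

lemma ideal_sum: "ideal_in S I ==> (!!i. i : A ==> f i : I) ==> sum f A : I"
	by (induction A rule: infinite_finite_induct) (auto simp: ideal_inD)

lemma ideal_self: "ideal_in S S" by (auto simp: ideal_in_def ring_mem)

lemma ideal_gen_ideal:
	assumes "G \<subseteq> S"
	shows "ideal_in S (ideal_gen S G)"
proof -
	have "ideal_gen S G \<subseteq> S" unfolding ideal_gen_def using assms ideal_self by auto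
	thus ?thesis by (auto simp: ideal_in_def ideal_gen_def)
qed

lemma ideal_gen_incl: "G \<subseteq> ideal_gen S G" by (auto simp: ideal_gen_def)

lemma ideal_gen_least: "ideal_in S J ==> G \<subseteq> J ==> ideal_gen S G \<subseteq> J" by (auto simp: ideal_gen_def)

lemma ideal_gen_mono: "G \<subseteq> H ==> ideal_gen S G \<subseteq> ideal_gen S H" by (auto simp: ideal_gen_def)

lemma ideal_Union_chain:
	assumes "!!n::nat. ideal_in S (I n)" "!!n. I n \<subseteq> I (Suc n)"
	shows "ideal_in S (\<Union>n. I n)"
proof -
	have mono: "I m \<subseteq> I n" if "m \<le> n" for m n using lift_Suc_mono_le[of I, OF assms(2) that] .
	have "a + b : (\<Union>n. I n)" if ab: "a : I m" "b : I n" for a b m n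
	proof -
		have "a : I (max m n)" "b : I (max m n)" using ab mono[of m "max m n"] mono[of n "max m n"] by auto
		thus ?thesis using ideal_inD(3)[OF assms(1)] by auto
	qed
	moreover have "s * a : (\<Union>n. I n)" if "s : S" "a : I m" for s a m using ideal_inD(4)[OF assms(1)] that by auto
	moreover have "(\<Union>n. I n) \<subseteq> S" "0 : (\<Union>n. I n)" using assms(1) unfolding ideal_in_def by blast+
	ultimately show ?thesis by (auto simp: ideal_in_def)
qed

lemma noetherian_chain:
	assumes "noetherian_in S" "!!n::nat. ideal_in S (I n)" "!!n. I n \<subseteq> I (Suc n)"
	obtains N where "!!n. n \<ge> N ==> I n = I N"
proof -
	have mono: "I m \<subseteq> I n" if "m \<le> n" for m n using lift_Suc_mono_le[of I, OF assms(3) that] .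
	obtain G where G: "finite G" "G \<subseteq> (\<Union>n. I n)" "!!J. ideal_in S J ==> G \<subseteq> J ==> (\<Union>n. I n) \<subseteq> J"
		using assms(1) ideal_Union_chain[of I] assms(2,3) unfolding noetherian_in_def by metis
	have "EX N. G \<subseteq> I N" using G(1,2)
	proof (induction G)
		case (insert x G)
		then obtain N m where "G \<subseteq> I N" "x : I m" by auto
		hence "insert x G \<subseteq> I (max N m)" using mono[of N "max N m"] mono[of m "max N m"] by auto
		thus ?case by blast
	qed auto
	then obtain N where "G \<subseteq> I N" by blast
	hence "(\<Union>n. I n) \<subseteq> I N" using G(3) assms(2) by simp
	hence "I n = I N" if "n \<ge> N" for n using mono[OF that] by auto
	thus ?thesis using that by auto
qed

lemma noetherian_maximal:
	assumes "noetherian_in S" "\<F> ~= {}" "!!I. I : \<F> ==> ideal_in S I"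
	obtains M where "M : \<F>" "!!I. I : \<F> ==> M \<subseteq> I ==> I = M"
proof (rule ccontr)
	note found = that
	assume no: "\<not> thesis"
	have *: "EX J:\<F>. I \<subset> J" if I: "I : \<F>" for I
	proof (rule ccontr)
		assume "\<not> (EX J:\<F>. I \<subset> J)"
		hence "!!J. J : \<F> ==> I \<subseteq> J ==> J = I" by blast
		thus False using no I found by simp
	qed
	obtain f where f: "!!n. f n : \<F>" "!!n. f n \<subset> f (Suc n)"
		using dependent_nat_choice[of "%n I. I : \<F>" "%n I J. I \<subset> J"] assms(2) * by (metis ex_in_conv)
	obtain N where "!!n. n \<ge> N ==> f n = f N" using noetherian_chain[of f] assms(1,3) f by blast
	thus False using f(2)[of N] by (metis le_SucI order_refl psubset_eq)
qed

text \<open>Every ideal has finitely many primes above it such that each prime above it lies over one of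
	them: a maximal counterexample is not prime, and a product in it passes the property on from two
	larger ideals.\<close>

lemma finite_primes_below:
	assumes "noetherian_in S" "ideal_in S I"
	shows "\<exists>\<Q>. finite \<Q> & (ALL Q:\<Q>. prime_in S Q & I \<subseteq> Q) \<and>
					 (ALL P. prime_in S P & I \<subseteq> P --> (EX Q:\<Q>. Q \<subseteq> P))" (is "?good I")
proof (rule ccontr)
	assume bad: "\<not> ?good I"
	define \<F> where "\<F> = {I. ideal_in S I & \<not> ?good I}"
	have "I : \<F>" using bad assms(2) unfolding \<F>_def by simp
	hence "\<F> ~= {}" by blast
	then obtain M where M: "M : \<F>" "!!I. I : \<F> ==> M \<subseteq> I ==> I = M"
		by (rule noetherian_maximal[OF assms(1), of \<F>]) (auto simp: \<F>_def)
	have idM: "ideal_in S M" and badM: "\<not> ?good M" using M(1) by (auto simp: \<F>_def)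
	have "1 \<notin> M"
	proof
		assume "1 : M"
		hence "\<not> (prime_in S P & M \<subseteq> P)" for P by (auto simp: prime_in_def)
		thus False using badM by auto
	qed
	moreover have "\<not> prime_in S M"
	proof
		assume "prime_in S M"
		hence "?good M" by (intro exI[of _ "{M}"]) auto
		thus False using badM by simp
	qed
	ultimately obtain x y where xy: "x : S" "y : S" "x * y : M" "x \<notin> M" "y \<notin> M"
		using idM unfolding prime_in_def by blast
	have good_above: "EX J. ideal_in S J & M \<subseteq> J & z : J & (ALL P. ideal_in S P & M \<subseteq> P & z : P --> J \<subseteq> P) & ?good J"
		if z: "z : S" "z \<notin> M" for z
	proof -
		define J where "J = ideal_gen S (insert z M)"
		have J: "ideal_in S J" "M \<subseteq> J" "z : J"
			using ideal_gen_ideal[of "insert z M"] ideal_gen_incl[of "insert z M"] z idM by (auto simp: J_def ideal_in_def)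
		have "?good J"
		proof (rule ccontr)
			assume "\<not> ?good J"
			hence "J : \<F>" unfolding \<F>_def using J(1) by simp
			thus False using M(2) J z by auto
		qed
		thus ?thesis using J ideal_gen_least[of _ "insert z M"] by (intro exI[of _ J]) (auto simp: J_def)
	qed
	obtain A1 where "ideal_in S A1 & M \<subseteq> A1 & x : A1 \<and>
			(ALL P. ideal_in S P & M \<subseteq> P & x : P --> A1 \<subseteq> P) & ?good A1" using good_above[OF xy(1,4)] by auto
	hence A1: "ideal_in S A1" "M \<subseteq> A1" "!!P. ideal_in S P ==> M \<subseteq> P ==> x : P ==> A1 \<subseteq> P" "?good A1" by simp_all
	obtain A2 where "ideal_in S A2 & M \<subseteq> A2 & y : A2 \<and>
			(ALL P. ideal_in S P & M \<subseteq> P & y : P --> A2 \<subseteq> P) & ?good A2" using good_above[OF xy(2,5)] by auto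
	hence A2: "ideal_in S A2" "M \<subseteq> A2" "!!P. ideal_in S P ==> M \<subseteq> P ==> y : P ==> A2 \<subseteq> P" "?good A2" by simp_all
	obtain QX where QX: "finite QX" "ALL Q:QX. prime_in S Q & A1 \<subseteq> Q" "ALL P. prime_in S P & A1 \<subseteq> P --> (EX Q:QX. Q \<subseteq> P)"
		using A1(4) by auto
	obtain QY where QY: "finite QY" "ALL Q:QY. prime_in S Q & A2 \<subseteq> Q" "ALL P. prime_in S P & A2 \<subseteq> P --> (EX Q:QY. Q \<subseteq> P)"
		using A2(4) by auto
	have "EX Q:QX \<union> QY. Q \<subseteq> P" if P: "prime_in S P" "M \<subseteq> P" for P
	proof -
		have "x : P | y : P" using P xy unfolding prime_in_def by blast
		hence "A1 \<subseteq> P | A2 \<subseteq> P" using A1(3) A2(3) P by (auto simp: prime_in_def)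
		thus ?thesis
		proof
			assume "A1 \<subseteq> P"
			with QX(3) P(1) have "EX Q:QX. Q \<subseteq> P" by simp
			thus ?thesis by auto
		next
			assume "A2 \<subseteq> P"
			with QY(3) P(1) have "EX Q:QY. Q \<subseteq> P" by simp
			thus ?thesis by auto
		qed
	qed
	hence "?good M" using QX(1,2) QY(1,2) A1(2) A2(2) by (intro exI[of _ "QX \<union> QY"]) (simp add: ball_Un subset_trans)
	thus False using badM by simp
qed

end

subsection \<open>The basis theorem\<close>

definition Pol :: "'r::comm_ring_1 set => 'r poly set" where
	"Pol S = {p. ALL i. coeff p i : S}"

context carrier_ring begin

lemma Pol_ring: "carrier_ring (Pol S)"
proof
	fix a b assume "a : Pol S" "b : Pol S"
	thus "a * b : Pol S" by (auto simp: Pol_def coeff_mult intro!: sum_mem mult_mem)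
qed (auto simp: Pol_def ring_mem coeff_pCons split: nat.split)

interpretation polys: carrier_ring "Pol S" by (rule Pol_ring)

lemma monom_over: "a : S ==> monom a n : Pol S" by (auto simp: Pol_def zero_mem)

lemma smult_over: "a : S ==> p : Pol S ==> smult a p : Pol S" by (auto simp: Pol_def mult_mem)

lemma const_over: "a : S ==> [:a:] : Pol S" by (auto simp: Pol_def coeff_pCons zero_mem split: nat.split)

lemma X_over: "[:0, 1:] : Pol S" by (auto simp: Pol_def coeff_pCons zero_mem one_mem split: nat.split)

text \<open>A polynomial in the ideal generated by \<open>G\<close> attains each leading coefficient from the ideal of
	the leading coefficients of \<open>G\<close> in any degree \<open>d\<close> that bounds the degrees in \<open>G\<close>.\<close>

lemma leading_coefficient_lift:
	assumes "G \<subseteq> Pol S" "!!g. g : G ==> degree g \<le> d" "a : ideal_gen S (lead_coeff ` G)"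
	obtains q where "q : ideal_gen (Pol S) G" "degree q \<le> d" "coeff q d = a"
proof -
	define J where "J = {a. EX q:ideal_gen (Pol S) G. degree q \<le> d & coeff q d = a}"
	have id: "ideal_in (Pol S) (ideal_gen (Pol S) G)" using polys.ideal_gen_ideal[OF assms(1)] .
	have "ideal_in S J" unfolding ideal_in_def
	proof (intro conjI ballI)
		show "J \<subseteq> S" using id by (auto simp: J_def ideal_in_def Pol_def)
		show "0 : J" unfolding J_def using ideal_inD(2)[OF id] by force
		fix a assume a: "a : J"
		then obtain q where q: "q : ideal_gen (Pol S) G" "degree q \<le> d" "coeff q d = a" by (auto simp: J_def)
		show "a + b : J" if b: "b : J" for b
		proof -
			obtain r where r: "r : ideal_gen (Pol S) G" "degree r \<le> d" "coeff r d = b" using b by (auto simp: J_def)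
			show ?thesis
				unfolding J_def using ideal_inD(3)[OF id q(1) r(1)] q r by (auto intro!: bexI[of _ "q + r"] degree_add_le)
		qed
		show "s * a : J" if "s : S" for s
		proof -
			have "smult s q : ideal_gen (Pol S) G" using ideal_inD(4)[OF id const_over[OF that] q(1)] by simp
			thus ?thesis
				unfolding J_def using q degree_smult_le[of s q] by (auto intro!: bexI[of _ "smult s q"] intro: order.trans)
		qed
	qed
	moreover have "lead_coeff g : J" if g: "g : G" for g
	proof -
		have "monom 1 (d - degree g) * g : ideal_gen (Pol S) G"
			using ideal_inD(4)[OF id monom_over[OF one_mem]] polys.ideal_gen_incl g by auto
		moreover have "degree (monom 1 (d - degree g) * g) \<le> d"
			using degree_mult_le[of "monom 1 (d - degree g)" g] degree_monom_le[of 1 "d - degree g"] assms(2)[OF g]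
			by (metis (no_types, lifting) add_le_mono1 dual_order.trans le_add_diff_inverse2)
		moreover have "coeff (monom 1 (d - degree g) * g) d = lead_coeff g"
			using assms(2)[OF g] by (simp add: coeff_monom_mult)
		ultimately show ?thesis unfolding J_def by blast
	qed
	ultimately have "a : J" using ideal_gen_least[of J "lead_coeff ` G"] assms(3) by auto
	thus ?thesis using that unfolding J_def by blast
qed

text \<open>Hilbert's basis theorem: in an ideal that is not finitely generated, polynomials of least degree
	outside the ideal generated by the earlier ones would have leading coefficients that generate a
	strictly ascending chain.\<close>

theorem noetherian_polys:
	assumes "noetherian_in S"
	shows "noetherian_in (Pol S)" unfolding noetherian_in_def
proof (intro allI impI, rule ccontr)
	fix I assume I: "ideal_in (Pol S) I"
	assume "\<not> (EX G. finite G & G \<subseteq> I & (ALL J. ideal_in (Pol S) J & G \<subseteq> J --> I \<subseteq> J))"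
	hence nfg: "I - ideal_gen (Pol S) G ~= {}" if "finite G" "G \<subseteq> I" for G using that unfolding ideal_gen_def by blast
	define P where "P = (%(G, p). finite G & G \<subseteq> I & p : I - ideal_gen (Pol S) G \<and>
			(ALL q:I - ideal_gen (Pol S) G. degree p \<le> degree q) & (ALL g:G. degree g \<le> degree p))"
	have least: "EX p. p : I - ideal_gen (Pol S) G & (ALL q:I - ideal_gen (Pol S) G. degree p \<le> degree q)"
		if "finite G" "G \<subseteq> I" for G
		using nfg[OF that] ex_has_least_nat[of "%p. p : I - ideal_gen (Pol S) G" _ degree] by blast
	have "EX x. P x" using least[of "{}"] by (auto simp: P_def)
	moreover have "EX y. P y & fst y = insert (snd x) (fst x)" if Px: "P x" for x
	proof -
		obtain G p where x: "x = (G, p)" by (cases x)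
		have G: "finite (insert p G)" "insert p G \<subseteq> I" using Px by (auto simp: P_def x)
		obtain q where q: "q : I - ideal_gen (Pol S) (insert p G)"
			"ALL r:I - ideal_gen (Pol S) (insert p G). degree q \<le> degree r" using least[OF G] by auto
		have "q : I - ideal_gen (Pol S) G" using q(1) polys.ideal_gen_mono[of G "insert p G"] by auto
		hence "degree p \<le> degree q" "ALL g:G. degree g \<le> degree q" using Px by (auto simp: P_def x intro: order.trans)
		hence "P (insert p G, q)" using q G by (auto simp: P_def)
		thus ?thesis by (intro exI[of _ "(insert p G, q)"]) (auto simp: x)
	qed
	ultimately obtain f where f: "!!n. P (f n)" "!!n. fst (f (Suc n)) = insert (snd (f n)) (fst (f n))"
		using dependent_nat_choice[of "%n. P" "%n x y. fst y = insert (snd x) (fst x)"] by metis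
	define L where "L n = ideal_gen S (lead_coeff ` fst (f n))" for n
	have Gover: "fst (f n) \<subseteq> Pol S" for n using f(1)[of n] I by (auto simp: P_def split_beta ideal_in_def)
	have "ideal_in S (L n)" for n unfolding L_def using Gover[of n] by (intro ideal_gen_ideal) (auto simp: Pol_def)
	moreover have "L n \<subseteq> L (Suc n)" for n unfolding L_def by (rule ideal_gen_mono) (auto simp: f(2))
	ultimately obtain N where N: "!!n. n \<ge> N ==> L n = L N" using noetherian_chain[OF assms] by blast
	obtain G p where fN: "f N = (G, p)" by (cases "f N")
	have Gp: "finite G" "G \<subseteq> I" "p : I" "p \<notin> ideal_gen (Pol S) G"
		"!!q. q : I ==> q \<notin> ideal_gen (Pol S) G ==> degree p \<le> degree q" "!!g. g : G ==> degree g \<le> degree p"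
		using f(1)[of N] by (auto simp: P_def fN)
	have "lead_coeff p : L (Suc N)"
		unfolding L_def using ideal_gen_incl[of "lead_coeff ` fst (f (Suc N))"] f(2)[of N] fN by auto
	hence "lead_coeff p : ideal_gen S (lead_coeff ` G)" using N[of "Suc N"] by (simp add: L_def fN)
	then obtain q where q: "q : ideal_gen (Pol S) G" "degree q \<le> degree p" "coeff q (degree p) = lead_coeff p"
		using leading_coefficient_lift[of G "degree p"] Gp(6) Gover[of N] by (auto simp: fN)
	have qI: "q : I" using q(1) polys.ideal_gen_least[OF I Gp(2)] by auto
	have genid: "ideal_in (Pol S) (ideal_gen (Pol S) G)"
		using Gover[of N] by (auto simp: fN intro: polys.ideal_gen_ideal)
	have diff: "p - q : I" "p - q \<notin> ideal_gen (Pol S) G"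
		using polys.ideal_diff[OF I Gp(3) qI] ideal_inD(3)[OF genid _ q(1), of "p - q"] Gp(4) by auto
	hence "degree p \<le> degree (p - q)" "p - q ~= 0" using Gp(5) ideal_inD(2)[OF genid] by auto
	moreover have "degree (p - q) \<le> degree p" "coeff (p - q) (degree p) = 0"
		using q degree_diff_le[of p "degree p" q] by auto
	ultimately show False by (metis dual_order.antisym leading_coeff_0_iff)
qed

end

subsection \<open>Finitely generated algebras\<close>

definition adjoin :: "'r::comm_ring_1 set => 'r => 'r set" where
	"adjoin S x = (%p. poly p x) ` Pol S"

inductive fg_over :: "('k::field => 'r::comm_ring_1) => 'r set => bool" for sc where
	fg_base: "fg_over sc (range sc)"
| fg_step: "fg_over sc S ==> fg_over sc (adjoin S x)"

lemma (in carrier_ring) adjoin_ring: "carrier_ring (adjoin S x)"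
proof -
	interpret polys: carrier_ring "Pol S" by (rule Pol_ring)
	show ?thesis
	proof
		show "1 : adjoin S x" unfolding adjoin_def using polys.one_mem by (force intro: image_eqI[of _ _ 1])
		fix a assume "a : adjoin S x"
		then obtain p where p: "p : Pol S" "a = poly p x" by (auto simp: adjoin_def)
		show "- a : adjoin S x" unfolding adjoin_def using p polys.uminus_mem by (auto intro!: image_eqI[of _ _ "- p"])
		fix b assume "b : adjoin S x"
		then obtain q where q: "q : Pol S" "b = poly q x" by (auto simp: adjoin_def)
		show "a + b : adjoin S x" unfolding adjoin_def using p q polys.add_mem by (auto intro!: image_eqI[of _ _ "p + q"])
		show "a * b : adjoin S x"
			unfolding adjoin_def using p q polys.mult_mem by (auto intro!: image_eqI[of _ _ "p * q"])
	qed
qed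

lemma (in carrier_ring) adjoin_incl: "S \<subseteq> adjoin S x" "x : adjoin S x"
proof -
	show "S \<subseteq> adjoin S x" unfolding adjoin_def using const_over by (auto intro!: image_eqI[of _ _ "[:_:]"])
	show "x : adjoin S x" unfolding adjoin_def using X_over by (auto intro!: image_eqI[of _ _ "[:0, 1:]"])
qed

lemma (in carrier_ring) adjoin_least:
	assumes "S0 \<subseteq> S" "x : S"
	shows "adjoin S0 x \<subseteq> S"
	using assms by (auto simp: adjoin_def Pol_def poly_altdef intro!: sum_mem mult_mem power_mem)

lemma (in carrier_ring) noetherian_adjoin:
	assumes "noetherian_in S"
	shows "noetherian_in (adjoin S x)" unfolding noetherian_in_def
proof (intro allI impI)
	fix I assume I: "ideal_in (adjoin S x) I"
	interpret polys: carrier_ring "Pol S" by (rule Pol_ring)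
	have pull: "ideal_in (Pol S) {p : Pol S. poly p x : J}" if "ideal_in (adjoin S x) J" for J
	proof -
		have "s * p : Pol S & poly s x * poly p x : J"
			if "s : Pol S" "p : Pol S" "poly p x : J" for s p
			using that polys.mult_mem[of s p] ideal_inD(4)[OF \<open>ideal_in (adjoin S x) J\<close>, of "poly s x" "poly p x"]
			by (auto simp: adjoin_def)
		thus ?thesis using polys.add_mem polys.zero_mem ideal_inD(2,3)[OF that] unfolding ideal_in_def by auto
	qed
	obtain G where G: "finite G" "G \<subseteq> {p : Pol S. poly p x : I}"
		"ALL J. ideal_in (Pol S) J & G \<subseteq> J --> {p : Pol S. poly p x : I} \<subseteq> J"
		using noetherian_polys[OF assms, unfolded noetherian_in_def, rule_format, OF pull[OF I]] by auto
	have "I \<subseteq> J" if J: "ideal_in (adjoin S x) J" "(%p. poly p x) ` G \<subseteq> J" for J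
	proof
		fix y assume y: "y : I"
		then obtain p where p: "p : Pol S" "y = poly p x" using I by (auto simp: ideal_in_def adjoin_def)
		have "G \<subseteq> {p : Pol S. poly p x : J}" using J(2) G(2) by auto
		thus "y : J" using G(3) pull[OF J(1)] p y by auto
	qed
	thus "EX G. finite G & G \<subseteq> I & (ALL J. ideal_in (adjoin S x) J & G \<subseteq> J --> I \<subseteq> J)"
		using G by (intro exI[of _ "(%p. poly p x) ` G"]) auto
qed

locale scalar_embedding =
	fixes sc :: "'k::field => 'r::comm_ring_1"
	assumes sc_one: "sc 1 = 1"
		and sc_add: "sc (a + b) = sc a + sc b"
		and sc_mult: "sc (a * b) = sc a * sc b"
begin

lemma sc_uminus: "sc (- a) = - sc a"
	using sc_add[of a "- a"] sc_add[of 0 0] by (simp add: eq_neg_iff_add_eq_0 add.commute)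

lemma range_ring: "carrier_ring (range sc)"
	by unfold_locales (auto simp: sc_one[symmetric] sc_add[symmetric] sc_mult[symmetric] sc_uminus[symmetric])

lemma fg_over_ring: "fg_over sc S ==> carrier_ring S"
	by (induction rule: fg_over.induct) (auto intro: range_ring carrier_ring.adjoin_ring)

lemma noetherian_range: "noetherian_in (range sc)" unfolding noetherian_in_def
proof (intro allI impI)
	fix I assume I: "ideal_in (range sc) I"
	show "EX G. finite G & G \<subseteq> I & (ALL J. ideal_in (range sc) J & G \<subseteq> J --> I \<subseteq> J)"
	proof (cases "I \<subseteq> {0}")
		case True
		thus ?thesis by (intro exI[of _ "{}"]) (auto simp: ideal_in_def)
	next
		case False
		then obtain z where "z : I" "z ~= 0" by blast
		then obtain c where c: "sc c : I" "sc c ~= 0" using I unfolding ideal_in_def by blast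
		hence "c ~= 0" using sc_add[of 0 0] by auto
		hence "sc (inverse c) * sc c = 1" by (simp add: sc_mult[symmetric] sc_one)
		hence "I \<subseteq> J" if "ideal_in (range sc) J" "sc c : J" for J
			using that I ideal_inD(4)[OF that(1), of "sc (inverse c)" "sc c"] ideal_inD(4)[OF that(1), of _ 1]
			by (auto simp: ideal_in_def)
		thus ?thesis using c by (intro exI[of _ "{sc c}"]) auto
	qed
qed

lemma fg_over_noetherian: "fg_over sc S ==> noetherian_in S" by (induction rule: fg_over.induct)
		 (auto intro: noetherian_range carrier_ring.noetherian_adjoin fg_over_ring)

lemma fg_over_range: "fg_over sc S ==> range sc \<subseteq> S"
proof (induction rule: fg_over.induct)
	case (fg_step S x)
	thus ?case using carrier_ring.adjoin_incl(1)[OF fg_over_ring[OF fg_step.hyps], of x] by simp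
qed simp

lemma fg_over_exists:
	assumes "finite G"
	shows "EX T. fg_over sc T & G \<subseteq> T & (ALL S. carrier_ring S & range sc \<subseteq> S & G \<subseteq> S --> T \<subseteq> S)" using assms
proof (induction G)
	case empty
	show ?case by (intro exI[of _ "range sc"]) (auto intro: fg_base)
next
	case (insert x G)
	obtain T where "fg_over sc T & G \<subseteq> T & (ALL S. carrier_ring S & range sc \<subseteq> S & G \<subseteq> S --> T \<subseteq> S)"
		using insert.IH by auto
	hence T: "fg_over sc T" "G \<subseteq> T" "!!S. carrier_ring S ==> range sc \<subseteq> S ==> G \<subseteq> S ==> T \<subseteq> S" by auto
	have "insert x G \<subseteq> adjoin T x" using T carrier_ring.adjoin_incl[OF fg_over_ring[OF T(1)], of x] by simp
	moreover have "adjoin T x \<subseteq> S" if "carrier_ring S" "range sc \<subseteq> S" "insert x G \<subseteq> S" for S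
		using carrier_ring.adjoin_least[OF that(1), of T x] T(3)[of S] that by simp
	ultimately show ?case using fg_step[OF T(1)] by blast
qed

end

section \<open>Points of finitely generated algebras\<close>

definition hom_on :: "'r::comm_ring_1 set => ('r => 'k::field) => bool" where
	"hom_on S phi \<longleftrightarrow> phi 1 = 1 & (ALL a:S. ALL b:S. phi (a + b) = phi a + phi b & phi (a * b) = phi a * phi b)"

lemma alg_closed_nonroot:
	fixes p :: "'k::alg_closed_field poly"
	assumes "p ~= 0"
	shows "EX xi. poly p xi ~= 0"
proof (rule ccontr)
	assume all: "\<not> (EX xi. poly p xi ~= 0)"
	have "degree p > 0"
	proof (rule ccontr)
		assume "\<not> degree p > 0"
		then obtain c where "p = [:c:]" by (auto elim: degree_eq_zeroE)
		thus False using all assms by simp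
	qed
	hence "degree (p + 1) > 0" by (simp add: degree_add_eq_left)
	then obtain xi where "poly (p + 1) xi = 0" using alg_closed_imp_poly_has_root[of "p + 1"] by auto
	thus False using all by simp
qed

lemma (in carrier_ring) pseudo_division:
	assumes "w : Pol S" "w ~= 0" "q : Pol S"
	shows "EX k r s. r : Pol S & s : Pol S & smult (lead_coeff w ^ k) q = w * r + s \<and>
					 (degree s < degree w | s = 0)" using assms(3)
proof (induction "degree q" arbitrary: q rule: less_induct)
	case less
	interpret polys: carrier_ring "Pol S" by (rule Pol_ring)
	show ?case
	proof (cases "degree q < degree w | q = 0")
		case True
		thus ?thesis using less.prems by (intro exI[of _ 0] exI[of _ 0] exI[of _ q]) (auto simp: polys.zero_mem)
	next
		case False
		define c where "c = lead_coeff w"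
		define m where "m = monom (lead_coeff q) (degree q - degree w)"
		define q1 where "q1 = smult c q - m * w"
		have over: "c : S" "m : Pol S" using assms(1) less.prems monom_over by (auto simp: c_def m_def Pol_def)
		hence q1: "q1 : Pol S"
			unfolding q1_def using assms(1) less.prems by (intro polys.diff_mem polys.mult_mem smult_over)
		have "degree (m * w) \<le> degree q"
			unfolding m_def using degree_mult_le[of "monom (lead_coeff q) (degree q - degree w)" w] degree_monom_le[of "lead_coeff q" "degree q - degree w"] False
			by auto
		hence dq1: "degree q1 \<le> degree q" unfolding q1_def by (intro degree_diff_le) (auto intro: degree_smult_le)
		have "coeff (m * w) (degree q) = lead_coeff q * lead_coeff w" using False by (simp add: m_def coeff_monom_mult)
		hence "coeff q1 (degree q) = 0" by (simp add: q1_def c_def mult.commute)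
		hence "degree q1 < degree q | q1 = 0" using dq1 by (metis leading_coeff_0_iff le_neq_implies_less)
		then obtain k r s where krs: "r : Pol S" "s : Pol S" "smult (c ^ k) q1 = w * r + s"
				"degree s < degree w | s = 0"
		proof
			assume "q1 = 0"
			thus ?thesis using that[of 0 0 0] by (auto simp: polys.zero_mem)
		qed (use less.hyps[of q1] q1 that c_def in blast)
		have "smult (c ^ Suc k) q = smult (c ^ k) q1 + smult (c ^ k) (m * w)"
			by (simp add: q1_def smult_diff_right mult.commute)
		also have "\<dots> = w * (r + smult (c ^ k) m) + s" by (simp add: krs(3) algebra_simps)
		finally show ?thesis using krs over by (intro exI[of _ "Suc k"] exI[of _ "r + smult (c ^ k) m"] exI[of _ s])
				 (auto simp: c_def intro!: polys.add_mem smult_over power_mem)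
	qed
qed

locale prime_adjunction = carrier_ring S for S :: "'r::comm_ring_1 set" +
	fixes x :: 'r and P :: "'r set"
	assumes P: "prime_in (adjoin S x) P"
begin

sublocale T: carrier_ring "adjoin S x" by (rule adjoin_ring)

sublocale polys: carrier_ring "Pol S" by (rule Pol_ring)

lemma P_ideal: "ideal_in (adjoin S x) P" using P by (simp add: prime_in_def)

lemma P_prime: "a : adjoin S x ==> b : adjoin S x ==> a * b : P ==> a : P | b : P" using P by (simp add: prime_in_def)

lemma S_mem: "a : S ==> a : adjoin S x" using adjoin_incl by auto

lemma eval_mem: "p : Pol S ==> poly p x : adjoin S x" by (simp add: adjoin_def)

lemma power_not_P: "a : S ==> a \<notin> P ==> a ^ k \<notin> P"
proof (induction k)
	case 0
	thus ?case using P by (simp add: prime_in_def)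
next
	case (Suc k)
	thus ?case using P_prime[of a "a ^ k"] S_mem power_mem by auto
qed

definition trivial :: "'r poly => bool" where
	"trivial p \<longleftrightarrow> (ALL i. coeff p i : P)"

lemma trivial_eval: "trivial p ==> poly p x : P" unfolding poly_altdef trivial_def
	using ideal_inD(4)[OF P_ideal, of "x ^ _" "coeff p _"] T.power_mem adjoin_incl(2)
	by (intro T.ideal_sum[OF P_ideal]) (auto simp: mult.commute)

text \<open>Modulo \<open>P\<close>, a nontrivial polynomial may be replaced by one whose leading coefficient survives.\<close>

lemma strip:
	assumes "p : Pol S" "\<not> trivial p"
	obtains p' where "p' : Pol S" "lead_coeff p' \<notin> P" "degree p' \<le> degree p" "trivial (p - p')"
		"!!i. coeff p i \<notin> P ==> i \<le> degree p'"
proof -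
	define A where "A = {i. coeff p i \<notin> P}"
	have zero: "0 : P" using ideal_inD(2)[OF P_ideal] .
	hence A: "finite A" "A ~= {}" using assms(2) le_degree[of p]
		by (auto simp: A_def trivial_def finite_nat_set_iff_bounded_le intro!: exI[of _ "degree p"]) metis
	define d where "d = Max A"
	have d: "coeff p d \<notin> P" "!!i. coeff p i \<notin> P ==> i \<le> d"
		using Max_in[OF A] Max_ge[OF A(1)] by (auto simp: d_def A_def)
	define p' where "p' = poly_cutoff (Suc d) p"
	have cp': "coeff p' k = (if k \<le> d then coeff p k else 0)" for k by (simp add: p'_def coeff_poly_cutoff)
	have "degree p' = d" using cp' d(1) zero by (intro antisym degree_le le_degree) auto
	moreover have "d \<le> degree p" using d(1) zero by (intro le_degree) auto
	moreover have "p' : Pol S" using assms(1) by (auto simp: Pol_def cp' zero_mem)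
	moreover have "trivial (p - p')" using d(2) zero by (auto simp: trivial_def cp')
	ultimately show ?thesis using that[of p'] d cp' by auto
qed

lemma trivial_mult: "p : Pol S ==> trivial q ==> trivial (p * q)" using ideal_inD(4)[OF P_ideal] S_mem
			by (auto simp: trivial_def coeff_mult Pol_def intro!: T.ideal_sum[OF P_ideal])

context
	fixes phi :: "'r => 'k::field"
	assumes phi: "hom_on S phi" and kill: "!!a. a : P ==> a : S ==> phi a = 0"
begin

lemma hom_zero: "phi 0 = 0" using phi zero_mem unfolding hom_on_def by auto

lemma hom_sum: "(!!i. i : A ==> f i : S) ==> phi (sum f A) = (\<Sum>i\<in>A. phi (f i))"
proof (induction A rule: infinite_finite_induct)
	case (insert a A)
	hence "f a : S" "sum f A : S" using sum_mem[of A f] by auto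
	thus ?case using phi insert by (simp add: hom_on_def)
qed (simp_all add: hom_zero)

lemma coeff_map: "coeff (map_poly phi p) i = phi (coeff p i)" by (simp add: coeff_map_poly hom_zero)

lemma map_add: "p : Pol S ==> q : Pol S ==> map_poly phi (p + q) = map_poly phi p + map_poly phi q"
	using phi by (intro poly_eqI) (auto simp: coeff_map hom_on_def Pol_def)

lemma map_mult: "p : Pol S ==> q : Pol S ==> map_poly phi (p * q) = map_poly phi p * map_poly phi q"
	using phi by (intro poly_eqI) (auto simp: coeff_map coeff_mult hom_sum hom_on_def Pol_def mult_mem)

lemma map_const: "map_poly phi [:a:] = [:phi a:]"
	by (intro poly_eqI) (auto simp: coeff_map coeff_pCons hom_zero split: nat.split)

lemma map_trivial: "p : Pol S ==> trivial p ==> map_poly phi p = 0"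
	by (intro poly_eqI) (auto simp: coeff_map trivial_def kill Pol_def)

lemma map_cong_trivial:
	assumes "p : Pol S" "q : Pol S" "trivial (p - q)"
	shows "map_poly phi p = map_poly phi q"
	using map_add[of "p - q" q] map_trivial[of "p - q"] assms polys.diff_mem by auto

lemma extend_hom:
	assumes "!!p. p : Pol S ==> poly p x : P ==> poly (map_poly phi p) xi = 0"
	obtains psi where "hom_on (adjoin S x) psi" "!!a. a : P ==> psi a = 0"
		"!!p. p : Pol S ==> psi (poly p x) = poly (map_poly phi p) xi"
proof -
	define psi where "psi y = poly (map_poly phi (SOME p. p : Pol S & poly p x = y)) xi" for y
	have psi: "psi (poly p x) = poly (map_poly phi p) xi" if p: "p : Pol S" for p
	proof -
		define q where "q = (SOME q. q : Pol S & poly q x = poly p x)"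
		have q: "q : Pol S" "poly q x = poly p x"
			unfolding q_def using someI_ex[of "%q. q : Pol S & poly q x = poly p x"] p by auto
		have "poly (map_poly phi (p - q)) xi = 0"
			using q p assms[of "p - q"] polys.diff_mem ideal_inD(2)[OF P_ideal] by auto
		moreover have "map_poly phi p = map_poly phi (p - q) + map_poly phi q"
			using map_add[of "p - q" q] p q polys.diff_mem by simp
		ultimately show ?thesis unfolding psi_def q_def[symmetric] by simp
	qed
	have "hom_on (adjoin S x) psi" unfolding hom_on_def
	proof (intro conjI ballI)
		have "psi (poly [:1:] x) = poly (map_poly phi [:1:]) xi" using const_over[OF one_mem] by (rule psi)
		thus "psi 1 = 1" using phi by (simp add: map_const hom_on_def)
		fix a b assume "a : adjoin S x" "b : adjoin S x"
		then obtain p q where pq: "p : Pol S" "a = poly p x" "q : Pol S" "b = poly q x" by (auto simp: adjoin_def)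
		show "psi (a + b) = psi a + psi b"
			using psi[of "p + q"] psi[of p] psi[of q] pq polys.add_mem by (simp add: map_add)
		show "psi (a * b) = psi a * psi b"
			using psi[of "p * q"] psi[of p] psi[of q] pq polys.mult_mem by (simp add: map_mult)
	qed
	moreover have "psi a = 0" if a: "a : P" for a
	proof -
		obtain p where "p : Pol S" "a = poly p x" using a ideal_inD(1)[OF P_ideal] by (auto simp: adjoin_def)
		thus ?thesis using psi[of p] assms[of p] a by simp
	qed
	ultimately show ?thesis using that psi by simp
qed

end

text \<open>The extension lemma behind the Nullstellensatz. If \<open>x\<close> is transcendental modulo \<open>P\<close>, the leading
	coefficient of an expression of \<open>b\<close> in \<open>x\<close> must survive. If it is algebraic, the leading coefficient
	of its minimal equation must survive, so that the equation keeps a root, together with a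
	nonzero multiple of \<open>b\<close> that is free of \<open>x\<close>.\<close>

lemma extension_condition:
	assumes b: "b : adjoin S x" "b \<notin> P"
	shows "EX a:S. a \<notin> P \<and>
		(ALL phi. hom_on S phi & (ALL c:P \<inter> S. phi c = 0) & phi a ~= (0 :: 'k::alg_closed_field) -->
			(EX psi. hom_on (adjoin S x) psi & (ALL c:P. psi c = 0) & psi b ~= 0 & (ALL c:S. psi c = phi c)))"
proof -
	obtain q where q: "q : Pol S" "b = poly q x" using b by (auto simp: adjoin_def)
	have ntq: "\<not> trivial q" using trivial_eval b q by auto
	have on_S: "psi c = phi c" if "hom_on S phi" "!!c. c : P ==> c : S ==> phi c = 0" "c : S"
			"!!p. p : Pol S ==> psi (poly p x) = poly (map_poly phi p) xi"
		for psi phi :: "'r => 'k" and c xi using that(4)[OF const_over[OF that(3)]] map_const[OF that(1,2)] by simp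
	show ?thesis
	proof (cases "ALL p:Pol S. poly p x : P --> trivial p")
		case True
		obtain q' where q': "q' : Pol S" "lead_coeff q' \<notin> P" "trivial (q - q')" using strip[OF q(1) ntq] by metis
		show ?thesis
		proof (intro bexI[of _ "lead_coeff q'"] conjI allI impI)
			fix phi :: "'r => 'k"
			assume phi: "hom_on S phi & (ALL c:P \<inter> S. phi c = 0) & phi (lead_coeff q') ~= 0"
			hence phi1: "hom_on S phi" and phi2: "!!c. c : P ==> c : S ==> phi c = 0" by auto
			have "coeff (map_poly phi q') (degree q') ~= 0" using phi by (simp add: coeff_map[OF phi1 phi2])
			hence "map_poly phi q ~= 0" using map_cong_trivial[OF phi1 phi2 q(1) q'(1,3)] by auto
			then obtain xi where xi: "poly (map_poly phi q) xi ~= 0" using alg_closed_nonroot by auto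
			obtain psi where psi: "hom_on (adjoin S x) psi" "!!a. a : P ==> psi a = 0"
				"!!p. p : Pol S ==> psi (poly p x) = poly (map_poly phi p) xi"
				by (rule extend_hom[OF phi1 phi2, of xi]) (use True map_trivial[OF phi1 phi2] in auto)
			thus "EX psi. hom_on (adjoin S x) psi & (ALL c:P. psi c = 0) & psi b ~= 0 & (ALL c:S. psi c = phi c)"
				using xi q on_S[OF phi1 phi2 _ psi(3)] by (intro exI[of _ psi]) auto
		qed (use q' in \<open>auto simp: Pol_def\<close>)
	next
		case False
		define A where "A p \<longleftrightarrow> p : Pol S & lead_coeff p \<notin> P & poly p x : P" for p
		have strip_A: "EX p'. A p' & degree p' \<le> degree p & (ALL i. coeff p i \<notin> P --> i \<le> degree p')"
			if p: "p : Pol S" "\<not> trivial p" "poly p x : P" for p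
		proof -
			obtain p' where p': "p' : Pol S" "lead_coeff p' \<notin> P" "degree p' \<le> degree p" "trivial (p - p')"
				"!!i. coeff p i \<notin> P ==> i \<le> degree p'" using strip[OF p(1,2)] by auto
			have "poly p' x = poly p x - poly (p - p') x" by simp
			hence "poly p' x : P" using T.ideal_diff[OF P_ideal p(3) trivial_eval[OF p'(4)]] by simp
			thus ?thesis using p' A_def by auto
		qed
		obtain p where p: "A p" "!!p'. A p' ==> degree p \<le> degree p'"
			using False strip_A ex_has_least_nat[of A _ degree] by blast
		define m where "m = degree p"
		define c where "c = lead_coeff p"
		have pS: "p : Pol S" and cP: "c \<notin> P" and px: "poly p x : P" and cS: "c : S"
			using p(1) by (auto simp: A_def c_def Pol_def)
		have p0: "p ~= 0" using cP ideal_inD(2)[OF P_ideal] by (auto simp: c_def)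
		have small: "trivial s" if s: "s : Pol S" "degree s < m | s = 0" "poly s x : P" for s
		proof (rule ccontr)
			assume nt: "\<not> trivial s"
			hence "s ~= 0" using ideal_inD(2)[OF P_ideal] by (auto simp: trivial_def)
			thus False using strip_A[OF s(1) nt s(3)] p(2) s(2) m_def by fastforce
		qed
		have m: "m > 0"
		proof (rule ccontr)
			assume "\<not> m > 0"
			hence "poly p x = c" by (auto simp: m_def c_def elim: degree_eq_zeroE)
			thus False using px cP by simp
		qed
		have rem_m: "EX k s. s : Pol S & (degree s < m | s = 0) & c ^ k * poly r x - poly s x : P \<and>
				(EX t:Pol S. smult (c ^ k) r = p * t + s)" if r: "r : Pol S" for r
		proof -
			obtain k t s where kts: "t : Pol S" "s : Pol S" "smult (c ^ k) r = p * t + s"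
					"degree s < m | s = 0" using pseudo_division[OF pS p0 r] by (auto simp: c_def m_def)
			have "c ^ k * poly r x - poly s x = poly t x * poly p x" using arg_cong[OF kts(3), of "%p. poly p x"] by simp
			hence "c ^ k * poly r x - poly s x : P" using ideal_inD(4)[OF P_ideal eval_mem[OF kts(1)] px] by simp
			thus ?thesis using kts by auto
		qed
		define W where "W w \<longleftrightarrow> w : Pol S & lead_coeff w \<notin> P & degree w < m \<and>
				(EX y:adjoin S x. poly w x - b * y : P)" for w
		have strip_W: "EX w. W w & degree w \<le> degree s" if s: "s : Pol S" "\<not> trivial s" "degree s < m"
			"y : adjoin S x" "poly s x - b * y : P" for s y
		proof -
			obtain s' where s': "s' : Pol S" "lead_coeff s' \<notin> P" "degree s' \<le> degree s" "trivial (s - s')"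
				using strip[OF s(1,2)] by metis
			have "poly s' x - b * y = (poly s x - b * y) - poly (s - s') x" by simp
			hence "poly s' x - b * y : P" using T.ideal_diff[OF P_ideal s(5) trivial_eval[OF s'(4)]] by simp
			thus ?thesis using s' s(3,4) by (intro exI[of _ s']) (auto simp: W_def)
		qed
		have "EX w. W w"
		proof -
			obtain k s where ks: "s : Pol S" "degree s < m | s = 0" "c ^ k * b - poly s x : P"
				using rem_m[OF q(1)] q(2) by auto
			have "c ^ k * b \<notin> P" using P_prime[of "c ^ k" b] power_not_P[OF cS cP] b S_mem power_mem cS by auto
			hence "\<not> trivial s" using ideal_inD(3)[OF P_ideal ks(3) trivial_eval[of s]] by auto
			moreover have "poly s x - b * c ^ k : P" using T.ideal_uminus[OF P_ideal ks(3)] by (simp add: mult.commute)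
			moreover have "degree s < m" using ks(2) m by auto
			ultimately show ?thesis using strip_W[OF ks(1)] S_mem power_mem cS by blast
		qed
		then obtain w where w: "W w" "!!w'. W w' ==> degree w \<le> degree w'" using ex_has_least_nat[of W _ degree] by auto
		obtain y where wS: "w : Pol S" and wP: "lead_coeff w \<notin> P" and wm: "degree w < m"
				and y: "y : adjoin S x" "poly w x - b * y : P" using w(1) by (auto simp: W_def)
		have w0: "w ~= 0" using wP ideal_inD(2)[OF P_ideal] by auto
		have wxP: "poly w x \<notin> P" using small[OF wS] wm wP by (auto simp: trivial_def)
		have "degree w = 0"
		proof (rule ccontr)
			assume dw: "degree w ~= 0"
			obtain k r s where krs: "r : Pol S" "s : Pol S" "smult (lead_coeff w ^ k) p = w * r + s"
					"degree s < degree w | s = 0" using pseudo_division[OF wS w0 pS] by auto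
			have "poly s x = lead_coeff w ^ k * poly p x - poly w x * poly r x"
				using arg_cong[OF krs(3), of "%p. poly p x"] by simp
			hence "poly s x + poly w x * poly r x : P"
				using ideal_inD(4)[OF P_ideal _ px, of "lead_coeff w ^ k"] wS S_mem power_mem by (auto simp: Pol_def)
			have rT: "poly r x : adjoin S x" using krs eval_mem by simp
			have "poly s x - b * - (y * poly r x) = (poly s x + poly w x * poly r x) - poly r x * (poly w x - b * y)"
				by (simp add: algebra_simps)
			hence "poly s x - b * - (y * poly r x) : P"
				using T.ideal_diff[OF P_ideal] ideal_inD(4)[OF P_ideal rT y(2)] \<open>poly s x + poly w x * poly r x : P\<close>
			by metis
			moreover have "degree s < degree w" using krs(4) dw by auto
			ultimately have "trivial s"
				using strip_W[OF krs(2), of "- (y * poly r x)"] w(2) wm rT y(1) T.uminus_mem T.mult_mem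
			by (metis leD le_less_trans less_trans)
			hence "poly w x * poly r x : P"
				using \<open>poly s x + poly w x * poly r x : P\<close> T.ideal_diff[OF P_ideal _ trivial_eval]
			by (metis add_diff_cancel_left')
			hence rP: "poly r x : P" using P_prime[OF eval_mem[OF wS] rT] wxP by simp
			have lwS: "lead_coeff w ^ k : S" "lead_coeff w ^ k \<notin> P"
				using wS power_mem power_not_P[OF _ wP] by (auto simp: Pol_def)
			have "\<not> trivial r"
			proof
				assume "trivial r"
				hence "trivial (w * r + s)"
					using trivial_mult[OF wS] \<open>trivial s\<close> ideal_inD(3)[OF P_ideal] by (auto simp: trivial_def)
				hence "lead_coeff w ^ k * c : P" unfolding krs(3)[symmetric] trivial_def c_def by simp
				thus False using P_prime[of "lead_coeff w ^ k" c] lwS cP cS S_mem by simp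
			qed
			then obtain r' where r': "r' : Pol S" "lead_coeff r' \<notin> P" "degree r' \<le> degree r" "trivial (r - r')"
				using strip[OF krs(1)] by metis
			have "poly r' x = poly r x - poly (r - r') x" by simp
			hence "A r'" using r' T.ideal_diff[OF P_ideal rP trivial_eval[OF r'(4)]] by (simp add: A_def)
			hence dr': "m \<le> degree r'" using p(2) m_def by simp
			have "trivial (w * (r - r') + s)"
				using trivial_mult[OF wS r'(4)] \<open>trivial s\<close> ideal_inD(3)[OF P_ideal] by (auto simp: trivial_def)
			moreover have "w * (r - r') + s = smult (lead_coeff w ^ k) p - w * r'" using krs(3) by (simp add: algebra_simps)
			ultimately have "coeff (smult (lead_coeff w ^ k) p - w * r') (degree w + degree r') : P"
				by (simp add: trivial_def)
			moreover have "coeff p (degree w + degree r') = 0" using dr' dw by (intro coeff_eq_0) (auto simp: m_def)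
			ultimately have "- (lead_coeff w * lead_coeff r') : P" by (simp add: coeff_mult_degree_sum)
			hence "lead_coeff w * lead_coeff r' : P" using T.ideal_uminus[OF P_ideal] by fastforce
			thus False using P_prime[of "lead_coeff w" "lead_coeff r'"] wP r'(1,2) wS S_mem by (auto simp: Pol_def)
		qed
		then obtain e where e: "w = [:e:]" by (auto elim: degree_eq_zeroE)
		have eS: "e : S" "e \<notin> P" using wS wP by (auto simp: e Pol_def coeff_pCons split: nat.splits if_splits)
		have ey: "e - b * y : P" using y(2) by (simp add: e)
		show ?thesis
		proof (intro bexI[of _ "c * e"] conjI allI impI)
			show "c * e \<notin> P" using P_prime[of c e] cS cP eS S_mem by auto
			fix phi :: "'r => 'k"
			assume phi: "hom_on S phi & (ALL c:P \<inter> S. phi c = 0) & phi (c * e) ~= 0"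
			hence phi1: "hom_on S phi" and phi2: "!!c. c : P ==> c : S ==> phi c = 0" by auto
			have phice: "phi c ~= 0" "phi e ~= 0" using phi cS eS by (auto simp: hom_on_def)
			have "coeff (map_poly phi p) m ~= 0" using phice by (simp add: coeff_map[OF phi1 phi2] m_def c_def)
			hence "m \<le> degree (map_poly phi p)" by (rule le_degree)
			then obtain xi where xi: "poly (map_poly phi p) xi = 0"
				using alg_closed_imp_poly_has_root[of "map_poly phi p"] m by auto
			have WD: "poly (map_poly phi r) xi = 0" if r: "r : Pol S" "poly r x : P" for r
			proof -
				obtain k s t where ks: "s : Pol S" "degree s < m | s = 0" "c ^ k * poly r x - poly s x : P"
						"t : Pol S" "smult (c ^ k) r = p * t + s" using rem_m[OF r(1)] by auto
				have ckS: "c ^ k : S" using cS power_mem by simp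
				have "poly s x : P" using T.ideal_diff[OF P_ideal ideal_inD(4)[OF P_ideal S_mem[OF ckS] r(2)] ks(3)] by simp
				hence "trivial s" using small ks by simp
				have "[:c ^ k:] * r = p * t + s" using ks(5) by simp
				hence "[:phi (c ^ k):] * map_poly phi r = map_poly phi p * map_poly phi t + map_poly phi s"
					using map_mult[OF phi1 phi2 const_over[OF ckS] r(1)] map_const[OF phi1 phi2, of "c ^ k"] map_add[OF phi1 phi2, of "p * t" s] map_mult[OF phi1 phi2 pS ks(4)] polys.mult_mem[OF pS ks(4)] ks(1)
			by simp
				hence "poly ([:phi (c ^ k):] * map_poly phi r) xi = 0"
					using xi map_trivial[OF phi1 phi2 ks(1) \<open>trivial s\<close>] by simp
				moreover have "phi (c ^ k) ~= 0" using phi1 phice(1) cS power_mem by (induction k) (auto simp: hom_on_def)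
				ultimately show ?thesis by simp
			qed
			obtain psi where psi: "hom_on (adjoin S x) psi" "!!a. a : P ==> psi a = 0"
				"!!p. p : Pol S ==> psi (poly p x) = poly (map_poly phi p) xi"
				by (rule extend_hom[OF phi1 phi2, of xi]) (use WD in auto)
			have same: "psi z = phi z" if "z : S" for z using on_S[OF phi1 phi2 that psi(3)] .
			have "b * y : adjoin S x" "e - b * y : adjoin S x"
				using b(1) y(1) T.mult_mem ideal_inD(1)[OF P_ideal ey] by auto
			hence "psi (b * y + (e - b * y)) = psi (b * y) + psi (e - b * y)" "psi (b * y) = psi b * psi y"
				using psi(1) b(1) y(1) unfolding hom_on_def by blast+
			hence "psi e = psi b * psi y" using psi(2)[OF ey] by simp
			hence "psi b ~= 0" using same[OF eS(1)] phice by auto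
			thus "EX psi. hom_on (adjoin S x) psi & (ALL c:P. psi c = 0) & psi b ~= 0 & (ALL c:S. psi c = phi c)"
				using psi same by auto
		qed (use cS eS mult_mem in auto)
	qed
qed

end

text \<open>The Nullstellensatz: the points at which a prime ideal vanishes detect each element outside it.\<close>

theorem prime_has_point:
	fixes sc :: "'k::alg_closed_field => 'r::comm_ring_1"
	assumes "scalar_embedding sc" "fg_over sc T" "prime_in T P" "b : T" "b \<notin> P"
	shows "EX phi. hom_on T phi & (ALL c. phi (sc c) = c) & (ALL a:P. phi a = (0::'k)) & phi b ~= 0" using assms(2-5)
proof (induction arbitrary: P b rule: fg_over.induct)
	interpret scalar_embedding sc by (rule assms(1))
	case fg_base
	have sc0: "sc 0 = 0" using sc_add[of 0 0] by simp
	have P0: "c = 0" if "sc c : P" for c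
	proof (rule ccontr)
		assume "c ~= 0"
		hence "sc (inverse c) * sc c = 1" by (simp add: sc_mult[symmetric] sc_one)
		thus False
			using fg_base(1) ideal_inD(4)[of "range sc" P "sc (inverse c)" "sc c"] that by (auto simp: prime_in_def)
	qed
	have inj: "c = d" if "sc c = sc d" for c d
		using P0[of "c - d"] that sc_add[of c "- d"] sc_uminus[of d] fg_base(1) by (simp add: prime_in_def ideal_in_def)
	define phi where "phi = inv_into UNIV sc"
	have phi: "phi (sc c) = c" for c unfolding phi_def by (rule inv_into_f_f) (auto intro: injI inj)
	have "hom_on (range sc) phi"
		using phi[of 1] by (auto simp: hom_on_def sc_one phi sc_add[symmetric] sc_mult[symmetric])
	moreover have "phi a = 0" if "a : P" for a using that P0 phi fg_base(1) by (auto simp: prime_in_def ideal_in_def)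
	moreover have "phi b ~= 0" using fg_base sc0 phi by (auto simp: prime_in_def ideal_in_def)
	ultimately show ?case using phi by auto
next
	interpret scalar_embedding sc by (rule assms(1))
	case (fg_step S x)
	interpret carrier_ring S by (rule fg_over_ring[OF fg_step.hyps])
	interpret prime_adjunction S x P by unfold_locales (rule fg_step.prems)
	have "prime_in S (P \<inter> S)" using fg_step.prems(1) S_mem ring_mem unfolding prime_in_def ideal_in_def by auto
	moreover obtain a where a: "a : S" "a \<notin> P" "ALL phi. hom_on S phi & (ALL c:P \<inter> S. phi c = 0) & phi a ~= (0::'k) -->
			(EX psi. hom_on (adjoin S x) psi & (ALL c:P. psi c = 0) & psi b ~= 0 & (ALL c:S. psi c = phi c))"
		using extension_condition[OF fg_step.prems(2,3)] by auto
	ultimately obtain phi where phi: "hom_on S phi" "ALL c. phi (sc c) = c" "ALL c:P \<inter> S. phi c = 0" "phi a ~= (0::'k)"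
		using fg_step.IH[of "P \<inter> S" a] by auto
	obtain psi where psi: "hom_on (adjoin S x) psi" "ALL c:P. psi c = 0" "psi b ~= 0" "ALL c:S. psi c = phi c"
		using a(3) phi(1,3,4) by auto
	moreover have "psi (sc c) = c" for c using psi(4) phi(2) fg_over_range[OF fg_step.hyps] by (simp add: subset_iff)
	ultimately show ?case by blast
qed

section \<open>Normal noetherian domains\<close>

locale normal_noetherian = carrier_ring S for S :: "'r::comm_ring_1 set" +
	assumes no_zero_divisors: "a : S ==> b : S ==> a * b = 0 ==> a = 0 | b = 0"
		and noetherian: "noetherian_in S"
		and integrally_closed: "a : S ==> b : S ==> b ~= 0 ==> (!!i. i < n ==> c i : S) ==>
				a ^ n + (\<Sum>i<n. c i * a ^ i * b ^ (n - i)) = 0 ==> EX q:S. a = b * q"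
begin

lemma cancel: "a : S ==> b : S ==> c : S ==> c ~= 0 ==> c * a = c * b ==> a = b"
	using no_zero_divisors[of c "a - b"] diff_mem by (auto simp: right_diff_distrib)

definition colon :: "'r => 'r => 'r set" where
	"colon b a = {r : S. EX s:S. r * a = b * s}"

lemma colon_ideal: "a : S ==> b : S ==> ideal_in S (colon b a)" unfolding ideal_in_def colon_def
proof (intro conjI ballI)
	show "0 : {r : S. EX s:S. r * a = b * s}" using zero_mem by (auto intro!: bexI[of _ 0])
	fix x assume "x : {r : S. EX s:S. r * a = b * s}"
	then obtain s where s: "x : S" "s : S" "x * a = b * s" by auto
	show "t * x : {r : S. EX s:S. r * a = b * s}" if "t : S" for t
		using s that by (auto intro!: mult_mem bexI[of _ "t * s"] simp: mult.assoc mult.left_commute[of b])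
	fix y assume "y : {r : S. EX s:S. r * a = b * s}"
	then obtain t where t: "y : S" "t : S" "y * a = b * t" by auto
	show "x + y : {r : S. EX s:S. r * a = b * s}"
		using s t by (auto intro!: add_mem bexI[of _ "s + t"] simp: algebra_simps)
qed auto

lemma colon_mult: "a : S ==> b : S ==> r : S ==> colon b a \<subseteq> colon b (a * r)" unfolding colon_def
proof safe
	fix x s assume "a : S" "b : S" "r : S" "x : S" "s : S" "x * a = b * s"
	thus "EX s:S. x * (a * r) = b * s" by (intro bexI[of _ "s * r"]) (auto simp: mult.assoc[symmetric] mult_mem)
qed

lemma colon_multD: "x : S ==> x : colon b (a * r) ==> r : S ==> x * r : colon b a"
	by (auto simp: colon_def mult_mem mult.commute mult.left_commute)

text \<open>A fraction \<open>a / b\<close> that is not in \<open>S\<close> has an associated prime.\<close>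

lemma associated_prime:
	assumes "a : S" "b : S" "\<not> (EX q:S. a = b * q)"
	obtains r where "r : S" "prime_in S (colon b (a * r))"
proof -
	define \<F> where "\<F> = {colon b (a * r) | r. r : S & 1 \<notin> colon b (a * r)}"
	have "1 \<notin> colon b (a * 1)" using assms(3) by (auto simp: colon_def)
	hence "\<F> ~= {}" unfolding \<F>_def using one_mem by auto
	moreover have "ideal_in S I" if "I : \<F>" for I using that assms by (auto simp: \<F>_def intro: colon_ideal mult_mem)
	ultimately obtain M where M: "M : \<F>" "!!I. I : \<F> ==> M \<subseteq> I ==> I = M"
		using noetherian_maximal[OF noetherian] by blast
	obtain r where r: "r : S" "M = colon b (a * r)" "1 \<notin> M" using M(1) by (auto simp: \<F>_def)
	have "x : M | y : M" if xy: "x : S" "y : S" "x * y : M" for x y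
	proof (cases "1 : colon b (a * (r * y))")
		case True
		hence "y : M" using colon_multD[OF one_mem, of b "a * r" y] xy r by (simp add: mult.assoc)
		thus ?thesis ..
	next
		case False
		hence "colon b (a * (r * y)) : \<F>" unfolding \<F>_def using xy r mult_mem by auto
		hence "colon b (a * (r * y)) = M"
			using M(2) colon_mult[of "a * r" b y] assms xy r mult_mem by (simp add: mult.assoc)
		moreover have "x : colon b (a * (r * y))" using xy r by (auto simp: colon_def mult_ac)
		ultimately show ?thesis by simp
	qed
	hence "prime_in S M" using r colon_ideal[of "a * r" b] assms mult_mem by (auto simp: prime_in_def)
	thus ?thesis using that r by simp
qed

text \<open>A uniformizer at \<open>P\<close> is an element that generates \<open>P\<close> after inverting the element \<open>u\<close> outside \<open>P\<close>.\<close>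

definition uniformizer :: "'r set => 'r => 'r => bool" where
	"uniformizer P t u \<longleftrightarrow> t : P & u : S - P & (ALL c:P. EX d:S. u * c = t * d)"

text \<open>Multiplication by \<open>a / b\<close> maps \<open>P = (b : a)\<close> into \<open>S\<close>. If it mapped \<open>P\<close> into itself, then
	\<open>a / b\<close> would be integral over \<open>S\<close>, because the ideal generated by the elements
	\<open>b (a / b) ^ i\<close> of \<open>P\<close> is finitely generated. This replaces Krull's height theorem.\<close>

lemma colon_uniformizer:
	assumes a: "a : S" and b: "b : S" "b ~= 0" and P: "prime_in S (colon b a)"
	obtains t u where "uniformizer (colon b a) t u"
proof -
	define P where "P = colon b a"
	have idP: "ideal_in S P" using colon_ideal a b by (simp add: P_def)
	define f where "f c = (SOME s. s : S & c * a = b * s)" for c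
	have f: "f c : S" "c * a = b * f c" if "c : P" for c
		using someI_ex[of "%s. s : S & c * a = b * s"] that by (auto simp: f_def P_def colon_def)
	have PS: "P \<subseteq> S" by (auto simp: P_def colon_def)
	show ?thesis
	proof (cases "ALL c:P. f c : P")
		case False
		then obtain t where t: "t : P" "f t \<notin> P" by blast
		have "EX d:S. f t * c = t * d" if c: "c : P" for c
		proof
			have "b * (f t * c) = b * (t * f c)" using f(2)[OF c] f(2)[OF t(1)] by (metis mult.assoc mult.commute)
			moreover have "f t * c : S" "t * f c : S" using f(1) c t(1) PS mult_mem by (blast dest: subsetD)+
			ultimately show "f t * c = t * f c" using cancel[of "f t * c" "t * f c" b] b by simp
			show "f c : S" using f c by simp
		qed
		hence "uniformizer P t (f t)" using t f by (auto simp: uniformizer_def)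
		thus ?thesis using that by (simp add: P_def)
	next
		case True
		have bP: "b : P" using a b by (auto simp: P_def colon_def)
		define g where "g n = (f ^^ n) b" for n
		have g: "g n : P" for n using True bP by (induction n) (auto simp: g_def)
		have gS: "a * g n = b * g (Suc n)" for n using f(2)[OF g[of n]] by (simp add: g_def mult.commute)
		have power: "a ^ n * b = b ^ n * g n" for n
		proof (induction n)
			case (Suc n)
			thus ?case using gS[of n] by (metis mult.assoc mult.commute power_Suc)
		qed (simp add: g_def)
		define L where "L n = {\<Sum>i<n. c i * g i | c. \<forall>i<n. c i : S}" for n
		have "ideal_in S (L n)" for n unfolding ideal_in_def
		proof (intro conjI ballI)
			show "L n \<subseteq> S" unfolding L_def using g PS by (auto intro!: sum_mem mult_mem)
			show "0 : L n" unfolding L_def using zero_mem by (auto intro!: exI[of _ "%_. 0"])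
			fix x assume "x : L n"
			then obtain c where c: "x = (\<Sum>i<n. c i * g i)" "\<forall>i<n. c i : S" by (auto simp: L_def)
			show "s * x : L n" if "s : S" for s unfolding L_def using c that
			by (auto intro!: exI[of _ "%i. s * c i"] mult_mem simp: sum_distrib_left mult.assoc)
			fix y assume "y : L n"
			then obtain d where d: "y = (\<Sum>i<n. d i * g i)" "\<forall>i<n. d i : S" by (auto simp: L_def)
			show "x + y : L n" unfolding L_def using c d
			by (auto intro!: exI[of _ "%i. c i + d i"] add_mem simp: sum.distrib distrib_right)
		qed
		moreover have "L n \<subseteq> L (Suc n)" for n
		proof
			fix x assume "x : L n"
			then obtain c where c: "x = (\<Sum>i<n. c i * g i)" "\<forall>i<n. c i : S" by (auto simp: L_def)
			thus "x : L (Suc n)"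
				unfolding L_def using zero_mem by (auto intro!: exI[of _ "%i. if i < n then c i else 0"] simp: less_Suc_eq)
		qed
		ultimately obtain n where n: "L (Suc n) = L n"
			using noetherian_chain[OF noetherian, of L] by (metis le_SucI order_refl)
		have "g n : L (Suc n)"
			unfolding L_def using zero_mem one_mem by (auto intro!: exI[of _ "%i. if i = n then 1 else 0"])
		then obtain c where c: "g n = (\<Sum>i<n. c i * g i)" "\<forall>i<n. c i : S" unfolding n by (auto simp: L_def)
		have "b * a ^ n = b ^ n * g n" using power[of n] by (simp add: mult.commute)
		also have "\<dots> = (\<Sum>i<n. c i * (b ^ i * g i) * b ^ (n - i))" unfolding c(1) sum_distrib_left
			by (intro sum.cong) (auto simp: power_add[symmetric] mult_ac)
		also have "\<dots> = (\<Sum>i<n. b * (c i * a ^ i * b ^ (n - i)))"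
		proof (intro sum.cong refl)
			fix i
			show "c i * (b ^ i * g i) * b ^ (n - i) = b * (c i * a ^ i * b ^ (n - i))" unfolding power[symmetric] by simp
		qed
		also have "\<dots> = b * (\<Sum>i<n. c i * a ^ i * b ^ (n - i))" by (simp add: sum_distrib_left)
		finally have "a ^ n = (\<Sum>i<n. c i * a ^ i * b ^ (n - i))"
			using cancel[of "a ^ n" "\<Sum>i<n. c i * a ^ i * b ^ (n - i)" b] a b c(2)
			by (auto intro!: sum_mem mult_mem power_mem)
		hence "a ^ n + (\<Sum>i<n. - c i * a ^ i * b ^ (n - i)) = 0" by (simp add: sum_negf)
		hence "EX q:S. a = b * q" using integrally_closed[of a b n "%i. - c i"] a b c(2) uminus_mem by auto
		hence "1 : colon b a" using one_mem by (auto simp: colon_def)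
		thus ?thesis using P by (simp add: prime_in_def)
	qed
qed

definition height_one :: "'r set => bool" where
	"height_one P \<longleftrightarrow> prime_in S P & P ~= {0} & (ALL Q. prime_in S Q & Q \<subseteq> P --> Q = P | Q = {0})"

text \<open>An element without a factorization \<open>w c = v t ^ n\<close> would be divisible by \<open>t\<close> arbitrarily often.\<close>

lemma uniformizer_factorization:
	assumes P: "prime_in S P" and tu: "uniformizer P t u" and c: "c : S" "c ~= 0"
	shows "EX n. EX v:S - P. EX w:S - P. w * c = v * t ^ n"
proof (rule ccontr)
	define N where "N c \<longleftrightarrow> (EX n. EX v:S - P. EX w:S - P. w * c = v * t ^ n)" for c
	assume "\<not> (EX n. EX v:S - P. EX w:S - P. w * c = v * t ^ n)"
	hence notN: "\<not> N c" by (simp add: N_def)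
	have idP: "ideal_in S P" and t: "t : P" "t : S" and u: "u : S" "u \<notin> P" and oneP: "1 \<notin> P"
		and prime: "!!a b. a : S ==> b : S ==> a * b : P ==> a : P | b : P"
		using P tu by (auto simp: uniformizer_def prime_in_def ideal_in_def)
	define I where "I c = {z : S. EX s:S - P. EX d:S. s * z = c * d}" for c
	have idI: "ideal_in S (I c)" if "c : S" for c unfolding ideal_in_def
	proof (intro conjI ballI)
		show "0 : I c" using oneP one_mem zero_mem by (auto simp: I_def intro!: bexI[of _ 1] bexI[of _ 0])
		fix x assume "x : I c"
		then obtain s d where x: "x : S" "s : S - P" "d : S" "s * x = c * d" by (auto simp: I_def)
		show "r * x : I c" if "r : S" for r
		proof -
			have "s * (r * x) = c * (r * d)" using x(4) by (metis mult.left_commute)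
			thus ?thesis using x that mult_mem unfolding I_def by blast
		qed
		fix y assume "y : I c"
		then obtain s' d' where y: "y : S" "s' : S - P" "d' : S" "s' * y = c * d'" by (auto simp: I_def)
		have "s * s' * (x + y) = s' * (s * x) + s * (s' * y)" by (simp add: algebra_simps)
		also have "\<dots> = c * (s' * d + s * d')" by (simp add: x y algebra_simps)
		finally have "s * s' * (x + y) = c * (s' * d + s * d')" .
		moreover have "s * s' : S - P" "s' * d + s * d' : S" "x + y : S" using x y prime[of s s'] mult_mem add_mem by auto
		ultimately show "x + y : I c" unfolding I_def by blast
	qed (auto simp: I_def)
	define \<F> where "\<F> = {I c | c. c : S & c ~= 0 & \<not> N c}"
	have "\<F> ~= {}" using notN c by (auto simp: \<F>_def)
	then obtain M where M: "M : \<F>" "!!J. J : \<F> ==> M \<subseteq> J ==> J = M"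
		using noetherian_maximal[OF noetherian, of \<F>] idI \<F>_def by auto
	then obtain a where a: "a : S" "a ~= 0" "\<not> N a" "M = I a" by (auto simp: \<F>_def)
	have aP: "a : P"
	proof (rule ccontr)
		assume "a \<notin> P"
		hence "a : S - P" "1 : S - P" "1 * a = a * t ^ 0" using a(1) oneP one_mem by auto
		thus False using a(3) unfolding N_def by blast
	qed
	then obtain d where d: "d : S" "u * a = t * d" using tu by (auto simp: uniformizer_def)
	have "d ~= 0" using d no_zero_divisors[of u a] a u ideal_inD(2)[OF idP] by auto
	have "\<not> N d"
	proof
		assume "N d"
		then obtain n v w where vw: "v : S - P" "w : S - P" "w * d = v * t ^ n" by (auto simp: N_def)
		have "(w * u) * a = v * t ^ Suc n" using d vw by (metis mult.assoc mult.left_commute power_Suc)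
		moreover have "w * u : S - P" using vw u prime[of w u] mult_mem by auto
		ultimately show False using a(3) vw(1) unfolding N_def by blast
	qed
	have "I a \<subseteq> I d"
	proof
		fix x assume "x : I a"
		then obtain s e where x: "x : S" "s : S - P" "e : S" "s * x = a * e" by (auto simp: I_def)
		have "(u * s) * x = d * (t * e)" using x d by (metis mult.assoc mult.commute)
		moreover have "u * s : S - P" using x u prime[of u s] mult_mem by auto
		ultimately show "x : I d" using x t mult_mem unfolding I_def by blast
	qed
	hence "I d = I a" using M(2)[of "I d"] a d \<open>d ~= 0\<close> \<open>\<not> N d\<close> by (auto simp: \<F>_def)
	moreover have "d : I d" using d one_mem oneP by (auto simp: I_def intro!: bexI[of _ 1])
	ultimately obtain s e where s: "s : S - P" "e : S" "s * d = a * e" by (auto simp: I_def)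
	have "a * (s * u) = s * (u * a)" by simp
	also have "\<dots> = t * (s * d)" unfolding d(2) by simp
	also have "\<dots> = a * (t * e)" unfolding s(3) by simp
	finally have "s * u = t * e" using cancel[of "s * u" "t * e" a] s u t a mult_mem by auto
	hence "s * u : P" using ideal_inD(4)[OF idP s(2) t(1)] by (simp add: mult.commute)
	thus False using prime[of s u] s u by auto
qed

lemma prime_powerD: "prime_in S Q ==> a : S ==> a ^ n : Q ==> a : Q"
	using power_mem by (induction n) (auto simp: prime_in_def)

lemma uniformizer_height_one:
	assumes P: "prime_in S P" "P ~= {0}" and tu: "uniformizer P t u"
	shows "height_one P"
proof -
	have "Q = P | Q = {0}" if Q: "prime_in S Q" "Q \<subseteq> P" for Q
	proof (rule ccontr)
		assume *: "\<not> (Q = P | Q = {0})"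
		have t: "t : P" "t : S" and u: "u : S" "u \<notin> P"
			using P tu by (auto simp: uniformizer_def prime_in_def ideal_in_def)
		have QS: "Q \<subseteq> S" "0 : Q" and idQ: "ideal_in S Q"
			and primeQ: "!!a b. a : S ==> b : S ==> a * b : Q ==> a : Q | b : Q"
			using Q by (auto simp: prime_in_def ideal_in_def)
		have tQ: "t \<notin> Q"
		proof
			assume tQ: "t : Q"
			have "c : Q" if cP: "c : P" for c
			proof -
				obtain d where "d : S" "u * c = t * d" using tu cP unfolding uniformizer_def by blast
				hence "u * c : Q" using ideal_inD(4)[OF idQ _ tQ] by (simp add: mult.commute)
				thus ?thesis using primeQ[of u c] u Q(2) cP P by (auto simp: prime_in_def ideal_in_def)
			qed
			thus False using * Q(2) by blast
		qed
		obtain z where z: "z : Q" "z ~= 0" using * QS by blast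
		then obtain n v w where vw: "v : S - P" "w : S - P" "w * z = v * t ^ n"
			using uniformizer_factorization[OF P(1) tu, of z] QS by auto
		hence "v * t ^ n : Q" using ideal_inD(4)[OF idQ _ z(1)] by (metis DiffD1)
		hence "t ^ n : Q" using primeQ[of v "t ^ n"] vw Q(2) t power_mem by auto
		thus False using prime_powerD[OF Q(1) t(2)] tQ by simp
	qed
	thus ?thesis using P by (auto simp: height_one_def)
qed

text \<open>Conversely a prime of height one is of the form \<open>(b : a)\<close>: a maximal ideal of this form
	below \<open>P\<close> is prime.\<close>

lemma height_one_uniformizer:
	assumes "height_one P"
	obtains t u where "uniformizer P t u"
proof -
	have P: "prime_in S P" "P ~= {0}" using assms by (auto simp: height_one_def)
	hence idP: "ideal_in S P" and PS: "P \<subseteq> S"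
		and prime: "!!a b. a : S ==> b : S ==> a * b : P ==> a : P | b : P" by (auto simp: prime_in_def ideal_in_def)
	obtain b where b: "b : P" "b ~= 0" using P(2) ideal_inD(2)[OF idP] by auto
	hence bS: "b : S" using PS by auto
	define \<F> where "\<F> = {colon b a | a. a : S & colon b a \<subseteq> P}"
	have "colon b 1 \<subseteq> P" using ideal_inD(4)[OF idP _ b(1)] by (auto simp: colon_def mult.commute)
	hence "\<F> ~= {}" using one_mem by (auto simp: \<F>_def)
	moreover have "ideal_in S I" if "I : \<F>" for I using that colon_ideal bS by (auto simp: \<F>_def)
	ultimately obtain M where M: "M : \<F>" "!!J. J : \<F> ==> M \<subseteq> J ==> J = M"
		using noetherian_maximal[OF noetherian] by blast
	then obtain a where a: "a : S" "colon b a \<subseteq> P" "M = colon b a" by (auto simp: \<F>_def)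
	have "x : M | y : M" if xy: "x : S" "y : S" "x * y : M" for x y
	proof (cases "colon b (a * y) \<subseteq> P")
		case True
		hence "colon b (a * y) = M"
			using M(2)[of "colon b (a * y)"] colon_mult[of a b y] a xy bS mult_mem unfolding \<F>_def by blast
		moreover have "x : colon b (a * y)" using xy a by (auto simp: colon_def mult_ac)
		ultimately show ?thesis by simp
	next
		case False
		then obtain s where s: "s : colon b (a * y)" "s \<notin> P" by blast
		hence sS: "s : S" by (auto simp: colon_def)
		have sy: "s * y : M" using colon_multD[OF sS s(1)] xy a by simp
		have "colon b (a * s) \<subseteq> P"
		proof
			fix r assume r: "r : colon b (a * s)"
			hence "r : S" by (auto simp: colon_def)
			hence "r * s : P" using colon_multD[OF _ r sS] a by auto
			thus "r : P" using prime \<open>r : S\<close> sS s by auto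
		qed
		hence "colon b (a * s) = M"
			using M(2)[of "colon b (a * s)"] colon_mult[of a b s] a sS bS mult_mem unfolding \<F>_def by blast
		moreover have "y : colon b (a * s)" using sy a xy by (auto simp: colon_def mult_ac)
		ultimately show ?thesis by simp
	qed
	moreover have "1 \<notin> M" using a P by (auto simp: prime_in_def)
	ultimately have primeM: "prime_in S M" using a colon_ideal bS by (auto simp: prime_in_def)
	moreover have "b : M" using a bS by (auto simp: colon_def)
	ultimately have "M = P" using assms a b(2) unfolding height_one_def by blast
	thus ?thesis using colon_uniformizer[OF a(1) bS b(2)] primeM a(3) that by auto
qed

text \<open>A fraction outside \<open>S\<close> has all its denominators in a prime of height one.\<close>

lemma fraction_denominators:
	assumes "a : S" "b : S" "b ~= 0" "\<not> (EX q:S. a = b * q)"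
	obtains P where "height_one P" "!!r. r : S ==> (EX q:S. r * a = b * q) ==> r : P"
proof -
	obtain r where r: "r : S" "prime_in S (colon b (a * r))" using associated_prime[OF assms(1,2,4)] by auto
	have ar: "a * r : S" using assms r mult_mem by simp
	obtain t u where tu: "uniformizer (colon b (a * r)) t u" using colon_uniformizer[OF ar assms(2,3) r(2)] by auto
	have "b : colon b (a * r)" using ar assms by (auto simp: colon_def)
	hence "height_one (colon b (a * r))" using uniformizer_height_one[OF r(2) _ tu] assms(3) by auto
	moreover have "x : colon b (a * r)" if "x : S" "EX q:S. x * a = b * q" for x
		using colon_mult[OF assms(1,2) r(1)] that by (auto simp: colon_def)
	ultimately show ?thesis using that by simp
qed

lemma finite_height_one:
	assumes "a : S" "a ~= 0"
	shows "finite {P. height_one P & a : P}"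
proof -
	have id: "ideal_in S (ideal_gen S {a})" using ideal_gen_ideal assms by simp
	obtain \<Q> where "finite \<Q>" "ALL Q:\<Q>. prime_in S Q & ideal_gen S {a} \<subseteq> Q"
		"ALL P. prime_in S P & ideal_gen S {a} \<subseteq> P --> (EX Q:\<Q>. Q \<subseteq> P)"
		using finite_primes_below[OF noetherian id] by auto
	hence \<Q>: "finite \<Q>" "!!Q. Q : \<Q> ==> prime_in S Q & ideal_gen S {a} \<subseteq> Q"
		"!!P. prime_in S P ==> ideal_gen S {a} \<subseteq> P ==> EX Q:\<Q>. Q \<subseteq> P" by auto
	have "P : \<Q>" if P: "height_one P" "a : P" for P
	proof -
		have prP: "prime_in S P" using P by (simp add: height_one_def)
		hence "ideal_gen S {a} \<subseteq> P" using P ideal_gen_least[of P "{a}"] by (auto simp: prime_in_def)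
		then obtain Q where Q: "Q : \<Q>" "Q \<subseteq> P" using \<Q>(3) prP by blast
		moreover have "a : Q" using \<Q>(2)[OF Q(1)] ideal_gen_incl[of "{a}"] by auto
		ultimately have "Q ~= {0}" using assms(2) by auto
		moreover have "ALL Q. prime_in S Q & Q \<subseteq> P --> Q = P | Q = {0}" using P(1) unfolding height_one_def by simp
		ultimately have "Q = P" using \<Q>(2)[OF Q(1)] Q(2) by auto
		thus ?thesis using Q by simp
	qed
	thus ?thesis using finite_subset[OF _ \<Q>(1), of "{P. height_one P & a : P}"] by auto
qed

end

section \<open>Fields of fractions\<close>

locale fraction_domain = "domain" A for A :: "('k, 'a) module" (structure)
begin

abbreviation nonzero :: "'a set" where
	"nonzero == carrier A - {\<zero>}"

abbreviation fr :: "'a => 'a => ('a \<times> 'a) set" where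
	"fr == fraction A"

abbreviation FF :: "('k, ('a \<times> 'a) set) module" where
	"FF == fraction_field A"

lemma nonzero_mult: "b : nonzero ==> d : nonzero ==> b \<otimes> d : nonzero" by (auto simp: integral_iff)

lemma nonzero_one: "\<one> : nonzero" by auto

lemma fraction_alt:
	assumes "a : carrier A" "b : nonzero"
	shows "fr a b = {(c, d). c : carrier A & d : nonzero & a \<otimes> d = c \<otimes> b}"
	using assms by (auto simp: fraction_def fraction_rel_def)

lemma fraction_self: "a : carrier A ==> b : nonzero ==> (a, b) : fr a b" by (simp add: fraction_alt)

lemma fraction_eq_iff:
	assumes a: "a : carrier A" "b : nonzero" and c: "c : carrier A" "d : nonzero"
	shows "fr a b = fr c d \<longleftrightarrow> a \<otimes> d = c \<otimes> b"
proof
	assume "fr a b = fr c d"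
	hence "(c, d) : fr a b" using fraction_self[OF c] by simp
	thus "a \<otimes> d = c \<otimes> b" by (simp add: fraction_alt[OF a])
next
	assume eq: "a \<otimes> d = c \<otimes> b"
	have "a \<otimes> y = x \<otimes> b \<longleftrightarrow> c \<otimes> y = x \<otimes> d" if x: "x : carrier A" "y : nonzero" for x y
	proof
		assume *: "a \<otimes> y = x \<otimes> b"
		have "b \<otimes> (c \<otimes> y) = y \<otimes> (c \<otimes> b)" using a c x by (simp add: m_ac)
		also have "\<dots> = d \<otimes> (a \<otimes> y)" unfolding eq[symmetric] using a c x by (simp add: m_ac)
		also have "\<dots> = b \<otimes> (x \<otimes> d)" unfolding * using a c x by (simp add: m_ac)
		finally show "c \<otimes> y = x \<otimes> d" using m_lcancel[of b "c \<otimes> y" "x \<otimes> d"] a c x by auto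
	next
		assume *: "c \<otimes> y = x \<otimes> d"
		have "d \<otimes> (a \<otimes> y) = y \<otimes> (a \<otimes> d)" using a c x by (simp add: m_ac)
		also have "\<dots> = b \<otimes> (c \<otimes> y)" unfolding eq using a c x by (simp add: m_ac)
		also have "\<dots> = d \<otimes> (x \<otimes> b)" unfolding * using a c x by (simp add: m_ac)
		finally show "a \<otimes> y = x \<otimes> b" using m_lcancel[of d "a \<otimes> y" "x \<otimes> b"] a c x by auto
	qed
	thus "fr a b = fr c d" unfolding fraction_alt[OF a] fraction_alt[OF c] by blast
qed

lemma fractionE:
	assumes "x : carrier FF"
	obtains a b where "a : carrier A" "b : nonzero" "x = fr a b" using assms by (auto simp: fraction_field_def)

lemma fraction_closed: "a : carrier A ==> b : nonzero ==> fr a b : carrier FF" by (auto simp: fraction_field_def)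

lemma fraction_mult:
	assumes a: "a : carrier A" "b : nonzero" and c: "c : carrier A" "d : nonzero"
	shows "fr a b \<otimes>\<^bsub>FF\<^esub> fr c d = fr (a \<otimes> c) (b \<otimes> d)"
proof -
	have "fr (x \<otimes> x') (y \<otimes> y') = fr (a \<otimes> c) (b \<otimes> d)" if x: "(x, y) : fr a b" "(x', y') : fr c d" for x y x' y'
	proof -
		have m: "x : carrier A" "y : nonzero" "a \<otimes> y = x \<otimes> b" "x' : carrier A" "y' : nonzero" "c \<otimes> y' = x' \<otimes> d"
			using x by (auto simp: fraction_alt[OF a] fraction_alt[OF c])
		have "x \<otimes> x' \<otimes> (b \<otimes> d) = (x \<otimes> b) \<otimes> (x' \<otimes> d)" using m(1,2,4,5) a c by (simp add: m_ac)
		also have "\<dots> = a \<otimes> c \<otimes> (y \<otimes> y')" unfolding m(3,6)[symmetric] using m(1,2,4,5) a c by (simp add: m_ac)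
		finally show ?thesis using m a c nonzero_mult by (subst fraction_eq_iff) auto
	qed
	hence "(\<Union>(x, y)\<in>fr a b. \<Union>(x', y')\<in>fr c d. fr (x \<otimes> x') (y \<otimes> y')) =
			(\<Union>(x, y)\<in>fr a b. \<Union>(x', y')\<in>fr c d. fr (a \<otimes> c) (b \<otimes> d))" by (intro SUP_cong refl) (auto split: prod.splits)
	also have "\<dots> = fr (a \<otimes> c) (b \<otimes> d)" using fraction_self[OF a] fraction_self[OF c] by auto
	finally show ?thesis by (simp add: fraction_field_def)
qed

lemma fraction_add:
	assumes a: "a : carrier A" "b : nonzero" and c: "c : carrier A" "d : nonzero"
	shows "fr a b \<oplus>\<^bsub>FF\<^esub> fr c d = fr (a \<otimes> d \<oplus> c \<otimes> b) (b \<otimes> d)"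
proof -
	have "fr (x \<otimes> y' \<oplus> x' \<otimes> y) (y \<otimes> y') = fr (a \<otimes> d \<oplus> c \<otimes> b) (b \<otimes> d)"
		if x: "(x, y) : fr a b" "(x', y') : fr c d" for x y x' y'
	proof -
		have m: "x : carrier A" "y : nonzero" "a \<otimes> y = x \<otimes> b" "x' : carrier A" "y' : nonzero" "c \<otimes> y' = x' \<otimes> d"
			using x by (auto simp: fraction_alt[OF a] fraction_alt[OF c])
		have "(x \<otimes> y' \<oplus> x' \<otimes> y) \<otimes> (b \<otimes> d) = (x \<otimes> b) \<otimes> (y' \<otimes> d) \<oplus> (x' \<otimes> d) \<otimes> (y \<otimes> b)"
			using m(1,2,4,5) a c by (simp add: m_ac l_distr r_distr)
		also have "\<dots> = (a \<otimes> d \<oplus> c \<otimes> b) \<otimes> (y \<otimes> y')"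
			unfolding m(3,6)[symmetric] using m(1,2,4,5) a c by (simp add: m_ac l_distr r_distr)
		finally show ?thesis using m a c nonzero_mult by (subst fraction_eq_iff) auto
	qed
	hence "(\<Union>(x, y)\<in>fr a b. \<Union>(x', y')\<in>fr c d. fr (x \<otimes> y' \<oplus> x' \<otimes> y) (y \<otimes> y')) =
			(\<Union>(x, y)\<in>fr a b. \<Union>(x', y')\<in>fr c d. fr (a \<otimes> d \<oplus> c \<otimes> b) (b \<otimes> d))"
		by (intro SUP_cong refl) (auto split: prod.splits)
	also have "\<dots> = fr (a \<otimes> d \<oplus> c \<otimes> b) (b \<otimes> d)" using fraction_self[OF a] fraction_self[OF c] by auto
	finally show ?thesis by (simp add: fraction_field_def)
qed

lemma FF_zero: "\<zero>\<^bsub>FF\<^esub> = fr \<zero> \<one>" and FF_one: "\<one>\<^bsub>FF\<^esub> = fr \<one> \<one>" by (simp_all add: fraction_field_def)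

lemma fraction_zero_iff:
	assumes "a : carrier A" "b : nonzero"
	shows "fr a b = \<zero>\<^bsub>FF\<^esub> \<longleftrightarrow> a = \<zero>" unfolding FF_zero using assms by (subst fraction_eq_iff) auto

lemma fraction_field_abelian: "abelian_group FF"
proof (rule abelian_groupI)
	show "\<zero>\<^bsub>FF\<^esub> : carrier FF" unfolding FF_zero by (intro fraction_closed) auto
	fix x assume "x : carrier FF"
	then obtain a b where x: "a : carrier A" "b : nonzero" "x = fr a b" by (rule fractionE)
	show "\<zero>\<^bsub>FF\<^esub> \<oplus>\<^bsub>FF\<^esub> x = x" unfolding FF_zero x(3) using x by (subst fraction_add) auto
	show "EX y:carrier FF. y \<oplus>\<^bsub>FF\<^esub> x = \<zero>\<^bsub>FF\<^esub>"
	proof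
		have "fr (\<ominus> a) b \<oplus>\<^bsub>FF\<^esub> x = fr (\<ominus> a \<otimes> b \<oplus> a \<otimes> b) (b \<otimes> b)" unfolding x(3) using x by (subst fraction_add) auto
		also have "\<dots> = \<zero>\<^bsub>FF\<^esub>" using x nonzero_mult by (subst fraction_zero_iff) (auto simp: l_minus l_neg)
		finally show "fr (\<ominus> a) b \<oplus>\<^bsub>FF\<^esub> x = \<zero>\<^bsub>FF\<^esub>" .
		show "fr (\<ominus> a) b : carrier FF" using x by (intro fraction_closed) auto
	qed
	fix y assume "y : carrier FF"
	then obtain c d where y: "c : carrier A" "d : nonzero" "y = fr c d" by (rule fractionE)
	show "x \<oplus>\<^bsub>FF\<^esub> y : carrier FF" unfolding x(3) y(3) fraction_add[OF x(1,2) y(1,2)]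
		by (intro fraction_closed nonzero_mult) (use x y in auto)
	show "x \<oplus>\<^bsub>FF\<^esub> y = y \<oplus>\<^bsub>FF\<^esub> x" unfolding x(3) y(3) fraction_add[OF x(1,2) y(1,2)] fraction_add[OF y(1,2) x(1,2)]
		using x y by (simp add: a_comm m_comm)
	fix z assume "z : carrier FF"
	then obtain e f where z: "e : carrier A" "f : nonzero" "z = fr e f" by (rule fractionE)
	have bd: "b \<otimes> d : nonzero" "d \<otimes> f : nonzero" using nonzero_mult x y z by blast+
	have "x \<oplus>\<^bsub>FF\<^esub> y \<oplus>\<^bsub>FF\<^esub> z = fr ((a \<otimes> d \<oplus> c \<otimes> b) \<otimes> f \<oplus> e \<otimes> (b \<otimes> d)) (b \<otimes> d \<otimes> f)"
		unfolding x(3) y(3) z(3) fraction_add[OF x(1,2) y(1,2)] using x y z bd by (subst fraction_add) auto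
	also have "\<dots> = fr (a \<otimes> (d \<otimes> f) \<oplus> (c \<otimes> f \<oplus> e \<otimes> d) \<otimes> b) (b \<otimes> (d \<otimes> f))"
		using x y z by (intro arg_cong2[of _ _ _ _ fr]) (auto simp: l_distr r_distr a_ac m_ac)
	also have "\<dots> = x \<oplus>\<^bsub>FF\<^esub> (y \<oplus>\<^bsub>FF\<^esub> z)" unfolding x(3) y(3) z(3) fraction_add[OF y(1,2) z(1,2)]
		using x y z bd by (subst fraction_add) auto
	finally show "x \<oplus>\<^bsub>FF\<^esub> y \<oplus>\<^bsub>FF\<^esub> z = x \<oplus>\<^bsub>FF\<^esub> (y \<oplus>\<^bsub>FF\<^esub> z)" .
qed

lemma fraction_field_comm_monoid: "comm_monoid FF"
proof (rule comm_monoidI)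
	show "\<one>\<^bsub>FF\<^esub> : carrier FF" unfolding FF_one by (intro fraction_closed) auto
	fix x assume "x : carrier FF"
	then obtain a b where x: "a : carrier A" "b : nonzero" "x = fr a b" by (rule fractionE)
	show "\<one>\<^bsub>FF\<^esub> \<otimes>\<^bsub>FF\<^esub> x = x" unfolding FF_one x(3) using x by (subst fraction_mult) auto
	fix y assume "y : carrier FF"
	then obtain c d where y: "c : carrier A" "d : nonzero" "y = fr c d" by (rule fractionE)
	show "x \<otimes>\<^bsub>FF\<^esub> y : carrier FF" unfolding x(3) y(3) fraction_mult[OF x(1,2) y(1,2)]
		by (intro fraction_closed nonzero_mult) (use x y in auto)
	show "x \<otimes>\<^bsub>FF\<^esub> y = y \<otimes>\<^bsub>FF\<^esub> x" unfolding x(3) y(3) fraction_mult[OF x(1,2) y(1,2)] fraction_mult[OF y(1,2) x(1,2)]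
		using x y by (simp add: m_comm)
	fix z assume "z : carrier FF"
	then obtain e f where z: "e : carrier A" "f : nonzero" "z = fr e f" by (rule fractionE)
	have bd: "b \<otimes> d : nonzero" "d \<otimes> f : nonzero" using nonzero_mult x y z by blast+
	have "x \<otimes>\<^bsub>FF\<^esub> y \<otimes>\<^bsub>FF\<^esub> z = fr (a \<otimes> c \<otimes> e) (b \<otimes> d \<otimes> f)" unfolding x(3) y(3) z(3) fraction_mult[OF x(1,2) y(1,2)]
		using x y z bd by (subst fraction_mult) auto
	also have "\<dots> = fr (a \<otimes> (c \<otimes> e)) (b \<otimes> (d \<otimes> f))" using x y z by (simp add: m_assoc)
	also have "\<dots> = x \<otimes>\<^bsub>FF\<^esub> (y \<otimes>\<^bsub>FF\<^esub> z)" unfolding x(3) y(3) z(3) fraction_mult[OF y(1,2) z(1,2)]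
		using x y z bd by (subst fraction_mult) auto
	finally show "x \<otimes>\<^bsub>FF\<^esub> y \<otimes>\<^bsub>FF\<^esub> z = x \<otimes>\<^bsub>FF\<^esub> (y \<otimes>\<^bsub>FF\<^esub> z)" .
qed

theorem fraction_field_field: "field FF"
proof -
	interpret F: abelian_group FF by (rule fraction_field_abelian)
	have "cring FF"
	proof (rule cringI[OF fraction_field_abelian fraction_field_comm_monoid])
		fix x y z assume "x : carrier FF" "y : carrier FF" "z : carrier FF"
		then obtain a b c d e f where x: "a : carrier A" "b : nonzero" "x = fr a b"
			and y: "c : carrier A" "d : nonzero" "y = fr c d" and z: "e : carrier A" "f : nonzero" "z = fr e f"
			by (metis fractionE)
		have bd: "b \<otimes> d : nonzero" "b \<otimes> f : nonzero" "d \<otimes> f : nonzero" using nonzero_mult x y z by blast+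
		have "(x \<oplus>\<^bsub>FF\<^esub> y) \<otimes>\<^bsub>FF\<^esub> z = fr ((a \<otimes> d \<oplus> c \<otimes> b) \<otimes> e) (b \<otimes> d \<otimes> f)"
			unfolding x(3) y(3) z(3) fraction_add[OF x(1,2) y(1,2)] using x y z bd by (subst fraction_mult) auto
		also have "\<dots> = fr (a \<otimes> e \<otimes> (d \<otimes> f) \<oplus> c \<otimes> e \<otimes> (b \<otimes> f)) (b \<otimes> f \<otimes> (d \<otimes> f))"
			using x y z nonzero_mult[OF bd(1) z(2)] nonzero_mult[OF bd(2,3)]
			by (subst fraction_eq_iff) (auto simp: l_distr r_distr m_ac)
		also have "\<dots> = x \<otimes>\<^bsub>FF\<^esub> z \<oplus>\<^bsub>FF\<^esub> y \<otimes>\<^bsub>FF\<^esub> z"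
			unfolding x(3) y(3) z(3) fraction_mult[OF x(1,2) z(1,2)] fraction_mult[OF y(1,2) z(1,2)]
			using x y z bd by (subst fraction_add) auto
		finally show "(x \<oplus>\<^bsub>FF\<^esub> y) \<otimes>\<^bsub>FF\<^esub> z = x \<otimes>\<^bsub>FF\<^esub> z \<oplus>\<^bsub>FF\<^esub> y \<otimes>\<^bsub>FF\<^esub> z" .
	qed
	thus ?thesis
	proof (rule cring.cring_fieldI2)
		show "\<zero>\<^bsub>FF\<^esub> ~= \<one>\<^bsub>FF\<^esub>" unfolding FF_zero FF_one by (subst fraction_eq_iff) auto
		fix x assume x: "x : carrier FF" "x ~= \<zero>\<^bsub>FF\<^esub>"
		obtain a b where ab: "a : carrier A" "b : nonzero" "x = fr a b" using x(1) by (rule fractionE)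
		have a: "a : nonzero" using x(2) ab fraction_zero_iff[OF ab(1,2)] by auto
		show "EX y:carrier FF. x \<otimes>\<^bsub>FF\<^esub> y = \<one>\<^bsub>FF\<^esub>"
		proof
			have "fr a b \<otimes>\<^bsub>FF\<^esub> fr b a = fr (a \<otimes> b) (b \<otimes> a)" using ab a by (intro fraction_mult) auto
			also have "\<dots> = \<one>\<^bsub>FF\<^esub>"
				unfolding FF_one using ab a nonzero_mult[of b a] by (subst fraction_eq_iff) (auto simp: m_comm)
			finally show "x \<otimes>\<^bsub>FF\<^esub> fr b a = \<one>\<^bsub>FF\<^esub>" by (simp add: ab(3))
			show "fr b a : carrier FF" using ab a by (intro fraction_closed) auto
		qed
	qed
qed

lemma fraction_hom: "(%a. fr a \<one>) : ring_hom A FF"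
	by (rule ring_hom_memI) (auto simp: fraction_mult fraction_add fraction_closed FF_one)

end

section \<open>Affine varieties\<close>

text \<open>Basic open sets are closed under intersection as soon as products of functions are functions.\<close>

lemma openin_zariski_if_mult_closed:
	fixes W :: "('p, 'k::field) variety"
	assumes mult: "!!f g. f : regs W ==> g : regs W ==> (\<lambda>p\<in>points W. f p * g p) : regs W"
	shows "openin (zariski W) U \<longleftrightarrow> (\<exists>S\<subseteq>regs W. U = {p : points W. EX f:S. f p ~= 0})"
proof -
	let ?O = "%U. \<exists>S\<subseteq>regs W. U = {p : points W. EX f:S. f p ~= 0}"
	have "istopology ?O" unfolding istopology_def
	proof (intro conjI allI impI)
		fix A B assume "?O A" "?O B"
		then obtain S S' where S: "S \<subseteq> regs W" "A = {p : points W. EX f:S. f p ~= 0}"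
			"S' \<subseteq> regs W" "B = {p : points W. EX f:S'. f p ~= 0}" by blast
		let ?P = "(%(f, g). \<lambda>p\<in>points W. f p * g p) ` (S \<times> S')"
		have "?P \<subseteq> regs W" using mult S(1,3) by auto
		moreover have "A \<inter> B = {p : points W. EX f:?P. f p ~= 0}" unfolding S(2,4) by auto
		ultimately show "?O (A \<inter> B)" by blast
	next
		fix \<K> assume "ALL A:\<K>. ?O A"
		hence "EX S. ALL A:\<K>. S A \<subseteq> regs W & A = {p : points W. EX f:S A. f p ~= 0}" by (rule bchoice)
		then obtain S where "ALL A:\<K>. S A \<subseteq> regs W & A = {p : points W. EX f:S A. f p ~= 0}" ..
		note S = conjunct1[OF bspec[OF this]] conjunct2[OF bspec[OF this]]
		have "\<Union>\<K> = {p : points W. EX f:(\<Union>A\<in>\<K>. S A). f p ~= 0}" using S(2) by blast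
		moreover have "(\<Union>A\<in>\<K>. S A) \<subseteq> regs W" using S(1) by auto
		ultimately show "?O (\<Union>\<K>)" by blast
	qed
	thus ?thesis unfolding zariski_def by (subst topology_inverse') auto
qed

locale affine =
	fixes V :: "('p, 'k::alg_closed_field) variety"
	assumes affine: "affine_variety V"
begin

abbreviation A :: "('k, 'p => 'k) module" where
	"A == coordinate_algebra V"

lemma A_simps [simp]:
	"carrier A = regs V" "f \<otimes>\<^bsub>A\<^esub> g = (\<lambda>p\<in>points V. f p * g p)" "\<one>\<^bsub>A\<^esub> = (\<lambda>p\<in>points V. 1)"
	"\<zero>\<^bsub>A\<^esub> = (\<lambda>p\<in>points V. 0)" "f \<oplus>\<^bsub>A\<^esub> g = (\<lambda>p\<in>points V. f p + g p)"
	"c \<odot>\<^bsub>A\<^esub> f = (\<lambda>p\<in>points V. c * f p)" by (simp_all add: coordinate_algebra_def)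

lemma algebra: "algebra ring_of_type_algebra A" using affine by (simp add: affine_variety_def)

lemma cring: "cring A" using algebra by (simp add: algebra_def)

lemma reg_ext: "f : regs V ==> f : extensional (points V)" using affine by (auto simp: affine_variety_def)

lemma reg_eqI: "f : regs V ==> g : regs V ==> (!!p. p : points V ==> f p = g p) ==> f = g"
	by (rule extensionalityI[OF reg_ext reg_ext])

lemma reg_restrict: "f : regs V ==> (\<lambda>p\<in>points V. f p) = f" using reg_ext by (simp add: extensional_restrict)

lemma reg_mult: "f : regs V ==> g : regs V ==> (\<lambda>p\<in>points V. f p * g p) : regs V"
	and reg_add: "f : regs V ==> g : regs V ==> (\<lambda>p\<in>points V. f p + g p) : regs V"
	and reg_one: "(\<lambda>p\<in>points V. 1) : regs V"
	and reg_zero: "(\<lambda>p\<in>points V. 0) : regs V"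
proof -
	interpret cring A by (rule cring)
	show "f : regs V ==> g : regs V ==> (\<lambda>p\<in>points V. f p * g p) : regs V" using m_closed[of f g] by simp
	show "f : regs V ==> g : regs V ==> (\<lambda>p\<in>points V. f p + g p) : regs V" using a_closed[of f g] by simp
	show "(\<lambda>p\<in>points V. 1) : regs V" "(\<lambda>p\<in>points V. 0) : regs V" using one_closed zero_closed by auto
qed

lemma reg_scale: "f : regs V ==> (\<lambda>p\<in>points V. c * f p) : regs V"
proof -
	interpret algebra ring_of_type_algebra A by (rule algebra)
	show "f : regs V ==> (\<lambda>p\<in>points V. c * f p) : regs V"
		using smult_closed[of c f] by (simp add: ring_of_type_algebra_def)
qed

lemma reg_uminus: "f : regs V ==> (\<lambda>p\<in>points V. - f p) : regs V" using reg_scale[of f "- 1"] by simp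

lemma A_uminus: "f : regs V ==> \<ominus>\<^bsub>A\<^esub> f = (\<lambda>p\<in>points V. - f p)"
proof -
	interpret cring A by (rule cring)
	assume f: "f : regs V"
	have "(\<lambda>p\<in>points V. - f p) \<oplus>\<^bsub>A\<^esub> f = \<zero>\<^bsub>A\<^esub>" unfolding A_simps by (intro restrict_ext) simp
	thus ?thesis using minus_equality[of "\<lambda>p\<in>points V. - f p" f] f reg_uminus[OF f] by simp
qed

lemma reg_sum: "(!!i. i : I ==> f i : regs V) ==> (\<lambda>p\<in>points V. \<Sum>i\<in>I. f i p) : regs V"
proof (induction I rule: infinite_finite_induct)
	case (insert i I)
	have eq: "(\<lambda>p\<in>points V. \<Sum>j\<in>insert i I. f j p) = (\<lambda>p\<in>points V. f i p + (\<lambda>p\<in>points V. \<Sum>j\<in>I. f j p) p)"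
		using insert.hyps by (intro restrict_ext) simp
	show ?case unfolding eq by (rule reg_add) (use insert in auto)
qed (use reg_zero in auto)

lemma reg_prod: "(!!i. i : I ==> f i : regs V) ==> (\<lambda>p\<in>points V. \<Prod>i\<in>I. f i p) : regs V"
proof (induction I rule: infinite_finite_induct)
	case (insert i I)
	have eq: "(\<lambda>p\<in>points V. \<Prod>j\<in>insert i I. f j p) = (\<lambda>p\<in>points V. f i p * (\<lambda>p\<in>points V. \<Prod>j\<in>I. f j p) p)"
		using insert.hyps by (intro restrict_ext) simp
	show ?case unfolding eq by (rule reg_mult) (use insert in auto)
qed (use reg_one in auto)

lemma A_apply [simp]:
	assumes "p : points V"
	shows "(f \<otimes>\<^bsub>A\<^esub> g) p = f p * g p" "\<one>\<^bsub>A\<^esub> p = 1" "\<zero>\<^bsub>A\<^esub> p = 0" "(f \<oplus>\<^bsub>A\<^esub> g) p = f p + g p"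
		"(c \<odot>\<^bsub>A\<^esub> f) p = c * f p" using assms by auto

declare A_simps(2-) [simp del]

lemma A_uminus_apply [simp]: "f : regs V ==> p : points V ==> (\<ominus>\<^bsub>A\<^esub> f) p = - f p" by (simp add: A_uminus)

lemma A_finsum_apply:
	assumes "!!i. i : I ==> f i : regs V" "p : points V"
	shows "(\<Oplus>\<^bsub>A\<^esub>i\<in>I. f i) p = (\<Sum>i\<in>I. f i p)"
proof -
	interpret cring A by (rule cring)
	show ?thesis using assms
	proof (induction I rule: infinite_finite_induct)
		case (insert i I)
		thus ?case by simp
	qed simp_all
qed

lemma A_pow_apply [simp]: "p : points V ==> (f [^]\<^bsub>A\<^esub> n) p = f p ^ n" for n :: nat
proof -
	interpret cring A by (rule cring)
	show "p : points V ==> (f [^]\<^bsub>A\<^esub> n) p = f p ^ n" by (induction n) simp_all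
qed

lemma point_eqI: "p : points V ==> q : points V ==> (!!f. f : regs V ==> f p = f q) ==> p = q"
proof -
	assume pq: "p : points V" "q : points V" "!!f. f : regs V ==> f p = f q"
	have "eval_at V p = eval_at V q" unfolding eval_at_def using pq(3) by auto
	thus "p = q" using affine pq(1,2) unfolding affine_variety_def bij_betw_def inj_on_def by blast
qed

lemma reg_smult: "f : regs V ==> c \<odot>\<^bsub>A\<^esub> f : regs V" using reg_scale by (simp add: A_simps(6))

lemma alg_homsI:
	assumes "!!f g. f : regs V ==> g : regs V ==> x (f \<otimes>\<^bsub>A\<^esub> g) = x f * x g"
		and "!!f g. f : regs V ==> g : regs V ==> x (f \<oplus>\<^bsub>A\<^esub> g) = x f + x g"
		and "x \<one>\<^bsub>A\<^esub> = 1" "!!c f. f : regs V ==> x (c \<odot>\<^bsub>A\<^esub> f) = c * x f"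
	obtains p where "p : points V" "!!f. f : regs V ==> x f = f p"
proof -
	interpret cring A by (rule cring)
	have "f \<otimes>\<^bsub>A\<^esub> g : regs V" "f \<oplus>\<^bsub>A\<^esub> g : regs V" if "f : regs V" "g : regs V" for f g
		using m_closed[of f g] a_closed[of f g] that by auto
	moreover have "\<one>\<^bsub>A\<^esub> : regs V" using one_closed by simp
	ultimately have "(\<lambda>f\<in>regs V. x f) : alg_homs A"
		unfolding alg_homs_def using assms reg_smult by (auto intro!: ring_hom_memI simp: ring_of_type_algebra_def)
	then obtain p where "p : points V" "(\<lambda>f\<in>regs V. x f) = eval_at V p"
		using affine unfolding affine_variety_def bij_betw_def by blast
	thus ?thesis using that[of p] by (metis (no_types, lifting) eval_at_def restrict_apply')
qed

subsection \<open>The Zariski topology\<close>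

lemma openin_zariski: "openin (zariski V) U \<longleftrightarrow> (\<exists>S\<subseteq>regs V. U = {p : points V. EX f:S. f p ~= 0})"
	by (rule openin_zariski_if_mult_closed) (rule reg_mult)

lemma topspace_zariski: "topspace (zariski V) = points V"
proof
	show "topspace (zariski V) \<subseteq> points V" unfolding topspace_def openin_zariski by blast
	have "openin (zariski V) (points V)"
		unfolding openin_zariski using reg_one by (intro exI[of _ "{\<lambda>p\<in>points V. 1}"]) auto
	thus "points V \<subseteq> topspace (zariski V)" by (rule openin_subset)
qed

lemma closedin_zariski: "closedin (zariski V) Y \<longleftrightarrow> (\<exists>S\<subseteq>regs V. Y = {p : points V. ALL f:S. f p = 0})"
proof
	assume "closedin (zariski V) Y"
	then obtain S where "S \<subseteq> regs V" "points V - Y = {p : points V. EX f:S. f p ~= 0}" "Y \<subseteq> points V"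
		unfolding closedin_def topspace_zariski openin_zariski by blast
	thus "\<exists>S\<subseteq>regs V. Y = {p : points V. ALL f:S. f p = 0}" by (intro exI[of _ S]) blast
next
	assume "\<exists>S\<subseteq>regs V. Y = {p : points V. ALL f:S. f p = 0}"
	then obtain S where "S \<subseteq> regs V" "Y = {p : points V. ALL f:S. f p = 0}" by blast
	thus "closedin (zariski V) Y" unfolding closedin_def topspace_zariski openin_zariski by blast
qed

definition zeros :: "('p => 'k) set => 'p set" where
	"zeros S = {p : points V. ALL f:S. f p = 0}"

definition vanishing :: "'p set => ('p => 'k) set" where
	"vanishing Y = {f : regs V. ALL p:Y. f p = 0}"

lemma closed_zeros: "S \<subseteq> regs V ==> closedin (zariski V) (zeros S)" unfolding closedin_zariski zeros_def by blast

lemma zeros_vanishing: "closedin (zariski V) Y ==> zeros (vanishing Y) = Y"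
	unfolding closedin_zariski zeros_def vanishing_def by blast

lemma vanishing_antimono: "Y \<subseteq> Y' ==> vanishing Y' \<subseteq> vanishing Y" by (auto simp: vanishing_def)

lemma vanishing_subset_iff:
	"closedin (zariski V) Y ==> closedin (zariski V) Y' ==> vanishing Y' \<subseteq> vanishing Y \<longleftrightarrow> Y \<subseteq> Y'"
	using zeros_vanishing[of Y] zeros_vanishing[of Y'] vanishing_antimono unfolding zeros_def by blast

lemma closure_zariski:
	assumes "Y \<subseteq> points V"
	shows "zariski V closure_of Y = zeros (vanishing Y)"
proof
	have "closedin (zariski V) (zeros (vanishing Y))" by (rule closed_zeros) (auto simp: vanishing_def)
	thus "zariski V closure_of Y \<subseteq> zeros (vanishing Y)"
		using assms by (intro closure_of_minimal) (auto simp: zeros_def vanishing_def)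
	have "vanishing (zariski V closure_of Y) \<subseteq> vanishing Y"
		using closure_of_subset[of Y "zariski V"] assms topspace_zariski by (intro vanishing_antimono) auto
	moreover have "vanishing Y \<subseteq> vanishing (zariski V closure_of Y)"
	proof
		fix f assume f: "f : vanishing Y"
		hence "closedin (zariski V) (zeros {f})" by (intro closed_zeros) (auto simp: vanishing_def)
		hence "zariski V closure_of Y \<subseteq> zeros {f}"
			using f assms by (intro closure_of_minimal) (auto simp: zeros_def vanishing_def)
		thus "f : vanishing (zariski V closure_of Y)" using f by (auto simp: zeros_def vanishing_def)
	qed
	ultimately show "zeros (vanishing Y) \<subseteq> zariski V closure_of Y"
		using zeros_vanishing[OF closedin_closure_of, of Y] by simp
qed

lemma irreducible_closed_prime:
	assumes "irreducible_closed V Y" "f : regs V" "g : regs V" "!!p. p : Y ==> f p * g p = 0"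
	shows "f : vanishing Y | g : vanishing Y"
proof -
	have "closedin (zariski V) (zeros {f})" "closedin (zariski V) (zeros {g})" using assms by (auto intro: closed_zeros)
	moreover have "Y \<subseteq> zeros {f} \<union> zeros {g}" using assms closedin_subset[of "zariski V" Y]
			by (auto simp: zeros_def topspace_zariski irreducible_closed_def)
	ultimately have "Y \<subseteq> zeros {f} | Y \<subseteq> zeros {g}" using assms(1) unfolding irreducible_closed_def by blast
	thus ?thesis using assms by (auto simp: vanishing_def zeros_def)
qed

lemma irreducible_closedI:
	assumes "closedin (zariski V) Y" "Y ~= {}"
		and "!!f g. f : regs V ==> g : regs V ==> (\<lambda>p\<in>points V. f p * g p) : vanishing Y ==>
			f : vanishing Y | g : vanishing Y"
	shows "irreducible_closed V Y" unfolding irreducible_closed_def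
proof (intro conjI allI impI, rule assms(1), rule assms(2), rule ccontr, elim conjE)
	fix C D assume CD: "closedin (zariski V) C" "closedin (zariski V) D" "Y \<subseteq> C \<union> D" "\<not> (Y \<subseteq> C | Y \<subseteq> D)"
	have "\<not> vanishing C \<subseteq> vanishing Y" "\<not> vanishing D \<subseteq> vanishing Y" using CD vanishing_subset_iff[OF assms(1)] by auto
	then obtain f g where fg: "f : vanishing C" "f \<notin> vanishing Y" "g : vanishing D" "g \<notin> vanishing Y" by blast
	hence "(\<lambda>p\<in>points V. f p * g p) : vanishing Y"
		using CD(3) closedin_subset[OF assms(1)] reg_mult by (auto simp: vanishing_def topspace_zariski)
	thus False using assms(3)[of f g] fg by (auto simp: vanishing_def)
qed

end

locale irreducible_affine = affine V for V :: "('p, 'k::alg_closed_field) variety" +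
	assumes irreducible: "irreducible_variety V"
begin

abbreviation PD where "PD == prime_divisors V"
abbreviation ordV where "ordV == ord_along V"
abbreviation OV where "OV == divisor_sections V"
abbreviation irrc where "irrc == irreducible_closed V"

text \<open>A subscript on a ring operation names the ring: \<open>A\<close> for the functions on \<open>V\<close> and \<open>F\<close> for its rational functions.\<close>

abbreviation A_mult (infixl "*\<^sub>A" 70) where "f *\<^sub>A g == f \<otimes>\<^bsub>A\<^esub> g"
abbreviation A_add (infixl "+\<^sub>A" 65) where "f +\<^sub>A g == f \<oplus>\<^bsub>A\<^esub> g"
abbreviation A_one ("1\<^sub>A") where "1\<^sub>A == \<one>\<^bsub>A\<^esub>"
abbreviation A_zero ("0\<^sub>A") where "0\<^sub>A == \<zero>\<^bsub>A\<^esub>"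
abbreviation rat_mult (infixl "*\<^sub>F" 70) where "f *\<^sub>F g == f \<otimes>\<^bsub>rat_funs V\<^esub> g"
abbreviation rat_add (infixl "+\<^sub>F" 65) where "f +\<^sub>F g == f \<oplus>\<^bsub>rat_funs V\<^esub> g"
abbreviation rat_one ("1\<^sub>F") where "1\<^sub>F == \<one>\<^bsub>rat_funs V\<^esub>"
abbreviation rat_zero ("0\<^sub>F") where "0\<^sub>F == \<zero>\<^bsub>rat_funs V\<^esub>"
abbreviation rat_inv ("inv\<^sub>F _" [81] 80) where "inv\<^sub>F x == inv\<^bsub>rat_funs V\<^esub> x"

lemma irreducible_points: "irrc (points V)" using irreducible by (simp add: irreducible_variety_def)

lemma points_nonempty: "points V ~= {}" using irreducible_points by (simp add: irreducible_closed_def)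

lemma irreducible_closedD:
	assumes "irrc Y"
	shows "closedin (zariski V) Y" "Y ~= {}" "Y \<subseteq> points V"
	using assms closedin_subset[of "zariski V" Y] by (auto simp: irreducible_closed_def topspace_zariski)

subsection \<open>Codimension one\<close>

lemma codim_chain:
	assumes "C 0 = Y" "!!i. i \<le> n ==> irrc (C i)" "!!i. i < n ==> C i \<subset> C (Suc i)"
	shows "enat n \<le> codim V Y" unfolding codim_def using assms by (intro Sup_upper) blast

lemma codim_ge_2:
	assumes "irrc Y" "irrc C" "Y \<subset> C" "C ~= points V"
	shows "2 \<le> codim V Y"
proof -
	define D where "D = (\<lambda>i::nat. if i = 0 then Y else if i = 1 then C else points V)"
	have "C \<subset> points V" using irreducible_closedD(3)[OF assms(2)] assms(4) by simp
	hence "enat 2 \<le> codim V Y" using assms irreducible_points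
		by (intro codim_chain[of D]) (auto simp: D_def less_Suc_eq numeral_2_eq_2)
	thus ?thesis by (simp add: numeral_eq_enat)
qed

lemma codim_le:
	assumes "!!n C. C 0 = Y ==> (!!i. i \<le> n ==> irrc (C i)) ==> (!!i. i < n ==> C i \<subset> C (Suc i)) ==> n \<le> m"
	shows "codim V Y \<le> enat m" unfolding codim_def using assms by (intro Sup_least) auto

lemma codim_points: "codim V (points V) = 0"
proof -
	have "codim V (points V) \<le> enat 0"
	proof (rule codim_le)
		fix n C assume C: "C 0 = points V" "!!i. i \<le> n ==> irrc (C i)" "!!i. i < n ==> C i \<subset> C (Suc i)"
		show "n \<le> 0"
		proof (rule ccontr)
			assume "\<not> n \<le> 0"
			thus False using C(1) C(2)[of 1] C(3)[of 0] irreducible_closedD(3)[of "C 1"] by auto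
		qed
	qed
	thus ?thesis by (simp add: zero_enat_def[symmetric])
qed

lemma prime_divisor_iff:
	"D : PD \<longleftrightarrow> irrc D & D ~= points V \<and>
		 (ALL C. irrc C & D \<subset> C --> C = points V)"
proof
	assume D: "D : PD"
	hence "irrc D" "codim V D = 1" by (auto simp: prime_divisors_def)
	moreover have "\<not> (2::enat) \<le> 1" by simp
	ultimately show "irrc D & D ~= points V \<and>
		 (ALL C. irrc C & D \<subset> C --> C = points V)" using codim_ge_2[of D] codim_points by auto
next
	assume D: "irrc D & D ~= points V \<and>
		 (ALL C. irrc C & D \<subset> C --> C = points V)"
	have "codim V D \<le> enat 1"
	proof (rule codim_le)
		fix n C assume C: "C 0 = D" "!!i. i \<le> n ==> irrc (C i)" "!!i. i < n ==> C i \<subset> C (Suc i)"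
		show "n \<le> 1"
		proof (rule ccontr)
			assume n: "\<not> n \<le> 1"
			hence "C 1 = points V" using D C(1) C(2)[of 1] C(3)[of 0] by auto
			thus False using n C(2)[of 2] C(3)[of 1] irreducible_closedD(3)[of "C 2"] by (auto simp: numeral_2_eq_2)
		qed
	qed
	moreover have "enat 1 \<le> codim V D" using D irreducible_points irreducible_closedD(3)[of D]
		by (intro codim_chain[of "%i. if i = 0 then D else points V"]) auto
	ultimately show "D : PD" using D by (simp add: prime_divisors_def one_enat_def)
qed

lemma codim_le_one:
	assumes "irrc Y" "codim V Y \<le> 1"
	shows "Y = points V | Y : PD"
proof -
	have "\<not> (2::enat) \<le> codim V Y" using order_trans[of 2 "codim V Y" "1::enat"] assms(2) by auto
	thus ?thesis unfolding prime_divisor_iff using assms(1) codim_ge_2 by auto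
qed

subsection \<open>The function field\<close>

lemma domain: "domain A"
proof -
	interpret cring A by (rule cring)
	obtain p where p: "p : points V" using points_nonempty by auto
	have "1\<^sub>A ~= 0\<^sub>A" using A_apply(2,3)[OF p] by auto
	moreover have "f = 0\<^sub>A | g = 0\<^sub>A" if fg: "f *\<^sub>A g = 0\<^sub>A" "f : carrier A" "g : carrier A" for f g
	proof -
		have "f p * g p = 0" if "p : points V" for p using A_apply(1,3)[OF that] fg(1) by metis
		hence "f : vanishing (points V) | g : vanishing (points V)"
			using irreducible_closed_prime[OF irreducible_points] fg by auto
		thus ?thesis using zero_closed by (auto simp: vanishing_def intro: reg_eqI)
	qed
	ultimately show ?thesis by unfold_locales auto
qed

definition nzs :: "('p => 'k) set" where
	"nzs = {b : regs V. EX p:points V. b p ~= 0}"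

sublocale FR: fraction_domain A by (intro fraction_domain.intro domain)

lemma FR_nonzero: "carrier A - {0\<^sub>A} = nzs"
proof -
	have "b = 0\<^sub>A \<longleftrightarrow> \<not> (EX p:points V. b p ~= 0)" if "b : regs V" for b
		using that FR.zero_closed by (auto intro: reg_eqI)
	thus ?thesis by (auto simp: nzs_def)
qed

sublocale K: field "rat_funs V" unfolding rat_funs_def by (rule FR.fraction_field_field)

abbreviation rat :: "('p => 'k) => ('p, 'k) rat_fun" where
	"rat == rat_of_reg V"

sublocale rat: ring_hom_cring A "rat_funs V" rat
	using FR.fraction_hom by unfold_locales (simp add: rat_funs_def rat_of_reg_def[abs_def] quot_fun_def)

lemma nzsD: "b : nzs ==> b : regs V" by (simp add: nzs_def)

lemma nzs_one: "1\<^sub>A : nzs" unfolding FR_nonzero[symmetric] by (rule FR.nonzero_one)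

lemma nzs_mult: "b : nzs ==> d : nzs ==> b *\<^sub>A d : nzs" unfolding FR_nonzero[symmetric] by (rule FR.nonzero_mult)

lemma quot_eq_iff:
	assumes "a : regs V" "b : nzs" "c : regs V" "d : nzs"
	shows "quot_fun V a b = quot_fun V c d \<longleftrightarrow> a *\<^sub>A d = c *\<^sub>A b"
	unfolding quot_fun_def using FR.fraction_eq_iff[of a b c d] assms unfolding FR_nonzero by simp

lemma quot_closed: "a : regs V ==> b : nzs ==> quot_fun V a b : carrier (rat_funs V)"
	unfolding quot_fun_def rat_funs_def using FR.fraction_closed[of a b] unfolding FR_nonzero by simp

lemma quotE:
	assumes "x : carrier (rat_funs V)"
	obtains a b where "a : regs V" "b : nzs" "x = quot_fun V a b"
	using assms FR.fractionE[of x] unfolding quot_fun_def rat_funs_def FR_nonzero by auto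

lemma quot_mult:
	assumes "a : regs V" "b : nzs" "c : regs V" "d : nzs"
	shows "quot_fun V a b *\<^sub>F quot_fun V c d = quot_fun V (a *\<^sub>A c) (b *\<^sub>A d)"
	unfolding quot_fun_def rat_funs_def using FR.fraction_mult[of a b c d] assms unfolding FR_nonzero by simp

lemma quot_add:
	assumes "a : regs V" "b : nzs" "c : regs V" "d : nzs"
	shows "quot_fun V a b +\<^sub>F quot_fun V c d =
		quot_fun V (a *\<^sub>A d +\<^sub>A c *\<^sub>A b) (b *\<^sub>A d)"
	unfolding quot_fun_def rat_funs_def using FR.fraction_add[of a b c d] assms unfolding FR_nonzero by simp

lemma quot_zero_iff:
	assumes "a : regs V" "b : nzs"
	shows "quot_fun V a b = 0\<^sub>F \<longleftrightarrow> a = 0\<^sub>A"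
	unfolding quot_fun_def rat_funs_def using FR.fraction_zero_iff[of a b] assms unfolding FR_nonzero by simp

lemma quot_smult:
	assumes "a : regs V" "b : nzs"
	shows "c \<odot>\<^bsub>rat_funs V\<^esub> quot_fun V a b = quot_fun V (c \<odot>\<^bsub>A\<^esub> a) b"
proof -
	interpret algebra ring_of_type_algebra A by (rule algebra)
	have sc: "c \<odot>\<^bsub>A\<^esub> x : regs V" "(c \<odot>\<^bsub>A\<^esub> x) *\<^sub>A y = c \<odot>\<^bsub>A\<^esub> (x *\<^sub>A y)" if "x : regs V" "y : regs V" for x y
		using smult_closed[of c x] smult_assoc2[of c x y] that by (simp_all add: ring_of_type_algebra_def)
	have fa: "fraction A a b = {(x, y). x : regs V & y : nzs & a *\<^sub>A y = x *\<^sub>A b}"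
		using FR.fraction_alt[of a b] assms unfolding FR_nonzero by simp
	have "fraction A (c \<odot>\<^bsub>A\<^esub> x) y = quot_fun V (c \<odot>\<^bsub>A\<^esub> a) b" if "(x, y) : fraction A a b" for x y
	proof -
		have xy: "x : regs V" "y : nzs" "a *\<^sub>A y = x *\<^sub>A b" using that unfolding fa by auto
		thus ?thesis unfolding quot_fun_def[symmetric] using assms sc nzsD by (subst quot_eq_iff) auto
	qed
	hence "(\<Union>(x, y)\<in>fraction A a b. fraction A (c \<odot>\<^bsub>A\<^esub> x) y) =
			(\<Union>(x, y)\<in>fraction A a b. quot_fun V (c \<odot>\<^bsub>A\<^esub> a) b)" by (intro SUP_cong refl) (auto split: prod.splits)
	also have "\<dots> = quot_fun V (c \<odot>\<^bsub>A\<^esub> a) b" using FR.fraction_self[of a b] assms unfolding FR_nonzero by auto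
	finally show ?thesis by (simp add: rat_funs_def fraction_field_def quot_fun_def)
qed

lemma rat_closed: "a : regs V ==> rat a : carrier (rat_funs V)" by simp

lemma rat_eq_iff: "a : regs V ==> b : regs V ==> rat a = rat b \<longleftrightarrow> a = b"
	unfolding rat_of_reg_def using nzs_one by (subst quot_eq_iff) auto

lemma rat_zero_iff: "a : regs V ==> rat a = 0\<^sub>F \<longleftrightarrow> a = 0\<^sub>A"
	unfolding rat_of_reg_def by (rule quot_zero_iff[OF _ nzs_one])

lemma rat_nonzero: "a : nzs ==> rat a ~= 0\<^sub>F" using rat_zero_iff[of a] unfolding FR_nonzero[symmetric] by auto

lemma quot_rat:
	assumes "a : regs V" "b : nzs"
	shows "quot_fun V a b *\<^sub>F rat b = rat a"
proof -
	have b: "b : regs V" using assms nzsD by simp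
	show ?thesis unfolding rat_of_reg_def quot_mult[OF assms b nzs_one]
		using assms b nzs_one nzs_mult FR.m_closed[of a b] by (subst quot_eq_iff) (auto simp: FR.m_ac)
qed

lemma smult_rat:
	assumes "x : carrier (rat_funs V)"
	shows "c \<odot>\<^bsub>rat_funs V\<^esub> x = rat (c \<odot>\<^bsub>A\<^esub> 1\<^sub>A) *\<^sub>F x"
proof -
	obtain a b where ab: "a : regs V" "b : nzs" "x = quot_fun V a b" using assms by (rule quotE)
	interpret algebra ring_of_type_algebra A by (rule algebra)
	have "c \<odot>\<^bsub>A\<^esub> 1\<^sub>A : regs V" "(c \<odot>\<^bsub>A\<^esub> 1\<^sub>A) *\<^sub>A a = c \<odot>\<^bsub>A\<^esub> a"
		using smult_closed[of c "1\<^sub>A"] smult_assoc2[of c "1\<^sub>A" a] FR.one_closed ab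
			by (simp_all add: ring_of_type_algebra_def)
	thus ?thesis unfolding ab(3) rat_of_reg_def quot_smult[OF ab(1,2)]
		using ab nzs_one nzsD[OF ab(2)] by (subst quot_mult) simp_all
qed

subsection \<open>Regular functions as a ring of functions\<close>

text \<open>Regular functions are extended to the whole type by their value at a base point. In this way
	they form a subring, with the same unit, of the ring of all functions on the type.\<close>

definition extend :: "('p => 'k) => 'p => 'k" where
	"extend f = (%p. f (if p : points V then p else (SOME q. q : points V)))"

definition ring_of_regs :: "('p => 'k) set" where
	"ring_of_regs = extend ` regs V"

lemma base_point: "(SOME q. q : points V) : points V" using points_nonempty by (simp add: some_in_eq)

lemma extend_apply: "p : points V ==> extend f p = f p" by (simp add: extend_def)

lemma extend_add: "extend (f +\<^sub>A g) = extend f + extend g"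
	and extend_mult: "extend (f *\<^sub>A g) = extend f * extend g"
	and extend_one: "extend 1\<^sub>A = 1" and extend_zero: "extend 0\<^sub>A = 0"
	and extend_smult: "extend (c \<odot>\<^bsub>A\<^esub> f) = (%_. c) * extend f" using base_point by (auto simp: extend_def fun_eq_iff)

lemma extend_uminus: "f : regs V ==> extend (\<ominus>\<^bsub>A\<^esub> f) = - extend f"
	using base_point by (auto simp: extend_def fun_eq_iff)

lemma extend_inj: "f : regs V ==> g : regs V ==> extend f = extend g \<longleftrightarrow> f = g" by (metis extend_apply reg_eqI)

lemma ring_of_regs: "carrier_ring ring_of_regs"
proof
	show "1 : ring_of_regs" unfolding ring_of_regs_def extend_one[symmetric] using FR.one_closed by (intro imageI) simp
	fix a assume "a : ring_of_regs"
	then obtain f where f: "f : regs V" "a = extend f" by (auto simp: ring_of_regs_def)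
	show "- a : ring_of_regs"
		unfolding ring_of_regs_def f(2) extend_uminus[OF f(1), symmetric] using FR.a_inv_closed f by (intro imageI) simp
	fix b assume "b : ring_of_regs"
	then obtain g where g: "g : regs V" "b = extend g" by (auto simp: ring_of_regs_def)
	show "a + b : ring_of_regs"
		unfolding ring_of_regs_def f(2) g(2) extend_add[symmetric] using FR.a_closed[of f g] f g by (intro imageI) simp
	show "a * b : ring_of_regs"
		unfolding ring_of_regs_def f(2) g(2) extend_mult[symmetric] using FR.m_closed[of f g] f g by (intro imageI) simp
qed

sublocale RR: carrier_ring ring_of_regs by (rule ring_of_regs)

lemma scalar_embedding_const: "scalar_embedding (\<lambda>c::'k. \<lambda>_::'p. c)" by unfold_locales (auto simp: fun_eq_iff)

lemma extend_mem: "f : regs V ==> extend f : ring_of_regs" by (simp add: ring_of_regs_def)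

lemma ring_of_regs_fg: "fg_over (\<lambda>c::'k. \<lambda>_::'p. c) ring_of_regs"
proof -
	interpret sc: scalar_embedding "\<lambda>c::'k. \<lambda>_::'p. c" by (rule scalar_embedding_const)
	obtain G where G: "finite G" "G \<subseteq> regs V" "generate_ring A (G \<union> scalars A) = regs V"
		using affine by (auto simp: affine_variety_def finitely_generated_algebra_def)
	obtain T where "fg_over (\<lambda>c::'k. \<lambda>_::'p. c) T & extend ` G \<subseteq> T \<and>
		(ALL S. carrier_ring S & range (\<lambda>c::'k. \<lambda>_::'p. c) \<subseteq> S & extend ` G \<subseteq> S --> T \<subseteq> S)"
		using sc.fg_over_exists[OF finite_imageI[OF G(1), of extend]] by auto
	hence T: "fg_over (\<lambda>c::'k. \<lambda>_::'p. c) T" "extend ` G \<subseteq> T"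
		"!!S. carrier_ring S ==> range (\<lambda>c::'k. \<lambda>_::'p. c) \<subseteq> S ==> extend ` G \<subseteq> S ==> T \<subseteq> S" by auto
	interpret T: carrier_ring T by (rule sc.fg_over_ring[OF T(1)])
	have const_ext: "extend (c \<odot>\<^bsub>A\<^esub> 1\<^sub>A) = (%_. c)" for c unfolding extend_smult extend_one by simp
	have "c \<odot>\<^bsub>A\<^esub> 1\<^sub>A : regs V" for c using reg_smult[of "1\<^sub>A" c] FR.one_closed by simp
	hence "range (\<lambda>c::'k. \<lambda>_::'p. c) \<subseteq> ring_of_regs"
		unfolding ring_of_regs_def using const_ext by (metis (no_types, lifting) image_eqI image_subset_iff)
	hence sub: "T \<subseteq> ring_of_regs" using G(2) ring_of_regs by (intro T(3)) (auto simp: ring_of_regs_def)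
	have scalars: "extend f : T" if "f : scalars A" for f
		using that const_ext sc.fg_over_range[OF T(1)] by (auto simp: scalars_def)
	have "f : regs V & extend f : T" if "f : generate_ring A (G \<union> scalars A)" for f using that
	proof (induction rule: generate_ring.induct)
		case one
		show ?case unfolding extend_one using T.one_mem FR.one_closed unfolding A_simps(1) by (rule conjI[rotated])
	next
		case (incl h)
		thus ?case using T(2) scalars G generate_ring.incl[of h "G \<union> scalars A" A] by auto
	next
		case (a_inv h)
		hence "extend (\<ominus>\<^bsub>A\<^esub> h) = - extend h" "- extend h : T" "\<ominus>\<^bsub>A\<^esub> h : regs V"
			using extend_uminus[of h] T.uminus_mem[of "extend h"] FR.a_inv_closed[of h] by auto
		thus ?case by (simp only:)
	next
		case (eng_add h1 h2)
		hence "h1 +\<^sub>A h2 : regs V" "extend h1 + extend h2 : T"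
			using T.add_mem[of "extend h1" "extend h2"] FR.a_closed[of h1 h2] by auto
		thus ?case by (simp only: extend_add)
	next
		case (eng_mult h1 h2)
		hence "h1 *\<^sub>A h2 : regs V" "extend h1 * extend h2 : T"
			using T.mult_mem[of "extend h1" "extend h2"] FR.m_closed[of h1 h2] by auto
		thus ?case by (simp only: extend_mult)
	qed
	hence "ring_of_regs \<subseteq> T" unfolding ring_of_regs_def using G(3) by auto
	hence "T = ring_of_regs" using sub by simp
	thus ?thesis using T(1) by simp
qed

lemma ring_of_regs_noetherian: "noetherian_in ring_of_regs"
	using scalar_embedding.fg_over_noetherian[OF scalar_embedding_const ring_of_regs_fg] .

text \<open>The Nullstellensatz for \<open>V\<close>, and the resulting dictionary between irreducible closed sets and
	prime ideals.\<close>

lemma prime_zero: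
	assumes P: "prime_in ring_of_regs P" and b: "b : ring_of_regs" "b \<notin> P"
	obtains p where "p : points V" "!!a. a : P ==> a p = 0" "b p ~= 0"
proof -
	obtain phi where phi: "hom_on ring_of_regs phi" "!!c. phi (\<lambda>_::'p. c) = (c::'k)" "!!a. a : P ==> phi a = 0" "phi b ~= 0"
		using prime_has_point[OF scalar_embedding_const ring_of_regs_fg P b] by auto
	have hom: "phi (extend f * extend g) = phi (extend f) * phi (extend g)"
		"phi (extend f + extend g) = phi (extend f) + phi (extend g)" if "f : regs V" "g : regs V" for f g
		using phi(1) that extend_mem unfolding hom_on_def by auto
	obtain p where p: "p : points V" "!!f. f : regs V ==> phi (extend f) = f p"
	proof (rule alg_homsI[of "%f. phi (extend f)"])
		fix c f assume f: "f : regs V"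
		have "(%_. c) = extend (c \<odot>\<^bsub>A\<^esub> 1\<^sub>A)" unfolding extend_smult extend_one by simp
		moreover have "c \<odot>\<^bsub>A\<^esub> 1\<^sub>A : regs V" using reg_smult[of "1\<^sub>A" c] FR.one_closed by simp
		ultimately have "phi ((%_. c) * extend f) = c * phi (extend f)" using hom(1)[OF _ f] phi(2) by metis
		thus "phi (extend (c \<odot>\<^bsub>A\<^esub> f)) = c * phi (extend f)" unfolding extend_smult .
	next
		show "phi (extend 1\<^sub>A) = 1" using phi(2)[of 1] unfolding extend_one by (simp add: one_fun_def)
	qed (use hom in \<open>auto simp: extend_mult extend_add\<close>)
	have val: "phi a = a p" if a: "a : ring_of_regs" for a
		using a p extend_apply[OF p(1)] by (auto simp: ring_of_regs_def)
	thus ?thesis using that[OF p(1)] phi(3,4) b P by (auto simp: prime_in_def ideal_in_def subset_iff)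
qed

lemma vanishing_prime:
	assumes "irrc Y"
	shows "prime_in ring_of_regs (extend ` vanishing Y)" unfolding prime_in_def
proof (intro conjI ballI impI)
	have Y: "Y \<subseteq> points V" "Y ~= {}" using irreducible_closedD[OF assms] by auto
	have val: "extend f p = f p" if "p : Y" for p f using that Y extend_apply by auto
	have mem_iff: "extend f : extend ` vanishing Y \<longleftrightarrow> f : vanishing Y" if "f : regs V" for f
		using that extend_inj by (auto simp: vanishing_def)
	show "ideal_in ring_of_regs (extend ` vanishing Y)" unfolding ideal_in_def
	proof (intro conjI ballI)
		show "extend ` vanishing Y \<subseteq> ring_of_regs" by (auto simp: ring_of_regs_def vanishing_def)
		show "0 : extend ` vanishing Y"
			using FR.zero_closed Y extend_zero by (intro image_eqI[of _ _ "0\<^sub>A"]) (auto simp: vanishing_def)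
		fix a assume "a : extend ` vanishing Y"
		then obtain f where f: "f : vanishing Y" "a = extend f" by blast
		{
			fix b assume "b : extend ` vanishing Y"
			then obtain g where g: "g : vanishing Y" "b = extend g" by blast
			show "a + b : extend ` vanishing Y"
				unfolding f(2) g(2) extend_add[symmetric] using f g Y FR.a_closed[of f g] by (intro imageI) (auto simp: vanishing_def)
		}
		fix s assume "s : ring_of_regs"
		then obtain g where g: "g : regs V" "s = extend g" by (auto simp: ring_of_regs_def)
		show "s * a : extend ` vanishing Y"
			unfolding f(2) g(2) extend_mult[symmetric] using f g Y FR.m_closed[of g f] by (intro imageI) (auto simp: vanishing_def)
	qed
	show "1 \<notin> extend ` vanishing Y" using val Y by (auto simp: vanishing_def) (metis one_fun_apply zero_neq_one)
	fix a b assume "a : ring_of_regs" "b : ring_of_regs" and ab: "a * b : extend ` vanishing Y"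
	then obtain f g where fg: "f : regs V" "a = extend f" "g : regs V" "b = extend g" by (auto simp: ring_of_regs_def)
	hence "f *\<^sub>A g : vanishing Y" using ab mem_iff[of "f *\<^sub>A g"] FR.m_closed[of f g] by (simp add: extend_mult)
	hence "f : vanishing Y | g : vanishing Y"
		using Y fg by (intro irreducible_closed_prime[OF assms]) (auto simp: vanishing_def subset_iff dest!: bspec)
	thus "a : extend ` vanishing Y | b : extend ` vanishing Y" using fg by auto
qed

lemma prime_is_vanishing:
	assumes P: "prime_in ring_of_regs P"
	obtains Y where "irrc Y" "extend ` vanishing Y = P"
proof -
	define S where "S = {f : regs V. extend f : P}"
	have PS: "P = extend ` S" using P by (auto simp: S_def prime_in_def ideal_in_def ring_of_regs_def)
	define Y where "Y = zeros S"
	have closed: "closedin (zariski V) Y" unfolding Y_def by (rule closed_zeros) (auto simp: S_def)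
	have van: "vanishing Y = S"
	proof
		show "S \<subseteq> vanishing Y" by (auto simp: vanishing_def Y_def zeros_def S_def)
		show "vanishing Y \<subseteq> S"
		proof
			fix f assume f: "f : vanishing Y"
			show "f : S"
			proof (rule ccontr)
				assume "f \<notin> S"
				hence "extend f \<notin> P" "extend f : ring_of_regs" using f extend_mem by (auto simp: S_def vanishing_def)
				then obtain p where p: "p : points V" "!!a. a : P ==> a p = 0" "extend f p ~= 0"
					using prime_zero[OF P] by auto
				have "h p = 0" if "h : S" for h using p(2)[of "extend h"] that extend_apply[OF p(1)] by (simp add: S_def)
				hence "p : Y" using p(1) by (simp add: Y_def zeros_def)
				thus False using f p(3) extend_apply[OF p(1)] by (simp add: vanishing_def)
			qed
		qed
	qed
	have "Y ~= {}"
	proof -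
		have "1 \<notin> P" using P by (simp add: prime_in_def)
		then obtain p where p: "p : points V" "!!a. a : P ==> a p = 0" using prime_zero[OF P RR.one_mem] by auto
		have "h p = 0" if "h : S" for h using p(2)[of "extend h"] that extend_apply[OF p(1)] by (simp add: S_def)
		thus ?thesis using p(1) by (auto simp: Y_def zeros_def)
	qed
	moreover have "f : vanishing Y | g : vanishing Y"
		if "f : regs V" "g : regs V" "(\<lambda>p\<in>points V. f p * g p) : vanishing Y" for f g
		using that P unfolding van S_def prime_in_def A_simps(2)[symmetric] by (auto simp: extend_mult extend_mem)
	ultimately have "irrc Y" using closed by (intro irreducible_closedI) auto
	thus ?thesis using that[of Y] van PS by simp
qed

lemma extend_vanishing_eq:
	assumes "irrc Y" "irrc Y'"
	shows "extend ` vanishing Y \<subseteq> extend ` vanishing Y' \<longleftrightarrow> Y' \<subseteq> Y"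
proof -
	have "extend ` vanishing Y \<subseteq> extend ` vanishing Y' \<longleftrightarrow> vanishing Y \<subseteq> vanishing Y'"
	proof (rule iffI[OF _ image_mono], rule subsetI)
		fix f assume *: "extend ` vanishing Y \<subseteq> extend ` vanishing Y'" "f : vanishing Y"
		then obtain g where "g : vanishing Y'" "extend f = extend g" by blast
		thus "f : vanishing Y'" using *(2) extend_inj[of f g] by (simp add: vanishing_def)
	qed
	thus ?thesis
		using vanishing_subset_iff[OF irreducible_closedD(1)[OF assms(2)] irreducible_closedD(1)[OF assms(1)]] by simp
qed

lemma vanishing_points: "extend ` vanishing (points V) = {0}"
proof -
	have "vanishing (points V) = {0\<^sub>A}" using FR.zero_closed by (auto simp: vanishing_def intro: reg_eqI)
	thus ?thesis by (simp add: extend_zero)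
qed

end

section \<open>Orders along prime divisors\<close>

lemma (in monoid) int_pow_units_of:
	fixes n :: int
	assumes "x : Units G"
	shows "x [^]\<^bsub>units_of G\<^esub> n = x [^] n"
proof -
	have "x [^]\<^bsub>units_of G\<^esub> k : Units G" for k :: nat
		using assms units_group monoid.nat_pow_closed[of "units_of G" x k] by (simp add: group_def units_of_carrier)
	hence "inv\<^bsub>units_of G\<^esub> (x [^] k) = inv (x [^] k)" for k :: nat using units_of_pow[OF assms] units_of_inv by simp
	thus ?thesis unfolding int_pow_def2 units_of_pow[OF assms] by (simp only:)
qed

locale normal_affine = irreducible_affine +
	assumes normal: "normal_variety V"
begin

lemma integrally_closed:
	assumes f: "f : regs V" and h: "h : nzs" and g: "!!i. i < n ==> g i : regs V"
		and eq: "!!p. p : points V ==> f p ^ n + (\<Sum>i<n. g i p * f p ^ i * h p ^ (n - i)) = 0"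
	shows "EX q:regs V. f = h *\<^sub>A q"
proof -
	define x where "x = quot_fun V f h"
	have hr: "h : regs V" using nzsD[OF h] .
	have xK: "x : carrier (rat_funs V)" unfolding x_def using f h by (rule quot_closed)
	have xh: "x *\<^sub>F rat h = rat f" unfolding x_def using f h by (rule quot_rat)
	have hK: "rat h : carrier (rat_funs V)" "rat h ~= 0\<^sub>F" using rat_closed[OF hr] rat_nonzero[OF h] by auto
	have gK: "rat (g i) : carrier (rat_funs V)" if "i < n" for i using rat_closed g that by simp
	have fr: "f : carrier A" "h : carrier A" "!!i. i < n ==> g i : carrier A" using f hr g by auto
	have hom_pow: "rat (a [^]\<^bsub>A\<^esub> k) = rat a [^]\<^bsub>rat_funs V\<^esub> k" if "a : carrier A" for a and k :: nat using that by simp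
	define s where "s = (\<Oplus>\<^bsub>rat_funs V\<^esub>i\<in>{..<n}. rat (g i) *\<^sub>F x [^]\<^bsub>rat_funs V\<^esub> i)"
	define S where "S = (\<Oplus>\<^bsub>A\<^esub>i\<in>{..<n}. g i *\<^sub>A f [^]\<^bsub>A\<^esub> i *\<^sub>A h [^]\<^bsub>A\<^esub> (n - i))"
	have sK: "s : carrier (rat_funs V)" unfolding s_def using gK xK by (intro K.finsum_closed) auto
	have SA: "S : carrier A"
		unfolding S_def using fr by (intro FR.finsum_closed Pi_I FR.m_closed FR.nat_pow_closed) auto
	have pow_h: "x [^]\<^bsub>rat_funs V\<^esub> k *\<^sub>F rat h [^]\<^bsub>rat_funs V\<^esub> k = rat f [^]\<^bsub>rat_funs V\<^esub> k" for k :: nat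
		using K.nat_pow_distrib[OF xK hK(1), of k] xh by simp
	have term_eq: "(rat (g i) *\<^sub>F x [^]\<^bsub>rat_funs V\<^esub> i) *\<^sub>F rat h [^]\<^bsub>rat_funs V\<^esub> n =
			rat (g i *\<^sub>A f [^]\<^bsub>A\<^esub> i *\<^sub>A h [^]\<^bsub>A\<^esub> (n - i))" if i: "i < n" for i
	proof -
		have hn: "rat h [^]\<^bsub>rat_funs V\<^esub> n = rat h [^]\<^bsub>rat_funs V\<^esub> i *\<^sub>F rat h [^]\<^bsub>rat_funs V\<^esub> (n - i)"
			using K.nat_pow_mult[OF hK(1), of i "n - i"] i by simp
		have "(rat (g i) *\<^sub>F x [^]\<^bsub>rat_funs V\<^esub> i) *\<^sub>F rat h [^]\<^bsub>rat_funs V\<^esub> n =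
				rat (g i) *\<^sub>F (x [^]\<^bsub>rat_funs V\<^esub> i *\<^sub>F rat h [^]\<^bsub>rat_funs V\<^esub> i) *\<^sub>F rat h [^]\<^bsub>rat_funs V\<^esub> (n - i)"
			unfolding hn using gK[OF i] xK hK by (simp add: K.m_assoc)
		also have "\<dots> = rat (g i *\<^sub>A f [^]\<^bsub>A\<^esub> i *\<^sub>A h [^]\<^bsub>A\<^esub> (n - i))"
			unfolding pow_h using fr i by (simp add: hom_pow del: A_simps(1))
		finally show ?thesis .
	qed
	have "s *\<^sub>F rat h [^]\<^bsub>rat_funs V\<^esub> n =
			(\<Oplus>\<^bsub>rat_funs V\<^esub>i\<in>{..<n}. (rat (g i) *\<^sub>F x [^]\<^bsub>rat_funs V\<^esub> i) *\<^sub>F rat h [^]\<^bsub>rat_funs V\<^esub> n)"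
		unfolding s_def using gK xK hK by (intro K.finsum_ldistr) auto
	also have "\<dots> = (\<Oplus>\<^bsub>rat_funs V\<^esub>i\<in>{..<n}. rat (g i *\<^sub>A f [^]\<^bsub>A\<^esub> i *\<^sub>A h [^]\<^bsub>A\<^esub> (n - i)))"
	proof (intro K.finsum_cong' refl Pi_I)
		fix i assume "i : {..<n}"
		hence i: "i < n" by simp
		show "rat (g i *\<^sub>A f [^]\<^bsub>A\<^esub> i *\<^sub>A h [^]\<^bsub>A\<^esub> (n - i)) : carrier (rat_funs V)" using fr(1,2) fr(3)[OF i] by blast
	qed (use term_eq in auto)
	also have "\<dots> = rat S"
	proof -
		have "(%i. g i *\<^sub>A f [^]\<^bsub>A\<^esub> i *\<^sub>A h [^]\<^bsub>A\<^esub> (n - i)) : {..<n} \<rightarrow> carrier A"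
			using fr by (intro Pi_I FR.m_closed FR.nat_pow_closed) auto
		thus ?thesis unfolding S_def by (simp add: comp_def)
	qed
	finally have sS: "s *\<^sub>F rat h [^]\<^bsub>rat_funs V\<^esub> n = rat S" .
	have "(x [^]\<^bsub>rat_funs V\<^esub> n +\<^sub>F s) *\<^sub>F rat h [^]\<^bsub>rat_funs V\<^esub> n =
			rat f [^]\<^bsub>rat_funs V\<^esub> n +\<^sub>F rat S" using xK sK hK by (simp add: K.l_distr pow_h sS)
	also have "\<dots> = rat (f [^]\<^bsub>A\<^esub> n +\<^sub>A S)" using fr SA by (simp add: hom_pow del: A_simps(1))
	also have "f [^]\<^bsub>A\<^esub> n +\<^sub>A S = 0\<^sub>A"
	proof (rule reg_eqI)
		show "f [^]\<^bsub>A\<^esub> n +\<^sub>A S : regs V" "0\<^sub>A : regs V"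
			using FR.a_closed[OF FR.nat_pow_closed[OF fr(1), of n] SA] FR.zero_closed by auto
		fix p assume p: "p : points V"
		have "g i *\<^sub>A f [^]\<^bsub>A\<^esub> i *\<^sub>A h [^]\<^bsub>A\<^esub> (n - i) : regs V" if "i < n" for i
			using FR.m_closed[OF FR.m_closed[OF fr(3)[OF that] FR.nat_pow_closed[OF fr(1)]] FR.nat_pow_closed[OF fr(2)]] by simp
		hence "S p = (\<Sum>i<n. g i p * f p ^ i * h p ^ (n - i))" unfolding S_def using p by (subst A_finsum_apply) auto
		thus "(f [^]\<^bsub>A\<^esub> n +\<^sub>A S) p = 0\<^sub>A p" using eq[OF p] p by simp
	qed
	finally have "(x [^]\<^bsub>rat_funs V\<^esub> n +\<^sub>F s) *\<^sub>F rat h [^]\<^bsub>rat_funs V\<^esub> n = 0\<^sub>F" by simp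
	moreover have "rat h [^]\<^bsub>rat_funs V\<^esub> n ~= 0\<^sub>F" using hK by (induction n) (auto simp: K.integral_iff)
	ultimately have "x [^]\<^bsub>rat_funs V\<^esub> n +\<^sub>F s = 0\<^sub>F"
		using K.integral_iff[of "x [^]\<^bsub>rat_funs V\<^esub> n +\<^sub>F s" "rat h [^]\<^bsub>rat_funs V\<^esub> n"] xK sK hK by auto
	hence "\<exists>(n::nat) c. (\<forall>i<n. c i : regs V) \<and>
					 x [^]\<^bsub>rat_funs V\<^esub> n +\<^sub>F
						 (\<Oplus>\<^bsub>rat_funs V\<^esub>i\<in>{..<n}. rat_of_reg V (c i) *\<^sub>F x [^]\<^bsub>rat_funs V\<^esub> i)
					 = 0\<^sub>F" unfolding s_def using g by auto
	hence "x : rat ` regs V" using normal xK unfolding normal_variety_def by blast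
	then obtain q where q: "q : regs V" "x = rat q" by blast
	have "rat q *\<^sub>F rat h = rat (h *\<^sub>A q)" using q hr K.m_comm[OF rat_closed[OF q(1)] hK(1)] by simp
	hence "rat f = rat (h *\<^sub>A q)" using xh q(2) by simp
	moreover have "h *\<^sub>A q : regs V" using FR.m_closed[of h q] hr q by simp
	ultimately have "f = h *\<^sub>A q" using rat_eq_iff[OF f] by simp
	thus ?thesis using q by auto
qed

sublocale NR: normal_noetherian ring_of_regs
proof
	have mem: "EX f:regs V. a = extend f" if "a : ring_of_regs" for a using that by (auto simp: ring_of_regs_def)
	have nz: "f : nzs" if "f : regs V" "extend f ~= 0" for f
		unfolding FR_nonzero[symmetric] using that extend_zero by auto
	show "noetherian_in ring_of_regs" by (rule ring_of_regs_noetherian)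
	fix a b assume ab: "a : ring_of_regs" "b : ring_of_regs"
	obtain f where f: "f : regs V" "a = extend f" using mem ab by auto
	obtain h where h: "h : regs V" "b = extend h" using mem ab by auto
	{
		assume "a * b = 0"
		hence "extend (f *\<^sub>A h) = extend 0\<^sub>A" by (simp only: f h extend_mult extend_zero)
		hence "f *\<^sub>A h = 0\<^sub>A" using extend_inj[of "f *\<^sub>A h" "0\<^sub>A"] FR.m_closed[of f h] FR.zero_closed f h by simp
		hence "f = 0\<^sub>A | h = 0\<^sub>A" using FR.integral[of f h] f h by simp
		thus "a = 0 | b = 0" using f h extend_zero by auto
	}
	fix n and c :: "nat => _"
	assume b0: "b ~= 0" and c: "!!i. i < n ==> c i : ring_of_regs"
		and eq: "a ^ n + (\<Sum>i<n. c i * a ^ i * b ^ (n - i)) = 0"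
	have "ALL i:{..<n}. EX g. g : regs V & c i = extend g" using c mem by auto
	from bchoice[OF this] obtain g where g: "ALL i:{..<n}. g i : regs V & c i = extend (g i)" ..
	have "f p ^ n + (\<Sum>i<n. g i p * f p ^ i * h p ^ (n - i)) = 0" if p: "p : points V" for p
	proof -
		have pw: "(F ^ k) p = F p ^ k" for F :: "'a => 'b" and k by (induction k) simp_all
		have sm: "(\<Sum>i<n. G i) p = (\<Sum>i<n. G i p)" for G :: "nat => 'a => 'b" by (induction n) simp_all
		have "(a ^ n + (\<Sum>i<n. c i * a ^ i * b ^ (n - i))) p = 0" using eq by simp
		thus ?thesis using g p by (simp add: pw sm f(2) h(2) extend_apply)
	qed
	then obtain q where "q : regs V" "f = h *\<^sub>A q" using integrally_closed[OF f(1) nz, of h n g] h b0 g by auto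
	thus "EX q:ring_of_regs. a = b * q" using f h extend_mult extend_mem by auto
qed

lemma prime_divisor_height_one:
	assumes "D : PD"
	shows "NR.height_one (extend ` vanishing D)" unfolding NR.height_one_def
proof (intro conjI allI impI)
	have D: "irrc D" "D ~= points V"
		"!!C. irrc C ==> D \<subset> C ==> C = points V" using assms by (auto simp: prime_divisor_iff)
	show "prime_in ring_of_regs (extend ` vanishing D)" by (rule vanishing_prime[OF D(1)])
	show "extend ` vanishing D ~= {0}"
		using D(2) extend_vanishing_eq[OF D(1) irreducible_points] irreducible_closedD(3)[OF D(1)]
		unfolding vanishing_points by auto
	fix Q assume Q: "prime_in ring_of_regs Q & Q \<subseteq> extend ` vanishing D"
	then obtain C where C: "irrc C" "extend ` vanishing C = Q" using prime_is_vanishing by auto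
	hence "D \<subseteq> C" using Q extend_vanishing_eq[OF C(1) D(1)] by simp
	thus "Q = extend ` vanishing D | Q = {0}" using D(3)[OF C(1)] C(2) vanishing_points by (cases "D = C") auto
qed

lemma height_one_prime_divisor:
	assumes P: "NR.height_one P"
	obtains D where "D : PD" "extend ` vanishing D = P"
proof -
	have "prime_in ring_of_regs P" using P by (simp add: NR.height_one_def)
	then obtain D where D: "irrc D" "extend ` vanishing D = P" using prime_is_vanishing by auto
	have "D ~= points V" using P D vanishing_points by (auto simp: NR.height_one_def)
	moreover have "C = points V" if C: "irrc C" "D \<subset> C" for C
	proof -
		have "D \<subseteq> C" "\<not> C \<subseteq> D" using C(2) by blast+
		hence "extend ` vanishing C \<subseteq> P" "\<not> P \<subseteq> extend ` vanishing C"
			using extend_vanishing_eq[OF C(1) D(1)] extend_vanishing_eq[OF D(1) C(1)] D(2) by auto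
		hence "extend ` vanishing C \<subseteq> P" "extend ` vanishing C ~= P" by blast+
		hence "extend ` vanishing C = {0}" using P vanishing_prime[OF C(1)] unfolding NR.height_one_def by blast
		thus "C = points V"
			using extend_vanishing_eq[OF C(1) irreducible_points] irreducible_closedD(3)[OF C(1)] vanishing_points by auto
	qed
	ultimately have "D : PD" using D by (simp add: prime_divisor_iff)
	thus ?thesis using that D by simp
qed

lemma extend_mem_vanishing: "f : regs V ==> extend f : extend ` vanishing Y \<longleftrightarrow> f : vanishing Y"
	using extend_inj by (auto simp: vanishing_def)

lemma divisor_uniformizer:
	assumes D: "D : PD"
	obtains t where "t : vanishing D"
		"!!c. c : nzs ==> EX n. EX v:regs V - vanishing D. EX w:regs V - vanishing D.
			w *\<^sub>A c = v *\<^sub>A t [^]\<^bsub>A\<^esub> (n::nat)"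
proof -
	define P where "P = extend ` vanishing D"
	have P: "NR.height_one P" "prime_in ring_of_regs P"
		using prime_divisor_height_one[OF D] by (auto simp: P_def NR.height_one_def)
	obtain t' u where tu: "NR.uniformizer P t' u" using NR.height_one_uniformizer[OF P(1)] .
	then obtain t where t: "t : vanishing D" "t' = extend t" by (auto simp: NR.uniformizer_def P_def)
	have lift: "EX f:regs V - vanishing D. a = extend f" if a: "a : ring_of_regs - P" for a
		using a by (auto simp: ring_of_regs_def P_def)
	have ext_pow: "extend (f [^]\<^bsub>A\<^esub> n) = extend f ^ n" for f and n :: nat
		by (induction n) (simp_all only: FR.nat_pow_0 FR.nat_pow_Suc extend_one extend_mult power_0 power_Suc2)
	have "EX n. EX v:regs V - vanishing D. EX w:regs V - vanishing D. w *\<^sub>A c = v *\<^sub>A t [^]\<^bsub>A\<^esub> (n::nat)"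
		if c: "c : nzs" for c
	proof -
		have cr: "c : carrier A" "c ~= 0\<^sub>A" using c unfolding FR_nonzero[symmetric] by auto
		hence "extend c ~= 0" using extend_inj[of c "0\<^sub>A"] FR.zero_closed by (simp add: extend_zero)
		then obtain n v' w' where vw: "v' : ring_of_regs - P" "w' : ring_of_regs - P" "w' * extend c = v' * t' ^ n"
			using NR.uniformizer_factorization[OF P(2) tu, of "extend c"] extend_mem cr by auto
		obtain v w where v: "v : regs V - vanishing D" "v' = extend v" and w: "w : regs V - vanishing D" "w' = extend w"
			using lift vw by blast
		have tA: "t : carrier A" using t by (auto simp: vanishing_def)
		have "extend (w *\<^sub>A c) = extend (v *\<^sub>A t [^]\<^bsub>A\<^esub> n)" using vw(3) by (simp only: v w t extend_mult ext_pow)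
		hence "w *\<^sub>A c = v *\<^sub>A t [^]\<^bsub>A\<^esub> n"
			using extend_inj[of "w *\<^sub>A c" "v *\<^sub>A t [^]\<^bsub>A\<^esub> n"] v w cr FR.m_closed[of w c] FR.m_closed[OF _ FR.nat_pow_closed[OF tA], of v n]
			by simp
		thus ?thesis using v w by auto
	qed
	thus ?thesis using that t by simp
qed

lemma finite_divisors:
	assumes "a : nzs"
	shows "finite {D : PD. a : vanishing D}"
proof -
	have "a : carrier A" "a ~= 0\<^sub>A" using assms unfolding FR_nonzero[symmetric] by auto
	hence a: "extend a : ring_of_regs" "extend a ~= 0"
		using extend_mem extend_inj[of a "0\<^sub>A"] FR.zero_closed by (auto simp: extend_zero)
	have "inj_on (%D. extend ` vanishing D) {D : PD. a : vanishing D}"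
	proof (rule inj_onI)
		fix C D assume "C : {D : PD. a : vanishing D}" "D : {D : PD. a : vanishing D}"
			and eq: "extend ` vanishing C = extend ` vanishing D"
		hence "irrc C" "irrc D" by (auto simp: prime_divisor_iff)
		thus "C = D" using extend_vanishing_eq[of C D] extend_vanishing_eq[of D C] eq by auto
	qed
	moreover have "(%D. extend ` vanishing D) ` {D : PD. a : vanishing D} \<subseteq> {P. NR.height_one P & extend a : P}"
		using prime_divisor_height_one by auto
	ultimately show ?thesis using finite_imageD[OF finite_subset[OF _ NR.finite_height_one[OF a]]] by simp
qed

lemma pole_divisor:
	assumes "a : regs V" "b : nzs" "\<not> (EX q:regs V. a = b *\<^sub>A q)"
	obtains D where "D : PD"
		"!!r. r : regs V ==> (EX q:regs V. r *\<^sub>A a = b *\<^sub>A q) ==> r : vanishing D"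
proof -
	have b: "b : carrier A" "b ~= 0\<^sub>A" using assms unfolding FR_nonzero[symmetric] by auto
	have "extend b ~= 0" using b extend_inj[of b "0\<^sub>A"] FR.zero_closed by (simp add: extend_zero)
	moreover have "\<not> (EX q:ring_of_regs. extend a = extend b * q)"
	proof
		assume "EX q:ring_of_regs. extend a = extend b * q"
		then obtain q where q: "q : regs V" "extend a = extend (b *\<^sub>A q)" by (auto simp: ring_of_regs_def extend_mult)
		hence "a = b *\<^sub>A q" using extend_inj[of a "b *\<^sub>A q"] assms(1) FR.m_closed[of b q] b by simp
		thus False using assms(3) q by auto
	qed
	ultimately obtain P where P: "NR.height_one P"
		"!!r. r : ring_of_regs ==> (EX q:ring_of_regs. r * extend a = extend b * q) ==> r : P"
		using NR.fraction_denominators[of "extend a" "extend b"] extend_mem assms(1) b(1) by auto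
	obtain D where D: "D : PD" "extend ` vanishing D = P" using height_one_prime_divisor[OF P(1)] .
	have "r : vanishing D" if r: "r : regs V" "q : regs V" "r *\<^sub>A a = b *\<^sub>A q" for r q
	proof -
		have "extend r * extend a = extend b * extend q" using r(3) by (simp only: extend_mult[symmetric])
		hence "extend r : P" using P(2) extend_mem r by auto
		thus ?thesis using D(2) extend_mem_vanishing r(1) by auto
	qed
	thus ?thesis using that D(1) by blast
qed

end

context normal_affine begin

abbreviation Kx :: "('a, 'b) rat_fun set" where
	"Kx == carrier (rat_funs V) - {0\<^sub>F}"

lemma Kx_mult: "x : Kx ==> y : Kx ==> x *\<^sub>F y : Kx" using K.integral by auto

lemma Kx_one: "1\<^sub>F : Kx" by simp

lemma Kx_Units: "Units (rat_funs V) = Kx" by (rule K.field_Units)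

lemma Kx_inv: "x : Kx ==> inv\<^sub>F x : Kx" "x : Kx ==> x *\<^sub>F inv\<^sub>F x = 1\<^sub>F" unfolding Kx_Units[symmetric] by auto

lemma Kx_quotE:
	assumes "x : Kx"
	obtains a b where "a : nzs" "b : nzs" "x = quot_fun V a b"
proof -
	obtain a b where ab: "a : regs V" "b : nzs" "x = quot_fun V a b" using assms quotE[of x] by auto
	hence "a ~= 0\<^sub>A" using assms quot_zero_iff[of a b] by auto
	hence "a : nzs" using ab(1) unfolding FR_nonzero[symmetric] by simp
	thus ?thesis using that ab by simp
qed

lemma quot_Kx: "a : nzs ==> b : nzs ==> quot_fun V a b : Kx"
	using quot_closed[of a b] quot_zero_iff[of a b] nzsD[of a] unfolding FR_nonzero[symmetric] by auto

lemma rat_Kx: "a : nzs ==> rat a : Kx" using rat_nonzero nzsD by simp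

lemma not_vanishing_nonzero: "D \<subseteq> points V ==> a : regs V - vanishing D ==> a : nzs"
	by (auto simp: vanishing_def nzs_def)

lemma not_vanishing_mult:
	assumes "irrc D" "a : regs V - vanishing D" "b : regs V - vanishing D"
	shows "a *\<^sub>A b : regs V - vanishing D"
proof -
	have "\<not> (ALL p:D. a p * b p = 0)" using irreducible_closed_prime[OF assms(1), of a b] assms(2,3) by auto
	thus ?thesis
		using FR.m_closed[of a b] assms irreducible_closedD(3)[OF assms(1)] by (auto simp: vanishing_def subset_iff)
qed

lemma vanishing_mult: "D \<subseteq> points V ==> a : vanishing D ==> b : regs V ==> b *\<^sub>A a : vanishing D"
	using FR.m_closed[of b a] by (auto simp: vanishing_def subset_iff)

lemma not_vanishing_one: "irrc D ==> 1\<^sub>A : regs V - vanishing D"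
proof -
	assume D: "irrc D"
	then obtain p where "p : D" "p : points V" using irreducible_closedD(2,3)[OF D] by auto
	thus ?thesis using FR.one_closed by (auto simp: vanishing_def intro!: bexI[of _ p])
qed

text \<open>The multiplicity of a regular function along \<open>D\<close> is the exponent of the uniformizer in it.
	It is additive, hence extends to a valuation of the function field.\<close>

lemma valuation_exists:
	assumes D: "D : PD"
	obtains v :: "('a, 'b) rat_fun => int" and tau where
		"!!x y. x : Kx ==> y : Kx ==> v (x *\<^sub>F y) = v x + v y"
		"!!x. x : Kx ==> 0 \<le> v x \<longleftrightarrow> x : local_ring V D"
		"!!x. x : Kx ==> 1 \<le> v x \<longleftrightarrow> x : local_max_ideal V D"
		"tau : Kx" "v tau = 1"
proof -
	have irr: "irrc D" and Dne: "D ~= points V" using D by (auto simp: prime_divisor_iff)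
	have Dsub: "D \<subseteq> points V" using irreducible_closedD(3)[OF irr] .
	obtain t where t: "t : vanishing D"
		"!!c. c : nzs ==> EX n. EX v:regs V - vanishing D. EX w:regs V - vanishing D.
			w *\<^sub>A c = v *\<^sub>A t [^]\<^bsub>A\<^esub> (n::nat)" using divisor_uniformizer[OF D] by auto
	have tA: "t : carrier A" using t(1) by (simp add: vanishing_def)
	define U where "U = regs V - vanishing D"
	have UA: "a : carrier A" "a : nzs" "a \<notin> vanishing D" if "a : U" for a
		using that not_vanishing_nonzero[OF Dsub] by (auto simp: U_def)
	have Umult: "a *\<^sub>A b : U" if "a : U" "b : U" for a b using not_vanishing_mult[OF irr] that by (simp add: U_def)
	have Uone: "1\<^sub>A : U" using not_vanishing_one[OF irr] by (simp add: U_def)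
	have nzA: "a : carrier A" "a ~= 0\<^sub>A" if "a : nzs" for a using that unfolding FR_nonzero[symmetric] by auto
	have tpow: "t [^]\<^bsub>A\<^esub> n : carrier A" for n :: nat using FR.nat_pow_closed[OF tA] .
	have tpow_van: "t [^]\<^bsub>A\<^esub> n : vanishing D" if n: "n > 0" for n :: nat
	proof -
		obtain m where m: "n = Suc m" using n gr0_conv_Suc by auto
		show ?thesis using vanishing_mult[OF Dsub t(1), of "t [^]\<^bsub>A\<^esub> m"] tpow[of m] by (simp add: m)
	qed
	have t0: "t : nzs"
	proof (rule ccontr)
		assume "t \<notin> nzs"
		hence t0: "t = 0\<^sub>A" using tA unfolding FR_nonzero[symmetric] by auto
		have "\<not> vanishing D \<subseteq> vanishing (points V)"
			using vanishing_subset_iff[OF irreducible_closedD(1)[OF irreducible_points] irreducible_closedD(1)[OF irr]] Dsub Dne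
			by simp
		then obtain c where c: "c : vanishing D" "c : nzs" by (auto simp: vanishing_def nzs_def)
		obtain n :: nat and v w where vw: "v : U" "w : U" "w *\<^sub>A c = v *\<^sub>A t [^]\<^bsub>A\<^esub> n"
			using t(2)[OF c(2)] unfolding U_def by blast
		show False
		proof (cases n)
			case 0
			hence "v : vanishing D" using vanishing_mult[OF Dsub c(1), of w] vw UA by simp
			thus False using UA vw by simp
		next
			case (Suc m)
			hence "w *\<^sub>A c = 0\<^sub>A" using vw t0 UA(1)[OF vw(1)] by (simp del: A_simps(1))
			thus False using FR.integral[of w c] nzA[OF UA(2)[OF vw(2)]] nzA[OF c(2)] by simp
		qed
	qed
	have t1: "t ~= 0\<^sub>A" using nzA[OF t0] by simp
	have tpow0: "t [^]\<^bsub>A\<^esub> n ~= 0\<^sub>A" for n :: nat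
		using t1 tA tpow by (induction n) (auto simp: FR.integral_iff simp del: A_simps(1))
	define mlt where "mlt n c \<longleftrightarrow> (EX v:U. EX w:U. w *\<^sub>A c = v *\<^sub>A t [^]\<^bsub>A\<^esub> n)" for n :: nat and c
	have ex: "EX n. mlt n c" if "c : nzs" for c using t(2)[OF that] unfolding mlt_def U_def by blast
	have le: "n \<le> m" if c: "c : carrier A" "mlt n c" "mlt m c" for n m c
	proof (rule ccontr)
		assume "\<not> n \<le> m"
		hence nm: "n = m + (n - m)" "n - m > 0" by auto
		obtain v w where 1: "v : U" "w : U" "w *\<^sub>A c = v *\<^sub>A t [^]\<^bsub>A\<^esub> n" using c(2) unfolding mlt_def by blast
		obtain v' w' where 2: "v' : U" "w' : U" "w' *\<^sub>A c = v' *\<^sub>A t [^]\<^bsub>A\<^esub> m" using c(3) unfolding mlt_def by blast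
		have car: "v : carrier A" "w : carrier A" "v' : carrier A" "w' : carrier A" using UA 1 2 by auto
		have "t [^]\<^bsub>A\<^esub> m *\<^sub>A (w *\<^sub>A v') = w *\<^sub>A (v' *\<^sub>A t [^]\<^bsub>A\<^esub> m)" using car tpow by (simp add: FR.m_ac del: A_simps(1))
		also have "\<dots> = w' *\<^sub>A (w *\<^sub>A c)" unfolding 2(3)[symmetric] using car c(1) by (simp add: FR.m_ac del: A_simps(1))
		also have "\<dots> = w' *\<^sub>A (v *\<^sub>A (t [^]\<^bsub>A\<^esub> m *\<^sub>A t [^]\<^bsub>A\<^esub> (n - m)))"
			unfolding 1(3) using FR.nat_pow_mult[OF tA, of m "n - m"] nm(1) by simp
		also have "\<dots> = t [^]\<^bsub>A\<^esub> m *\<^sub>A (w' *\<^sub>A v *\<^sub>A t [^]\<^bsub>A\<^esub> (n - m))"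
			using car tpow by (simp add: FR.m_ac del: A_simps(1))
		finally have "w *\<^sub>A v' = w' *\<^sub>A v *\<^sub>A t [^]\<^bsub>A\<^esub> (n - m)"
			using FR.m_lcancel[OF tpow0 tpow] car tpow by (simp del: A_simps(1))
		hence "w *\<^sub>A v' : vanishing D"
			using vanishing_mult[OF Dsub tpow_van[OF nm(2)], of "w' *\<^sub>A v"] FR.m_closed[OF car(4,1)] by simp
		thus False using UA(3)[OF Umult[OF 1(2) 2(1)]] by simp
	qed
	define N where "N c = (THE n. mlt n c)" for c
	have N_eq: "N c = n" if "c : nzs" "mlt n c" for c n
		unfolding N_def using that le[OF nzA(1)[OF that(1)]] by (intro the_equality) (auto intro: antisym)
	have N: "mlt (N c) c" if "c : nzs" for c using ex[OF that] N_eq[OF that] by auto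
	have NE: "EX v:U. EX w:U. w *\<^sub>A c = v *\<^sub>A t [^]\<^bsub>A\<^esub> N c" if "c : nzs" for c using N[OF that] by (simp add: mlt_def)
	have N_mult: "N (a *\<^sub>A b) = N a + N b" if ab: "a : nzs" "b : nzs" for a b
	proof (rule N_eq)
		show "a *\<^sub>A b : nzs" using nzs_mult ab by simp
		obtain v w where 1: "v : U" "w : U" "w *\<^sub>A a = v *\<^sub>A t [^]\<^bsub>A\<^esub> N a" using NE[OF ab(1)] by auto
		obtain v' w' where 2: "v' : U" "w' : U" "w' *\<^sub>A b = v' *\<^sub>A t [^]\<^bsub>A\<^esub> N b" using NE[OF ab(2)] by auto
		have car: "v : carrier A" "w : carrier A" "v' : carrier A" "w' : carrier A" "a : carrier A" "b : carrier A"
			using UA 1 2 nzA ab by auto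
		have "(w *\<^sub>A w') *\<^sub>A (a *\<^sub>A b) = (w *\<^sub>A a) *\<^sub>A (w' *\<^sub>A b)" using car by (simp add: FR.m_ac del: A_simps(1))
		also have "\<dots> = (v *\<^sub>A v') *\<^sub>A (t [^]\<^bsub>A\<^esub> N a *\<^sub>A t [^]\<^bsub>A\<^esub> N b)"
			unfolding 1(3) 2(3) using car tpow by (simp add: FR.m_ac del: A_simps(1))
		also have "\<dots> = (v *\<^sub>A v') *\<^sub>A t [^]\<^bsub>A\<^esub> (N a + N b)" using FR.nat_pow_mult[OF tA] by simp
		finally show "mlt (N a + N b) (a *\<^sub>A b)" unfolding mlt_def using Umult 1 2 by blast
	qed
	have N_U: "N c = 0" if c: "c : U" for c
	proof (rule N_eq[OF UA(2)[OF c]])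
		have "1\<^sub>A *\<^sub>A c = c *\<^sub>A t [^]\<^bsub>A\<^esub> (0::nat)" using UA(1)[OF c] by simp
		thus "mlt 0 c" unfolding mlt_def using c Uone by auto
	qed
	have N_pos: "N c > 0" if c: "c : nzs" "c : vanishing D" for c
	proof (rule ccontr)
		assume "\<not> N c > 0"
		then obtain v w where "v : U" "w : U" "w *\<^sub>A c = v" using NE[OF c(1)] UA by auto
		thus False using vanishing_mult[OF Dsub c(2), of w] UA by auto
	qed
	have N_t: "N t = 1"
	proof (rule N_eq[OF t0])
		have "1\<^sub>A *\<^sub>A t = 1\<^sub>A *\<^sub>A t [^]\<^bsub>A\<^esub> (1::nat)" using tA by simp
		thus "mlt 1 t" unfolding mlt_def using Uone by auto
	qed
	define v where "v x = (THE k. EX a:nzs. EX b:nzs. x = quot_fun V a b & k = int (N a) - int (N b))" for x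
	have v: "v (quot_fun V a b) = int (N a) - int (N b)" if ab: "a : nzs" "b : nzs" for a b unfolding v_def
	proof (rule the_equality)
		show "EX c:nzs. EX d:nzs. quot_fun V a b = quot_fun V c d & int (N a) - int (N b) = int (N c) - int (N d)"
			using ab by auto
		fix k assume "EX c:nzs. EX d:nzs. quot_fun V a b = quot_fun V c d & k = int (N c) - int (N d)"
		then obtain c d where cd: "c : nzs" "d : nzs" "quot_fun V a b = quot_fun V c d" "k = int (N c) - int (N d)"
			by blast
		hence "a *\<^sub>A d = c *\<^sub>A b" using quot_eq_iff[of a b c d] ab nzsD by auto
		hence "N a + N d = N c + N b" using N_mult ab cd by metis
		thus "k = int (N a) - int (N b)" using cd(4) by simp
	qed
	have local: "EX c:regs V. EX d:U. quot_fun V a b = quot_fun V c d & (N b < N a --> c : vanishing D)"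
		if ab: "a : nzs" "b : nzs" "N b \<le> N a" for a b
	proof -
		obtain v w where 1: "v : U" "w : U" "w *\<^sub>A a = v *\<^sub>A t [^]\<^bsub>A\<^esub> N a" using NE[OF ab(1)] by auto
		obtain v' w' where 2: "v' : U" "w' : U" "w' *\<^sub>A b = v' *\<^sub>A t [^]\<^bsub>A\<^esub> N b" using NE[OF ab(2)] by auto
		have car: "v : carrier A" "w : carrier A" "v' : carrier A" "w' : carrier A" "a : carrier A" "b : carrier A"
			using UA 1 2 nzA ab by auto
		define e where "e = t [^]\<^bsub>A\<^esub> (N a - N b)"
		have eA: "e : carrier A" unfolding e_def by (rule tpow)
		have "t [^]\<^bsub>A\<^esub> N a = t [^]\<^bsub>A\<^esub> N b *\<^sub>A e"
			using FR.nat_pow_mult[OF tA, of "N b" "N a - N b"] ab(3) by (simp add: e_def)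
		hence "a *\<^sub>A (w *\<^sub>A v') = (v' *\<^sub>A t [^]\<^bsub>A\<^esub> N b) *\<^sub>A (v *\<^sub>A e)"
			using 1(3) car eA tpow by (metis FR.m_assoc FR.m_comm FR.m_closed)
		also have "\<dots> = (v *\<^sub>A w' *\<^sub>A e) *\<^sub>A b"
			unfolding 2(3)[symmetric] using car eA by (simp add: FR.m_ac del: A_simps(1))
		finally have "quot_fun V a b = quot_fun V (v *\<^sub>A w' *\<^sub>A e) (w *\<^sub>A v')"
			using quot_eq_iff[of a b "v *\<^sub>A w' *\<^sub>A e" "w *\<^sub>A v'"] ab nzsD UA(2)[OF Umult[OF 1(2) 2(1)]] FR.m_closed[OF FR.m_closed[OF car(1,4)] eA]
			by simp
		moreover have "v *\<^sub>A w' *\<^sub>A e : vanishing D" if "N b < N a"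
			using vanishing_mult[OF Dsub tpow_van, of "N a - N b" "v *\<^sub>A w'"] FR.m_closed[OF car(1,4)] that
			by (simp add: e_def)
		moreover have "v *\<^sub>A w' *\<^sub>A e : regs V" using FR.m_closed[OF FR.m_closed[OF car(1,4)] eA] by simp
		ultimately show ?thesis using Umult[OF 1(2) 2(1)] by auto
	qed
	have U_iff: "b : U \<longleftrightarrow> b : regs V & (EX p:D. b p ~= 0)" for b by (auto simp: U_def vanishing_def)
	show ?thesis
	proof (rule that[of v "rat t"])
		show "rat t : Kx" using rat_Kx t0 by simp
		show "v (rat t) = 1" unfolding rat_of_reg_def using v[OF t0 nzs_one] N_t N_U[OF Uone] by simp
		fix x assume x: "x : Kx"
		obtain a b where ab: "a : nzs" "b : nzs" "x = quot_fun V a b" using Kx_quotE[OF x] .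
		show "v (x *\<^sub>F y) = v x + v y" if y: "y : Kx" for y
		proof -
			obtain c d where cd: "c : nzs" "d : nzs" "y = quot_fun V c d" using Kx_quotE[OF y] .
			show ?thesis unfolding ab(3) cd(3) using quot_mult[of a b c d] ab cd nzsD nzs_mult by (simp add: v N_mult)
		qed
		show "0 \<le> v x \<longleftrightarrow> x : local_ring V D"
		proof
			assume "0 \<le> v x"
			hence "N b \<le> N a" using v[OF ab(1,2)] ab(3) by simp
			then obtain c d where cd: "c : regs V" "d : U" "x = quot_fun V c d" using local[OF ab(1,2)] ab(3) by auto
			hence "d : regs V" "EX p:D. d p ~= 0" unfolding U_iff by auto
			thus "x : local_ring V D" unfolding local_ring_def using cd by auto
		next
			assume "x : local_ring V D"
			then obtain c d where cd: "c : regs V" "d : U" "x = quot_fun V c d" unfolding local_ring_def U_iff by blast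
			hence "c : nzs" using x quot_zero_iff[OF cd(1) UA(2)[OF cd(2)]] unfolding FR_nonzero[symmetric] by auto
			thus "0 \<le> v x" using v[of c d] UA(2)[OF cd(2)] N_U[OF cd(2)] cd(3) by simp
		qed
		show "1 \<le> v x \<longleftrightarrow> x : local_max_ideal V D"
		proof
			assume "1 \<le> v x"
			hence "N b < N a" using v[OF ab(1,2)] ab(3) by simp
			then obtain c d where cd: "c : regs V" "d : U" "x = quot_fun V c d" "c : vanishing D"
				using local[OF ab(1,2)] ab(3) by auto
			hence "ALL p:D. c p = 0" "d : regs V" "EX p:D. d p ~= 0" unfolding U_iff vanishing_def by auto
			thus "x : local_max_ideal V D" unfolding local_max_ideal_def using cd by auto
		next
			assume "x : local_max_ideal V D"
			then obtain c d where cd: "c : regs V" "c : vanishing D" "d : U" "x = quot_fun V c d"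
				unfolding local_max_ideal_def U_iff vanishing_def by blast
			hence "c : nzs" using x quot_zero_iff[OF cd(1) UA(2)[OF cd(3)]] unfolding FR_nonzero[symmetric] by auto
			thus "1 \<le> v x" using v[of c d] UA(2)[OF cd(3)] N_U[OF cd(3)] N_pos[of c] cd by auto
		qed
	qed
qed

text \<open>The order along a prime divisor is the valuation of the previous lemma, because a valuation
	with this valuation ring is determined by it.\<close>

lemma ord_along_valuation:
	assumes D: "D : PD"
	shows "x : Kx ==> y : Kx ==> ordV D (x *\<^sub>F y) = ordV D x + ordV D y"
		and "x : Kx ==> 0 \<le> ordV D x \<longleftrightarrow> x : local_ring V D"
		and "x : Kx ==> 1 \<le> ordV D x \<longleftrightarrow> x : local_max_ideal V D"
		and "EX t:Kx. ordV D t = 1"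
proof -
	obtain v :: "('a, 'b) rat_fun => int" and tau where
		v_mult: "!!x y. x : Kx ==> y : Kx ==> v (x *\<^sub>F y) = v x + v y"
		and v_local: "!!x. x : Kx ==> 0 \<le> v x \<longleftrightarrow> x : local_ring V D"
		and v_max: "!!x. x : Kx ==> 1 \<le> v x \<longleftrightarrow> x : local_max_ideal V D"
		and tau: "tau : Kx" "v tau = 1" by (rule valuation_exists[OF D]) (rule that)
	have irr: "irrc D" using D by (auto simp: prime_divisor_iff)
	interpret G: comm_group "units_of (rat_funs V)" by (rule K.units_comm_group)
	have carG: "carrier (units_of (rat_funs V)) = Kx" by (simp add: units_of_carrier Kx_Units)
	have v_one: "v 1\<^sub>F = 0" using v_mult[OF Kx_one Kx_one] by simp
	have v_hom: "v : hom (units_of (rat_funs V)) integer_group"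
		by (rule homI) (auto simp: carG units_of_mult integer_group_def v_mult)
	have v_pow: "v (x [^]\<^bsub>rat_funs V\<^esub> n) = n * v x" if x: "x : Kx" for x and n :: int
	proof -
		have "v (x [^]\<^bsub>units_of (rat_funs V)\<^esub> n) = v x [^]\<^bsub>integer_group\<^esub> n"
			using group_hom.hom_int_pow[of "units_of (rat_funs V)" integer_group v x n] v_hom x carG
			by (simp add: group_hom_def group_hom_axioms_def G.is_group)
		thus ?thesis using K.int_pow_units_of[of x n] x by (simp add: Kx_Units mult.commute)
	qed
	have pow_Kx: "x [^]\<^bsub>rat_funs V\<^esub> n : Kx" if "x : Kx" for x and n :: int
		using G.int_pow_closed[of x n] K.int_pow_units_of[of x n] that by (simp add: carG Kx_Units)
	have zero_local: "0\<^sub>F : local_ring V D" "0\<^sub>F : local_max_ideal V D"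
	proof -
		have "0\<^sub>F = quot_fun V 0\<^sub>A 1\<^sub>A" "0\<^sub>A : regs V" using quot_zero_iff[of "0\<^sub>A" "1\<^sub>A"] FR.zero_closed nzs_one by auto
		moreover have "1\<^sub>A : regs V" "EX p:D. 1\<^sub>A p ~= 0" "ALL p:D. 0\<^sub>A p = 0"
			using not_vanishing_one[OF irr] irreducible_closedD[OF irr] by (auto simp: vanishing_def)
		ultimately show "0\<^sub>F : local_ring V D" "0\<^sub>F : local_max_ideal V D"
			unfolding local_ring_def local_max_ideal_def by blast+
	qed
	have sub: "local_ring V D \<subseteq> carrier (rat_funs V)" "local_max_ideal V D \<subseteq> carrier (rat_funs V)"
	proof -
		have "b : nzs" if "b : regs V" "EX p:D. b p ~= 0" for b
			using that irreducible_closedD(3)[OF irr] by (auto simp: nzs_def)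
		thus "local_ring V D \<subseteq> carrier (rat_funs V)" "local_max_ideal V D \<subseteq> carrier (rat_funs V)"
			unfolding local_ring_def local_max_ideal_def using quot_closed by blast+
	qed
	have max_eq: "local_max_ideal V D = (%s. s *\<^sub>F tau) ` local_ring V D"
	proof (intro equalityI subsetI)
		fix x assume x: "x : local_max_ideal V D"
		show "x : (%s. s *\<^sub>F tau) ` local_ring V D"
		proof (cases "x = 0\<^sub>F")
			case True
			thus ?thesis using zero_local tau(1) by (intro image_eqI[of _ _ "0\<^sub>F"]) auto
		next
			case False
			hence xK: "x : Kx" using x sub by auto
			define s where "s = x *\<^sub>F inv\<^sub>F tau"
			have sK: "s : Kx" and xs: "x = s *\<^sub>F tau"
				unfolding s_def using Kx_mult[OF xK Kx_inv(1)[OF tau(1)]] Kx_inv[OF tau(1)] xK tau(1) K.m_comm[of tau]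
			by (auto simp: K.m_assoc)
			have "1 \<le> v s + v tau" using v_max[OF xK] x v_mult[OF sK tau(1)] xs by simp
			thus ?thesis using v_local[OF sK] xs tau(2) by auto
		qed
	next
		fix x assume "x : (%s. s *\<^sub>F tau) ` local_ring V D"
		then obtain s where s: "s : local_ring V D" "x = s *\<^sub>F tau" by blast
		show "x : local_max_ideal V D"
		proof (cases "s = 0\<^sub>F")
			case True
			thus ?thesis using s zero_local tau(1) by simp
		next
			case False
			hence sK: "s : Kx" using s sub by auto
			thus ?thesis using v_max[OF Kx_mult[OF sK tau(1)]] v_mult[OF sK tau(1)] v_local[OF sK] s tau(2) by simp
		qed
	qed
	have ord: "ordV D x = v x" if x: "x : Kx" for x unfolding ord_along_def
	proof (rule the_equality)
		define u where "u = x *\<^sub>F tau [^]\<^bsub>rat_funs V\<^esub> (- v x)"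
		have taun: "tau [^]\<^bsub>rat_funs V\<^esub> n : Kx" for n :: int using pow_Kx tau(1) by simp
		have uK: "u : Kx" unfolding u_def using Kx_mult[OF x taun] .
		have vu: "v u = 0" unfolding u_def using v_mult[OF x taun] v_pow[OF tau(1)] tau(2) by simp
		have inv: "tau [^]\<^bsub>rat_funs V\<^esub> (- v x) *\<^sub>F tau [^]\<^bsub>rat_funs V\<^esub> v x = 1\<^sub>F"
			using G.int_pow_mult[of tau "- v x" "v x"] tau(1) K.int_pow_units_of[of tau]
			by (simp add: carG Kx_Units units_of_mult units_of_one)
		have "u *\<^sub>F tau [^]\<^bsub>rat_funs V\<^esub> v x = x" unfolding u_def using inv x taun K.m_assoc[of x] by auto
		moreover have "u : local_ring V D - local_max_ideal V D" using v_local[OF uK] v_max[OF uK] vu by simp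
		moreover have "tau : local_max_ideal V D" using v_max[OF tau(1)] tau(2) by simp
		ultimately show "EX t u. t : local_max_ideal V D \<and>
				local_max_ideal V D = (%s. s *\<^sub>F t) ` local_ring V D \<and>
				u : local_ring V D - local_max_ideal V D & x = u *\<^sub>F t [^]\<^bsub>rat_funs V\<^esub> v x"
			using max_eq by (intro exI[of _ tau] exI[of _ u] conjI) simp_all
		fix n :: int assume "EX t u. t : local_max_ideal V D \<and>
				local_max_ideal V D = (%s. s *\<^sub>F t) ` local_ring V D \<and>
				u : local_ring V D - local_max_ideal V D & x = u *\<^sub>F t [^]\<^bsub>rat_funs V\<^esub> n"
		then obtain t u where t: "t : local_max_ideal V D" "local_max_ideal V D = (%s. s *\<^sub>F t) ` local_ring V D"
				and u: "u : local_ring V D - local_max_ideal V D" and xu: "x = u *\<^sub>F t [^]\<^bsub>rat_funs V\<^esub> n" by blast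
		have "tau : local_max_ideal V D" using v_max[OF tau(1)] tau(2) by simp
		then obtain s where s: "s : local_ring V D" "tau = s *\<^sub>F t" using t(2) by auto
		have "t : carrier (rat_funs V)" "s : carrier (rat_funs V)" using t(1) s sub by auto
		hence tK: "t : Kx" and sK: "s : Kx" using s(2) tau(1) by auto
		have "v s + v t = 1" "0 \<le> v s" "1 \<le> v t" using v_mult[OF sK tK] s tau(2) v_local[OF sK] v_max[OF tK] t(1) by auto
		hence vt: "v t = 1" by simp
		have uK: "u : Kx" using u sub zero_local by auto
		hence "v u = 0" using u v_local[OF uK] v_max[OF uK] by auto
		thus "n = v x" using xu v_mult[OF uK pow_Kx[OF tK]] v_pow[OF tK] vt by simp
	qed
	show "x : Kx ==> y : Kx ==> ordV D (x *\<^sub>F y) = ordV D x + ordV D y"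
		using ord[of x] ord[of y] ord[OF Kx_mult, of x y] v_mult by simp
	show "x : Kx ==> 0 \<le> ordV D x \<longleftrightarrow> x : local_ring V D" using ord v_local by simp
	show "x : Kx ==> 1 \<le> ordV D x \<longleftrightarrow> x : local_max_ideal V D" using ord v_max by simp
	show "EX t:Kx. ordV D t = 1" using ord[OF tau(1)] tau by auto
qed

end

section \<open>Divisors and their sections\<close>

context normal_affine begin

lemma ord_mult: "D : PD ==> x : Kx ==> y : Kx ==>
		ordV D (x *\<^sub>F y) = ordV D x + ordV D y" by (rule ord_along_valuation(1))

lemma ord_one: "D : PD ==> ordV D 1\<^sub>F = 0" using ord_mult[of D "1\<^sub>F" "1\<^sub>F"] by simp

lemma ord_inv: "D : PD ==> x : Kx ==> ordV D (inv\<^sub>F x) = - ordV D x"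
	using ord_mult[of D x "inv\<^sub>F x"] ord_one[of D] Kx_inv[of x] by simp

lemma prime_divisorD:
	assumes "D : PD"
	shows "irrc D" "D ~= points V" "D \<subseteq> points V" "D ~= {}"
	using assms irreducible_closedD[of D] by (auto simp: prime_divisor_iff)

lemma ord_rat_nonneg:
	assumes D: "D : PD" and a: "a : nzs"
	shows "0 \<le> ordV D (rat a)"
proof -
	have "rat a : local_ring V D" unfolding local_ring_def rat_of_reg_def
		using nzsD[OF a] not_vanishing_one[OF prime_divisorD(1)[OF D]] by (auto simp: vanishing_def)
	thus ?thesis using ord_along_valuation(2)[OF D rat_Kx[OF a]] by simp
qed

lemma ord_rat_pos:
	assumes D: "D : PD" and a: "a : nzs" "a : vanishing D"
	shows "1 \<le> ordV D (rat a)"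
proof -
	have "rat a : local_max_ideal V D" unfolding local_max_ideal_def rat_of_reg_def
		using a not_vanishing_one[OF prime_divisorD(1)[OF D]] by (auto simp: vanishing_def)
	thus ?thesis using ord_along_valuation(3)[OF D rat_Kx[OF a(1)]] by simp
qed

lemma ord_rat_zero:
	assumes D: "D : PD" and a: "a : regs V - vanishing D"
	shows "ordV D (rat a) = 0"
proof -
	have anz: "a : nzs" using not_vanishing_nonzero[OF prime_divisorD(3)[OF D] a] .
	define y where "y = quot_fun V 1\<^sub>A a"
	have yK: "y : Kx" unfolding y_def using quot_Kx nzs_one anz by simp
	have "y : local_ring V D" unfolding local_ring_def y_def using a nzsD[OF nzs_one] by (auto simp: vanishing_def)
	hence "0 \<le> ordV D y" using ord_along_valuation(2)[OF D yK] by simp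
	moreover have "y *\<^sub>F rat a = 1\<^sub>F" unfolding y_def using quot_rat[OF nzsD[OF nzs_one] anz] by simp
	hence "ordV D y + ordV D (rat a) = 0" using ord_mult[OF D yK rat_Kx[OF anz]] ord_one[OF D] by simp
	ultimately show ?thesis using ord_rat_nonneg[OF D anz] by simp
qed

lemma finite_ord:
	assumes x: "x : Kx"
	shows "finite {D : PD. ordV D x ~= 0}"
proof -
	obtain a b where ab: "a : nzs" "b : nzs" "x = quot_fun V a b" using Kx_quotE[OF x] .
	have "D : {D : PD. a : vanishing D} \<union> {D : PD. b : vanishing D}"
		if D: "D : PD" "ordV D x ~= 0" for D
	proof (rule ccontr)
		assume "D \<notin> {D : PD. a : vanishing D} \<union> {D : PD. b : vanishing D}"
		hence "a : regs V - vanishing D" "b : regs V - vanishing D" using D ab nzsD by auto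
		hence "ordV D (rat a) = 0" "ordV D (rat b) = 0" using ord_rat_zero D by blast+
		moreover have "x *\<^sub>F rat b = rat a" using quot_rat[of a b] ab nzsD by simp
		ultimately show False using ord_mult[OF D(1) x rat_Kx[OF ab(2)]] D(2) by simp
	qed
	hence "{D : PD. ordV D x ~= 0} \<subseteq>
			{D : PD. a : vanishing D} \<union> {D : PD. b : vanishing D}" by blast
	thus ?thesis using finite_subset finite_divisors ab by auto
qed

lemma lookup_div:
	assumes "x : Kx"
	shows "lkp (div_of V x) D = (if D : PD then ordV D x else 0)"
proof -
	have "{D. (if D : PD then ordV D x else 0) ~= 0} =
			{D : PD. ordV D x ~= 0}" by auto
	thus ?thesis unfolding div_of_def using finite_ord[OF assms] by (subst lookup_Abs_poly_mapping) auto
qed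

lemma div_mult: "x : Kx ==> y : Kx ==> div_of V (x *\<^sub>F y) = div_of V x + div_of V y"
	using Kx_mult[of x y] by (intro poly_mapping_eqI) (simp add: lookup_div lookup_add ord_mult)

lemma div_one: "div_of V 1\<^sub>F = 0" using div_mult[OF Kx_one Kx_one] by simp

lemma div_inv: "x : Kx ==> div_of V (inv\<^sub>F x) = - div_of V x"
	using Kx_inv[of x] by (intro poly_mapping_eqI) (simp add: lookup_div ord_inv)

lemma weil_carrier: "D : carrier (weil_divisors V) \<longleftrightarrow> pkeys D \<subseteq> PD"
	by (simp add: weil_divisors_def free_Abelian_group_def)

lemma weil_mult: "D \<otimes>\<^bsub>weil_divisors V\<^esub> E = D + E" and weil_one: "\<one>\<^bsub>weil_divisors V\<^esub> = 0"
	by (simp_all add: weil_divisors_def free_Abelian_group_def)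

lemma weil_uminus: "D : carrier (weil_divisors V) ==> - D : carrier (weil_divisors V)" by (simp add: weil_carrier)

lemma div_weil: "x : Kx ==> div_of V x : carrier (weil_divisors V)"
	unfolding weil_carrier by (rule subsetI, rule ccontr) (simp only: in_keys_iff lookup_div if_False simp_thms)

text \<open>A normal variety is regular in codimension one, and its functions are determined there.\<close>

lemma regular_if_no_poles:
	assumes x: "x : Kx" "!!D. D : PD ==> 0 \<le> ordV D x"
	shows "x : rat ` regs V"
proof -
	obtain a b where ab: "a : nzs" "b : nzs" "x = quot_fun V a b" using Kx_quotE[OF x(1)] .
	have bA: "a : carrier A" "b : carrier A" using ab nzsD by auto
	have "EX q:regs V. a = b *\<^sub>A q"
	proof (rule ccontr)
		assume no: "\<not> (EX q:regs V. a = b *\<^sub>A q)"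
		obtain D where D: "D : PD"
			"!!r. r : regs V ==> (EX q:regs V. r *\<^sub>A a = b *\<^sub>A q) ==> r : vanishing D"
			using pole_divisor[OF nzsD[OF ab(1)] ab(2) no] by auto
		have "x : local_ring V D" using ord_along_valuation(2)[OF D(1) x(1)] x(2)[OF D(1)] by simp
		then obtain c d where cd: "c : regs V" "d : regs V" "EX p:D. d p ~= 0" "x = quot_fun V c d"
			unfolding local_ring_def by blast
		have "d : nzs" using cd prime_divisorD(3)[OF D(1)] by (auto simp: nzs_def)
		hence "a *\<^sub>A d = c *\<^sub>A b" using quot_eq_iff[of a b c d] ab cd nzsD by auto
		hence "d *\<^sub>A a = b *\<^sub>A c" using FR.m_comm[of a d] FR.m_comm[of c b] bA cd by simp
		hence "d : vanishing D" using D(2)[OF cd(2)] cd(1) by auto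
		thus False using cd(3) by (simp add: vanishing_def)
	qed
	then obtain q where q: "q : regs V" "a = b *\<^sub>A q" by blast
	hence "x = rat q" unfolding ab(3) rat_of_reg_def using quot_eq_iff[of a b q "1\<^sub>A"] ab nzs_one FR.m_comm[of b q] bA
			by auto
	thus ?thesis using q by simp
qed

lemma sections_iff:
	"x : OV D \<longleftrightarrow> x : carrier (rat_funs V) \<and>
		 (x = 0\<^sub>F | (ALL P:PD. - lkp D P \<le> ordV P x))"
proof (cases "x : Kx")
	case True
	thus ?thesis by (auto simp: divisor_sections_def lookup_add lookup_div dest: bspec)
qed (auto simp: divisor_sections_def)

lemma sections_carrier: "x : OV D ==> x : carrier (rat_funs V)" by (simp add: sections_iff)

lemma sections_zero: "0\<^sub>F : OV D" by (simp add: sections_iff)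

lemma sections_mult:
	assumes x: "x : OV D" and y: "y : OV E"
	shows "x *\<^sub>F y : OV (D + E)"
proof (cases "x : Kx & y : Kx")
	case True
	thus ?thesis
	proof -
		have "- lkp (D + E) P \<le> ordV P (x *\<^sub>F y)" if P: "P : PD" for P
		proof -
			have "- lkp D P \<le> ordV P x" "- lkp E P \<le> ordV P y" using x y True P by (simp_all add: sections_iff)
			thus ?thesis using ord_mult[OF P, of x y] True by (simp add: lookup_add)
		qed
		thus ?thesis using True by (simp add: sections_iff)
	qed
next
	case False
	thus ?thesis using x y by (auto simp: sections_iff)
qed

lemma sections_div_mult:
	assumes x: "x : OV D" and y: "y : Kx"
	shows "y *\<^sub>F x : OV (D - div_of V y)"
proof (cases "x : Kx")
	case True
	thus ?thesis using x y by (auto simp: sections_iff ord_mult lookup_minus lookup_div)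
next
	case False
	thus ?thesis using x y by (auto simp: sections_iff)
qed

lemma sections_rat: "a : regs V ==> rat a : OV 0"
proof -
	assume a: "a : regs V"
	show ?thesis
	proof (cases "a : nzs")
		case True
		thus ?thesis using a ord_rat_nonneg by (auto simp: sections_iff)
	next
		case False
		hence "a = 0\<^sub>A" using a unfolding FR_nonzero[symmetric] by simp
		hence "rat a = 0\<^sub>F" by simp
		thus ?thesis using sections_zero by simp
	qed
qed

lemma sections_0: "OV 0 = rat ` regs V"
proof (intro equalityI subsetI)
	fix x assume x: "x : OV 0"
	show "x : rat ` regs V"
	proof (cases "x = 0\<^sub>F")
		case True
		thus ?thesis using rat_zero_iff[of "0\<^sub>A"] FR.zero_closed by (intro image_eqI[of _ _ "0\<^sub>A"]) auto
	next
		case False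
		thus ?thesis using x regular_if_no_poles[of x] by (simp add: sections_iff)
	qed
qed (use sections_rat in auto)

lemma local_ring_add:
	assumes D: "D : PD" and x: "x : local_ring V D" and y: "y : local_ring V D"
	shows "x +\<^sub>F y : local_ring V D"
proof -
	obtain a b where a: "a : regs V" "b : regs V - vanishing D" "x = quot_fun V a b"
		using x by (auto simp: local_ring_def vanishing_def)
	obtain c d where c: "c : regs V" "d : regs V - vanishing D" "y = quot_fun V c d"
		using y by (auto simp: local_ring_def vanishing_def)
	have nz: "b : nzs" "d : nzs" using not_vanishing_nonzero[OF prime_divisorD(3)[OF D]] a c by auto
	have "b *\<^sub>A d : regs V - vanishing D" using not_vanishing_mult[OF prime_divisorD(1)[OF D]] a c by simp
	moreover have "a *\<^sub>A d +\<^sub>A c *\<^sub>A b : regs V"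
		using FR.a_closed[OF FR.m_closed[of a d] FR.m_closed[of c b]] a c by simp
	ultimately show ?thesis
		unfolding local_ring_def using quot_add[OF a(1) nz(1) c(1) nz(2)] a(3) c(3) by (auto simp: vanishing_def)
qed

lemma KG_pow:
	fixes n :: int
	assumes D: "D : PD" and x: "x : Kx"
	shows "EX y:Kx. ALL P:PD. ordV P y = n * ordV P x"
proof -
	have nat: "EX y:Kx. ALL P:PD. ordV P y = int k * ordV P x" for k
	proof (induction k)
		case 0
		thus ?case using Kx_one ord_one by (intro bexI[of _ "1\<^sub>F"]) auto
	next
		case (Suc k)
		then obtain y where "y : Kx" "ALL P:PD. ordV P y = int k * ordV P x" by blast
		thus ?case using x Kx_mult[of x y] ord_mult by (intro bexI[of _ "x *\<^sub>F y"]) (auto simp: algebra_simps)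
	qed
	show ?thesis
	proof (cases "n \<ge> 0")
		case True
		thus ?thesis using nat[of "nat n"] by simp
	next
		case False
		obtain y where y: "y : Kx" "ALL P:PD. ordV P y = int (nat (- n)) * ordV P x" using nat by blast
		thus ?thesis using False Kx_inv(1)[OF y(1)] ord_inv[OF _ y(1)] by (intro bexI[of _ "inv\<^sub>F y"]) auto
	qed
qed

lemma sections_add:
	assumes x: "x : OV D" and y: "y : OV D"
	shows "x +\<^sub>F y : OV D"
proof (cases "x : Kx & y : Kx & x +\<^sub>F y : Kx")
	case True
	have "- lkp D P \<le> ordV P (x +\<^sub>F y)" if P: "P : PD" for P
	proof -
		obtain t where t: "t : Kx" "ordV P t = 1" using ord_along_valuation(4)[OF P] by auto
		obtain z where z: "z : Kx" "ALL P':PD. ordV P' z = lkp D P * ordV P' t"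
			using KG_pow[OF P t(1), of "lkp D P"] by auto
		hence z: "z : Kx" "ordV P z = lkp D P" using t(2) P by auto
		have "z *\<^sub>F w : local_ring V P" if w: "w : Kx" "w : OV D" for w
			using ord_along_valuation(2)[OF P Kx_mult[OF z(1) w(1)]] ord_mult[OF P z(1) w(1)] w P z(2)
			by (force simp: sections_iff)
		hence "z *\<^sub>F x +\<^sub>F z *\<^sub>F y : local_ring V P" using local_ring_add[OF P] True x y by simp
		hence "z *\<^sub>F (x +\<^sub>F y) : local_ring V P" using True z by (simp add: K.r_distr)
		hence "0 \<le> ordV P z + ordV P (x +\<^sub>F y)"
			using ord_along_valuation(2)[OF P Kx_mult[OF z(1)]] ord_mult[OF P z(1)] True by auto
		thus ?thesis using z(2) by simp
	qed
	thus ?thesis using True by (simp add: sections_iff)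
next
	case False
	have "x : carrier (rat_funs V)" "y : carrier (rat_funs V)" using x y sections_carrier by auto
	thus ?thesis using False x y sections_zero by auto
qed

lemma sections_smult: "x : OV D ==> c \<odot>\<^bsub>rat_funs V\<^esub> x : OV D"
	using sections_mult[OF sections_rat, of "c \<odot>\<^bsub>A\<^esub> 1\<^sub>A" x D] smult_rat[of x c] sections_carrier[of x D] reg_smult[of "1\<^sub>A" c] FR.one_closed
			by simp

lemma sections_uminus: "x : OV D ==> \<ominus>\<^bsub>rat_funs V\<^esub> x : OV D"
proof -
	assume x: "x : OV D"
	have "\<ominus>\<^bsub>rat_funs V\<^esub> x = rat (\<ominus>\<^bsub>A\<^esub> 1\<^sub>A) *\<^sub>F x" using sections_carrier[OF x] by (simp add: K.l_minus del: A_simps(1))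
	thus ?thesis using sections_mult[OF sections_rat x, of "\<ominus>\<^bsub>A\<^esub> 1\<^sub>A"] FR.a_inv_closed[OF FR.one_closed] by simp
qed

text \<open>Prime avoidance: a function that vanishes along finitely many prime divisors to a given order
	but not along a set \<open>Y\<close> of codimension at most one.\<close>

lemma avoiding_function:
	assumes Y: "Y = points V | Y : PD"
		and PP: "finite PP" "PP \<subseteq> PD" "Y \<notin> PP"
	shows "EX g:regs V - vanishing Y. ALL P:PP. int m \<le> ordV P (rat g)" using PP
proof (induction PP)
	have irrY: "irrc Y" using Y irreducible_points prime_divisorD by auto
	case empty
	thus ?case using not_vanishing_one[OF irrY] by auto
next
	have irrY: "irrc Y" using Y irreducible_points prime_divisorD by auto
	case (insert P PP)
	then obtain g where g: "g : regs V - vanishing Y" "ALL P:PP. int m \<le> ordV P (rat g)" by auto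
	have P: "P : PD" "P ~= Y" using insert by auto
	have "\<not> Y \<subseteq> P"
	proof
		assume "Y \<subseteq> P"
		hence YP: "Y \<subset> P" using P(2) by simp
		hence "Y : PD" using Y prime_divisorD(3)[OF P(1)] by auto
		hence "P = points V" using YP prime_divisorD(1)[OF P(1)] unfolding prime_divisor_iff by blast
		thus False using prime_divisorD(2)[OF P(1)] by simp
	qed
	hence "\<not> vanishing P \<subseteq> vanishing Y"
		using vanishing_subset_iff irreducible_closedD(1)[OF irrY] irreducible_closedD(1)[OF prime_divisorD(1)[OF P(1)]] by simp
	then obtain h where h: "h : vanishing P" "h : regs V - vanishing Y" by (auto simp: vanishing_def)
	have nz: "a : nzs" if "a : regs V - vanishing Y" for a
		using not_vanishing_nonzero[OF irreducible_closedD(3)[OF irrY] that] .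
	have "EX e:regs V - vanishing Y. int k \<le> ordV P (rat e)" for k
	proof (induction k)
		case 0
		thus ?case using ord_rat_nonneg[OF P(1) nz] h(2) by auto
	next
		case (Suc k)
		then obtain e where e: "e : regs V - vanishing Y" "int k \<le> ordV P (rat e)" by blast
		have "ordV P (rat (h *\<^sub>A e)) = ordV P (rat h) + ordV P (rat e)"
			using ord_mult[OF P(1) rat_Kx[OF nz[OF h(2)]] rat_Kx[OF nz[OF e(1)]]] h(2) e(1) by simp
		thus ?case using ord_rat_pos[OF P(1) nz[OF h(2)] h(1)] e(2) not_vanishing_mult[OF irrY h(2) e(1)]
			by (intro bexI[of _ "h *\<^sub>A e"]) auto
	qed
	then obtain e where e: "e : regs V - vanishing Y" "int m \<le> ordV P (rat e)" by blast
	have "ordV Q (rat (e *\<^sub>A g)) = ordV Q (rat e) + ordV Q (rat g)"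
		"0 \<le> ordV Q (rat e)" "0 \<le> ordV Q (rat g)" if "Q : PD" for Q
		using ord_mult[OF that rat_Kx[OF nz[OF e(1)]] rat_Kx[OF nz[OF g(1)]]] g(1) e(1) ord_rat_nonneg[OF that nz] by auto
	moreover have "int m \<le> ordV Q (rat e) | int m \<le> ordV Q (rat g)" if "Q : insert P PP" for Q
		using that e(2) g(2) by auto
	moreover have "Q : PD" if "Q : insert P PP" for Q using that insert.prems by auto
	ultimately have "ALL Q:insert P PP. int m \<le> ordV Q (rat (e *\<^sub>A g))" by smt
	thus ?case using not_vanishing_mult[OF irrY e(1) g(1)] by auto
qed

text \<open>Because \<open>V\<close> is affine, each sheaf \<open>O(D)\<close> is generated in codimension one by global sections.\<close>

lemma section_generating:
	assumes Y: "Y = points V | Y : PD" and D: "D : carrier (weil_divisors V)"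
	obtains f where "f : OV D" "f : Kx" "Y : PD ==> ordV Y f = - lkp D Y"
proof -
	have "EX x0:Kx. Y : PD --> ordV Y x0 = - lkp D Y"
	proof (cases "Y : PD")
		case True
		obtain t where t: "t : Kx" "ordV Y t = 1" using ord_along_valuation(4)[OF True] by auto
		obtain z where "z : Kx" "ALL P':PD. ordV P' z = - lkp D Y * ordV P' t"
			using KG_pow[OF True t(1), of "- lkp D Y"] by auto
		hence "z : Kx" "ordV Y z = - lkp D Y" using t(2) True by simp_all
		thus ?thesis by blast
	qed (use Kx_one in blast)
	then obtain x0 where x0: "x0 : Kx" "Y : PD ==> ordV Y x0 = - lkp D Y" by blast
	define PP where "PP = ({P : PD. ordV P x0 ~= 0} \<union> pkeys D) - {Y}"
	have PP: "finite PP" "PP \<subseteq> PD" "Y \<notin> PP" using finite_ord[OF x0(1)] D by (auto simp: PP_def weil_carrier)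
	define m where "m = nat (\<Sum>P\<in>PP. \<bar>ordV P x0 + lkp D P\<bar>)"
	have m: "\<bar>ordV P x0 + lkp D P\<bar> \<le> int m" if "P : PP" for P
		unfolding m_def using member_le_sum[OF that, of "%P. \<bar>ordV P x0 + lkp D P\<bar>"] PP(1) by simp
	obtain g where g: "g : regs V - vanishing Y" "ALL P:PP. int m \<le> ordV P (rat g)"
		using avoiding_function[OF Y PP] by blast
	have gnz: "g : nzs" using not_vanishing_nonzero[OF _ g(1)] Y prime_divisorD(3) by auto
	define f where "f = rat g *\<^sub>F x0"
	have fK: "f : Kx" unfolding f_def by (rule Kx_mult[OF rat_Kx[OF gnz] x0(1)])
	have ordf: "ordV P f = ordV P (rat g) + ordV P x0" if "P : PD" for P
		unfolding f_def by (rule ord_mult[OF that rat_Kx[OF gnz] x0(1)])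
	have ordY: "ordV Y f = - lkp D Y" if "Y : PD" using ordf[OF that] x0(2)[OF that] ord_rat_zero[OF that g(1)] by simp
	have "- lkp D P \<le> ordV P f" if P: "P : PD" for P
	proof (cases "P = Y")
		case True
		thus ?thesis using ordY P by simp
	next
		case ne: False
		show ?thesis
		proof (cases "P : PP")
			case True
			hence "\<bar>ordV P x0 + lkp D P\<bar> \<le> ordV P (rat g)" using m[OF True] g(2) by auto
			thus ?thesis using ordf[OF P] by simp
		next
			case False
			hence "ordV P x0 = 0" "lkp D P = 0" using ne P by (auto simp: PP_def in_keys_iff)
			thus ?thesis using ordf[OF P] ord_rat_nonneg[OF P gnz] by simp
		qed
	qed
	hence "f : OV D" using fK by (simp add: sections_iff)
	thus ?thesis using that fK ordY by simp
qed

lemma sections_nonzero: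
	assumes "D : carrier (weil_divisors V)"
	obtains f where "f : OV D" "f : Kx" using section_generating[OF _ assms, of "points V"] by auto

lemma complementary_sections:
	assumes Y: "Y = points V | Y : PD" and D: "D : carrier (weil_divisors V)"
	obtains f f' g where "f : OV D" "f' : OV (- D)"
		"g : regs V - vanishing Y" "f *\<^sub>F f' = rat g"
proof -
	obtain f where f: "f : OV D" "f : Kx" "Y : PD ==> ordV Y f = - lkp D Y" using section_generating[OF Y D] by auto
	obtain f' where f': "f' : OV (- D)" "f' : Kx" "Y : PD ==> ordV Y f' = lkp D Y"
		using section_generating[OF Y weil_uminus[OF D]] by auto
	have "f *\<^sub>F f' : OV 0" using sections_mult[OF f(1) f'(1)] by simp
	then obtain g where g: "g : regs V" "f *\<^sub>F f' = rat g" unfolding sections_0 by blast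
	have "rat g : Kx" using Kx_mult[OF f(2) f'(2)] g by simp
	hence gnz: "g : nzs" using g(1) rat_zero_iff[OF g(1)] unfolding FR_nonzero[symmetric] by auto
	have "g \<notin> vanishing Y" using Y
	proof
		assume "Y = points V"
		thus ?thesis using gnz by (auto simp: nzs_def vanishing_def)
	next
		assume YP: "Y : PD"
		have "ordV Y (rat g) = 0" using ord_mult[OF YP f(2) f'(2)] f(3)[OF YP] f'(3)[OF YP] g(2) by simp
		thus ?thesis using ord_rat_pos[OF YP gnz] by auto
	qed
	thus ?thesis using that f f' g by simp
qed

text \<open>At every prime divisor the sections of \<open>D\<close> and of \<open>- D\<close> attain the smallest possible orders, which
	bounds the order of \<open>w\<close> from both sides.\<close>

lemma divisor_of_generator:
	assumes D: "D : carrier (weil_divisors V)" and w: "w : Kx"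
		and pos: "!!f. f : OV D ==> f *\<^sub>F w : rat ` regs V"
		and neg: "!!f. f : OV (- D) ==> f *\<^sub>F inv\<^sub>F w : rat ` regs V"
	shows "div_of V w = D"
proof (rule poly_mapping_eqI)
	fix P
	have ge: "lkp E P \<le> ordV P z"
		if P: "P : PD" and E: "E : carrier (weil_divisors V)" and z: "z : Kx"
			"!!f. f : OV E ==> f *\<^sub>F z : rat ` regs V" for E z
	proof -
		obtain f where f: "f : OV E" "f : Kx" "ordV P f = - lkp E P" using section_generating[OF _ E, of P] P by auto
		have "f *\<^sub>F z : OV 0" using z(2)[OF f(1)] sections_0 by simp
		moreover have "f *\<^sub>F z ~= 0\<^sub>F" using Kx_mult[OF f(2) z(1)] by simp
		ultimately have "0 \<le> ordV P (f *\<^sub>F z)" using P by (auto simp: sections_iff)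
		thus ?thesis using ord_mult[OF P f(2) z(1)] f(3) by simp
	qed
	show "lkp (div_of V w) P = lkp D P"
	proof (cases "P : PD")
		case True
		thus ?thesis using ge[OF True D w pos] ge[OF True weil_uminus[OF D] Kx_inv(1)[OF w] neg] ord_inv[OF True w]
			by (simp add: lookup_div[OF w])
	next
		case False
		thus ?thesis using D by (auto simp: lookup_div[OF w] weil_carrier in_keys_iff)
	qed
qed

end

section \<open>Complements of divisible subgroups\<close>

text \<open>Divisible groups are injective. In the form used here: a subgroup that meets a divisible
	subgroup \<open>C\<close> trivially is contained in a complement of \<open>C\<close>.\<close>

lemma (in comm_group) divisible_complement:
	assumes C: "subgroup C G" and div: "!!c n. c : C ==> 0 < (n::nat) ==> EX d:C. d [^] n = c"
		and S: "subgroup S G" "S \<inter> C = {\<one>}"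
	obtains T where "subgroup T G" "S \<subseteq> T" "T \<inter> C = {\<one>}" "!!e. e : carrier G ==> EX t:T. EX c:C. e = t \<otimes> c"
proof -
	define \<A> where "\<A> = {T. subgroup T G & S \<subseteq> T & T \<inter> C = {\<one>}}"
	have "\<A> ~= {}" using S by (auto simp: \<A>_def)
	moreover have "\<Union>\<C> : \<A>" if ch: "\<C> ~= {}" "subset.chain \<A> \<C>" for \<C>
	proof -
		have mem: "!!T. T : \<C> ==> subgroup T G & S \<subseteq> T & T \<inter> C = {\<one>}"
			and lin: "!!T T'. T : \<C> ==> T' : \<C> ==> T \<subseteq> T' | T' \<subseteq> T" using ch(2) by (auto simp: subset_chain_def \<A>_def)
		have "subgroup (\<Union>\<C>) G"
		proof (rule subgroupI)
			show "\<Union>\<C> \<subseteq> carrier G" "\<Union>\<C> ~= {}" using mem ch(1) subgroup.subset subgroup.one_closed by blast+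
			fix a assume "a : \<Union>\<C>"
			then obtain T where T: "T : \<C>" "a : T" by blast
			hence "inv a : T" using mem[OF T(1)] subgroup.m_inv_closed[of T G a] by simp
			thus "inv a : \<Union>\<C>" using T(1) by auto
			fix b assume "b : \<Union>\<C>"
			then obtain T' where T': "T' : \<C>" "b : T'" by blast
			show "a \<otimes> b : \<Union>\<C>" using lin[OF T(1) T'(1)]
			proof
				assume "T \<subseteq> T'"
				thus ?thesis using T T' mem[OF T'(1)] subgroup.m_closed[of T' G a b] by auto
			next
				assume "T' \<subseteq> T"
				thus ?thesis using T T' mem[OF T(1)] subgroup.m_closed[of T G a b] by auto
			qed
		qed
		thus ?thesis using mem ch(1) by (auto simp: \<A>_def)
	qed
	ultimately obtain T where T: "T : \<A>" "!!T'. T' : \<A> ==> T \<subseteq> T' ==> T' = T" using subset_Zorn_nonempty[of \<A>] by auto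
	have subT: "subgroup T G" and ST: "S \<subseteq> T" and TC: "T \<inter> C = {\<one>}" using T(1) by (auto simp: \<A>_def)
	interpret T: subgroup T G by (rule subT)
	interpret C: subgroup C G by (rule C)
	define TC where "TC = {t \<otimes> c | t c. t : T & c : C}"
	have TC_I: "t \<otimes> c : TC" if "t : T" "c : C" for t c using that by (auto simp: TC_def)
	have TC_car: "x : carrier G" if "x : TC" for x using that by (auto simp: TC_def)
	have TC_mult: "x \<otimes> y : TC" if xy: "x : TC" "y : TC" for x y
	proof -
		obtain t c t' c' where "t : T" "c : C" "x = t \<otimes> c" "t' : T" "c' : C" "y = t' \<otimes> c'"
			using xy unfolding TC_def by blast
		hence "x \<otimes> y = (t \<otimes> t') \<otimes> (c \<otimes> c')" "t \<otimes> t' : T" "c \<otimes> c' : C" by (auto simp: m_ac)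
		thus ?thesis using TC_I by simp
	qed
	have TC_inv: "inv x : TC" if x: "x : TC" for x
	proof -
		obtain t c where "t : T" "c : C" "x = t \<otimes> c" using x unfolding TC_def by blast
		hence "inv x = inv t \<otimes> inv c" "inv t : T" "inv c : C" by (auto simp: inv_mult)
		thus ?thesis using TC_I by simp
	qed
	have T_TC: "T \<subseteq> TC"
	proof
		fix t assume "t : T"
		thus "t : TC" using TC_I[of t \<one>] by simp
	qed
	have C_TC: "C \<subseteq> TC"
	proof
		fix c assume "c : C"
		thus "c : TC" using TC_I[of \<one> c] by simp
	qed
	have TC_pow: "x [^] n : TC" if "x : TC" for x and n :: int
	proof -
		have nat: "x [^] k : TC" for k :: nat using that T_TC T.one_closed TC_mult by (induction k) auto
		thus ?thesis unfolding int_pow_def2 using TC_inv by (auto simp del: pow_nat)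
	qed
	have "e : TC" if e: "e : carrier G" for e
	proof (rule ccontr)
		assume eTC: "e \<notin> TC"
		obtain e' where e': "e' : carrier G" "e' \<notin> TC" "!!n::int. e' [^] n : TC ==> e' [^] n : T"
		proof (cases "\<exists>k::nat. 0 < k & e [^] k : TC")
			case False
			have "n = 0" if n: "e [^] n : TC" for n :: int
			proof (rule ccontr)
				assume "n ~= 0"
				have "e [^] \<bar>n\<bar> : TC" using n TC_inv[OF n] int_pow_neg[OF e, of n] by (cases "n \<ge> 0") auto
				hence "e [^] nat \<bar>n\<bar> : TC" by simp
				moreover have "0 < nat \<bar>n\<bar>" using \<open>n ~= 0\<close> by simp
				ultimately show False using False by blast
			qed
			hence "e [^] n : T" if "e [^] n : TC" for n :: int using that T.one_closed int_pow_0[of G e] by metis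
			thus ?thesis using that e eTC by simp
		next
			case True
			define k where "k = (LEAST k::nat. 0 < k & e [^] k : TC)"
			have k: "0 < k" "e [^] k : TC" using LeastI_ex[OF True] by (auto simp: k_def)
			have least: "\<not> (0 < j & e [^] j : TC)" if "j < k" for j :: nat
				using not_less_Least[of j "%k. 0 < k & e [^] k : TC"] that by (simp add: k_def)
			obtain t c where tc: "t : T" "c : C" "e [^] k = t \<otimes> c" using k(2) unfolding TC_def by blast
			obtain d where d: "d : C" "d [^] k = c" using div[OF tc(2) k(1)] by auto
			define f where "f = e \<otimes> inv d"
			have fG: "f : carrier G" and dG: "d : carrier G" using e d by (auto simp: f_def)
			have "f [^] k = e [^] k \<otimes> inv (d [^] k)" unfolding f_def using e dG by (simp add: nat_pow_distrib nat_pow_inv)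
			also have "\<dots> = t" using tc d by (simp add: m_assoc)
			finally have fk: "f [^] k = t" .
			have "f \<otimes> d = e" using e dG by (simp add: f_def m_assoc)
			hence fTC: "f \<notin> TC" using eTC TC_mult[of f d] C_TC d(1) by auto
			have "f [^] n : T" if n: "f [^] n : TC" for n :: int
			proof -
				have "e [^] n = f [^] n \<otimes> d [^] n" using \<open>f \<otimes> d = e\<close> int_pow_distrib[OF fG dG, of n] by simp
				hence en: "e [^] n : TC" using TC_mult[OF n TC_pow[of d n]] C_TC d(1) by auto
				have "e [^] n = e [^] (int k * (n div int k)) \<otimes> e [^] (n mod int k)"
					using int_pow_mult[OF e, of "int k * (n div int k)" "n mod int k"] by simp
				moreover have "e [^] (int k * (n div int k)) : TC"
					using TC_pow[OF k(2), of "n div int k"] int_pow_pow[OF e, of "int k" "n div int k"]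
			by (simp add: int_pow_int mult.commute)
				ultimately have "e [^] (n mod int k) = inv (e [^] (int k * (n div int k))) \<otimes> e [^] n"
					using e by (simp add: m_assoc[symmetric])
				hence "e [^] (n mod int k) : TC" using TC_mult[OF TC_inv[OF \<open>e [^] (int k * (n div int k)) : TC\<close>] en] by simp
				hence mem: "e [^] nat (n mod int k) : TC" using k(1) by simp
				have "nat (n mod int k) < k" using k(1) by (simp add: nat_less_iff)
				from least[OF this] mem have "\<not> 0 < nat (n mod int k)" by simp
				hence "n mod int k = 0" using k(1) pos_mod_sign[of "int k" n] by linarith
				hence "n = int k * (n div int k)" by auto
				hence "f [^] n = t [^] (n div int k)"
					using int_pow_pow[OF fG, of "int k" "n div int k"] fk by (simp add: int_pow_int mult.commute)
				thus ?thesis using subgroup_int_pow_closed[OF subT tc(1)] by simp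
			qed
			thus ?thesis using that fG fTC by simp
		qed
		define T' where "T' = {t \<otimes> e' [^] n | t n. t : T & n : (UNIV :: int set)}"
		have T'I: "t \<otimes> e' [^] n : T'" if "t : T" for t and n :: int using that by (auto simp: T'_def)
		have "subgroup T' G"
		proof (rule subgroupI)
			show "T' \<subseteq> carrier G" using e'(1) by (auto simp: T'_def)
			show "T' ~= {}" using T'I[OF T.one_closed, of 0] by auto
			fix a assume "a : T'"
			then obtain t and n :: int where a: "t : T" "a = t \<otimes> e' [^] n" by (auto simp: T'_def)
			have "inv a = inv t \<otimes> e' [^] (- n)" using a e' by (simp add: inv_mult int_pow_neg)
			thus "inv a : T'" using T'I[of "inv t" "- n"] a by simp
			fix b assume "b : T'"
			then obtain s and m :: int where b: "s : T" "b = s \<otimes> e' [^] m" by (auto simp: T'_def)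
			have "a \<otimes> b = (t \<otimes> s) \<otimes> e' [^] (n + m)" using a b e' by (simp add: int_pow_mult m_ac)
			thus "a \<otimes> b : T'" using T'I[of "t \<otimes> s" "n + m"] a b by simp
		qed
		moreover have TT': "T \<subseteq> T'" using T'I[of _ 0] by auto
		moreover have "x = \<one>" if x: "x : T'" "x : C" for x
		proof -
			obtain t and n :: int where a: "t : T" "x = t \<otimes> e' [^] n" using x(1) by (auto simp: T'_def)
			have "e' [^] n = inv t \<otimes> x" using a e' by (simp add: m_assoc[symmetric])
			hence "e' [^] n : TC" using TC_I[of "inv t" x] a(1) x(2) by simp
			hence "e' [^] n : T" by (rule e'(3))
			hence "x : T" using a by simp
			thus ?thesis using TC x(2) by auto
		qed
		ultimately have "T' : \<A>" using ST by (auto simp: \<A>_def)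
		hence "T' = T" using T(2) TT' by simp
		moreover have "e' : T'" using T'I[of \<one> 1] e' by simp
		ultimately show False using T_TC e'(2) by auto
	qed
	thus ?thesis using that[OF subT ST TC] unfolding TC_def by blast
qed

definition multiplicative :: "('a, 'm) monoid_scheme => ('a => 'k::field) => bool" where
	"multiplicative G chi \<longleftrightarrow> (ALL x:carrier G. chi x ~= 0) & (ALL x:carrier G. ALL y:carrier G. chi (x \<otimes>\<^bsub>G\<^esub> y) = chi x * chi y)"

definition Kstar :: "'k::field monoid" where
	"Kstar = \<lparr>carrier = {c. c ~= 0}, monoid.mult = (*), one = 1\<rparr>"

lemma comm_group_Kstar: "comm_group Kstar" by (rule comm_groupI) (auto simp: Kstar_def intro!: exI[of _ "inverse _"])

lemma Kstar_pow: "x [^]\<^bsub>Kstar\<^esub> n = x ^ n" for n :: nat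
	by (induction n) (auto simp: Kstar_def nat_pow_def mult.commute)

lemma DirProd_comm_group:
	assumes "comm_group G" "comm_group H"
	shows "comm_group (G \<times>\<times> H)"
proof -
	interpret G: comm_group G by (rule assms(1))
	interpret H: comm_group H by (rule assms(2))
	interpret GH: group "G \<times>\<times> H" by (rule DirProd_group[OF G.is_group H.is_group])
	show ?thesis by (rule GH.group_comm_groupI) (auto simp: G.m_comm H.m_comm)
qed

lemma DirProd_pow: "(x, y) [^]\<^bsub>G \<times>\<times> H\<^esub> n = (x [^]\<^bsub>G\<^esub> n, y [^]\<^bsub>H\<^esub> n)" for n :: nat
	by (induction n) (auto simp: nat_pow_def)

lemma multiplicative_one:
	assumes "group G" "multiplicative G chi"
	shows "chi \<one>\<^bsub>G\<^esub> = 1"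
proof -
	interpret group G by (rule assms(1))
	have "chi \<one>\<^bsub>G\<^esub> * chi \<one>\<^bsub>G\<^esub> = chi \<one>\<^bsub>G\<^esub> * 1" "chi \<one>\<^bsub>G\<^esub> ~= 0"
		using assms(2) unfolding multiplicative_def by (metis one_closed l_one mult_1_right)+
	thus ?thesis by simp
qed

text \<open>The nonzero constants form a divisible group, hence a complement of it that contains the graph of the
	given function is the graph of an extension.\<close>

lemma extend_multiplicative:
	fixes b :: "'i => 'k::alg_closed_field"
	assumes G: "comm_group G" and I: "comm_group I" and a: "a : hom I G" and b: "multiplicative I b"
		and ker: "!!i. i : carrier I ==> a i = \<one>\<^bsub>G\<^esub> ==> b i = 1"
	obtains theta where "multiplicative G theta" "!!i. i : carrier I ==> theta (a i) = b i"
proof -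
	interpret G: comm_group G by (rule G)
	interpret I: comm_group I by (rule I)
	interpret U: comm_group "Kstar :: 'k monoid" by (rule comm_group_Kstar)
	interpret E: comm_group "G \<times>\<times> (Kstar :: 'k monoid)" by (rule DirProd_comm_group[OF G comm_group_Kstar])
	have K: "carrier Kstar = {c::'k. c ~= 0}" "c \<otimes>\<^bsub>Kstar\<^esub> d = c * d" "\<one>\<^bsub>Kstar\<^esub> = (1::'k)" for c d :: 'k
		by (auto simp: Kstar_def)
	have aG: "a i : carrier G" if "i : carrier I" for i using a that by (auto simp: hom_def)
	have am: "a (i \<otimes>\<^bsub>I\<^esub> j) = a i \<otimes>\<^bsub>G\<^esub> a j" if "i : carrier I" "j : carrier I" for i j
		using a that by (auto simp: hom_def)
	have bm: "b (i \<otimes>\<^bsub>I\<^esub> j) = b i * b j" if "i : carrier I" "j : carrier I" for i j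
		using b that by (auto simp: multiplicative_def)
	have b0: "b i ~= 0" if "i : carrier I" for i using b that by (auto simp: multiplicative_def)
	have s: "(%i. (a i, b i)) : hom I (G \<times>\<times> Kstar)" by (rule homI) (auto simp: K aG am bm b0)
	interpret s: group_hom I "G \<times>\<times> (Kstar :: 'k monoid)" "%i. (a i, b i)"
		using s by (intro group_hom.intro group_hom_axioms.intro I.is_group E.is_group)
	define S where "S = (%i. (a i, b i)) ` carrier I"
	define C where "C = {\<one>\<^bsub>G\<^esub>} \<times> {c::'k. c ~= 0}"
	have subS: "subgroup S (G \<times>\<times> Kstar)" unfolding S_def by (rule s.img_is_subgroup)
	have subC: "subgroup C (G \<times>\<times> Kstar)"
		using DirProd_subgroups[OF G.is_group G.triv_subgroup U.is_group U.subgroup_self] by (simp add: C_def K)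
	have div: "EX d:C. d [^]\<^bsub>G \<times>\<times> Kstar\<^esub> n = c" if c: "c : C" "0 < n" for c and n :: nat
	proof -
		obtain z where z: "c = (\<one>\<^bsub>G\<^esub>, z)" "z ~= 0" using c(1) by (auto simp: C_def)
		obtain y where y: "y ^ n = z" using nth_root_exists[OF c(2), of z] by auto
		have "y ~= 0" using y z(2) c(2) by auto
		hence "(\<one>\<^bsub>G\<^esub>, y) : C" by (simp add: C_def)
		moreover have "(\<one>\<^bsub>G\<^esub>, y) [^]\<^bsub>G \<times>\<times> Kstar\<^esub> n = c" using y by (simp add: z(1) DirProd_pow Kstar_pow)
		ultimately show ?thesis by blast
	qed
	have SC: "S \<inter> C = {\<one>\<^bsub>G \<times>\<times> Kstar\<^esub>}"
	proof (intro equalityI subsetI)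
		fix x assume "x : S \<inter> C"
		then obtain i where "i : carrier I" "x = (a i, b i)" "a i = \<one>\<^bsub>G\<^esub>" by (auto simp: S_def C_def)
		thus "x : {\<one>\<^bsub>G \<times>\<times> Kstar\<^esub>}" using ker by (simp add: K)
	qed (use subgroup.one_closed[OF subS] subgroup.one_closed[OF subC] in auto)
	obtain T where T: "subgroup T (G \<times>\<times> Kstar)" "S \<subseteq> T" "T \<inter> C = {\<one>\<^bsub>G \<times>\<times> Kstar\<^esub>}"
		"!!e. e : carrier (G \<times>\<times> Kstar) ==> EX t:T. EX c:C. e = t \<otimes>\<^bsub>G \<times>\<times> Kstar\<^esub> c"
		using E.divisible_complement[OF subC div subS SC] by auto
	have exT: "EX y. (x, y) : T" if x: "x : carrier G" for x
	proof -
		have "(x, 1) : carrier (G \<times>\<times> (Kstar::'k monoid))" using x by (simp add: K)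
		then obtain t c where tc: "t : T" "c : C" "(x, 1) = t \<otimes>\<^bsub>G \<times>\<times> Kstar\<^esub> c" using T(4) by blast
		have "t : carrier (G \<times>\<times> (Kstar::'k monoid))" using tc(1) subgroup.subset[OF T(1)] by auto
		hence "fst t = x" using tc by (auto simp: C_def mult_DirProd')
		thus ?thesis using tc(1) by (metis prod.collapse)
	qed
	have uniq: "y = y'" if "(x, y) : T" "(x, y') : T" for x y y'
	proof -
		have car: "x : carrier G" "y ~= 0" "y' ~= 0" using that subgroup.subset[OF T(1)] by (auto simp: K)
		have "(x, y) \<otimes>\<^bsub>G \<times>\<times> Kstar\<^esub> inv\<^bsub>G \<times>\<times> Kstar\<^esub> (x, y') : T"
			using that T(1) by (intro subgroup.m_closed subgroup.m_inv_closed)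
		moreover have "inv\<^bsub>G \<times>\<times> Kstar\<^esub> (x, y') = (inv\<^bsub>G\<^esub> x, inv\<^bsub>Kstar\<^esub> y')"
			using car by (intro inv_DirProd G.is_group U.is_group) (auto simp: K)
		moreover have "inv\<^bsub>Kstar\<^esub> y' = inverse y'" using car by (intro U.inv_equality) (auto simp: K)
		ultimately have "(\<one>\<^bsub>G\<^esub>, y * inverse y') : T" using car by (simp add: K)
		moreover have "(\<one>\<^bsub>G\<^esub>, y * inverse y') : C" using car by (simp add: C_def)
		ultimately have "y * inverse y' = 1" using T(3) by (auto simp: K)
		thus ?thesis by (simp add: field_simps)
	qed
	define theta where "theta x = (THE y. (x, y) : T)" for x
	have theta: "(x, theta x) : T" if "x : carrier G" for x
		unfolding theta_def using exT[OF that] uniq by (intro theI'[of "%y. (x, y) : T"]) blast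
	have theta_eq: "theta x = y" if "(x, y) : T" for x y using theta[of x] uniq that subgroup.subset[OF T(1)] by auto
	have "multiplicative G theta" unfolding multiplicative_def
	proof (intro conjI ballI)
		fix x assume x: "x : carrier G"
		show "theta x ~= 0" using theta[OF x] subgroup.subset[OF T(1)] by (auto simp: K)
		fix y assume y: "y : carrier G"
		show "theta (x \<otimes>\<^bsub>G\<^esub> y) = theta x * theta y"
			using subgroup.m_closed[OF T(1) theta[OF x] theta[OF y]] by (intro theta_eq) (simp add: K)
	qed
	moreover have "theta (a i) = b i" if "i : carrier I" for i using that T(2) by (intro theta_eq) (auto simp: S_def)
	ultimately show ?thesis using that by simp
qed

section \<open>Linear combinations of multiplicative functions\<close>

definition combination :: "('k::field \<times> ('a => 'k)) list => 'a => 'k" where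
	"combination xs g = (\<Sum>(c, chi)\<leftarrow>xs. c * chi g)"

lemma combination_simps [simp]:
	"combination [] g = 0" "combination ((c, chi) # xs) g = c * chi g + combination xs g"
	"combination (xs @ ys) g = combination xs g + combination ys g" by (auto simp: combination_def)

lemma combination_scale: "combination (map (%(c, chi). (d * c, chi)) xs) g = d * combination xs g"
	by (induction xs) (auto simp: algebra_simps)

lemma combination_product:
	assumes "!!chi psi. chi : snd ` set xs ==> psi : snd ` set ys ==> F (m chi psi) = F1 chi * F2 psi"
	shows "(\<Sum>(c, chi)\<leftarrow>concat (map (%(c, chi). map (%(d, psi). (c * d, m chi psi)) ys) xs). c * F chi) =
		(\<Sum>(c, chi)\<leftarrow>xs. c * F1 chi) * ((\<Sum>(c, chi)\<leftarrow>ys. c * F2 chi) :: 'k::field)" using assms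
proof (induction xs)
	case (Cons x xs)
	obtain c chi where x: "x = (c, chi)" by (cases x)
	note m = Cons.prems
	have "(\<Sum>(e, rho)\<leftarrow>map (%(d, psi). (c * d, m chi psi)) zs. e * F rho) = c * F1 chi * (\<Sum>(d, psi)\<leftarrow>zs. d * F2 psi)"
		if "set zs \<subseteq> set ys" for zs using that
	proof (induction zs)
		case (Cons z zs)
		thus ?case
		proof -
			have "F (m chi (snd z)) = F1 chi * F2 (snd z)" using Cons(2) by (intro m) (auto simp: x)
			thus ?thesis using Cons by (cases z) (simp add: algebra_simps)
		qed
	qed simp
	from this[of ys] show ?case using Cons by (simp add: x algebra_simps)
qed simp

text \<open>Linear combinations, compared on the set \<open>A\<close> only.\<close>

definition span_on :: "'a set => ('a => 'k::field) set => ('a => 'k) set" where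
	"span_on A B = {f. EX xs. snd ` set xs \<subseteq> B & (ALL g:A. f g = combination xs g)}"

lemma span_onI: "snd ` set xs \<subseteq> B ==> (!!g. g : A ==> f g = combination xs g) ==> f : span_on A B"
	by (auto simp: span_on_def)

lemma span_on_base: "f : B ==> f : span_on A B" by (rule span_onI[of "[(1, f)]"]) auto

lemma span_on_cong: "f : span_on A B ==> (!!g. g : A ==> f' g = f g) ==> f' : span_on A B" by (auto simp: span_on_def)

lemma span_on_add:
	assumes "f : span_on A B" "h : span_on A B"
	shows "(%g. f g + h g) : span_on A B"
proof -
	obtain xs ys where "snd ` set xs \<subseteq> B" "ALL g:A. f g = combination xs g"
		"snd ` set ys \<subseteq> B" "ALL g:A. h g = combination ys g" using assms by (auto simp: span_on_def)
	thus ?thesis by (intro span_onI[of "xs @ ys"]) (simp_all add: image_Un)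
qed

lemma span_on_scale:
	assumes "f : span_on A B"
	shows "(%g. c * f g) : span_on A B"
proof -
	obtain xs where "snd ` set xs \<subseteq> B" "ALL g:A. f g = combination xs g" using assms by (auto simp: span_on_def)
	thus ?thesis by (intro span_onI[of "map (%(d, chi). (c * d, chi)) xs"]) (auto simp: combination_scale)
qed

lemma span_on_zero: "(%g. 0) : span_on A B" by (rule span_onI[of "[]"]) auto

lemma span_on_sum: "(!!i. i : I ==> f i : span_on A B) ==> (%g. \<Sum>i\<in>I. f i g) : span_on A B"
	by (induction I rule: infinite_finite_induct) (auto intro: span_on_zero span_on_add)

lemma span_on_mult:
	assumes f: "f : span_on A B" and h: "h : span_on A B'"
		and m: "!!chi psi. chi : B ==> psi : B' ==> EX rho:B''. ALL g:A. rho g = chi g * psi g"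
	shows "(%g. f g * h g) : span_on A B''"
proof -
	obtain xs ys where x: "snd ` set xs \<subseteq> B" "ALL g:A. f g = combination xs g"
		and y: "snd ` set ys \<subseteq> B'" "ALL g:A. h g = combination ys g" using f h by (auto simp: span_on_def)
	define p where "p chi psi = (SOME rho. rho : B'' & (ALL g:A. rho g = chi g * psi g))" for chi psi
	have p: "p chi psi : B''" "!!g. g : A ==> p chi psi g = chi g * psi g" if "chi : B" "psi : B'" for chi psi
		using someI_ex[of "%rho. rho : B'' & (ALL g:A. rho g = chi g * psi g)"] m[OF that] by (auto simp: p_def)
	let ?zs = "concat (map (%(c, chi). map (%(d, psi). (c * d, p chi psi)) ys) xs)"
	show ?thesis
	proof (rule span_onI)
		show "snd ` set ?zs \<subseteq> B''" using x(1) y(1) p(1) by force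
		fix g assume g: "g : A"
		have "combination ?zs g = combination xs g * combination ys g" unfolding combination_def using x(1) y(1) p(2) g
			by (intro combination_product[where F = "%chi. chi g"]) blast
		thus "f g * h g = combination ?zs g" using x y g by simp
	qed
qed

fun coefficient :: "('k::field \<times> ('a => 'k)) list => ('a => 'k) => 'k" where
	"coefficient [] chi = 0"
| "coefficient ((c, psi) # xs) chi = (if psi = chi then c else 0) + coefficient xs chi"

lemma combination_collect:
	assumes "finite B" "snd ` set xs \<subseteq> B"
	shows "(\<Sum>(c, chi)\<leftarrow>xs. c * F chi) = (\<Sum>chi\<in>B. coefficient xs chi * F chi)" using assms(2)
proof (induction xs)
	case (Cons x xs)
	obtain c psi where x: "x = (c, psi)" by (cases x)
	have "(\<Sum>chi\<in>B. (if psi = chi then c else 0) * F chi) = c * F psi"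
		using assms(1) Cons.prems x by (simp add: if_distrib[of "%c. c * _"] sum.delta cong: if_cong)
	thus ?case using Cons by (simp add: x distrib_right sum.distrib)
qed simp

text \<open>Dedekind: distinct multiplicative functions are linearly independent.\<close>

lemma multiplicative_independent:
	fixes c :: "('a => 'k::field) => 'k"
	assumes G: "group G" and B: "finite B" "!!chi. chi : B ==> multiplicative G chi"
		and distinct: "!!chi psi. chi : B ==> psi : B ==> (!!g. g : carrier G ==> chi g = psi g) ==> chi = psi"
		and zero: "!!g. g : carrier G ==> (\<Sum>chi\<in>B. c chi * chi g) = 0"
	shows "chi : B ==> c chi = 0" using B distinct zero
proof (induction B arbitrary: c chi)
	case (insert psi B)
	interpret group G by (rule G)
	have m: "rho (h \<otimes>\<^bsub>G\<^esub> g) = rho h * rho g" if "rho : insert psi B" "h : carrier G" "g : carrier G" for rho h g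
		using insert.prems(2)[OF that(1)] that by (auto simp: multiplicative_def)
	have B0: "c rho = 0" if rho: "rho : B" for rho
	proof -
		have "rho ~= psi" using rho insert.hyps by auto
		then obtain h where h: "h : carrier G" "rho h ~= psi h" using insert.prems(3)[of rho psi] rho by auto
		have "(\<Sum>chi\<in>B. c chi * (chi h - psi h) * chi g) = 0" if g: "g : carrier G" for g
		proof -
			have "c psi * psi (h \<otimes>\<^bsub>G\<^esub> g) + (\<Sum>chi\<in>B. c chi * chi (h \<otimes>\<^bsub>G\<^esub> g)) = 0"
				using insert.prems(4)[of "h \<otimes>\<^bsub>G\<^esub> g"] h(1) g insert.hyps by simp
			moreover have "(\<Sum>chi\<in>B. c chi * chi (h \<otimes>\<^bsub>G\<^esub> g)) = (\<Sum>chi\<in>B. c chi * chi h * chi g)"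
				using m h(1) g by (intro sum.cong) auto
			moreover have "c psi * psi g + (\<Sum>chi\<in>B. c chi * chi g) = 0" using insert.prems(4)[OF g] insert.hyps by simp
			ultimately have "(\<Sum>chi\<in>B. c chi * chi h * chi g) = - (c psi * (psi h * psi g))" "(\<Sum>chi\<in>B. c chi * chi g) = - (c psi * psi g)"
				using m[of psi h g] h(1) g by (simp_all add: eq_neg_iff_add_eq_0 add.commute)
			hence "(\<Sum>chi\<in>B. c chi * chi h * chi g) - psi h * (\<Sum>chi\<in>B. c chi * chi g) = 0" by simp
			thus ?thesis by (simp add: sum_distrib_left sum_subtractf[symmetric] algebra_simps)
		qed
		hence "c rho * (rho h - psi h) = 0"
			using insert.IH[of rho "%chi. c chi * (chi h - psi h)"] rho insert.prems by auto
		thus ?thesis using h(2) by simp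
	qed
	have "c psi * psi \<one>\<^bsub>G\<^esub> = 0" using insert.prems(4)[of "\<one>\<^bsub>G\<^esub>"] insert.hyps B0 by simp
	moreover have "psi \<one>\<^bsub>G\<^esub> ~= 0" using insert.prems(2)[of psi] by (auto simp: multiplicative_def)
	ultimately have "c psi = 0" by simp
	thus ?case using insert.prems(1) B0 by auto
qed simp

section \<open>Quasitori\<close>

lemma root_of_unity_exists:
	assumes "n > 1"
	shows "\<exists>zeta::'k::{alg_closed_field, field_char_0}. zeta ^ n = 1 & zeta ~= 1"
proof -
	define p :: "'k poly" where "p = (\<Sum>i<n. monom 1 i)"
	have "coeff p (n - 1) = 1" using assms by (simp add: p_def coeff_sum if_distrib sum.delta cong: if_cong)
	hence "n - 1 \<le> degree p" by (intro le_degree) simp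
	then obtain zeta where z: "poly p zeta = 0"
		using alg_closed_imp_poly_has_root[of p] assms by (metis zero_less_diff less_le_trans)
	have s: "(\<Sum>i<n. zeta ^ i) = 0" using z by (simp add: p_def poly_sum poly_monom)
	hence "zeta ~= 1" using assms by auto
	moreover have "zeta ^ n = 1" using s power_diff_1_eq[of zeta n] by simp
	ultimately show ?thesis by blast
qed

lemma finite_group_separating:
	assumes F: "comm_group F" "finite (carrier F)" and f: "f : carrier F" "f ~= \<one>\<^bsub>F\<^esub>"
	obtains psi :: "'f => 'k::{alg_closed_field, field_char_0}" where "multiplicative F psi" "psi f ~= 1"
proof -
	interpret F: comm_group F by (rule F(1))
	define n where "n = F.ord f"
	have n: "n > 1" using F.ord_ge_1[OF F(2) f(1)] F.ord_eq_1[OF f(1)] f(2) by (simp add: n_def)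
	obtain zeta :: 'k where z: "zeta ^ n = 1" "zeta ~= 1" using root_of_unity_exists[OF n] by auto
	have z0: "zeta ~= 0" using z(1) n by (auto simp: power_0_left)
	have I: "comm_group integer_group"
		by (rule group.group_comm_groupI[OF group_integer_group]) (auto simp: integer_group_def)
	obtain psi where "multiplicative F psi" "!!i. i : carrier integer_group ==> psi (f [^]\<^bsub>F\<^esub> i) = zeta powi i"
	proof (rule extend_multiplicative[OF F(1) I, of "%i. f [^]\<^bsub>F\<^esub> (i::int)" "%i. zeta powi i"])
		show "(%i. f [^]\<^bsub>F\<^esub> (i::int)) : hom integer_group F"
			using f(1) by (intro homI) (auto simp: integer_group_def F.int_pow_mult)
		show "multiplicative integer_group (%i. zeta powi i)"
			using z0 by (auto simp: multiplicative_def integer_group_def power_int_add)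
		fix i :: int assume "f [^]\<^bsub>F\<^esub> i = \<one>\<^bsub>F\<^esub>"
		hence "int n dvd i" using F.int_pow_eq_id[OF f(1), of i] by (simp add: n_def)
		then obtain j where "i = int n * j" by blast
		thus "zeta powi i = 1" using z(1) by (simp add: power_int_mult)
	qed blast
	hence "multiplicative F psi" "psi (f [^]\<^bsub>F\<^esub> (1::int)) = zeta powi 1" by auto
	thus ?thesis using that[of psi] z(2) f(1) by simp
qed

lemma finite_group_functions:
	fixes w :: "'f => 'k::{alg_closed_field, field_char_0}"
	assumes F: "comm_group F" "finite (carrier F)"
	shows "w : span_on (carrier F) {psi. multiplicative F psi}"
proof -
	interpret F: comm_group F by (rule F(1))
	let ?S = "span_on (carrier F) {psi. multiplicative F (psi :: 'f => 'k)}"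
	have mult: "(%g. u g * h g) : ?S" if "u : ?S" "h : ?S" for u h
	proof (rule span_on_mult[OF that])
		fix chi psi :: "'f => 'k" assume "chi : {psi. multiplicative F psi}" "psi : {psi. multiplicative F psi}"
		hence "(%g. chi g * psi g) : {psi. multiplicative F psi}" by (auto simp: multiplicative_def)
		thus "EX rho:{psi. multiplicative F psi}. ALL g:carrier F. rho g = chi g * psi g"
			by (intro bexI[of _ "%g. chi g * psi g"]) simp_all
	qed
	have const: "(%g. c) : ?S" for c
	proof -
		have "(%_. 1) : ?S" by (rule span_on_base) (simp add: multiplicative_def)
		thus ?thesis using span_on_scale[of "%_. 1" "carrier F" _ c] by simp
	qed
	have sep: "EX h:?S. h b = 0 & h a = 1" if ab: "a : carrier F" "b : carrier F" "a ~= b" for a b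
	proof -
		have "a \<otimes>\<^bsub>F\<^esub> inv\<^bsub>F\<^esub> b ~= \<one>\<^bsub>F\<^esub>" using ab F.inv_equality[of a "inv\<^bsub>F\<^esub> b"] by auto
		then obtain psi :: "'f => 'k" where psi: "multiplicative F psi" "psi (a \<otimes>\<^bsub>F\<^esub> inv\<^bsub>F\<^esub> b) ~= 1"
			using finite_group_separating[OF F, of "a \<otimes>\<^bsub>F\<^esub> inv\<^bsub>F\<^esub> b"] ab by auto
		have "psi (a \<otimes>\<^bsub>F\<^esub> inv\<^bsub>F\<^esub> b) * psi b = psi (a \<otimes>\<^bsub>F\<^esub> inv\<^bsub>F\<^esub> b \<otimes>\<^bsub>F\<^esub> b)"
			using psi(1) ab by (simp add: multiplicative_def)
		hence "psi (a \<otimes>\<^bsub>F\<^esub> inv\<^bsub>F\<^esub> b) * psi b = psi a" using ab by (simp add: F.m_assoc)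
		moreover have "psi b ~= 0" using psi(1) ab by (simp add: multiplicative_def)
		ultimately have ne: "psi a ~= psi b" using psi(2) by auto
		let ?h = "%g. (1 / (psi a - psi b)) * (psi g + - psi b)"
		have "?h : ?S"
		proof (rule span_on_scale, rule span_on_add)
			show "psi : ?S" using psi(1) by (intro span_on_base) simp
			show "(%g. - psi b) : ?S" by (rule const)
		qed
		moreover have "?h b = 0" "?h a = 1" using ne by auto
		ultimately show ?thesis by (intro bexI[of _ ?h] conjI)
	qed
	have delta: "EX h:?S. ALL b:carrier F. h b = (if b = a then 1 else 0)" if a: "a : carrier F" for a
	proof -
		have "EX h:?S. h a = 1 & (ALL b:A. h b = 0)" if "finite A" "A \<subseteq> carrier F - {a}" for A using that
		proof (induction A)
			case empty
			thus ?case using const[of 1] by (intro bexI[of _ "%g. 1"]) auto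
		next
			case (insert b A)
			then obtain h where h: "h : ?S" "h a = 1" "ALL b:A. h b = 0" by auto
			obtain h' where h': "h' : ?S" "h' b = 0" "h' a = 1" using sep[OF a, of b] insert.prems by auto
			thus ?case using mult[OF h(1) h'(1)] h by (intro bexI[of _ "%g. h g * h' g"]) auto
		qed
		from this[of "carrier F - {a}"] obtain h where "h : ?S" "h a = 1" "ALL b:carrier F - {a}. h b = 0"
			using F(2) by auto
		thus ?thesis by (intro bexI[of _ h]) auto
	qed
	then obtain \<delta> where \<delta>: "ALL a:carrier F. \<delta> a : ?S & (ALL b:carrier F. \<delta> a b = (if b = a then 1 else 0))"
		by (metis (no_types, lifting) bchoice)
	have "(%g. \<Sum>a\<in>carrier F. w a * \<delta> a g) : ?S" using \<delta> by (intro span_on_sum span_on_scale) blast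
	thus ?thesis
	proof (rule span_on_cong)
		fix g assume g: "g : carrier F"
		have "(\<Sum>a\<in>carrier F. w a * \<delta> a g) = (\<Sum>a\<in>carrier F. if g = a then w a else 0)" using \<delta> g by (intro sum.cong) auto
		thus "w g = (\<Sum>a\<in>carrier F. w a * \<delta> a g)" using g F(2) by simp
	qed
qed

lemma span_on_pullback:
	fixes f :: "'a => 'k::field" and pi :: "'p => 'a"
	assumes "f : span_on A B" "!!p. p : A' ==> pi p : A"
	shows "(%p. f (pi p)) : span_on A' ((%chi p. chi (pi p)) ` B)"
proof -
	obtain xs where xs: "snd ` set xs \<subseteq> B" "ALL g:A. f g = combination xs g" using assms(1) by (auto simp: span_on_def)
	have comb: "combination (map (%(c, chi). (c, %p. chi (pi p))) ys) p = combination ys (pi p)"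
		for ys :: "('k \<times> ('a => 'k)) list" and p by (induction ys) auto
	thus ?thesis
	proof (intro span_onI[of "map (%(c, chi). (c, %p. chi (pi p))) xs"])
		show "snd ` set (map (%(c, chi). (c, %p. chi (pi p))) xs) \<subseteq> (%chi p. chi (pi p)) ` B" using xs(1) by auto
		fix p assume "p : A'"
		thus "f (pi p) = combination (map (%(c, chi). (c, %p. chi (pi p))) xs) p" using xs(2) assms(2) comb by simp
	qed
qed

lemma span_on_transfer:
	assumes "f : span_on A B" "!!chi. chi : B ==> EX rho:B'. ALL g:A. rho g = chi g"
	shows "f : span_on A B'"
proof -
	have "(%g. f g * 1) : span_on A B'"
		using assms(1) span_on_base[of "%_. 1" "{%_. 1}"] assms(2) by (rule span_on_mult) auto
	thus ?thesis by simp
qed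

lemma torus_mult_closed:
	fixes x y :: "nat => 'k::field"
	assumes "x : {..<n} \<rightarrow>\<^sub>E {c. c ~= 0}" "y : {..<n} \<rightarrow>\<^sub>E {c. c ~= 0}"
	shows "(\<lambda>i\<in>{..<n}. x i * y i) : {..<n} \<rightarrow>\<^sub>E {c. c ~= 0}" unfolding restrict_PiE_iff using assms by auto

lemma torus_characters_span:
	assumes "f : regular (torus n)"
	shows "f : span_on (carrier (torus n)) {chi : regular (torus n). multiplicative (torus n) chi}"
proof -
	let ?A = "{..<n} \<rightarrow>\<^sub>E {c::'a. c ~= 0}"
	have treg: "regular (torus n) = {\<lambda>x\<in>?A. \<Sum>j<r. c j * (\<Prod>i<n. x i powi m j i)
								 | (r::nat) (c :: nat => 'a) (m :: nat => nat => int). True}" by (simp add: torus_def)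
	obtain r :: nat and c m where f: "f = (\<lambda>x\<in>?A. \<Sum>j<r. c j * (\<Prod>i<n. x i powi m j i))"
		using assms by (auto simp: torus_def)
	have mono: "(\<lambda>x\<in>?A. \<Prod>i<n. x i powi e i) : {chi : regular (torus n). multiplicative (torus n) chi}" for e :: "nat => int"
	proof -
		have "(\<lambda>x\<in>?A. \<Prod>i<n. x i powi e i) = (\<lambda>x\<in>?A. \<Sum>j<(1::nat). (%_. 1) j * (\<Prod>i<n. x i powi (%_. e) j i))"
			by (intro restrict_ext) simp
		hence "(\<lambda>x\<in>?A. \<Prod>i<n. x i powi e i) : regular (torus n)"
			unfolding treg by (intro CollectI exI[of _ "1::nat"] exI[of _ "%_. 1"] exI[of _ "%_. e"] conjI TrueI)
		moreover have "multiplicative (torus n) (\<lambda>x\<in>?A. \<Prod>i<n. x i powi e i)" unfolding multiplicative_def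
		proof (intro conjI ballI)
			fix x assume "x : carrier (torus n :: (nat => 'a, 'a) alg_group)"
			hence x: "x : ?A" by (simp add: torus_def)
			hence x0: "x i ~= 0" if "i < n" for i using that by auto
			thus "(\<lambda>x\<in>?A. \<Prod>i<n. x i powi e i) x ~= 0" using x by simp
			fix y assume "y : carrier (torus n :: (nat => 'a, 'a) alg_group)"
			hence y: "y : ?A" by (simp add: torus_def)
			have "(\<lambda>i\<in>{..<n}. x i * y i) : ?A" using x y by (rule torus_mult_closed)
			thus "(\<lambda>x\<in>?A. \<Prod>i<n. x i powi e i) (x \<otimes>\<^bsub>torus n\<^esub> y) =
					(\<lambda>x\<in>?A. \<Prod>i<n. x i powi e i) x * (\<lambda>x\<in>?A. \<Prod>i<n. x i powi e i) y"
				using x y by (simp add: torus_def power_int_mult_distrib prod.distrib)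
		qed
		ultimately show ?thesis by simp
	qed
	have "(%x. \<Sum>j<r. c j * (\<lambda>x\<in>?A. \<Prod>i<n. x i powi m j i) x)
			: span_on (carrier (torus n)) {chi : regular (torus n). multiplicative (torus n) chi}"
		by (intro span_on_sum span_on_scale span_on_base mono)
	thus ?thesis by (rule span_on_cong) (simp add: f torus_def)
qed

lemma product_characters_span:
	fixes F :: "'f monoid" and n :: nat
	defines "G == product_alg_group (torus n :: (nat => 'k::{alg_closed_field, field_char_0}, 'k) alg_group) (finite_alg_group F)"
	assumes F: "comm_group F" "finite (carrier F)" and f: "f : regular G"
	shows "f : span_on (carrier G) {chi : regular G. multiplicative G chi}"
proof -
	let ?T = "torus n :: (nat => 'k, 'k) alg_group"
	have car: "carrier G = carrier ?T \<times> carrier F"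
		by (simp add: G_def product_alg_group_def DirProd_def finite_alg_group_def)
	have mul: "(x, y) \<otimes>\<^bsub>G\<^esub> (x', y') = (x \<otimes>\<^bsub>?T\<^esub> x', y \<otimes>\<^bsub>F\<^esub> y')" for x y x' y'
		by (simp add: G_def product_alg_group_def DirProd_def finite_alg_group_def)
	have reg: "regular G = {\<lambda>p\<in>carrier ?T \<times> carrier F. \<Sum>i<m. u i (fst p) * w i (snd p) | (m::nat) u w.
								(\<forall>i<m. u i : regular ?T & w i : carrier F \<rightarrow>\<^sub>E UNIV)}"
		by (simp add: G_def product_alg_group_def product_variety_def group_variety_def finite_alg_group_def)
	obtain m :: nat and u w where f_eq: "f = (\<lambda>p\<in>carrier ?T \<times> carrier F. \<Sum>i<m. u i (fst p) * w i (snd p))"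
		and uw: "!!i. i < m ==> u i : regular ?T" using f unfolding reg by blast
	have "(%p. u i (fst p) * w i (snd p)) : span_on (carrier G) {chi : regular G. multiplicative G chi}" if i: "i < m" for i
	proof (rule span_on_mult)
		show "(%p. u i (fst p)) : span_on (carrier G)
				((%chi p. chi (fst p)) ` {chi : regular ?T. multiplicative ?T chi})"
			using torus_characters_span[OF uw[OF i]] by (rule span_on_pullback) (auto simp: car)
		show "(%p. w i (snd p)) : span_on (carrier G) ((%chi p. chi (snd p)) ` {psi. multiplicative F psi})"
			using finite_group_functions[OF F] by (rule span_on_pullback) (auto simp: car)
		fix chi' psi' :: "(nat => 'k) \<times> 'f => 'k" assume "chi' : (%chi p. chi (fst p)) ` {chi : regular ?T. multiplicative ?T chi}"
			"psi' : (%chi p. chi (snd p)) ` {psi :: 'f => 'k. multiplicative F psi}"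
		then obtain chi psi where chi: "chi : regular ?T" "multiplicative ?T chi" "chi' = (%p. chi (fst p))"
			and psi: "multiplicative F (psi :: 'f => 'k)" "psi' = (%p. psi (snd p))" by blast
		let ?rho = "\<lambda>p\<in>carrier ?T \<times> carrier F. chi (fst p) * psi (snd p)"
		have "?rho = (\<lambda>p\<in>carrier ?T \<times> carrier F. \<Sum>i<(1::nat). (%_. chi) i (fst p) * (%_. \<lambda>y\<in>carrier F. psi y) i (snd p))"
			by (intro restrict_ext) auto
		hence "?rho : regular G"
			unfolding reg using chi(1) by (intro CollectI exI[of _ "1::nat"] exI[of _ "%_. chi"] exI[of _ "%_. \<lambda>y\<in>carrier F. psi y"]) auto
		moreover have "multiplicative G ?rho" unfolding multiplicative_def car
		proof (intro conjI ballI)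
			interpret F: comm_group F by (rule F(1))
			have Tm: "x \<otimes>\<^bsub>?T\<^esub> x' : carrier ?T" if "x : carrier ?T" "x' : carrier ?T" for x x'
				using that torus_mult_closed[of x n x'] by (simp add: torus_def)
			fix p assume p: "p : carrier ?T \<times> carrier F"
			thus "?rho p ~= 0" using chi(2) psi(1) by (auto simp: multiplicative_def)
			fix q assume q: "q : carrier ?T \<times> carrier F"
			show "?rho (p \<otimes>\<^bsub>G\<^esub> q) = ?rho p * ?rho q"
				using p q chi(2) psi(1) Tm by (cases p; cases q) (auto simp: multiplicative_def mul)
		qed
		ultimately show "EX rho:{chi : regular G. multiplicative G chi}. ALL p:carrier G. rho p = chi' p * psi' p"
			by (intro bexI[of _ ?rho]) (simp_all add: chi(3) psi(2) car)
	qed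
	hence "(%p. \<Sum>i<m. u i (fst p) * w i (snd p)) : span_on (carrier G) {chi : regular G. multiplicative G chi}"
		by (intro span_on_sum) auto
	thus ?thesis by (rule span_on_cong) (simp add: f_eq car)
qed

lemma Units_field: "Units (ring_of_type_algebra :: 'k::field ring) = {c. c ~= 0}"
proof -
	interpret field "ring_of_type_algebra :: 'k ring" by (rule field_from_type_algebra)
	show ?thesis unfolding field_Units by (auto simp: ring_of_type_algebra_def)
qed

lemma type_algebra_mult: "x \<otimes>\<^bsub>ring_of_type_algebra\<^esub> y = x * y" for x y :: "'k::field"
	by (simp add: ring_of_type_algebra_def)

locale quasitorus_group =
	fixes Q :: "('g, 'k::{alg_closed_field, field_char_0}) alg_group"
	assumes quasitorus: "quasitorus Q"
begin

lemma algebraic: "algebraic_group Q" using quasitorus by (simp add: quasitorus_def)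

sublocale group Q using algebraic by (simp add: algebraic_group_def)

sublocale GV: affine "group_variety Q" using algebraic by (intro affine.intro) (simp add: algebraic_group_def)

lemma GV_simps [simp]: "points (group_variety Q) = carrier Q" "regs (group_variety Q) = regular Q"
	by (simp_all add: group_variety_def)

lemma character_iff: "chi : carrier (character_group Q) \<longleftrightarrow> chi : regular Q & multiplicative Q chi"
	unfolding character_group_def multiplicative_def hom_def by (auto simp: units_of_def Units_field type_algebra_mult)

lemma character_mult: "chi \<otimes>\<^bsub>character_group Q\<^esub> psi = (\<lambda>g\<in>carrier Q. chi g * psi g)"
	and character_one: "\<one>\<^bsub>character_group Q\<^esub> = (\<lambda>g\<in>carrier Q. 1)" by (simp_all add: character_group_def)

lemma character_mult_closed:
	"chi : carrier (character_group Q) ==> psi : carrier (character_group Q) ==>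
		chi \<otimes>\<^bsub>character_group Q\<^esub> psi : carrier (character_group Q)"
	unfolding character_iff character_mult using GV.reg_mult[of chi psi] by (auto simp: multiplicative_def)

lemma character_inv_closed:
	assumes "chi : carrier (character_group Q)"
	shows "(\<lambda>g\<in>carrier Q. chi (inv\<^bsub>Q\<^esub> g)) : carrier (character_group Q)"
proof -
	have chi: "chi : regular Q" "multiplicative Q chi" using assms by (auto simp: character_iff)
	have "morphism (group_variety Q) (group_variety Q) (%g. inv\<^bsub>Q\<^esub> g)"
		using algebraic by (simp add: algebraic_group_def)
	hence "(\<lambda>g\<in>carrier Q. chi (inv\<^bsub>Q\<^esub> g)) : regular Q" using chi(1) by (simp add: morphism_def)
	moreover have "chi (inv\<^bsub>Q\<^esub> (g \<otimes>\<^bsub>Q\<^esub> h)) = chi (inv\<^bsub>Q\<^esub> g) * chi (inv\<^bsub>Q\<^esub> h)" if "g : carrier Q" "h : carrier Q" for g h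
		using chi(2) that by (simp add: multiplicative_def inv_mult_group mult.commute)
	ultimately show ?thesis using chi(2) by (auto simp: character_iff multiplicative_def)
qed

lemma character_comm_group: "comm_group (character_group Q)"
proof (rule comm_groupI)
	show "\<one>\<^bsub>character_group Q\<^esub> : carrier (character_group Q)"
		using GV.reg_one by (auto simp: character_iff character_one multiplicative_def)
	fix chi assume chi: "chi : carrier (character_group Q)"
	hence "chi : regular Q" and m: "multiplicative Q chi" by (auto simp: character_iff)
	hence ext: "(\<lambda>g\<in>carrier Q. chi g) = chi" using GV.reg_restrict[of chi] by simp
	have "\<one>\<^bsub>character_group Q\<^esub> \<otimes>\<^bsub>character_group Q\<^esub> chi = (\<lambda>g\<in>carrier Q. chi g)"
		unfolding character_mult character_one by (intro restrict_ext) simp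
	thus "\<one>\<^bsub>character_group Q\<^esub> \<otimes>\<^bsub>character_group Q\<^esub> chi = chi" using ext by simp
	have "chi (inv\<^bsub>Q\<^esub> g) * chi g = 1" if g: "g : carrier Q" for g
		using m g multiplicative_one[OF is_group m] unfolding multiplicative_def by (metis inv_closed l_inv)
	hence "(\<lambda>g\<in>carrier Q. chi (inv\<^bsub>Q\<^esub> g)) \<otimes>\<^bsub>character_group Q\<^esub> chi = \<one>\<^bsub>character_group Q\<^esub>"
		unfolding character_mult character_one by (intro restrict_ext) simp
	thus "EX psi:carrier (character_group Q). psi \<otimes>\<^bsub>character_group Q\<^esub> chi = \<one>\<^bsub>character_group Q\<^esub>"
		using character_inv_closed[OF chi] by auto
qed (auto simp: character_mult character_mult_closed[unfolded character_mult] mult_ac intro!: restrict_ext)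

text \<open>The coordinates of a torus are characters, and on a finite abelian group the characters separate the
	elements, so that products of them give all functions.\<close>

lemma characters_span:
	assumes f: "f : regular Q"
	shows "f : span_on (carrier Q) (carrier (character_group Q))"
proof -
	obtain n and F :: "nat monoid" and phi where F: "comm_group F" "finite (carrier F)"
		and phi: "alg_group_iso Q (product_alg_group (torus n) (finite_alg_group F)) phi"
		using quasitorus unfolding quasitorus_def by blast
	define G where "G = product_alg_group (torus n :: (nat => 'k, 'k) alg_group) (finite_alg_group F)"
	have bij: "bij_betw phi (carrier Q) (carrier G)" and hom: "phi : hom Q G"
		and mor: "!!chi. chi : regular G ==> (\<lambda>g\<in>carrier Q. chi (phi g)) : regular Q"
		and inv_mor: "!!h. h : regular Q ==> (\<lambda>p\<in>carrier G. h (inv_into (carrier Q) phi p)) : regular G"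
		using phi unfolding G_def[symmetric] alg_group_iso_def alg_group_hom_def morphism_def
		by (auto simp: group_variety_def)
	define f' where "f' = (\<lambda>p\<in>carrier G. f (inv_into (carrier Q) phi p))"
	have phiG: "phi g : carrier G" if "g : carrier Q" for g using bij that by (auto simp: bij_betw_def)
	have "f' : span_on (carrier G) {chi : regular G. multiplicative G chi}"
		using product_characters_span[OF F, of f' n] inv_mor[OF f] by (simp add: G_def f'_def)
	hence "(%g. f' (phi g)) : span_on (carrier Q) ((%chi g. chi (phi g)) ` {chi : regular G. multiplicative G chi})"
		by (rule span_on_pullback) (rule phiG)
	hence "(%g. f' (phi g)) : span_on (carrier Q) (carrier (character_group Q))"
	proof (rule span_on_transfer)
		fix chi' assume "chi' : (%chi g. chi (phi g)) ` {chi : regular G. multiplicative G chi}"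
		then obtain chi where chi: "chi : regular G" "multiplicative G chi" "chi' = (%g. chi (phi g))" by blast
		have "(\<lambda>g\<in>carrier Q. chi (phi g)) : carrier (character_group Q)"
			using mor[OF chi(1)] chi(2) hom by (auto simp: character_iff multiplicative_def hom_def)
		thus "EX rho:carrier (character_group Q). ALL g:carrier Q. rho g = chi' g"
			by (intro bexI[of _ "\<lambda>g\<in>carrier Q. chi (phi g)"]) (simp_all add: chi(3))
	qed
	thus ?thesis
	proof (rule span_on_cong)
		fix g assume "g : carrier Q"
		thus "f g = f' (phi g)" using phiG bij by (simp add: f'_def bij_betw_def inv_into_f_f)
	qed
qed

lemma characters_separate:
	assumes "g : carrier Q" "h : carrier Q" "!!chi. chi : carrier (character_group Q) ==> chi g = chi h"
	shows "g = h"
proof (rule GV.point_eqI)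
	fix f assume "f : regs (group_variety Q)"
	then obtain xs where xs: "snd ` set xs \<subseteq> carrier (character_group Q)" "ALL g:carrier Q. f g = combination xs g"
		using characters_span[of f] by (auto simp: span_on_def)
	have "combination ys g = combination ys h" if "snd ` set ys \<subseteq> carrier (character_group Q)" for ys
		using that assms(3) by (induction ys) auto
	thus "f g = f h" using xs assms by simp
qed (use assms in simp_all)

lemma character_ext:
	assumes "chi : carrier (character_group Q)" "psi : carrier (character_group Q)" "!!g. g : carrier Q ==> chi g = psi g"
	shows "chi = psi" using GV.reg_eqI[of chi psi] assms by (simp add: character_iff)

lemma characters_independent:
	assumes B: "finite B" "B \<subseteq> carrier (character_group Q)"
		and zero: "!!g. g : carrier Q ==> (\<Sum>chi\<in>B. c chi * chi g) = 0"
	shows "chi : B ==> c chi = (0::'k)"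
proof (rule multiplicative_independent[where c = c, OF is_group B(1)])
	show "chi : B ==> multiplicative Q chi" for chi using B(2) by (auto simp: character_iff)
	show "chi : B ==> psi : B ==> (!!g. g : carrier Q ==> chi g = psi g) ==> chi = psi" for chi psi
		using B(2) character_ext by blast
	show "(\<Sum>chi\<in>B. c chi * chi g) = 0" if "g : carrier Q" for g using that by (rule zero)
qed

text \<open>Duality: since the characters are a basis of the regular functions, a multiplicative function on
	the character group extends to a homomorphism of algebras, that is, to a point.\<close>

lemma point_of_characters:
	assumes theta: "multiplicative (character_group Q) theta"
	obtains g where "g : carrier Q" "!!chi. chi : carrier (character_group Q) ==> chi g = theta chi"
proof -
	interpret X: comm_group "character_group Q" by (rule character_comm_group)
	let ?X = "carrier (character_group Q)"
	define ev where "ev xs = (\<Sum>(c, chi)\<leftarrow>xs. c * theta chi)" for xs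
	define rep where "rep f = (SOME xs. snd ` set xs \<subseteq> ?X & (ALL g:carrier Q. f g = combination xs g))" for f
	have rep: "snd ` set (rep f) \<subseteq> ?X" "!!g. g : carrier Q ==> f g = combination (rep f) g" if f: "f : regular Q" for f
	proof -
		have ex: "EX xs. snd ` set xs \<subseteq> ?X & (ALL g:carrier Q. f g = combination xs g)"
			using characters_span[OF f] by (simp add: span_on_def)
		have "snd ` set (rep f) \<subseteq> ?X & (ALL g:carrier Q. f g = combination (rep f) g)"
			unfolding rep_def by (rule someI_ex[OF ex])
		thus "snd ` set (rep f) \<subseteq> ?X" "!!g. g : carrier Q ==> f g = combination (rep f) g" by blast+
	qed
	have uniq: "ev xs = ev ys"
		if xs: "snd ` set xs \<subseteq> ?X" and ys: "snd ` set ys \<subseteq> ?X" and eq: "!!g. g : carrier Q ==> combination xs g = combination ys g" for xs ys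
	proof -
		define B where "B = snd ` set xs \<union> snd ` set ys"
		have B: "finite B" "B \<subseteq> ?X" "snd ` set xs \<subseteq> B" "snd ` set ys \<subseteq> B" using xs ys by (auto simp: B_def)
		have "(\<Sum>chi\<in>B. (coefficient xs chi - coefficient ys chi) * chi g) = 0" if g: "g : carrier Q" for g
			using eq[OF g] combination_collect[OF B(1,3), of "%chi. chi g"] combination_collect[OF B(1,4), of "%chi. chi g"]
			unfolding combination_def by (simp add: left_diff_distrib sum_subtractf)
		hence "coefficient xs chi - coefficient ys chi = 0" if "chi : B" for chi
			using characters_independent[OF B(1,2), of "%chi. coefficient xs chi - coefficient ys chi" chi] that by simp
		thus ?thesis unfolding ev_def combination_collect[OF B(1,3)] combination_collect[OF B(1,4)]
			by (intro sum.cong) auto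
	qed
	have ev_rep: "ev (rep f) = ev xs"
		if "f : regular Q" "snd ` set xs \<subseteq> ?X" "!!g. g : carrier Q ==> f g = combination xs g" for f xs
		using uniq[OF rep(1)[OF that(1)] that(2)] rep(2)[OF that(1)] that(3) by simp
	obtain g where g: "g : points (group_variety Q)" "!!f. f : regs (group_variety Q) ==> ev (rep f) = f g"
	proof (rule GV.alg_homsI[of "%f. ev (rep f)"])
		fix f h assume "f : regs (group_variety Q)" "h : regs (group_variety Q)"
		hence f: "f : regular Q" and h: "h : regular Q" by simp_all
		let ?p = "concat (map (%(c, chi). map (%(d, psi). (c * d, chi \<otimes>\<^bsub>character_group Q\<^esub> psi)) (rep h)) (rep f))"
		have sub: "snd ` set ?p \<subseteq> ?X" using rep(1)[OF f] rep(1)[OF h] by force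
		have "ev (rep (f \<otimes>\<^bsub>GV.A\<^esub> h)) = ev ?p"
		proof (rule ev_rep[OF _ sub])
			show "f \<otimes>\<^bsub>GV.A\<^esub> h : regular Q" using GV.reg_mult[of f h] f h by (simp add: GV.A_simps)
			fix g assume g: "g : carrier Q"
			have "combination ?p g = combination (rep f) g * combination (rep h) g" unfolding combination_def using g
				by (intro combination_product[where F = "%chi. chi g"]) (auto simp: character_mult)
			thus "(f \<otimes>\<^bsub>GV.A\<^esub> h) g = combination ?p g" using g rep(2)[OF f] rep(2)[OF h] by simp
		qed
		also have "\<dots> = ev (rep f) * ev (rep h)" unfolding ev_def using theta rep(1)[OF f] rep(1)[OF h]
			by (intro combination_product[where F = theta]) (auto simp: multiplicative_def subset_iff)
		finally show "ev (rep (f \<otimes>\<^bsub>GV.A\<^esub> h)) = ev (rep f) * ev (rep h)" .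
		have "ev (rep (f \<oplus>\<^bsub>GV.A\<^esub> h)) = ev (rep f @ rep h)"
			using GV.reg_add[of f h] rep[OF f] rep[OF h] f h by (intro ev_rep) (auto simp: GV.A_simps)
		thus "ev (rep (f \<oplus>\<^bsub>GV.A\<^esub> h)) = ev (rep f) + ev (rep h)" by (simp add: ev_def)
	next
		have "ev (rep \<one>\<^bsub>GV.A\<^esub>) = ev [(1, \<one>\<^bsub>character_group Q\<^esub>)]"
			using GV.reg_one X.one_closed by (intro ev_rep) (auto simp: GV.A_simps character_one)
		thus "ev (rep \<one>\<^bsub>GV.A\<^esub>) = 1" using multiplicative_one[OF X.is_group theta] by (simp add: ev_def)
	next
		fix c f assume "f : regs (group_variety Q)"
		hence f: "f : regular Q" by simp
		have "ev (rep (c \<odot>\<^bsub>GV.A\<^esub> f)) = ev (map (%(d, chi). (c * d, chi)) (rep f))"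
			using GV.reg_smult[of f c] rep[OF f] f by (intro ev_rep) (auto simp: combination_scale)
		also have "\<dots> = c * ev (rep f)"
			unfolding ev_def by (induction "rep f") (auto simp: algebra_simps sum_list_const_mult[symmetric] comp_def split_beta)
		finally show "ev (rep (c \<odot>\<^bsub>GV.A\<^esub> f)) = c * ev (rep f)" .
	qed blast
	have "chi g = theta chi" if chi: "chi : ?X" for chi
	proof -
		have "ev (rep chi) = ev [(1, chi)]" using chi by (intro ev_rep) (auto simp: character_iff)
		thus ?thesis using g(2)[of chi] chi by (simp add: ev_def character_iff)
	qed
	thus ?thesis using that g(1) by simp
qed

end

section \<open>The quotient and its function field\<close>

locale quasitorus_quotient = ZN: normal_affine Z + QG: quasitorus_group Q
	for Z :: "('z, 'k::{alg_closed_field, field_char_0}) variety" and Q :: "('g, 'k) alg_group" +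
	fixes rho :: "'g => 'z => 'z" and V :: "(('z => 'k) => 'k, 'k) variety"
	assumes action: "regular_action Q Z rho" and V_quotient: "V = affine_quotient Q Z rho"
		and V_affine: "affine_variety V" "normal_variety V"
begin

sublocale VN: normal_affine V
proof unfold_locales
	show "affine_variety V" "irreducible_variety V" "normal_variety V" using V_affine by (auto simp: normal_variety_def)
qed

abbreviation KZ where "KZ == rat_funs Z"
abbreviation KV where "KV == rat_funs V"
abbreviation AZ where "AZ == coordinate_algebra Z"
abbreviation AV where "AV == coordinate_algebra V"
abbreviation pi where "pi == quotient_morphism Q Z rho"
abbreviation rZ where "rZ == rat_of_reg Z"
abbreviation rV where "rV == rat_of_reg V"
abbreviation OV where "OV == divisor_sections V"
abbreviation XQ where "XQ == character_group Q"
abbreviation chars where "chars == carrier XQ"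
abbreviation indeg where "indeg == in_degree V"
abbreviation B0 where "B0 == invariants Q Z rho"
text \<open>In the subscripts, \<open>Z\<close> and \<open>V\<close> stand for the functions on the two varieties, \<open>K\<close> and \<open>L\<close> for the
	rational functions on \<open>Z\<close> and on \<open>V\<close>.\<close>

abbreviation AZ_mult (infixl "*\<^sub>Z" 70) where "f *\<^sub>Z g == f \<otimes>\<^bsub>AZ\<^esub> g"
abbreviation AZ_add (infixl "+\<^sub>Z" 65) where "f +\<^sub>Z g == f \<oplus>\<^bsub>AZ\<^esub> g"
abbreviation AZ_one ("1\<^sub>Z") where "1\<^sub>Z == \<one>\<^bsub>AZ\<^esub>"
abbreviation AZ_zero ("0\<^sub>Z") where "0\<^sub>Z == \<zero>\<^bsub>AZ\<^esub>"
abbreviation KZ_mult (infixl "*\<^sub>K" 70) where "f *\<^sub>K g == f \<otimes>\<^bsub>KZ\<^esub> g"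
abbreviation KZ_add (infixl "+\<^sub>K" 65) where "f +\<^sub>K g == f \<oplus>\<^bsub>KZ\<^esub> g"
abbreviation KZ_one ("1\<^sub>K") where "1\<^sub>K == \<one>\<^bsub>KZ\<^esub>"
abbreviation KZ_zero ("0\<^sub>K") where "0\<^sub>K == \<zero>\<^bsub>KZ\<^esub>"
abbreviation KV_mult (infixl "*\<^sub>L" 70) where "f *\<^sub>L g == f \<otimes>\<^bsub>KV\<^esub> g"
abbreviation KV_add (infixl "+\<^sub>L" 65) where "f +\<^sub>L g == f \<oplus>\<^bsub>KV\<^esub> g"
abbreviation KV_one ("1\<^sub>L") where "1\<^sub>L == \<one>\<^bsub>KV\<^esub>"
abbreviation KV_zero ("0\<^sub>L") where "0\<^sub>L == \<zero>\<^bsub>KV\<^esub>"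
abbreviation AV_mult (infixl "*\<^sub>V" 70) where "f *\<^sub>V g == f \<otimes>\<^bsub>AV\<^esub> g"
abbreviation AV_add (infixl "+\<^sub>V" 65) where "f +\<^sub>V g == f \<oplus>\<^bsub>AV\<^esub> g"
abbreviation AV_one ("1\<^sub>V") where "1\<^sub>V == \<one>\<^bsub>AV\<^esub>"
abbreviation AV_zero ("0\<^sub>V") where "0\<^sub>V == \<zero>\<^bsub>AV\<^esub>"
abbreviation KZ_inv ("inv\<^sub>K _" [81] 80) where "inv\<^sub>K x == inv\<^bsub>KZ\<^esub> x"
abbreviation KV_inv ("inv\<^sub>L _" [81] 80) where "inv\<^sub>L x == inv\<^bsub>KV\<^esub> x"

lemma action_closed: "g : carrier Q ==> z : points Z ==> rho g z : points Z"
	using action group_action.element_image[of Q "points Z" rho g z] by (auto simp: regular_action_def)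

lemma action_mult: "g : carrier Q ==> h : carrier Q ==> z : points Z ==> rho (g \<otimes>\<^bsub>Q\<^esub> h) z = rho g (rho h z)"
	using action group_action.composition_rule[of Q "points Z" rho z g h] by (auto simp: regular_action_def)

lemma translate_regular:
	assumes f: "f : regs Z" and g: "g : carrier Q"
	shows "(\<lambda>z\<in>points Z. f (rho g z)) : regs Z"
proof -
	have "morphism (product_variety (group_variety Q) Z) Z (%(g, p). rho g p)"
		using action by (simp add: regular_action_def)
	hence "(\<lambda>p\<in>carrier Q \<times> points Z. f ((%(g, p). rho g p) p)) : regs (product_variety (group_variety Q) Z)"
		using f by (simp add: morphism_def product_variety_def)
	then obtain n :: nat and u w where eq: "(\<lambda>p\<in>carrier Q \<times> points Z. f ((%(g, p). rho g p) p)) =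
			(\<lambda>p\<in>carrier Q \<times> points Z. \<Sum>i<n. u i (fst p) * w i (snd p))" and w: "!!i. i < n ==> w i : regs Z"
		unfolding product_variety_def by auto
	have "f (rho g z) = (\<Sum>i<n. u i g * w i z)" if "z : points Z" for z using fun_cong[OF eq, of "(g, z)"] that g by simp
	hence "(\<lambda>z\<in>points Z. f (rho g z)) = (\<lambda>z\<in>points Z. \<Sum>i<n. (\<lambda>z\<in>points Z. u i g * w i z) z)"
		by (intro restrict_ext) simp
	moreover have "(\<lambda>z\<in>points Z. \<Sum>i<n. (\<lambda>z\<in>points Z. u i g * w i z) z) : regs Z"
		by (intro ZN.reg_sum ZN.reg_scale w) simp
	ultimately show ?thesis by simp
qed

lemma invariantsD: "f : B0 ==> f : regs Z" "f : B0 ==> g : carrier Q ==> z : points Z ==> f (rho g z) = f z"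
	by (auto simp: invariants_def)

lemma invariants_closed:
	"f : B0 ==> h : B0 ==> f *\<^sub>Z h : B0" "f : B0 ==> h : B0 ==> f +\<^sub>Z h : B0"
	"1\<^sub>Z : B0" "f : B0 ==> c \<odot>\<^bsub>AZ\<^esub> f : B0"
	using ZN.FR.m_closed[of f h] ZN.FR.a_closed[of f h] ZN.FR.one_closed ZN.reg_smult[of f c] action_closed
			by (auto simp: invariants_def)

lemma V_points: "points V = alg_homs (AZ\<lparr>carrier := B0\<rparr>)" and V_regs: "regs V = spec_function (AZ\<lparr>carrier := B0\<rparr>) ` B0"
	by (simp_all add: V_quotient affine_quotient_def spec_def)

lemma pi_point: "z : points Z ==> pi z : points V" unfolding V_points alg_homs_def using invariants_closed
			by (auto simp: quotient_morphism_def ring_of_type_algebra_def intro!: ring_hom_memI)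

definition pull :: "((('z => 'k) => 'k) => 'k) => 'z => 'k" where
	"pull f = (\<lambda>z\<in>points Z. f (pi z))"

lemma pull_apply [simp]: "z : points Z ==> pull f z = f (pi z)" by (simp add: pull_def)

lemma pull_spec: "a : B0 ==> pull (spec_function (AZ\<lparr>carrier := B0\<rparr>) a) = a"
proof -
	assume a: "a : B0"
	have "pull (spec_function (AZ\<lparr>carrier := B0\<rparr>) a) = (\<lambda>z\<in>points Z. a z)"
		unfolding pull_def spec_function_def V_points[symmetric] using pi_point a
		by (intro restrict_ext) (simp add: quotient_morphism_def)
	thus ?thesis using ZN.reg_restrict invariantsD(1)[OF a] by simp
qed

lemma pull_B0: "f : regs V ==> pull f : B0" unfolding V_regs using pull_spec by auto

lemma pull_regs: "f : regs V ==> pull f : regs Z" using pull_B0 invariantsD by simp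

lemma pull_surj: "a : B0 ==> EX f:regs V. pull f = a" unfolding V_regs using pull_spec by auto

text \<open>The functions on the quotient are the invariants.\<close>

lemma pull_inj: "f : regs V ==> h : regs V ==> pull f = pull h ==> f = h" unfolding V_regs using pull_spec by auto

lemma pull_hom:
	"pull (f *\<^sub>V h) = pull f *\<^sub>Z pull h" "pull (f +\<^sub>V h) = pull f +\<^sub>Z pull h"
	"pull 1\<^sub>V = 1\<^sub>Z" "pull 0\<^sub>V = 0\<^sub>Z" "pull (c \<odot>\<^bsub>AV\<^esub> f) = c \<odot>\<^bsub>AZ\<^esub> pull f"
	unfolding pull_def ZN.A_simps using pi_point by auto

lemma pull_nonzero: "f : VN.nzs ==> pull f : ZN.nzs" unfolding VN.FR_nonzero[symmetric] ZN.FR_nonzero[symmetric]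
	using pull_inj[of f "0\<^sub>V"] VN.FR.zero_closed pull_regs[of f] by (auto simp: pull_hom(4))

text \<open>The pullback of rational functions along the quotient morphism.\<close>

definition inc :: "(('z => 'k) => 'k, 'k) rat_fun => ('z, 'k) rat_fun" where
	"inc x = (THE y. EX a:regs V. EX b:VN.nzs. x = quot_fun V a b & y = quot_fun Z (pull a) (pull b))"

lemma inc_quot:
	assumes ab: "a : regs V" "b : VN.nzs"
	shows "inc (quot_fun V a b) = quot_fun Z (pull a) (pull b)" unfolding inc_def
proof (rule the_equality)
	fix y assume "EX c:regs V. EX d:VN.nzs. quot_fun V a b = quot_fun V c d & y = quot_fun Z (pull c) (pull d)"
	then obtain c d where cd: "c : regs V" "d : VN.nzs" "quot_fun V a b = quot_fun V c d"
		"y = quot_fun Z (pull c) (pull d)" by blast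
	hence "a *\<^sub>V d = c *\<^sub>V b" using VN.quot_eq_iff[of a b c d] ab by simp
	hence "pull a *\<^sub>Z pull d = pull c *\<^sub>Z pull b" using pull_hom(1) by metis
	thus "y = quot_fun Z (pull a) (pull b)"
		using ZN.quot_eq_iff[of "pull a" "pull b" "pull c" "pull d"] ab cd pull_regs pull_nonzero by simp
qed (use ab in blast)

lemma inc_ring_hom: "inc : ring_hom KV KZ"
proof (rule ring_hom_memI)
	show "inc 1\<^sub>L = 1\<^sub>K" using inc_quot[of "1\<^sub>V" "1\<^sub>V"] VN.nzs_one VN.nzsD[OF VN.nzs_one] VN.rat.hom_one ZN.rat.hom_one
			by (simp add: rat_of_reg_def pull_hom)
	fix x assume "x : carrier KV"
	then obtain a b where x: "a : regs V" "b : VN.nzs" "x = quot_fun V a b" by (rule VN.quotE)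
	show "inc x : carrier KZ"
		unfolding x(3) inc_quot[OF x(1,2)] using x pull_regs pull_nonzero by (intro ZN.quot_closed)
	fix y assume "y : carrier KV"
	then obtain c d where y: "c : regs V" "d : VN.nzs" "y = quot_fun V c d" by (rule VN.quotE)
	have r: "b : regs V" "d : regs V" using x y VN.nzsD by auto
	have cl: "a *\<^sub>V c : regs V" "a *\<^sub>V d +\<^sub>V c *\<^sub>V b : regs V"
		using VN.FR.m_closed[of a c] VN.FR.a_closed[OF VN.FR.m_closed[of a d] VN.FR.m_closed[of c b]] x y r by auto
	show "inc (x *\<^sub>L y) = inc x *\<^sub>K inc y"
		unfolding x(3) y(3) VN.quot_mult[OF x(1,2) y(1,2)] inc_quot[OF x(1,2)] inc_quot[OF y(1,2)]
			inc_quot[OF cl(1) VN.nzs_mult[OF x(2) y(2)]] pull_hom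
		using x y pull_regs pull_nonzero by (simp add: ZN.quot_mult)
	show "inc (x +\<^sub>L y) = inc x +\<^sub>K inc y"
		unfolding x(3) y(3) VN.quot_add[OF x(1,2) y(1,2)] inc_quot[OF x(1,2)] inc_quot[OF y(1,2)]
			inc_quot[OF cl(2) VN.nzs_mult[OF x(2) y(2)]] pull_hom
		using x y pull_regs pull_nonzero by (simp add: ZN.quot_add)
qed

sublocale inc: ring_hom_cring KV KZ inc using inc_ring_hom by unfold_locales

lemma inc_rat: "a : regs V ==> inc (rV a) = rZ (pull a)"
	unfolding rat_of_reg_def using inc_quot[OF _ VN.nzs_one] by (simp add: pull_hom)

lemma inc_zero_iff: "x : carrier KV ==> inc x = 0\<^sub>K \<longleftrightarrow> x = 0\<^sub>L"
proof
	assume x: "x : carrier KV" "inc x = 0\<^sub>K"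
	obtain a b where ab: "a : regs V" "b : VN.nzs" "x = quot_fun V a b" using x(1) by (rule VN.quotE)
	have "pull a = 0\<^sub>Z"
		using x(2) ab inc_quot[OF ab(1,2)] ZN.quot_zero_iff[of "pull a" "pull b"] pull_regs pull_nonzero by simp
	hence "a = 0\<^sub>V" using pull_inj[of a "0\<^sub>V"] ab(1) VN.FR.zero_closed by (simp add: pull_hom)
	thus "x = 0\<^sub>L" using ab VN.quot_zero_iff[OF ab(1,2)] by simp
qed simp

lemma inc_Kx: "x : VN.Kx ==> inc x : ZN.Kx" using inc_zero_iff[of x] by simp

lemma inc_inv: "x : VN.Kx ==> inc (inv\<^sub>L x) = inv\<^sub>K (inc x)"
proof -
	assume x: "x : VN.Kx"
	have "inc x *\<^sub>K inc (inv\<^sub>L x) = 1\<^sub>K" using VN.Kx_inv[OF x] x inc.hom_mult[of x "inv\<^sub>L x"] by simp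
	thus ?thesis using ZN.K.comm_inv_char[of "inc x" "inc (inv\<^sub>L x)"] inc_Kx[OF x] inc_Kx[OF VN.Kx_inv(1)[OF x]] by simp
qed

text \<open>This is where the action has to be uncontracting: a pole of \<open>y\<close> is a prime divisor of \<open>Z\<close>, which
	maps to a set of codimension at most one, where some product of sections of \<open>O(D)\<close> and
	\<open>O(-D)\<close> does not vanish.\<close>

lemma regular_if_locally_regular:
	assumes unc: "uncontracting Q Z rho" and D: "D : carrier (weil_divisors V)" and y: "y : carrier KZ"
		and loc: "!!f f'. f : OV D ==> f' : OV (- D) ==>
			inc (f *\<^sub>L f') *\<^sub>K y : rZ ` regs Z"
	shows "y : rZ ` regs Z"
proof -
	obtain a b where ab: "a : regs Z" "b : ZN.nzs" "y = quot_fun Z a b" using y by (rule ZN.quotE)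
	have b: "b : regs Z" using ab ZN.nzsD by simp
	have "EX q:regs Z. a = b *\<^sub>Z q"
	proof (rule ccontr)
		assume no: "\<not> (EX q:regs Z. a = b *\<^sub>Z q)"
		obtain E where E: "E : prime_divisors Z"
			"!!r. r : regs Z ==> (EX q:regs Z. r *\<^sub>Z a = b *\<^sub>Z q) ==> r : ZN.vanishing E"
			using ZN.pole_divisor[OF ab(1,2) no] by auto
		have irrE: "irreducible_closed Z E" "E \<subseteq> points Z" "E ~= {}" using ZN.prime_divisorD[OF E(1)] by auto
		define Y where "Y = zariski V closure_of (pi ` E)"
		have piE: "pi ` E \<subseteq> points V" using irrE(2) pi_point by auto
		have Y: "Y = VN.zeros (VN.vanishing (pi ` E))" unfolding Y_def by (rule VN.closure_zariski[OF piE])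
		have piEY: "pi ` E \<subseteq> Y" unfolding Y using piE by (auto simp: VN.zeros_def VN.vanishing_def)
		have vanY: "f : VN.vanishing Y \<longleftrightarrow> f : regs V & pull f : ZN.vanishing E" for f
		proof
			assume "f : VN.vanishing Y"
			thus "f : regs V & pull f : ZN.vanishing E"
				using piEY irrE(2) pull_regs by (auto simp: VN.vanishing_def ZN.vanishing_def subset_iff)
		next
			assume f: "f : regs V & pull f : ZN.vanishing E"
			hence "f (pi z) = 0" if "z : E" for z using that irrE(2) by (auto simp: ZN.vanishing_def subset_iff)
			hence "f : VN.vanishing (pi ` E)" using f by (auto simp: VN.vanishing_def)
			thus "f : VN.vanishing Y" using f unfolding Y by (auto simp: VN.vanishing_def VN.zeros_def)
		qed
		have "irreducible_closed V Y"
		proof (rule VN.irreducible_closedI)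
			show "closedin (zariski V) Y" unfolding Y_def by simp
			show "Y ~= {}" using piEY irrE(3) by auto
			fix f g assume fg: "f : regs V" "g : regs V" "(\<lambda>p\<in>points V. f p * g p) : VN.vanishing Y"
			hence "pull f *\<^sub>Z pull g : ZN.vanishing E"
				using vanY[of "f *\<^sub>V g"] by (simp add: VN.A_simps(2) pull_hom(1)[symmetric])
			hence "f (pi z) * g (pi z) = 0" if "z : E" for z using that irrE(2) by (auto simp: ZN.vanishing_def subset_iff)
			hence "pull f : ZN.vanishing E | pull g : ZN.vanishing E"
				using irrE(2) pull_regs fg by (intro ZN.irreducible_closed_prime[OF irrE(1)]) (auto simp: subset_iff)
			thus "f : VN.vanishing Y | g : VN.vanishing Y" using vanY fg by simp
		qed
		moreover have "codim V Y \<le> 1" using unc E(1) by (simp add: uncontracting_def Y_def V_quotient)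
		ultimately have "Y = points V | Y : prime_divisors V" by (rule VN.codim_le_one)
		then obtain f f' g where fg: "f : OV D" "f' : OV (- D)"
				"g : regs V - VN.vanishing Y" "f *\<^sub>L f' = rV g" using VN.complementary_sections[OF _ D] by metis
		have pg: "pull g : regs Z" using fg(3) pull_regs by simp
		have "rZ (pull g) *\<^sub>K y : rZ ` regs Z" using loc[OF fg(1,2)] fg(3) unfolding fg(4) by (simp add: inc_rat)
		then obtain q where q: "q : regs Z" "rZ (pull g) *\<^sub>K y = rZ q" by blast
		have "rZ (pull g *\<^sub>Z a) = rZ (pull g) *\<^sub>K (y *\<^sub>K rZ b)"
			using ZN.quot_rat[OF ab(1,2)] pg ab(1) by (simp add: ab(3))
		also have "\<dots> = rZ (b *\<^sub>Z q)" using q pg b y by (simp add: ZN.K.m_assoc[symmetric] ZN.K.m_comm)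
		finally have "pull g *\<^sub>Z a = b *\<^sub>Z q"
			using ZN.rat_eq_iff[of "pull g *\<^sub>Z a" "b *\<^sub>Z q"] ZN.FR.m_closed[of "pull g" a] ZN.FR.m_closed[of b q] pg ab(1) b q(1)
			by simp
		hence "pull g : ZN.vanishing E" using E(2)[OF pg] q(1) by auto
		thus False using vanY[of g] fg(3) by simp
	qed
	then obtain q where q: "q : regs Z" "a = b *\<^sub>Z q" by blast
	hence "y = rZ q"
		unfolding ab(3) rat_of_reg_def using ZN.quot_eq_iff[of a b q "1\<^sub>Z"] ab b ZN.nzs_one ZN.FR.m_comm[of b q] by simp
	thus ?thesis using q by simp
qed

end

section \<open>Homogeneous elements\<close>

lemma (in comm_monoid) rearrange:
	assumes "a : carrier G" "b : carrier G" "c : carrier G" "d : carrier G"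
	shows "a \<otimes> b \<otimes> c = b \<otimes> (a \<otimes> c)" "a \<otimes> (b \<otimes> c \<otimes> d) = c \<otimes> (a \<otimes> b \<otimes> d)"
		"(a \<otimes> b) \<otimes> (c \<otimes> d) = (a \<otimes> c) \<otimes> (b \<otimes> d)" using assms by (simp_all add: m_ac)

context quasitorus_quotient begin

abbreviation ws where "ws == weight_space Q Z rho"

lemma wsD: "f : ws chi ==> f : regs Z" "f : ws chi ==> g : carrier Q ==> z : points Z ==> f (rho g z) = chi g * f z"
	by (auto simp: weight_space_def)

lemma wsI: "f : regs Z ==> (!!g z. g : carrier Q ==> z : points Z ==> f (rho g z) = chi g * f z) ==> f : ws chi"
	by (auto simp: weight_space_def)

lemma one_char: "\<one>\<^bsub>XQ\<^esub> : chars"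
proof -
	interpret C: comm_group "XQ" by (rule QG.character_comm_group)
	show ?thesis by (rule C.one_closed)
qed

lemma ws_one: "ws \<one>\<^bsub>XQ\<^esub> = B0" by (auto simp: weight_space_def invariants_def QG.character_one)

lemma ws_mult: "f : ws chi ==> h : ws psi ==> f *\<^sub>Z h : ws (chi \<otimes>\<^bsub>XQ\<^esub> psi)"
	using ZN.FR.m_closed[of f h] action_closed by (intro wsI) (auto simp: wsD QG.character_mult)

lemma ws_unique:
	assumes "f : ZN.nzs" "f : ws chi" "f : ws psi" "chi : chars" "psi : chars"
	shows "chi = psi"
proof (rule QG.character_ext[OF assms(4,5)])
	obtain z where z: "z : points Z" "f z ~= 0" using assms(1) by (auto simp: ZN.nzs_def)
	fix g assume g: "g : carrier Q"
	show "chi g = psi g" using wsD(2)[OF assms(2) g z(1)] wsD(2)[OF assms(3) g z(1)] z(2) by simp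
qed

text \<open>Weights can be cancelled because \<open>Z\<close> is irreducible: the translate of \<open>b\<close> and its multiple agree after
	multiplication by \<open>a\<close>.\<close>

lemma ws_cancel:
	assumes a: "a : ZN.nzs" "a : ws psi" "psi : chars" and b: "b : regs Z" and ab: "a *\<^sub>Z b : ws chi" "chi : chars"
	obtains theta where "theta : chars" "b : ws theta" "psi \<otimes>\<^bsub>XQ\<^esub> theta = chi"
proof -
	interpret C: comm_group "XQ" by (rule QG.character_comm_group)
	have aA: "a : carrier AZ" "a ~= 0\<^sub>Z" using a(1) unfolding ZN.FR_nonzero[symmetric] by auto
	define theta where "theta = inv\<^bsub>XQ\<^esub> psi \<otimes>\<^bsub>XQ\<^esub> chi"
	have theta: "theta : chars" "psi \<otimes>\<^bsub>XQ\<^esub> theta = chi"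
		unfolding theta_def using a(3) ab(2) by (auto simp: C.m_assoc[symmetric])
	have "b (rho g z) = theta g * b z" if g: "g : carrier Q" and z: "z : points Z" for g z
	proof -
		have psi0: "psi g ~= 0" using a(3) g by (simp add: QG.character_iff multiplicative_def)
		have psitheta: "chi g = psi g * theta g"
			using arg_cong[OF theta(2), of "%f. f g"] g by (simp add: QG.character_mult)
		define b1 where "b1 = (\<lambda>z\<in>points Z. b (rho g z))"
		define b2 where "b2 = theta g \<odot>\<^bsub>AZ\<^esub> b"
		have b12: "b1 : regs Z" "b2 : regs Z"
			unfolding b1_def b2_def using translate_regular[OF b g] ZN.reg_smult[OF b] by auto
		have "a *\<^sub>Z b1 = a *\<^sub>Z b2"
		proof (rule ZN.reg_eqI)
			show "a *\<^sub>Z b1 : regs Z" "a *\<^sub>Z b2 : regs Z"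
				using ZN.FR.m_closed[of a b1] ZN.FR.m_closed[of a b2] aA b12 by auto
			fix p assume p: "p : points Z"
			have "(a *\<^sub>Z b) (rho g p) = chi g * (a *\<^sub>Z b) p" using wsD(2)[OF ab(1) g p] .
			hence "psi g * (a p * b (rho g p)) = psi g * (a p * (theta g * b p))"
				using wsD(2)[OF a(2) g p] action_closed[OF g p] p psitheta by simp
			thus "(a *\<^sub>Z b1) p = (a *\<^sub>Z b2) p" using psi0 p by (simp add: b1_def b2_def)
		qed
		hence "b1 = b2" using ZN.FR.m_lcancel[OF aA(2,1)] b12 by simp
		thus ?thesis using z by (metis (no_types, lifting) ZN.A_apply(5) b1_def b2_def restrict_apply')
	qed
	thus ?thesis using that theta wsI[OF b] by simp
qed

definition homs :: "('z => 'k) set" where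
	"homs = {f : ZN.nzs. EX chi:chars. f : ws chi}"

lemma homsD: "f : homs ==> f : ZN.nzs" "f : homs ==> f : carrier AZ" "f : homs ==> f ~= 0\<^sub>Z"
	unfolding homs_def ZN.FR_nonzero[symmetric] by auto

lemma homs_mult: "f : homs ==> h : homs ==> f *\<^sub>Z h : homs"
	unfolding homs_def using ws_mult ZN.nzs_mult QG.character_mult_closed by blast

lemma homs_invariant: "f : B0 ==> f : ZN.nzs ==> f : homs" unfolding homs_def ws_one[symmetric] using one_char by auto

lemma homs_one: "1\<^sub>Z : homs" using homs_invariant invariants_closed(3) ZN.nzs_one by simp

lemma homs_cancel:
	assumes "a : homs" "b : regs Z" "a *\<^sub>Z b : homs"
	shows "b : homs"
proof -
	obtain psi chi where "psi : chars" "a : ws psi" "chi : chars" "a *\<^sub>Z b : ws chi"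
		using assms(1,3) by (auto simp: homs_def)
	then obtain theta where "theta : chars" "b : ws theta"
		using ws_cancel[OF homsD(1)[OF assms(1)] _ _ assms(2), of psi chi] by metis
	moreover have "b ~= 0\<^sub>Z" using homsD(3)[OF assms(3)] homsD(2)[OF assms(1)] by auto
	ultimately show ?thesis using assms(2) unfolding homs_def ZN.FR_nonzero[symmetric] by auto
qed

abbreviation girr where "girr == graded_irreducible AZ XQ ws"
abbreviation prodl where "prodl as == foldr (\<otimes>\<^bsub>AZ\<^esub>) as 1\<^sub>Z"

lemma homogeneous_iff: "f ~= 0\<^sub>Z ==> f : homogeneous XQ ws \<longleftrightarrow> f : homs"
	unfolding homogeneous_def homs_def ZN.FR_nonzero[symmetric] by (auto dest: wsD(1))

lemma girrD:
	assumes "girr p"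
	shows "p : homs" "p \<notin> Units AZ"
		"!!b c. b : homs ==> c : homs ==> p = b *\<^sub>Z c ==> b : Units AZ | c : Units AZ"
	using assms homogeneous_iff homsD(3) unfolding graded_irreducible_def by metis+

lemma girrI:
	assumes "p : homs" "p \<notin> Units AZ"
		"!!b c. b : homs ==> c : homs ==> p = b *\<^sub>Z c ==> b : Units AZ | c : Units AZ"
	shows "girr p" unfolding graded_irreducible_def
proof (intro conjI ballI impI)
	show "p : homogeneous XQ ws" "p ~= 0\<^sub>Z" "p \<notin> Units AZ" using assms(1,2) homogeneous_iff homsD(3) by auto
	fix b c assume b: "b : homogeneous XQ ws" and c: "c : homogeneous XQ ws"
		and eq: "p = b *\<^sub>Z c"
	have "b : carrier AZ" "c : carrier AZ" using b c wsD(1) by (auto simp: homogeneous_def)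
	hence "b ~= 0\<^sub>Z" "c ~= 0\<^sub>Z" using eq homsD(3)[OF assms(1)] by auto
	thus "b : Units AZ | c : Units AZ" using assms(3) b c eq homogeneous_iff by simp
qed

lemma prodl_hom: "(!!b. b : set as ==> girr b) ==> prodl as : homs"
	by (induction as) (auto intro: homs_one homs_mult girrD(1))

lemma prodl_append:
	assumes "!!b. b : set as \<union> set bs ==> girr b"
	shows "prodl (as @ bs) = prodl as *\<^sub>Z prodl bs" using assms
proof (induction as)
	case Nil
	thus ?case using homsD(2)[OF prodl_hom[of bs]] by simp
next
	case (Cons a as)
	thus ?case using homsD(2)[OF prodl_hom[of bs]] homsD(2)[OF prodl_hom[of as]] homsD(2)[OF girrD(1)[of a]]
			by (simp add: ZN.FR.m_assoc)
qed

lemma prodl_member: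
	assumes "!!b. b : set as ==> girr b" "x : set as"
	shows "EX q:homs. prodl as = x *\<^sub>Z q" using assms
proof (induction as)
	case (Cons a as)
	have a: "a : homs" and x: "x : homs" and p: "prodl as : homs" using girrD(1) Cons.prems prodl_hom by auto
	show ?case
	proof (cases "x = a")
		case False
		then obtain q where q: "q : homs" "prodl as = x *\<^sub>Z q" using Cons by auto
		have "prodl (a # as) = x *\<^sub>Z (a *\<^sub>Z q)"
			using homsD(2)[OF a] homsD(2)[OF x] homsD(2)[OF q(1)] by (simp add: q(2) ZN.FR.m_lcomm)
		thus ?thesis using homs_mult[OF a q(1)] by auto
	qed (use p in auto)
qed simp

lemma unit_factor_left: "a : homs ==> b : homs ==> a *\<^sub>Z b : Units AZ ==> a : Units AZ"
	using ZN.FR.unit_factor[of a b] homsD(2) by simp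

lemma unit_times_girr:
	assumes u: "u : Units AZ" "u : homs" and p: "girr p"
	shows "girr (u *\<^sub>Z p)"
proof (rule girrI)
	note ph = girrD(1)[OF p]
	show "u *\<^sub>Z p : homs" using homs_mult u ph by simp
	show "u *\<^sub>Z p \<notin> Units AZ" using girrD(2)[OF p] unit_factor_left[of p u] u ph ZN.FR.m_comm[of u p] homsD(2) by auto
	fix b c assume bc: "b : homs" "c : homs" "u *\<^sub>Z p = b *\<^sub>Z c"
	define v where "v = inv\<^bsub>AZ\<^esub> u"
	have v: "v : carrier AZ" "u *\<^sub>Z v = 1\<^sub>Z" "v : Units AZ"
		unfolding v_def using u(1) ZN.FR.Units_inv_closed ZN.FR.Units_r_inv ZN.FR.Units_inv_Units by blast+
	have vh: "v : homs" using homs_cancel[OF u(2), of v] v homs_one by simp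
	have car: "u : carrier AZ" "p : carrier AZ" "b : carrier AZ" "c : carrier AZ" using homsD(2) u(2) ph bc by blast+
	have "p = (u *\<^sub>Z v) *\<^sub>Z p" using v(2) car by simp
	also have "\<dots> = v *\<^sub>Z (u *\<^sub>Z p)" using car v(1) by (simp add: ZN.FR.m_ac del: ZN.A_simps(1))
	also have "\<dots> = (v *\<^sub>Z b) *\<^sub>Z c" unfolding bc(3) using car v(1) by (simp add: ZN.FR.m_ac del: ZN.A_simps(1))
	finally have "v *\<^sub>Z b : Units AZ | c : Units AZ" using girrD(3)[OF p homs_mult[OF vh bc(1)] bc(2)] by simp
	thus "b : Units AZ | c : Units AZ" using unit_factor_left[of b v] vh bc(1) ZN.FR.m_comm[OF v(1) car(3)] by auto
qed

lemma scalar_unit: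
	assumes "f : scalars AZ" "f ~= 0\<^sub>Z"
	shows "f : Units AZ"
proof -
	obtain c where c: "f = c \<odot>\<^bsub>AZ\<^esub> 1\<^sub>Z" using assms(1) by (auto simp: scalars_def)
	have r: "d \<odot>\<^bsub>AZ\<^esub> 1\<^sub>Z : regs Z" for d using ZN.reg_smult[of "1\<^sub>Z" d] ZN.FR.one_closed by simp
	have "c ~= 0"
	proof
		assume "c = 0"
		hence "f = 0\<^sub>Z" using r[of c] ZN.FR.zero_closed by (intro ZN.reg_eqI) (auto simp: c)
		thus False using assms(2) by simp
	qed
	hence "(inverse c \<odot>\<^bsub>AZ\<^esub> 1\<^sub>Z) *\<^sub>Z f = 1\<^sub>Z"
		using r ZN.FR.m_closed[of "inverse c \<odot>\<^bsub>AZ\<^esub> 1\<^sub>Z" f] ZN.FR.one_closed by (intro ZN.reg_eqI) (auto simp: c)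
	thus ?thesis using ZN.FR.m_comm[of f "inverse c \<odot>\<^bsub>AZ\<^esub> 1\<^sub>Z"] r[of c] r[of "inverse c"] c unfolding Units_def by auto
qed

end

locale factorial_quotient = quasitorus_quotient Z Q rho V
	for Z :: "('z, 'k::{alg_closed_field, field_char_0}) variety" and Q :: "('g, 'k) alg_group"
		and rho :: "'g => 'z => 'z" and V :: "(('z => 'k) => 'k, 'k) variety" +
	assumes uncontracting: "uncontracting Q Z rho" and factorial: "factorially_graded_variety Q Z rho"
begin

lemma hom_unit_scalar: "f : homs ==> f : Units AZ ==> f : scalars AZ"
	using factorial homogeneous_iff homsD(3) unfolding factorially_graded_variety_def factorially_graded_def by blast

lemma factorization_exists:
	assumes "a : homs" "a \<notin> Units AZ"
	obtains as where "!!b. b : set as ==> girr b" "prodl as = a"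
proof -
	have "a : homogeneous XQ ws - scalars AZ" using assms homogeneous_iff homsD(3) scalar_unit by auto
	thus ?thesis
		using factorial that unfolding factorially_graded_variety_def factorially_graded_def graded_factorization_def by blast
qed

lemma factorization_unique:
	assumes "a : homs" "a \<notin> Units AZ" "!!b. b : set as \<union> set bs ==> girr b" "prodl as = a" "prodl bs = a"
	shows "essentially_equal AZ as bs"
proof -
	have "a : homogeneous XQ ws - scalars AZ" using assms(1,2) homogeneous_iff homsD(3) scalar_unit by auto
	moreover have "graded_factorization AZ XQ ws as a" "graded_factorization AZ XQ ws bs a"
		using assms by (auto simp: graded_factorization_def)
	ultimately show ?thesis using factorial unfolding factorially_graded_variety_def factorially_graded_def by blast
qed

text \<open>A factorization up to a unit, so that units have a factorization of length zero.\<close>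

definition fac :: "('z => 'k) list => ('z => 'k) => bool" where
	"fac as a \<longleftrightarrow> (ALL b:set as. girr b) & (EX u:Units AZ. a = u *\<^sub>Z prodl as)"

lemma fac_exists:
	assumes "a : homs"
	shows "EX as. fac as a"
proof (cases "a : Units AZ")
	case True
	hence "fac [] a" by (auto simp: fac_def intro!: bexI[of _ a])
	thus ?thesis ..
next
	case False
	then obtain as where "!!b. b : set as ==> girr b" "prodl as = a" using factorization_exists assms by auto
	hence "fac as a" using homsD(2)[OF assms] by (auto simp: fac_def intro!: bexI[of _ "1\<^sub>Z"])
	thus ?thesis ..
qed

lemma fac_absorb:
	assumes a: "a : homs" and fac: "fac (p # as) a"
	obtains u where "u : Units AZ" "u : homs" "girr (u *\<^sub>Z p)" "prodl ((u *\<^sub>Z p) # as) = a"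
proof -
	obtain u where u: "u : Units AZ" "a = u *\<^sub>Z prodl (p # as)" and irr: "girr p" "!!b. b : set as ==> girr b"
		using fac by (auto simp: fac_def)
	have uA: "u : carrier AZ" using u(1) by auto
	have ph: "p : homs" "prodl as : homs" "prodl (p # as) : homs" using girrD(1) irr prodl_hom[of as] homs_mult by auto
	have "prodl (p # as) *\<^sub>Z u = a" using u(2) uA homsD(2)[OF ph(3)] ZN.FR.m_comm by simp
	hence uh: "u : homs" using homs_cancel[OF ph(3), of u] uA a by simp
	have "prodl ((u *\<^sub>Z p) # as) = a" unfolding u(2) using uA homsD(2)[OF ph(1)] homsD(2)[OF ph(2)]
			by (simp add: ZN.FR.m_assoc del: ZN.A_simps(1))
	thus ?thesis using that u(1) uh unit_times_girr[OF u(1) uh irr(1)] by simp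
qed

lemma fac_nonunit:
	assumes a: "a : homs" and fac: "fac as a"
	shows "a : Units AZ \<longleftrightarrow> as = []"
proof
	assume aU: "a : Units AZ"
	show "as = []"
	proof (cases as)
		case (Cons p bs)
		obtain u where u: "girr (u *\<^sub>Z p)" "prodl ((u *\<^sub>Z p) # bs) = a" using fac_absorb[OF a fac[unfolded Cons]] by metis
		have "prodl bs : homs" using fac Cons by (intro prodl_hom) (auto simp: fac_def)
		hence "u *\<^sub>Z p : Units AZ" using unit_factor_left[OF girrD(1)[OF u(1)], of "prodl bs"] u(2) aU by simp
		thus ?thesis using girrD(2)[OF u(1)] by simp
	qed
next
	assume "as = []"
	thus "a : Units AZ" using fac by (auto simp: fac_def simp del: ZN.A_simps(1))
qed

lemma fac_length:
	assumes a: "a : homs" and fac: "fac as a" "fac bs a"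
	shows "length as = length bs"
proof (cases "a : Units AZ")
	case True
	thus ?thesis using fac_nonunit[OF a fac(1)] fac_nonunit[OF a fac(2)] by simp
next
	case False
	then obtain p as' q bs' where Cons: "as = p # as'" "bs = q # bs'"
		using fac_nonunit[OF a] fac by (metis neq_Nil_conv)
	obtain u where u: "girr (u *\<^sub>Z p)" "prodl ((u *\<^sub>Z p) # as') = a"
		using fac_absorb[OF a fac(1)[unfolded Cons]] by metis
	obtain v where v: "girr (v *\<^sub>Z q)" "prodl ((v *\<^sub>Z q) # bs') = a"
		using fac_absorb[OF a fac(2)[unfolded Cons]] by metis
	have "essentially_equal AZ ((u *\<^sub>Z p) # as') ((v *\<^sub>Z q) # bs')"
		using u v fac Cons by (intro factorization_unique[OF a False]) (auto simp: fac_def)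
	then obtain cs where "mset ((u *\<^sub>Z p) # as') = mset cs" "list_all2 (\<sim>\<^bsub>AZ\<^esub>) cs ((v *\<^sub>Z q) # bs')"
		by (auto simp: essentially_equal_def)
	hence "length ((u *\<^sub>Z p) # as') = length ((v *\<^sub>Z q) # bs')" using mset_eq_length list_all2_lengthD by metis
	thus ?thesis by (simp add: Cons)
qed

definition len :: "('z => 'k) => nat" where
	"len a = length (SOME as. fac as a)"

lemma len_eq: "a : homs ==> fac as a ==> len a = length as"
	unfolding len_def using fac_length[of a "SOME as. fac as a" as] someI[of "%as. fac as a" as] by simp

lemma fac_append:
	assumes "a : homs" "b : homs" "fac as a" "fac bs b"
	shows "fac (as @ bs) (a *\<^sub>Z b)"
proof -
	obtain u v where u: "u : Units AZ" "a = u *\<^sub>Z prodl as" and v: "v : Units AZ" "b = v *\<^sub>Z prodl bs"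
		and irr: "!!b. b : set as \<union> set bs ==> girr b" using assms by (auto simp: fac_def)
	have car: "u : carrier AZ" "v : carrier AZ" "prodl as : carrier AZ" "prodl bs : carrier AZ"
		using u v homsD(2)[OF prodl_hom] irr by auto
	have "a *\<^sub>Z b = (u *\<^sub>Z v) *\<^sub>Z prodl (as @ bs)"
		using prodl_append[OF irr] ZN.FR.rearrange(3)[OF car(1,3,2,4)] unfolding u(2) v(2) by metis
	thus ?thesis using irr ZN.FR.Units_m_closed[OF u(1) v(1)] unfolding fac_def by auto
qed

lemma len_mult: "a : homs ==> b : homs ==> len (a *\<^sub>Z b) = len a + len b"
proof -
	assume a: "a : homs" and b: "b : homs"
	obtain as bs where f: "fac as a" "fac bs b" using fac_exists[OF a] fac_exists[OF b] by auto
	show ?thesis using len_eq[OF a f(1)] len_eq[OF b f(2)] len_eq[OF homs_mult[OF a b] fac_append[OF a b f]] by simp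
qed

lemma len_unit: "a : homs ==> len a = 0 \<longleftrightarrow> a : Units AZ" using fac_exists[of a] fac_nonunit[of a] len_eq[of a] by auto

lemma irreducible_divisor:
	assumes "a : homs" "a \<notin> Units AZ"
	obtains p q where "girr p" "q : homs" "a = p *\<^sub>Z q"
proof -
	obtain as where as: "!!b. b : set as ==> girr b" "prodl as = a" using factorization_exists assms by auto
	have "as ~= []" using as(2) assms(2) by auto
	then obtain p bs where Cons: "as = p # bs" by (cases as) auto
	show ?thesis using that[of p "prodl bs"] as Cons prodl_hom[of bs] by auto
qed

text \<open>Unique factorization makes irreducible homogeneous elements prime among homogeneous ones.\<close>

lemma girr_prime:
	assumes p: "girr p" and a: "a : homs" and b: "b : homs" and c: "c : regs Z" "a *\<^sub>Z b = p *\<^sub>Z c"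
	shows "(EX q:regs Z. a = p *\<^sub>Z q) | (EX q:regs Z. b = p *\<^sub>Z q)"
proof -
	have ab: "a *\<^sub>Z b : homs" using homs_mult a b by simp
	have ph: "p : homs" using girrD(1)[OF p] .
	have ch: "c : homs" using homs_cancel[OF ph c(1)] ab c(2) by simp
	obtain as bs cs where f: "fac as a" "fac bs b" "fac cs c"
		using fac_exists[OF a] fac_exists[OF b] fac_exists[OF ch] by auto
	have pf: "fac [p] p" using p homsD(2)[OF ph] by (auto simp: fac_def intro!: bexI[of _ "1\<^sub>Z"])
	have f1: "fac (p # cs) (a *\<^sub>Z b)" using fac_append[OF ph ch pf f(3)] c(2) by simp
	have f2: "fac (as @ bs) (a *\<^sub>Z b)" using fac_append[OF a b f(1,2)] .
	have nonunit: "a *\<^sub>Z b \<notin> Units AZ" using fac_nonunit[OF ab f1] by simp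
	then obtain x xs where xs: "as @ bs = x # xs" using fac_nonunit[OF ab f2] by (cases "as @ bs") auto
	obtain u where u: "u : Units AZ" "u : homs" "girr (u *\<^sub>Z p)" "prodl ((u *\<^sub>Z p) # cs) = a *\<^sub>Z b"
		using fac_absorb[OF ab f1] by auto
	obtain v where v: "v : Units AZ" "v : homs" "girr (v *\<^sub>Z x)" "prodl ((v *\<^sub>Z x) # xs) = a *\<^sub>Z b"
		using fac_absorb[OF ab f2[unfolded xs]] by auto
	have irr: "!!y. y : set as \<union> set bs \<union> set cs ==> girr y" using f by (auto simp: fac_def)
	have "set xs \<subseteq> set as \<union> set bs" "x : set as \<union> set bs" using arg_cong[OF xs, of set] by auto
	hence "essentially_equal AZ ((u *\<^sub>Z p) # cs) ((v *\<^sub>Z x) # xs)"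
		using u v irr by (intro factorization_unique[OF ab nonunit]) auto
	then obtain ds where ds: "mset ((u *\<^sub>Z p) # cs) = mset ds" "list_all2 (\<sim>\<^bsub>AZ\<^esub>) ds ((v *\<^sub>Z x) # xs)"
		by (auto simp: essentially_equal_def)
	have "u *\<^sub>Z p : set ds" using mset_eq_setD[OF ds(1)] by auto
	then obtain y where y: "y : set ((v *\<^sub>Z x) # xs)" "u *\<^sub>Z p \<sim>\<^bsub>AZ\<^esub> y"
		using ds(2) by (metis in_set_conv_nth list_all2_conv_all_nth)
	then obtain e where e: "e : carrier AZ" "y = u *\<^sub>Z p *\<^sub>Z e" by (auto simp: associated_def factor_def)
	have car: "u : carrier AZ" "v : carrier AZ" "p : carrier AZ" "x : carrier AZ"
		using homsD(2) u(2) v(2) ph girrD(1)[OF irr] \<open>x : set as \<union> set bs\<close> by blast+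
	have y': "EX w:set as \<union> set bs. EX q:carrier AZ. w = p *\<^sub>Z q"
	proof (cases "y = v *\<^sub>Z x")
		case True
		define v' where "v' = inv\<^bsub>AZ\<^esub> v"
		have v': "v' : carrier AZ" "v' *\<^sub>Z v = 1\<^sub>Z"
			unfolding v'_def using v(1) ZN.FR.Units_inv_closed ZN.FR.Units_l_inv by blast+
		have "x = v' *\<^sub>Z (v *\<^sub>Z x)" using v' car by (simp add: ZN.FR.m_assoc[symmetric] del: ZN.A_simps(1))
		also have "\<dots> = p *\<^sub>Z (v' *\<^sub>Z u *\<^sub>Z e)"
			unfolding True[symmetric] e(2) by (rule ZN.FR.rearrange(2)[OF v'(1) car(1,3) e(1)])
		finally have "x = p *\<^sub>Z (v' *\<^sub>Z u *\<^sub>Z e)" .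
		moreover have "v' *\<^sub>Z u *\<^sub>Z e : carrier AZ" by (rule ZN.FR.m_closed[OF ZN.FR.m_closed[OF v'(1) car(1)] e(1)])
		ultimately show ?thesis using \<open>x : set as \<union> set bs\<close> by auto
	next
		case False
		hence "y : set as \<union> set bs" using y(1) \<open>set xs \<subseteq> set as \<union> set bs\<close> by auto
		moreover have "y = p *\<^sub>Z (u *\<^sub>Z e)" unfolding e(2) by (rule ZN.FR.rearrange(1)[OF car(1,3) e(1) e(1)])
		moreover have "u *\<^sub>Z e : carrier AZ" by (rule ZN.FR.m_closed[OF car(1) e(1)])
		ultimately show ?thesis by auto
	qed
	then obtain w q where w: "w : set as \<union> set bs" "q : carrier AZ" "w = p *\<^sub>Z q" by blast
	have div: "EX q:regs Z. d = p *\<^sub>Z q" if d: "d : homs" "fac es d" "w : set es" for d es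
	proof -
		obtain u' where u': "u' : Units AZ" "d = u' *\<^sub>Z prodl es" using d(2) by (auto simp: fac_def)
		obtain r where r: "r : homs" "prodl es = w *\<^sub>Z r" using prodl_member[of es w] d by (auto simp: fac_def)
		have rc: "r : carrier AZ" "u' : carrier AZ" using homsD(2)[OF r(1)] ZN.FR.Units_closed[OF u'(1)] by auto
		have "d = p *\<^sub>Z (u' *\<^sub>Z q *\<^sub>Z r)"
			unfolding u'(2) r(2) w(3) using car w(2) rc by (simp add: ZN.FR.m_ac del: ZN.A_simps(1))
		moreover have "u' *\<^sub>Z q *\<^sub>Z r : regs Z" using ZN.FR.m_closed[OF ZN.FR.m_closed[OF rc(2) w(2)] rc(1)] by simp
		ultimately show ?thesis by blast
	qed
	show ?thesis using w(1) div[OF a f(1)] div[OF b f(2)] by auto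
qed

text \<open>A greatest common divisor: a common divisor with the largest number of factors.\<close>

lemma greatest_common_divisor:
	assumes G: "G \<subseteq> homs" "G ~= {}"
	obtains d where "d : homs" "!!e. e : G ==> EX q:homs. e = d *\<^sub>Z q"
		"!!p. girr p ==> EX q:homs. d *\<^sub>Z q : G & \<not> (EX r:regs Z. q = p *\<^sub>Z r)"
proof -
	define P where "P d \<longleftrightarrow> d : homs & (ALL e:G. EX q:homs. e = d *\<^sub>Z q)" for d
	obtain e0 where e0: "e0 : G" using G(2) by auto
	have "P 1\<^sub>Z" unfolding P_def using homs_one G(1) homsD(2) ZN.FR.l_one by auto
	moreover have bound: "len d \<le> len e0" if d: "P d" for d
	proof -
		obtain q where "q : homs" "e0 = d *\<^sub>Z q" using d e0 unfolding P_def by blast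
		thus ?thesis using len_mult d unfolding P_def by simp
	qed
	ultimately have Greatest_len: "EX d. P d & (ALL d'. P d' --> len d' \<le> len d)"
		by (intro ex_has_greatest_nat[of P "1\<^sub>Z" len "Suc (len e0)"]) (auto simp: le_imp_less_Suc)
	then obtain d where d: "P d" "!!d'. P d' ==> len d' \<le> len d" by metis
	have dh: "d : homs" using d(1) by (simp add: P_def)
	have "EX q:homs. d *\<^sub>Z q : G & \<not> (EX r:regs Z. q = p *\<^sub>Z r)" if p: "girr p" for p
	proof (rule ccontr)
		assume no: "\<not> (EX q:homs. d *\<^sub>Z q : G & \<not> (EX r:regs Z. q = p *\<^sub>Z r))"
		have ph: "p : homs" using girrD(1)[OF p] .
		have "EX q:homs. e = (d *\<^sub>Z p) *\<^sub>Z q" if e: "e : G" for e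
		proof -
			obtain q where q: "q : homs" "e = d *\<^sub>Z q" using d(1) e unfolding P_def by blast
			then obtain r where r: "r : regs Z" "q = p *\<^sub>Z r" using no e by auto
			have "r : homs" using homs_cancel[OF ph r(1)] q r by simp
			moreover have "e = (d *\<^sub>Z p) *\<^sub>Z r"
				unfolding q(2) r(2) using homsD(2)[OF dh] homsD(2)[OF ph] r(1) by (simp add: ZN.FR.m_assoc)
			ultimately show ?thesis by blast
		qed
		hence "P (d *\<^sub>Z p)" unfolding P_def using homs_mult[OF dh ph] by simp
		hence "len (d *\<^sub>Z p) \<le> len d" using d(2) by simp
		thus False using len_mult[OF dh ph] len_unit[OF ph] girrD(2)[OF p] by simp
	qed
	thus ?thesis using that dh d(1) unfolding P_def by blast
qed

end

section \<open>Multipliers of divisors\<close>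

context factorial_quotient begin

abbreviation RZ where "RZ == rZ ` regs Z"

definition hfracs :: "('z, 'k) rat_fun set" where
	"hfracs = {quot_fun Z a b | a b. a : homs & b : homs}"

definition multipliers :: "(('z => 'k) => 'k) divisor => ('z, 'k) rat_fun set" where
	"multipliers D = {h : hfracs.
		 (ALL f:OV D. inc f *\<^sub>K h : RZ) \<and>
		 (ALL f:OV (- D). inc f *\<^sub>K inv\<^sub>K h : RZ)}"

lemma hfracsE:
	assumes "h : hfracs"
	obtains a b where "a : homs" "b : homs" "h = quot_fun Z a b" using assms by (auto simp: hfracs_def)

lemma hfracs_Kx: "h : hfracs ==> h : ZN.Kx"
proof (elim hfracsE)
	fix a b assume "a : homs" "b : homs" "h = quot_fun Z a b"
	thus "h : ZN.Kx" using ZN.quot_Kx[of a b] homsD(1) by simp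
qed

lemma hfracs_mult:
	assumes "h : hfracs" "h' : hfracs"
	shows "h *\<^sub>K h' : hfracs"
proof -
	obtain a b c d where h: "a : homs" "b : homs" "h = quot_fun Z a b"
		"c : homs" "d : homs" "h' = quot_fun Z c d" using assms by (auto simp: hfracs_def)
	hence "h *\<^sub>K h' = quot_fun Z (a *\<^sub>Z c) (b *\<^sub>Z d)" using ZN.quot_mult[of a b c d] homsD(1) ZN.nzsD by simp
	thus ?thesis unfolding hfracs_def using homs_mult[OF h(1,4)] homs_mult[OF h(2,5)] by auto
qed

lemma quot_inv:
	assumes "a : ZN.nzs" "b : ZN.nzs"
	shows "inv\<^sub>K quot_fun Z a b = quot_fun Z b a"
proof (rule ZN.K.comm_inv_char)
	show "quot_fun Z a b : carrier KZ" "quot_fun Z b a : carrier KZ" using ZN.quot_Kx assms by blast+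
	have "quot_fun Z a b *\<^sub>K quot_fun Z b a = quot_fun Z (a *\<^sub>Z b) (b *\<^sub>Z a)"
		using ZN.quot_mult[of a b b a] assms ZN.nzsD by simp
	also have "\<dots> = quot_fun Z 1\<^sub>Z 1\<^sub>Z"
		using assms ZN.quot_eq_iff[of "a *\<^sub>Z b" "b *\<^sub>Z a" "1\<^sub>Z" "1\<^sub>Z"] ZN.nzs_mult[of b a] ZN.nzs_one ZN.nzsD ZN.FR.m_comm[of a b]
			by simp
	also have "\<dots> = 1\<^sub>K" using ZN.rat.hom_one by (simp add: rat_of_reg_def)
	finally show "quot_fun Z a b *\<^sub>K quot_fun Z b a = 1\<^sub>K" .
qed

lemma hfracs_inv: "h : hfracs ==> inv\<^sub>K h : hfracs" unfolding hfracs_def using quot_inv homsD(1) by blast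

lemma RZ_mult: "x : RZ ==> y : RZ ==> x *\<^sub>K y : RZ"
proof (elim imageE)
	fix a b assume ab: "x = rZ a" "y = rZ b" "a : regs Z" "b : regs Z"
	hence "x *\<^sub>K y = rZ (a *\<^sub>Z b)" "a *\<^sub>Z b : regs Z" using ZN.FR.m_closed[of a b] by auto
	thus ?thesis by blast
qed

lemma multipliersD:
	assumes "h : multipliers D"
	shows "h : hfracs" "h : ZN.Kx" "!!f. f : OV D ==> inc f *\<^sub>K h : RZ"
		"!!f. f : OV (- D) ==> inc f *\<^sub>K inv\<^sub>K h : RZ" using assms hfracs_Kx unfolding multipliers_def by blast+

lemma sections_inc: "f : OV D ==> inc f : carrier KZ" using VN.sections_carrier by simp

lemma multipliers_uminus: "h : multipliers D ==> inv\<^sub>K h : multipliers (- D)"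
proof -
	assume h: "h : multipliers D"
	have "inv\<^sub>K (inv\<^sub>K h) = h" using multipliersD(2)[OF h] ZN.Kx_Units ZN.K.Units_inv_inv by simp
	thus ?thesis using h hfracs_inv by (auto simp: multipliers_def)
qed

text \<open>Being a multiplier can be tested locally, and locally the sections of a sum of divisors are
	products of sections.\<close>

lemma multiplier_product_regular:
	assumes D: "D : carrier (weil_divisors V)" and h: "h : multipliers D" "h' : multipliers D'"
		and f: "f : OV (D + D')"
	shows "inc f *\<^sub>K (h *\<^sub>K h') : RZ"
proof (rule regular_if_locally_regular[OF uncontracting D])
	have car: "h : carrier KZ" "h' : carrier KZ" "inc f : carrier KZ"
		using multipliersD(2)[OF h(1)] multipliersD(2)[OF h(2)] sections_inc[OF f] by blast+
	thus "inc f *\<^sub>K (h *\<^sub>K h') : carrier KZ" by simp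
	fix s s' assume s: "s : OV D" "s' : OV (- D)"
	have sc: "s : carrier KV" "s' : carrier KV" "f : carrier KV" "inc s : carrier KZ" "inc s' : carrier KZ"
		using s f VN.sections_carrier sections_inc by blast+
	have "s' *\<^sub>L f : OV (- D + (D + D'))" using VN.sections_mult s(2) f by blast
	hence "s' *\<^sub>L f : OV D'" by simp
	hence "(inc s *\<^sub>K h) *\<^sub>K (inc (s' *\<^sub>L f) *\<^sub>K h') : RZ"
		using multipliersD(3)[OF h(1) s(1)] multipliersD(3)[OF h(2)] RZ_mult by blast
	moreover have "(inc s *\<^sub>K h) *\<^sub>K (inc (s' *\<^sub>L f) *\<^sub>K h')
			= inc (s *\<^sub>L s') *\<^sub>K (inc f *\<^sub>K (h *\<^sub>K h'))" using sc car by (simp add: ZN.K.m_ac)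
	ultimately show "inc (s *\<^sub>L s') *\<^sub>K (inc f *\<^sub>K (h *\<^sub>K h')) : RZ" by simp
qed

lemma multipliers_add:
	assumes D: "D : carrier (weil_divisors V)" and h: "h : multipliers D" "h' : multipliers D'"
	shows "h *\<^sub>K h' : multipliers (D + D')"
proof -
	have "inv\<^sub>K (h *\<^sub>K h') = inv\<^sub>K h *\<^sub>K inv\<^sub>K h'"
	proof (rule ZN.K.comm_inv_char)
		have i: "h : carrier KZ" "h' : carrier KZ" "inv\<^sub>K h : carrier KZ" "inv\<^sub>K h' : carrier KZ"
			"h *\<^sub>K inv\<^sub>K h = 1\<^sub>K" "h' *\<^sub>K inv\<^sub>K h' = 1\<^sub>K"
			using multipliersD(2)[OF h(1)] multipliersD(2)[OF h(2)] ZN.Kx_inv by blast+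
		thus "h *\<^sub>K h' : carrier KZ" "inv\<^sub>K h *\<^sub>K inv\<^sub>K h' : carrier KZ" by simp_all
		show "h *\<^sub>K h' *\<^sub>K (inv\<^sub>K h *\<^sub>K inv\<^sub>K h') = 1\<^sub>K" unfolding ZN.K.rearrange(3)[OF i(1,2,3,4)] i(5,6) by simp
	qed
	hence "inc f *\<^sub>K inv\<^sub>K (h *\<^sub>K h') : RZ" if "f : OV (- (D + D'))" for f
		using multiplier_product_regular[OF VN.weil_uminus[OF D] multipliers_uminus[OF h(1)] multipliers_uminus[OF h(2)]] that
			by simp
	thus ?thesis using multiplier_product_regular[OF D h] hfracs_mult multipliersD(1)[OF h(1)] multipliersD(1)[OF h(2)]
			by (simp add: multipliers_def)
qed

abbreviation scalar :: "'k => ('z, 'k) rat_fun" where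
	"scalar c == rZ (c \<odot>\<^bsub>AZ\<^esub> 1\<^sub>Z)"

lemma const_regs: "c \<odot>\<^bsub>AZ\<^esub> 1\<^sub>Z : regs Z" using ZN.reg_smult[of "1\<^sub>Z" c] ZN.FR.one_closed by simp

lemma points_nonempty: "EX z. z : points Z" using ZN.nzs_one by (auto simp: ZN.nzs_def)

lemma const_zero_iff: "c \<odot>\<^bsub>AZ\<^esub> 1\<^sub>Z = 0\<^sub>Z \<longleftrightarrow> c = 0"
proof
	assume eq: "c \<odot>\<^bsub>AZ\<^esub> 1\<^sub>Z = 0\<^sub>Z"
	obtain z where z: "z : points Z" using points_nonempty by auto
	show "c = 0" using arg_cong[OF eq, of "%f. f z"] z by simp
next
	assume "c = 0"
	thus "c \<odot>\<^bsub>AZ\<^esub> 1\<^sub>Z = 0\<^sub>Z" using const_regs ZN.FR.zero_closed by (intro ZN.reg_eqI) auto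
qed

lemma const_hom: "c ~= 0 ==> c \<odot>\<^bsub>AZ\<^esub> 1\<^sub>Z : homs"
	using homs_invariant[of "c \<odot>\<^bsub>AZ\<^esub> 1\<^sub>Z"] invariants_closed(3,4) const_regs const_zero_iff[of c]
	unfolding ZN.FR_nonzero[symmetric] by simp

lemma const_mult: "(c * d) \<odot>\<^bsub>AZ\<^esub> 1\<^sub>Z = (c \<odot>\<^bsub>AZ\<^esub> 1\<^sub>Z) *\<^sub>Z (d \<odot>\<^bsub>AZ\<^esub> 1\<^sub>Z)"
	using const_regs ZN.FR.m_closed[of "c \<odot>\<^bsub>AZ\<^esub> 1\<^sub>Z" "d \<odot>\<^bsub>AZ\<^esub> 1\<^sub>Z"] by (intro ZN.reg_eqI) auto

lemma const_one: "1 \<odot>\<^bsub>AZ\<^esub> 1\<^sub>Z = 1\<^sub>Z" using const_regs ZN.FR.one_closed by (intro ZN.reg_eqI) auto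

lemma scalar_closed: "scalar c : carrier KZ" using ZN.rat_closed const_regs by simp

lemma scalar_mult: "scalar (c * d) = scalar c *\<^sub>K scalar d"
	unfolding const_mult using const_regs by (intro ZN.rat.hom_mult) simp_all

lemma scalar_one: "scalar 1 = 1\<^sub>K" unfolding const_one by (rule ZN.rat.hom_one)

lemma scalar_inv: "c ~= 0 ==> inv\<^sub>K scalar c = scalar (inverse c)"
	using scalar_mult[of c "inverse c"] scalar_closed scalar_one by (intro ZN.K.comm_inv_char) simp_all

lemma rat_hom_fraction: "a : homs ==> rZ a : hfracs" unfolding hfracs_def rat_of_reg_def using homs_one by auto

lemma inc_multiplier:
	assumes w: "w : VN.Kx"
	shows "inc w : multipliers (div_of V w)"
proof -
	obtain a b where ab: "a : VN.nzs" "b : VN.nzs" "w = quot_fun V a b" using w by (rule VN.Kx_quotE)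
	have "inc w : hfracs"
		unfolding ab(3) hfracs_def using inc_quot[OF VN.nzsD[OF ab(1)] ab(2)] homs_invariant pull_B0 pull_nonzero ab VN.nzsD
			by blast
	moreover have reg: "inc f *\<^sub>K inc x : RZ" if x: "x : VN.Kx" and f: "f : OV (div_of V x)" for x f
	proof -
		have "x *\<^sub>L f : OV 0" using VN.sections_div_mult[OF f x] by simp
		then obtain c where c: "c : regs V" "x *\<^sub>L f = rV c" unfolding VN.sections_0 by blast
		have "inc f *\<^sub>K inc x = inc (x *\<^sub>L f)" using x VN.sections_carrier[OF f] by (simp add: ZN.K.m_comm)
		thus ?thesis unfolding c(2) inc_rat[OF c(1)] using pull_regs[OF c(1)] by simp
	qed
	moreover have "inc f *\<^sub>K inv\<^sub>K inc w : RZ" if f: "f : OV (- div_of V w)" for f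
		using reg[OF VN.Kx_inv(1)[OF w]] f VN.div_inv[OF w] inc_inv[OF w] by simp
	ultimately show ?thesis using w by (simp add: multipliers_def)
qed

lemma scalar_multiplier: "c ~= 0 ==> scalar c : multipliers 0"
proof -
	assume c: "c ~= 0"
	have "scalar d : RZ" for d using const_regs by simp
	moreover have "inc f : RZ" if "f : OV 0" for f using that inc_rat pull_regs unfolding VN.sections_0 by auto
	ultimately show ?thesis
		using rat_hom_fraction[OF const_hom[OF c]] scalar_inv[OF c] RZ_mult by (auto simp: multipliers_def)
qed

text \<open>A multiplier of zero is a homogeneous unit, and these are the scalars.\<close>

lemma multipliers_0:
	assumes h: "h : multipliers 0"
	obtains c where "c ~= 0" "h = scalar c"
proof -
	have one: "1\<^sub>L : OV 0" unfolding VN.sections_0 using VN.rat.hom_one VN.FR.one_closed by (metis VN.A_simps(1) imageI)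
	have hK: "h : carrier KZ" "inv\<^sub>K h : carrier KZ" using multipliersD(2)[OF h] ZN.Kx_inv(1) by blast+
	have "h : RZ" "inv\<^sub>K h : RZ" using multipliersD(3)[OF h one] multipliersD(4)[OF h, of "1\<^sub>L"] one hK by auto
	then obtain u v where u: "u : regs Z" "h = rZ u" and v: "v : regs Z" "inv\<^sub>K h = rZ v" by blast
	have "rZ (u *\<^sub>Z v) = 1\<^sub>K" using ZN.Kx_inv(2)[OF multipliersD(2)[OF h]] u v by simp
	hence "rZ (u *\<^sub>Z v) = rZ 1\<^sub>Z" by simp
	hence "u *\<^sub>Z v = 1\<^sub>Z" using ZN.rat_eq_iff[of "u *\<^sub>Z v" "1\<^sub>Z"] ZN.FR.m_closed[of u v] ZN.FR.one_closed u v by simp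
	hence unit: "u : Units AZ" using u(1) v(1) ZN.FR.m_comm[of u v] unfolding Units_def by auto
	obtain a b where ab: "a : homs" "b : homs" "h = quot_fun Z a b" using multipliersD(1)[OF h] by (rule hfracsE)
	have "a *\<^sub>Z 1\<^sub>Z = u *\<^sub>Z b" using ZN.quot_eq_iff[of a b u "1\<^sub>Z"] ab u ZN.nzs_one homsD(1) ZN.nzsD
			by (metis rat_of_reg_def)
	hence "b *\<^sub>Z u = a" using homsD(2)[OF ab(1)] homsD(2)[OF ab(2)] u(1) ZN.FR.m_comm[of b u] by simp
	hence "u : homs" using homs_cancel[OF ab(2) u(1)] ab(1) by simp
	hence "u : scalars AZ" using hom_unit_scalar unit by simp
	then obtain c where c: "u = c \<odot>\<^bsub>AZ\<^esub> 1\<^sub>Z" by (auto simp: scalars_def)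
	have "c ~= 0" using const_zero_iff[of c] homsD(3)[OF \<open>u : homs\<close>] c by simp
	thus ?thesis using that u(2) c by simp
qed

lemma multipliers_unique:
	assumes D: "D : carrier (weil_divisors V)" and h: "h : multipliers D" "h' : multipliers D"
	obtains c where "c ~= 0" "h' = scalar c *\<^sub>K h"
proof -
	have "h' *\<^sub>K inv\<^sub>K h : multipliers (D + - D)" using multipliers_add[OF D h(2) multipliers_uminus[OF h(1)]] .
	hence "h' *\<^sub>K inv\<^sub>K h : multipliers 0" by simp
	then obtain c where c: "c ~= 0" "h' *\<^sub>K inv\<^sub>K h = scalar c" by (rule multipliers_0)
	have car: "h : carrier KZ" "h' : carrier KZ" "inv\<^sub>K h : carrier KZ" "inv\<^sub>K h *\<^sub>K h = 1\<^sub>K"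
		using multipliersD(2)[OF h(1)] multipliersD(2)[OF h(2)] ZN.Kx_inv[of h] ZN.K.m_comm[of h "inv\<^sub>K h"] by auto
	have "h' = (h' *\<^sub>K inv\<^sub>K h) *\<^sub>K h" using car by (simp add: ZN.K.m_assoc)
	thus ?thesis using that c by simp
qed

text \<open>Existence. With a common denominator \<open>d\<close> of the sections of \<open>D\<close>, the greatest common divisor
	\<open>g\<close> of the products \<open>d f\<close> defines \<open>h = d / g\<close>. By construction \<open>h\<close> makes the sections
	of \<open>D\<close> regular without common factor; if an irreducible element occurred in the denominator of
	\<open>f' / h\<close> for a section \<open>f'\<close> of \<open>- D\<close>, it would divide all of them, because \<open>f' f\<close> is regular.\<close>

lemma multiplier_exists:
	assumes D: "D : carrier (weil_divisors V)"
	obtains h where "h : multipliers D"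
proof -
	obtain f0 where f0: "f0 : OV (- D)" "f0 : VN.Kx" using VN.sections_nonzero[OF VN.weil_uminus[OF D]] by auto
	obtain f1 where f1: "f1 : OV D" "f1 : VN.Kx" using VN.sections_nonzero[OF D] by auto
	obtain d b where db: "d : VN.nzs" "b : VN.nzs" "f0 = quot_fun V d b" using f0(2) by (rule VN.Kx_quotE)
	have dr: "d : regs V" "b : regs V" using db VN.nzsD by blast+
	have dd: "EX e:regs V. rV e = rV d *\<^sub>L f" if f: "f : OV D" for f
	proof -
		have fK: "f : carrier KV" "f0 : carrier KV" using VN.sections_carrier f f0(1) by blast+
		have "f0 *\<^sub>L f : OV 0" using VN.sections_mult[OF f0(1) f] by simp
		then obtain c where c: "c : regs V" "f0 *\<^sub>L f = rV c" unfolding VN.sections_0 by blast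
		have "rV d = f0 *\<^sub>L rV b" unfolding db(3) using VN.quot_rat[OF dr(1) db(2)] by simp
		hence "rV d *\<^sub>L f = (f0 *\<^sub>L f) *\<^sub>L rV b" using fK VN.rat_closed[OF dr(2)] by (simp add: VN.K.m_ac)
		also have "\<dots> = rV (c *\<^sub>V b)" unfolding c(2) using c(1) dr(2) by simp
		finally show ?thesis using VN.FR.m_closed[of c b] c(1) dr(2) by (metis VN.A_simps(1))
	qed
	define G where "G = {pull e | e. e : VN.nzs & (EX f:OV D. rV e = rV d *\<^sub>L f)}"
	have GI: "pull e : G" if "e : VN.nzs" "f : OV D" "rV e = rV d *\<^sub>L f" for e f using that unfolding G_def by blast
	have Gh: "G \<subseteq> homs" unfolding G_def using homs_invariant pull_B0 pull_nonzero VN.nzsD by auto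
	obtain e1 where e1: "e1 : regs V" "rV e1 = rV d *\<^sub>L f1" using dd[OF f1(1)] by auto
	have "rV e1 ~= 0\<^sub>L" using VN.Kx_mult[OF VN.rat_Kx[OF db(1)] f1(2)] unfolding e1(2) by blast
	hence "e1 ~= 0\<^sub>V" using VN.rat_zero_iff[OF e1(1)] by simp
	hence "e1 : VN.nzs" using e1(1) unfolding VN.FR_nonzero[symmetric] by simp
	hence Gne: "G ~= {}" using GI[OF _ f1(1) e1(2)] by auto
	obtain g where g: "g : homs" "!!e. e : G ==> EX q:homs. e = g *\<^sub>Z q"
		"!!p. girr p ==> EX q:homs. g *\<^sub>Z q : G & \<not> (EX r:regs Z. q = p *\<^sub>Z r)"
		using greatest_common_divisor[OF Gh Gne] by auto
	define pd where "pd = pull d"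
	have pd: "pd : homs" "pd : ZN.nzs" "pd : regs Z"
		unfolding pd_def using homs_invariant pull_B0[OF dr(1)] pull_nonzero[OF db(1)] pull_regs[OF dr(1)] by blast+
	have gn: "g : ZN.nzs" "g : regs Z" using homsD(1)[OF g(1)] ZN.nzsD by blast+
	define h where "h = quot_fun Z pd g"
	have h: "h : hfracs" "h : ZN.Kx" "h *\<^sub>K rZ g = rZ pd"
		unfolding h_def hfracs_def using pd g(1) ZN.quot_Kx[OF pd(2) gn(1)] ZN.quot_rat[OF pd(3) gn(1)] by blast+
	have hK: "h : carrier KZ" "inv\<^sub>K h : carrier KZ" "h *\<^sub>K inv\<^sub>K h = 1\<^sub>K" using h(2) ZN.Kx_inv[OF h(2)] by blast+
	have gK: "rZ g : carrier KZ" "rZ g ~= 0\<^sub>K" using ZN.rat_Kx[OF gn(1)] by blast+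
	have key: "inc f *\<^sub>K h = rZ q"
		if e: "e : regs V" "rV e = rV d *\<^sub>L f" "f : OV D"
			and q: "q : regs Z" "pull e = g *\<^sub>Z q" for e f q
	proof (rule ZN.K.m_rcancel[THEN iffD1])
		have fK: "f : carrier KV" "inc f : carrier KZ" using VN.sections_carrier[OF e(3)] sections_inc[OF e(3)] by blast+
		show "rZ g ~= 0\<^sub>K" "rZ g : carrier KZ" "inc f *\<^sub>K h : carrier KZ" "rZ q : carrier KZ"
			using gK fK hK ZN.rat_closed[OF q(1)] by auto
		have "(inc f *\<^sub>K h) *\<^sub>K rZ g = inc f *\<^sub>K rZ pd" using fK hK gK h(3) by (simp add: ZN.K.m_assoc)
		also have "\<dots> = inc (rV d *\<^sub>L f)"
			unfolding pd_def using fK VN.rat_closed[OF dr(1)] inc_rat[OF dr(1)] ZN.K.m_comm ZN.rat_closed[OF pull_regs[OF dr(1)]] by simp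
		also have "\<dots> = rZ (pull e)" unfolding e(2)[symmetric] by (rule inc_rat[OF e(1)])
		also have "\<dots> = rZ q *\<^sub>K rZ g" unfolding q(2) using gn(2) q(1) ZN.K.m_comm by simp
		finally show "(inc f *\<^sub>K h) *\<^sub>K rZ g = rZ q *\<^sub>K rZ g" .
	qed
	have pos: "inc f *\<^sub>K h : RZ" if f: "f : OV D" for f
	proof (cases "f = 0\<^sub>L")
		case True
		hence "inc f *\<^sub>K h = rZ 0\<^sub>Z" using hK by simp
		thus ?thesis using ZN.FR.zero_closed by (metis ZN.A_simps(1) imageI)
	next
		case False
		obtain e where e: "e : regs V" "rV e = rV d *\<^sub>L f" using dd[OF f] by auto
		have "f : VN.Kx" using False VN.sections_carrier[OF f] by simp
		hence "rV e ~= 0\<^sub>L" using VN.Kx_mult[OF VN.rat_Kx[OF db(1)], of f] unfolding e(2) by blast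
		hence "e : VN.nzs" using VN.rat_zero_iff[OF e(1)] e(1) unfolding VN.FR_nonzero[symmetric] by auto
		then obtain q where q: "q : homs" "pull e = g *\<^sub>Z q" using g(2)[OF GI[OF _ f e(2)]] by auto
		hence "q : regs Z" using homsD(1) ZN.nzsD by simp
		thus ?thesis using key[OF e f _ q(2)] by simp
	qed
	have neg: "inc f' *\<^sub>K inv\<^sub>K h : RZ" if f': "f' : OV (- D)" for f'
	proof (cases "f' = 0\<^sub>L")
		case True
		hence "inc f' *\<^sub>K inv\<^sub>K h = rZ 0\<^sub>Z" using hK by simp
		thus ?thesis using ZN.FR.zero_closed by (metis ZN.A_simps(1) imageI)
	next
		case False
		hence f'K: "f' : VN.Kx" using VN.sections_carrier[OF f'] by simp
		define y where "y = inc f' *\<^sub>K inv\<^sub>K h"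
		have yK: "y : carrier KZ" "inc f' : carrier KZ" using hK inc_Kx[OF f'K] by (auto simp: y_def)
		have "y : hfracs"
			unfolding y_def using hfracs_mult hfracs_inv[OF h(1)] multipliersD(1)[OF inc_multiplier[OF f'K]] by simp
		hence ex: "EX m n. m : homs & n : homs & y = quot_fun Z n m" by (auto simp: hfracs_def)
		define P where "P m \<longleftrightarrow> m : homs & (EX n:homs. y = quot_fun Z n m)" for m
		have "EX m. P m" using ex unfolding P_def by blast
		then obtain m where Pm: "P m" and least: "!!m'. P m' ==> len m \<le> len m'"
			using ex_has_least_nat[of P _ len] by auto
		obtain n where m: "m : homs" and n: "n : homs" "y = quot_fun Z n m" using Pm unfolding P_def by blast
		have mr: "m : ZN.nzs" "m : regs Z" "n : ZN.nzs" "n : regs Z"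
			using homsD(1)[OF m] homsD(1)[OF n(1)] ZN.nzsD by blast+
		have ym: "y *\<^sub>K rZ m = rZ n" unfolding n(2) by (rule ZN.quot_rat[OF mr(4,1)])
		have "m : Units AZ"
		proof (rule ccontr)
			assume "m \<notin> Units AZ"
			then obtain p m' where p: "girr p" "m' : homs" "m = p *\<^sub>Z m'" using irreducible_divisor m by auto
			have ph: "p : homs" "p : regs Z" "p : ZN.nzs" and mh': "m' : regs Z" "m' : ZN.nzs"
				using girrD(1)[OF p(1)] homsD(1) p(2) ZN.nzsD by blast+
			have ndvd: "\<not> (EX r:regs Z. n = p *\<^sub>Z r)"
			proof
				assume "EX r:regs Z. n = p *\<^sub>Z r"
				then obtain r where r: "r : regs Z" "n = p *\<^sub>Z r" by blast
				have rh: "r : homs" using homs_cancel[OF ph(1) r(1)] n(1) r(2) by simp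
				have "n *\<^sub>Z m' = r *\<^sub>Z m" unfolding r(2) p(3) using ZN.FR.rearrange(1)[of p r m' m'] ph(2) r(1) mh'(1) by simp
				hence "y = quot_fun Z r m'" unfolding n(2) using ZN.quot_eq_iff[OF mr(4,1) r(1) mh'(2)] by simp
				hence "P m'" unfolding P_def using p(2) rh by auto
				hence "len m \<le> len m'" by (rule least)
				thus False unfolding p(3) using len_mult[OF ph(1) p(2)] len_unit[OF ph(1)] girrD(2)[OF p(1)] by simp
			qed
			obtain q where q: "q : homs" "g *\<^sub>Z q : G" "\<not> (EX r:regs Z. q = p *\<^sub>Z r)" using g(3)[OF p(1)] by auto
			have qr: "q : regs Z" using homsD(1)[OF q(1)] ZN.nzsD by simp
			obtain e f where ef: "pull e = g *\<^sub>Z q" "e : VN.nzs" "f : OV D"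
					"rV e = rV d *\<^sub>L f" using q(2) unfolding G_def by force
			have fq: "inc f *\<^sub>K h = rZ q" using key[OF VN.nzsD[OF ef(2)] ef(4,3) qr ef(1)] .
			have fK: "f : carrier KV" "inc f : carrier KZ" "f' : carrier KV"
				using VN.sections_carrier[OF ef(3)] sections_inc[OF ef(3)] f'K by blast+
			have "f' *\<^sub>L f : OV 0" using VN.sections_mult[OF f' ef(3)] by simp
			then obtain c where c: "c : regs V" "f' *\<^sub>L f = rV c" unfolding VN.sections_0 by blast
			have pc: "pull c : regs Z" using pull_regs[OF c(1)] .
			have "y *\<^sub>K rZ q = (inc f' *\<^sub>K inc f) *\<^sub>K (h *\<^sub>K inv\<^sub>K h)"
				unfolding fq[symmetric] y_def using fK(2) yK(2) hK(1,2) by (simp only: ZN.K.m_ac ZN.K.m_closed)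
			also have "\<dots> = inc (f' *\<^sub>L f)" using hK(3) fK by simp
			also have "\<dots> = rZ (pull c)" unfolding c(2) by (rule inc_rat[OF c(1)])
			finally have yq: "y *\<^sub>K rZ q = rZ (pull c)" .
			have cl: "n *\<^sub>Z q : regs Z" "pull c *\<^sub>Z m : regs Z"
				using ZN.FR.m_closed[of n q] ZN.FR.m_closed[of "pull c" m] mr qr pc by auto
			have "rZ (n *\<^sub>Z q) = (y *\<^sub>K rZ m) *\<^sub>K rZ q" unfolding ym using mr qr by simp
			also have "\<dots> = (y *\<^sub>K rZ q) *\<^sub>K rZ m"
				using yK(1) ZN.rat_closed[OF mr(2)] ZN.rat_closed[OF qr] by (simp only: ZN.K.m_ac ZN.K.m_closed)
			also have "\<dots> = rZ (pull c *\<^sub>Z m)" unfolding yq using pc mr by simp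
			finally have "n *\<^sub>Z q = pull c *\<^sub>Z m" using ZN.rat_eq_iff[OF cl] by simp
			also have "\<dots> = p *\<^sub>Z (pull c *\<^sub>Z m')"
				unfolding p(3) using ZN.FR.m_lcomm[of "pull c" p m'] pc ph(2) mh'(1) by simp
			finally have "(EX r:regs Z. n = p *\<^sub>Z r) | (EX r:regs Z. q = p *\<^sub>Z r)"
				using girr_prime[OF p(1) n(1) q(1), of "pull c *\<^sub>Z m'"] ZN.FR.m_closed[of "pull c" m'] pc mh'(1) by simp
			thus False using ndvd q(3) by simp
		qed
		then obtain v where v: "v : carrier AZ" "m *\<^sub>Z v = 1\<^sub>Z" unfolding Units_def by blast
		have vr: "v : regs Z" using v(1) by simp
		have "rZ m *\<^sub>K rZ v = 1\<^sub>K" using ZN.rat.hom_mult[of m v] v(2) mr(2) vr by simp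
		hence "y = (y *\<^sub>K rZ m) *\<^sub>K rZ v"
			using yK(1) ZN.rat_closed[OF mr(2)] ZN.rat_closed[OF vr] by (simp add: ZN.K.m_assoc)
		hence "y : RZ" unfolding ym using RZ_mult mr(4) vr by simp
		thus ?thesis by (simp add: y_def)
	qed
	have "h : multipliers D" unfolding multipliers_def using h(1) pos neg by simp
	thus ?thesis using that by simp
qed

end

section \<open>A multiplicative choice of multipliers\<close>

locale cox_quotient = factorial_quotient Z Q rho V
	for Z :: "('z, 'k::{alg_closed_field, field_char_0}) variety" and Q :: "('g, 'k) alg_group"
		and rho :: "'g => 'z => 'z" and V :: "(('z => 'k) => 'k, 'k) variety" +
	fixes L :: "(('z => 'k) => 'k) divisor set"
		and F :: "(('z => 'k) => 'k) divisor => (('z => 'k) => 'k, 'k) rat_fun"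
	assumes presenting: "presenting_subgroup V L" and coherent: "coherent V L F"
begin

abbreviation PV where "PV == principal_divisors V"

lemma L_subgroup: "subgroup L (weil_divisors V)" using presenting by (simp add: presenting_subgroup_def)

lemma weil_comm_group: "comm_group (weil_divisors V)" unfolding weil_divisors_def by (rule abelian_free_Abelian_group)

lemma weil_inv: "D : carrier (weil_divisors V) ==> inv\<^bsub>weil_divisors V\<^esub> D = - D"
proof -
	assume D: "D : carrier (weil_divisors V)"
	interpret W: comm_group "weil_divisors V" by (rule weil_comm_group)
	show ?thesis using D VN.weil_uminus[OF D] by (intro W.inv_equality) (simp_all add: VN.weil_mult VN.weil_one)
qed

lemma L_weil: "D : L ==> D : carrier (weil_divisors V)" using subgroup.subset[OF L_subgroup] by auto

lemma L_closed: "0 : L" "D : L ==> E : L ==> D + E : L" "D : L ==> - D : L" "D : L ==> E : L ==> D - E : L"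
proof -
	show "0 : L" using subgroup.one_closed[OF L_subgroup] by (simp add: VN.weil_one)
	show add: "D + E : L" if "D : L" "E : L" for D E
		using subgroup.m_closed[OF L_subgroup that] by (simp add: VN.weil_mult)
	show um: "- D : L" if "D : L" for D
		using subgroup.m_inv_closed[OF L_subgroup that] weil_inv[OF L_weil[OF that]] by simp
	show "D - E : L" if "D : L" "E : L" for D E using add[OF that(1) um[OF that(2)]] by simp
qed

lemma principal_iff: "D : PV \<longleftrightarrow> (EX w:VN.Kx. D = div_of V w)" by (auto simp: principal_divisors_def)

lemma principal_closed: "0 : PV" "D : PV ==> E : PV ==> D + E : PV" "D : PV ==> - D : PV"
proof -
	show "0 : PV" unfolding principal_iff using VN.Kx_one VN.div_one by auto
	show "D + E : PV" if "D : PV" "E : PV" using that unfolding principal_iff by (metis VN.div_mult VN.Kx_mult)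
	show "- D : PV" if "D : PV" using that unfolding principal_iff by (metis VN.div_inv VN.Kx_inv(1))
qed

lemma F_Kx: "D : L ==> D : PV ==> F D : VN.Kx" and F_div: "D : L ==> D : PV ==> div_of V (F D) = D"
	and F_mult: "D : L ==> D : PV ==> E : L ==> E : PV ==> F (D + E) = F D *\<^sub>L F E"
	using coherent unfolding coherent_def by blast+

lemma F_0: "F 0 = 1\<^sub>L"
proof -
	have "F 0 : VN.Kx" "F 0 = F 0 *\<^sub>L F 0" using F_Kx[of 0] F_mult[of 0 0] L_closed(1) principal_closed(1) by auto
	thus ?thesis using VN.K.m_lcancel[of "F 0" "F 0" "1\<^sub>L"] by auto
qed

text \<open>Divisors together with their multipliers: an extension of \<open>L\<close> by the nonzero constants.\<close>

definition mgrp :: "((('z => 'k) => 'k) divisor \<times> ('z, 'k) rat_fun) monoid" where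
	"mgrp = \<lparr>carrier = {(D, h). D : L & h : multipliers D},
		 monoid.mult = (\<lambda>(D, h) (E, h'). (D + E, h *\<^sub>K h')), one = (0, 1\<^sub>K)\<rparr>"

lemma one_multiplier: "1\<^sub>K : multipliers 0" using scalar_multiplier[of 1] unfolding scalar_one by simp

lemma mgrp: "comm_group mgrp"
proof (rule comm_groupI)
	have car: "h : carrier KZ" if "h : multipliers D" for h D using multipliersD(2)[OF that] by simp
	show "\<one>\<^bsub>mgrp\<^esub> : carrier mgrp" using one_multiplier L_closed(1) by (simp add: mgrp_def)
	fix x y z assume "x : carrier mgrp"
	then obtain D h where x: "x = (D, h)" "D : L" "h : multipliers D" by (auto simp: mgrp_def)
	show "\<one>\<^bsub>mgrp\<^esub> \<otimes>\<^bsub>mgrp\<^esub> x = x" using x car by (simp add: mgrp_def)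
	have "inv\<^sub>K h *\<^sub>K h = 1\<^sub>K" using multipliersD(2)[OF x(3)] ZN.Kx_inv[of h] ZN.K.m_comm[of h "inv\<^sub>K h"] by auto
	thus "EX y:carrier mgrp. y \<otimes>\<^bsub>mgrp\<^esub> x = \<one>\<^bsub>mgrp\<^esub>" using x multipliers_uminus[OF x(3)] L_closed(3)
		by (intro bexI[of _ "(- D, inv\<^sub>K h)"]) (simp_all add: mgrp_def)
	assume "y : carrier mgrp"
	then obtain E h' where y: "y = (E, h')" "E : L" "h' : multipliers E" by (auto simp: mgrp_def)
	show "x \<otimes>\<^bsub>mgrp\<^esub> y : carrier mgrp"
		using x y multipliers_add[OF L_weil[OF x(2)] x(3) y(3)] L_closed(2) by (simp add: mgrp_def)
	show "x \<otimes>\<^bsub>mgrp\<^esub> y = y \<otimes>\<^bsub>mgrp\<^esub> x" using x y car ZN.K.m_comm[of h h'] by (simp add: mgrp_def add.commute)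
	assume "z : carrier mgrp"
	then obtain E' h'' where "z = (E', h'')" "h'' : multipliers E'" by (auto simp: mgrp_def)
	thus "x \<otimes>\<^bsub>mgrp\<^esub> y \<otimes>\<^bsub>mgrp\<^esub> z = x \<otimes>\<^bsub>mgrp\<^esub> (y \<otimes>\<^bsub>mgrp\<^esub> z)"
		using x y car ZN.K.m_assoc[of h h' h''] by (simp add: mgrp_def add.assoc)
qed

text \<open>The pairs of a principal divisor and its given function form a subgroup that meets the constants
	trivially, by coherence. A complement of the constants that contains it is the graph of the choice.\<close>

lemma multiplicative_choice:
	obtains H where "!!D. D : L ==> H D : multipliers D"
		"!!D E. D : L ==> E : L ==> H (D + E) = H D *\<^sub>K H E"
		"!!D. D : L ==> D : PV ==> H D = inc (F D)"
proof -
	interpret E: comm_group mgrp by (rule mgrp)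
	have simps: "x : carrier mgrp \<longleftrightarrow> fst x : L & snd x : multipliers (fst x)"
		"(D, h) \<otimes>\<^bsub>mgrp\<^esub> (D', h') = (D + D', h *\<^sub>K h')" "\<one>\<^bsub>mgrp\<^esub> = (0, 1\<^sub>K)" for x D D' h h' by (auto simp: mgrp_def)
	define C where "C = {(0 :: (('z => 'k) => 'k) divisor, scalar c) | c. c ~= 0}"
	define S where "S = {(D, inc (F D)) | D. D : L & D : PV}"
	have F_mem: "inc (F D) : multipliers D" if "D : L" "D : PV" for D
		using inc_multiplier[OF F_Kx[OF that]] F_div[OF that] by simp
	have inv: "inv\<^bsub>mgrp\<^esub> (D, h) = (- D, inv\<^sub>K h)" if D: "D : L" "h : multipliers D" for D h
	proof (rule E.inv_equality)
		have "inv\<^sub>K h *\<^sub>K h = 1\<^sub>K" using multipliersD(2)[OF D(2)] ZN.Kx_inv[of h] ZN.K.m_comm[of h "inv\<^sub>K h"] by auto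
		thus "(- D, inv\<^sub>K h) \<otimes>\<^bsub>mgrp\<^esub> (D, h) = \<one>\<^bsub>mgrp\<^esub>" by (simp add: simps)
		show "(D, h) : carrier mgrp" "(- D, inv\<^sub>K h) : carrier mgrp"
			using D multipliers_uminus[OF D(2)] L_closed(3) by (simp_all add: simps)
	qed
	have subC: "subgroup C mgrp"
	proof (rule E.subgroupI)
		show "C \<subseteq> carrier mgrp" using scalar_multiplier L_closed(1) by (auto simp: C_def simps)
		show "C ~= {}" by (auto simp: C_def intro: exI[of _ 1])
		fix x assume "x : C"
		then obtain c where c: "c ~= 0" "x = (0, scalar c)" by (auto simp: C_def)
		have "inv\<^bsub>mgrp\<^esub> x = (0, scalar (inverse c))"
			using inv[OF L_closed(1) scalar_multiplier[OF c(1)]] scalar_inv[OF c(1)] c(2) by simp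
		thus "inv\<^bsub>mgrp\<^esub> x : C" using c(1) unfolding C_def by (intro CollectI exI[of _ "inverse c"]) simp
		fix y assume "y : C"
		then obtain d where d: "d ~= 0" "y = (0, scalar d)" by (auto simp: C_def)
		have "x \<otimes>\<^bsub>mgrp\<^esub> y = (0, scalar (c * d))" using c d scalar_mult[of c d] by (simp add: simps)
		thus "x \<otimes>\<^bsub>mgrp\<^esub> y : C" using c(1) d(1) unfolding C_def by (intro CollectI exI[of _ "c * d"]) simp
	qed
	have subS: "subgroup S mgrp"
	proof (rule E.subgroupI)
		show "S \<subseteq> carrier mgrp" using F_mem by (auto simp: S_def simps)
		show "S ~= {}" using L_closed(1) principal_closed(1) by (auto simp: S_def)
		fix x assume "x : S"
		then obtain D where D: "D : L" "D : PV" "x = (D, inc (F D))" by (auto simp: S_def)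
		have mD: "- D : L" "- D : PV" using D L_closed(3) principal_closed(3) by auto
		have "F D *\<^sub>L F (- D) = 1\<^sub>L" using F_mult[OF D(1,2) mD] F_0 by simp
		hence "inc (F D) *\<^sub>K inc (F (- D)) = 1\<^sub>K"
			using F_Kx[OF D(1,2)] F_Kx[OF mD] inc.hom_mult[of "F D" "F (- D)"] by simp
		hence "inv\<^sub>K (inc (F D)) = inc (F (- D))"
			using inc_Kx[OF F_Kx[OF D(1,2)]] inc_Kx[OF F_Kx[OF mD]] by (intro ZN.K.comm_inv_char) auto
		thus "inv\<^bsub>mgrp\<^esub> x : S" using inv[OF D(1) F_mem[OF D(1,2)]] D(3) mD by (auto simp: S_def)
		fix y assume "y : S"
		then obtain E where E: "E : L" "E : PV" "y = (E, inc (F E))" by (auto simp: S_def)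
		have "inc (F (D + E)) = inc (F D) *\<^sub>K inc (F E)"
			unfolding F_mult[OF D(1,2) E(1,2)] using F_Kx[OF D(1,2)] F_Kx[OF E(1,2)] by (intro inc.hom_mult) auto
		thus "x \<otimes>\<^bsub>mgrp\<^esub> y : S"
			using D E L_closed(2)[OF D(1) E(1)] principal_closed(2)[OF D(2) E(2)] by (auto simp: S_def simps)
	qed
	have SC: "S \<inter> C = {\<one>\<^bsub>mgrp\<^esub>}"
	proof (intro equalityI subsetI)
		fix x assume "x : S \<inter> C"
		hence "x = (0, inc (F 0))" by (auto simp: S_def C_def)
		thus "x : {\<one>\<^bsub>mgrp\<^esub>}" by (simp add: F_0 simps)
	qed (use subgroup.one_closed[OF subS] subgroup.one_closed[OF subC] in auto)
	have div: "EX d:C. d [^]\<^bsub>mgrp\<^esub> n = x" if x: "x : C" "0 < n" for x and n :: nat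
	proof -
		obtain c where c: "c ~= 0" "x = (0, scalar c)" using x(1) by (auto simp: C_def)
		obtain b where b: "b ^ n = c" using nth_root_exists[OF x(2), of c] by auto
		have "b ~= 0" using b c(1) x(2) by auto
		moreover have "(0, scalar b) [^]\<^bsub>mgrp\<^esub> k = (0, scalar (b ^ k))" for k :: nat
			by (induction k) (simp_all add: simps scalar_one scalar_mult ZN.K.m_comm[OF scalar_closed scalar_closed])
		ultimately show ?thesis using b c(2) by (intro bexI[of _ "(0, scalar b)"]) (auto simp: C_def)
	qed
	obtain T where T: "subgroup T mgrp" "S \<subseteq> T" "T \<inter> C = {\<one>\<^bsub>mgrp\<^esub>}"
		"!!e. e : carrier mgrp ==> EX t:T. EX c:C. e = t \<otimes>\<^bsub>mgrp\<^esub> c"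
		using E.divisible_complement[OF subC div subS SC] by auto
	have Tcar: "D : L & h : multipliers D" if "(D, h) : T" for D h
		using that subgroup.subset[OF T(1)] by (auto simp: simps subset_iff)
	have ex: "EX h. (D, h) : T" if D: "D : L" for D
	proof -
		obtain h where h: "h : multipliers D" using multiplier_exists[OF L_weil[OF D]] .
		then obtain t c where tc: "t : T" "c : C" "(D, h) = t \<otimes>\<^bsub>mgrp\<^esub> c" using T(4)[of "(D, h)"] D by (auto simp: simps)
		hence "fst t = D" by (cases t) (auto simp: C_def simps)
		thus ?thesis using tc(1) by (metis prod.collapse)
	qed
	have uniq: "h = h'" if h: "(D, h) : T" "(D, h') : T" for D h h'
	proof -
		have D: "D : L" "h : multipliers D" "h' : multipliers D" using Tcar h by blast+
		obtain c where c: "c ~= 0" "h' = scalar c *\<^sub>K h" using multipliers_unique[OF L_weil[OF D(1)] D(2,3)] .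
		have hK: "h : carrier KZ" "h *\<^sub>K inv\<^sub>K h = 1\<^sub>K" "inv\<^sub>K h : carrier KZ"
			using multipliersD(2)[OF D(2)] ZN.Kx_inv[of h] by auto
		have "(D, h') \<otimes>\<^bsub>mgrp\<^esub> inv\<^bsub>mgrp\<^esub> (D, h) : T" using h T(1) by (intro subgroup.m_closed subgroup.m_inv_closed)
		moreover have "(D, h') \<otimes>\<^bsub>mgrp\<^esub> inv\<^bsub>mgrp\<^esub> (D, h) = (0, scalar c)"
			unfolding inv[OF D(1,2)] using hK scalar_closed[of c] by (simp add: simps c(2) ZN.K.m_assoc)
		ultimately have "(0, scalar c) : T" by simp
		moreover have "(0, scalar c) : C" unfolding C_def using c(1) by auto
		ultimately have "(0, scalar c) : T \<inter> C" by (rule IntI)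
		hence "(0, scalar c) = \<one>\<^bsub>mgrp\<^esub>" unfolding T(3) by (rule singletonD)
		thus ?thesis using c(2) hK by (simp add: simps)
	qed
	define H where "H D = (THE h. (D, h) : T)" for D
	have H: "(D, H D) : T" if "D : L" for D
		unfolding H_def using ex[OF that] uniq by (intro theI'[of "%h. (D, h) : T"]) blast
	show ?thesis
	proof (rule that[of H])
		show "H D : multipliers D" if "D : L" for D using H[OF that] Tcar by simp
		show "H (D + E) = H D *\<^sub>K H E" if "D : L" "E : L" for D E
			using subgroup.m_closed[OF T(1) H[OF that(1)] H[OF that(2)]] H[OF L_closed(2)[OF that]] uniq by (simp add: simps)
		show "H D = inc (F D)" if "D : L" "D : PV" for D
		proof (rule uniq[OF H[OF that(1)]])
			have "(D, inc (F D)) : S" unfolding S_def using that by simp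
			thus "(D, inc (F D)) : T" using T(2) by auto
		qed
	qed
qed

lemma inc_inj: "x : carrier KV ==> y : carrier KV ==> inc x = inc y ==> x = y"
proof -
	assume x: "x : carrier KV" and y: "y : carrier KV" and eq: "inc x = inc y"
	have "inc (x \<ominus>\<^bsub>KV\<^esub> y) = inc x \<ominus>\<^bsub>KZ\<^esub> inc y" using x y by simp
	also have "\<dots> = 0\<^sub>K" using y eq by simp
	finally show "x = y" using inc_zero_iff[of "x \<ominus>\<^bsub>KV\<^esub> y"] x y by simp
qed

text \<open>A rational function on the quotient is regular if its pullback is: the pullback is invariant.\<close>

lemma inc_regular:
	assumes x: "x : carrier KV" "inc x : RZ"
	shows "x : rV ` regs V"
proof (cases "x = 0\<^sub>L")
	case True
	hence "x = rV 0\<^sub>V" by simp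
	thus ?thesis using VN.FR.zero_closed by (metis VN.A_simps(1) imageI)
next
	case False
	obtain a b where ab: "a : regs V" "b : VN.nzs" "x = quot_fun V a b" using x(1) by (rule VN.quotE)
	obtain u where u: "u : regs Z" "inc x = rZ u" using x(2) by auto
	have p: "pull a : regs Z" "pull b : ZN.nzs" "pull a : B0" "pull b : B0" "pull b : regs Z"
		using pull_regs pull_nonzero pull_B0 ab VN.nzsD by blast+
	have "rZ u *\<^sub>K rZ (pull b) = rZ (pull a)"
		unfolding u(2)[symmetric] ab(3) inc_quot[OF ab(1,2)] using ZN.quot_rat[OF p(1,2)] .
	hence "rZ (pull b *\<^sub>Z u) = rZ (pull a)"
		using ZN.rat.hom_mult[of u "pull b"] ZN.FR.m_comm[of u "pull b"] u(1) p(5) by simp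
	hence eq: "pull b *\<^sub>Z u = pull a"
		using ZN.rat_eq_iff[of "pull b *\<^sub>Z u" "pull a"] ZN.FR.m_closed[of "pull b" u] u(1) p by simp
	interpret C: comm_group "XQ" by (rule QG.character_comm_group)
	obtain theta where "theta : chars" "u : ws theta" "\<one>\<^bsub>XQ\<^esub> \<otimes>\<^bsub>XQ\<^esub> theta = \<one>\<^bsub>XQ\<^esub>"
		using ws_cancel[OF p(2) _ one_char u(1), of "\<one>\<^bsub>XQ\<^esub>"] p(3,4) eq one_char ws_one by auto
	hence "u : B0" using ws_one by simp
	then obtain c where c: "c : regs V" "pull c = u" using pull_surj by auto
	have "inc x = inc (rV c)" using inc_rat[OF c(1)] c(2) u(2) by simp
	hence "x = rV c" using inc_inj[OF x(1) VN.rat_closed[OF c(1)]] by simp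
	thus ?thesis using c(1) by simp
qed

end

text \<open>A multiplicative choice of multipliers gives the graded pieces \<open>phi D\<close> of a homomorphism
	from the Cox ring to the functions on \<open>Z\<close>.\<close>

locale cox_multipliers = cox_quotient Z Q rho V L F
	for Z :: "('z, 'k::{alg_closed_field, field_char_0}) variety" and Q :: "('g, 'k) alg_group"
		and rho :: "'g => 'z => 'z" and V :: "(('z => 'k) => 'k, 'k) variety"
		and L :: "(('z => 'k) => 'k) divisor set"
		and F :: "(('z => 'k) => 'k) divisor => (('z => 'k) => 'k, 'k) rat_fun" +
	fixes H :: "(('z => 'k) => 'k) divisor => ('z, 'k) rat_fun"
	assumes H: "D : L ==> H D : multipliers D"
		and H_add: "D : L ==> E : L ==> H (D + E) = H D *\<^sub>K H E"
		and H_F: "D : L ==> D : PV ==> H D = inc (F D)"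
begin

definition phi :: "(('z => 'k) => 'k) divisor => (('z => 'k) => 'k, 'k) rat_fun => 'z => 'k" where
	"phi D f = inv_into (regs Z) (rZ) (inc f *\<^sub>K H D)"

lemma phi: assumes "D : L" "f : OV D" shows "phi D f : regs Z" "rZ (phi D f) = inc f *\<^sub>K H D"
proof -
	have r: "inc f *\<^sub>K H D : RZ" using multipliersD(3)[OF H[OF assms(1)] assms(2)] .
	show "phi D f : regs Z" unfolding phi_def by (rule inv_into_into[OF r])
	show "rZ (phi D f) = inc f *\<^sub>K H D" unfolding phi_def by (rule f_inv_into_f[OF r])
qed

lemma phi_eqI:
	assumes "D : L" "f : OV D" "a : regs Z" "rZ a = inc f *\<^sub>K H D"
	shows "phi D f = a" using phi[OF assms(1,2)] assms(3,4) ZN.rat_eq_iff by metis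

lemma H_Kx: "D : L ==> H D : ZN.Kx" using multipliersD(2)[OF H] .

lemma phi_mult:
	assumes "D : L" "E : L" "f : OV D" "g : OV E"
	shows "phi (D + E) (f *\<^sub>L g) = phi D f *\<^sub>Z phi E g"
proof (rule phi_eqI)
	show "D + E : L" "f *\<^sub>L g : OV (D + E)" using assms L_closed(2)[of D E] VN.sections_mult[of f D g E] by auto
	note r = phi[OF assms(1,3)] phi[OF assms(2,4)]
	show "phi D f *\<^sub>Z phi E g : regs Z" using ZN.FR.m_closed[of "phi D f" "phi E g"] r by simp
	have car: "inc f : carrier KZ" "inc g : carrier KZ" "H D : carrier KZ" "H E : carrier KZ"
		using sections_inc assms H_Kx by blast+
	have "rZ (phi D f *\<^sub>Z phi E g) = (inc f *\<^sub>K H D) *\<^sub>K (inc g *\<^sub>K H E)" using r by simp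
	also have "\<dots> = (inc f *\<^sub>K inc g) *\<^sub>K (H D *\<^sub>K H E)" by (rule ZN.K.rearrange(3)[OF car(1,3,2,4)])
	also have "\<dots> = inc (f *\<^sub>L g) *\<^sub>K H (D + E)"
		using VN.sections_carrier[OF assms(3)] VN.sections_carrier[OF assms(4)] H_add[OF assms(1,2)] by simp
	finally show "rZ (phi D f *\<^sub>Z phi E g) = inc (f *\<^sub>L g) *\<^sub>K H (D + E)" .
qed

lemma phi_add:
	assumes "D : L" "f : OV D" "g : OV D"
	shows "phi D (f +\<^sub>L g) = phi D f +\<^sub>Z phi D g"
proof (rule phi_eqI)
	show "D : L" "f +\<^sub>L g : OV D" using assms VN.sections_add by blast+
	note r = phi[OF assms(1,2)] phi[OF assms(1,3)]
	show "phi D f +\<^sub>Z phi D g : regs Z" using ZN.FR.a_closed[of "phi D f" "phi D g"] r by simp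
	have car: "inc f : carrier KZ" "inc g : carrier KZ" "H D : carrier KZ" using sections_inc assms H_Kx by blast+
	have "rZ (phi D f +\<^sub>Z phi D g) = inc f *\<^sub>K H D +\<^sub>K inc g *\<^sub>K H D" using r by simp
	thus "rZ (phi D f +\<^sub>Z phi D g) = inc (f +\<^sub>L g) *\<^sub>K H D"
		using car VN.sections_carrier[OF assms(2)] VN.sections_carrier[OF assms(3)] by (simp add: ZN.K.l_distr)
qed

lemma phi_zero_iff:
	assumes "D : L" "f : OV D"
	shows "phi D f = 0\<^sub>Z \<longleftrightarrow> f = 0\<^sub>L"
proof -
	have car: "f : carrier KV" "inc f : carrier KZ" "H D : carrier KZ" "H D ~= 0\<^sub>K"
		using VN.sections_carrier[OF assms(2)] H_Kx[OF assms(1)] by auto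
	have "phi D f = 0\<^sub>Z \<longleftrightarrow> inc f *\<^sub>K H D = 0\<^sub>K" using ZN.rat_zero_iff[OF phi(1)[OF assms]] phi(2)[OF assms] by simp
	also have "\<dots> \<longleftrightarrow> inc f = 0\<^sub>K" using ZN.K.integral_iff[OF car(2,3)] car(4) by simp
	finally show ?thesis using inc_zero_iff[OF car(1)] by simp
qed

lemma phi_nonzero: "D : L ==> f : OV D ==> f : VN.Kx ==> phi D f : ZN.nzs"
	using phi_zero_iff[of D f] phi(1)[of D f] unfolding ZN.FR_nonzero[symmetric] by simp

lemma phi_rat:
	assumes "a : regs V"
	shows "phi 0 (rV a) = pull a"
proof (rule phi_eqI)
	show "0 : L" "rV a : OV 0" "pull a : regs Z"
		using L_closed(1) VN.sections_rat[OF assms] pull_regs[OF assms] by blast+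
	have "H 0 = 1\<^sub>K" using H_F[OF L_closed(1) principal_closed(1)] F_0 by simp
	thus "rZ (pull a) = inc (rV a) *\<^sub>K H 0" using inc_rat[OF assms] ZN.rat_closed[OF pull_regs[OF assms]] by simp
qed

lemma phi_shift:
	assumes D: "D : L" "E : L" "D - E : PV" and f: "f : OV D"
	shows "F (D - E) *\<^sub>L f : OV E" "phi E (F (D - E) *\<^sub>L f) = phi D f"
proof -
	have DE: "D - E : L" using L_closed(4) D by simp
	note FK = F_Kx[OF DE D(3)] and Fd = F_div[OF DE D(3)]
	show O: "F (D - E) *\<^sub>L f : OV E" using VN.sections_div_mult[OF f FK] Fd by simp
	have car: "f : carrier KV" "inc f : carrier KZ" "H E : carrier KZ" "inc (F (D - E)) : carrier KZ" "F (D - E) : carrier KV"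
		using VN.sections_carrier[OF f] sections_inc[OF f] H_Kx[OF D(2)] inc_Kx[OF FK] FK by blast+
	have "H D = inc (F (D - E)) *\<^sub>K H E" using H_add[OF DE D(2)] H_F[OF DE D(3)] by simp
	thus "phi E (F (D - E) *\<^sub>L f) = phi D f"
		using phi(1)[OF D(1) f] phi(2)[OF D(1) f] car by (intro phi_eqI[OF D(2) O]) (simp_all add: ZN.K.m_ac)
qed

text \<open>All sections are multiplied by the same homogeneous fraction, and their pullbacks are quotients of
	invariants.\<close>

lemma weight_exists:
	assumes D: "D : L"
	shows "EX chi:chars. ALL f:OV D. phi D f : ws chi"
proof -
	interpret C: comm_group "XQ" by (rule QG.character_comm_group)
	obtain a b where ab: "a : homs" "b : homs" "H D = quot_fun Z a b"
		using multipliersD(1)[OF H[OF D]] by (rule hfracsE)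
	obtain alpha beta where alpha: "alpha : chars" "a : ws alpha" and beta: "beta : chars" "b : ws beta"
		using ab(1,2) by (auto simp: homs_def)
	have r: "a : regs Z" "b : regs Z" "a : ZN.nzs" "b : ZN.nzs" using homsD(1) ab ZN.nzsD by blast+
	have "phi D f : ws (inv\<^bsub>XQ\<^esub> beta \<otimes>\<^bsub>XQ\<^esub> alpha)" if f: "f : OV D" for f
	proof -
		obtain c d where cd: "c : regs V" "d : VN.nzs" "f = quot_fun V c d"
			using VN.sections_carrier[OF f] by (rule VN.quotE)
		have p: "pull c : regs Z" "pull c : B0" "pull d : regs Z" "pull d : B0" "pull d : ZN.nzs"
			using pull_regs pull_B0 pull_nonzero cd VN.nzsD by blast+
		have bd: "b *\<^sub>Z pull d : ZN.nzs" "b *\<^sub>Z pull d : regs Z" "pull c *\<^sub>Z a : regs Z"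
			using ZN.nzs_mult[OF r(4) p(5)] ZN.nzsD ZN.FR.m_closed[of "pull c" a] p r by auto
		have "rZ (phi D f) = quot_fun Z (pull c *\<^sub>Z a) (pull d *\<^sub>Z b)"
			unfolding phi(2)[OF D f] unfolding ab(3) unfolding cd(3) unfolding inc_quot[OF cd(1,2)]
			by (rule ZN.quot_mult[OF p(1,5) r(1,4)])
		also have "\<dots> = quot_fun Z (pull c *\<^sub>Z a) (b *\<^sub>Z pull d)" using ZN.FR.m_comm[of "pull d" b] p r by simp
		finally have "rZ (phi D f) *\<^sub>K rZ (b *\<^sub>Z pull d) = rZ (pull c *\<^sub>Z a)" using ZN.quot_rat[OF bd(3,1)] by simp
		hence "rZ ((b *\<^sub>Z pull d) *\<^sub>Z phi D f) = rZ (pull c *\<^sub>Z a)"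
			using ZN.rat.hom_mult[of "phi D f" "b *\<^sub>Z pull d"] ZN.FR.m_comm[of "phi D f" "b *\<^sub>Z pull d"] phi(1)[OF D f] bd(2)
			by simp
		hence eq: "(b *\<^sub>Z pull d) *\<^sub>Z phi D f = pull c *\<^sub>Z a"
			using ZN.rat_eq_iff[of "(b *\<^sub>Z pull d) *\<^sub>Z phi D f" "pull c *\<^sub>Z a"] bd ZN.FR.m_closed[of "b *\<^sub>Z pull d" "phi D f"] phi(1)[OF D f]
			by simp
		have w: "b *\<^sub>Z pull d : ws beta" "pull c *\<^sub>Z a : ws alpha"
			using ws_mult[OF beta(2), of "pull d" "\<one>\<^bsub>XQ\<^esub>"] ws_mult[of "pull c" "\<one>\<^bsub>XQ\<^esub>", OF _ alpha(2)] p ws_one alpha(1) beta(1)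
			by auto
		obtain theta where theta: "theta : chars" "phi D f : ws theta" "beta \<otimes>\<^bsub>XQ\<^esub> theta = alpha"
			using ws_cancel[OF bd(1) w(1) beta(1) phi(1)[OF D f], of alpha] w(2) eq alpha(1) by auto
		have "theta = inv\<^bsub>XQ\<^esub> beta \<otimes>\<^bsub>XQ\<^esub> alpha"
			unfolding theta(3)[symmetric] using theta(1) beta(1) by (simp add: C.m_assoc[symmetric])
		thus ?thesis using theta(2) by simp
	qed
	thus ?thesis using alpha(1) beta(1) by auto
qed

definition \<delta> :: "(('z => 'k) => 'k) divisor => 'g => 'k" where
	"\<delta> D = (SOME chi. chi : chars & (ALL f:OV D. phi D f : ws chi))"

lemma \<delta>: assumes "D : L" shows "\<delta> D : chars" "!!f. f : OV D ==> phi D f : ws (\<delta> D)"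
	using someI_ex[of "%chi. chi : chars & (ALL f:OV D. phi D f : ws chi)"] weight_exists[OF assms] unfolding \<delta>_def by blast+

lemma \<delta>_eqI: "D : L ==> f : OV D ==> f : VN.Kx ==> phi D f : ws chi ==> chi : chars ==> \<delta> D = chi"
	using ws_unique[OF phi_nonzero] \<delta> by simp

lemma \<delta>_add:
	assumes D: "D : L" "E : L"
	shows "\<delta> (D + E) = \<delta> D \<otimes>\<^bsub>XQ\<^esub> \<delta> E"
proof -
	obtain f g where fg: "f : OV D" "f : VN.Kx" "g : OV E" "g : VN.Kx" using VN.sections_nonzero[OF L_weil] D by metis
	show ?thesis
	proof (rule \<delta>_eqI)
		show "D + E : L" "f *\<^sub>L g : OV (D + E)" "f *\<^sub>L g : VN.Kx"
			using D L_closed(2) VN.sections_mult fg VN.Kx_mult by blast+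
		show "phi (D + E) (f *\<^sub>L g) : ws (\<delta> D \<otimes>\<^bsub>XQ\<^esub> \<delta> E)" unfolding phi_mult[OF D fg(1,3)] using ws_mult \<delta>(2) D fg by simp
		show "\<delta> D \<otimes>\<^bsub>XQ\<^esub> \<delta> E : chars" using QG.character_mult_closed \<delta>(1) D by simp
	qed
qed

lemma \<delta>_principal:
	assumes D: "D : L" "D : PV"
	shows "\<delta> D = \<one>\<^bsub>XQ\<^esub>"
proof -
	obtain f where f: "f : OV D" "f : VN.Kx" using VN.sections_nonzero[OF L_weil[OF D(1)]] .
	have sh: "F (D - 0) *\<^sub>L f : OV 0" "phi 0 (F (D - 0) *\<^sub>L f) = phi D f"
		using phi_shift[OF D(1) L_closed(1) _ f(1)] D(2) by auto
	then obtain c where "c : regs V" "F (D - 0) *\<^sub>L f = rV c" unfolding VN.sections_0 by blast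
	hence "phi D f : B0" using sh(2) phi_rat pull_B0 by metis
	thus ?thesis using \<delta>_eqI[OF D(1) f] one_char ws_one by simp
qed

text \<open>The weights distinguish divisor classes: a multiplier of trivial weight comes from a rational
	function on the quotient, and its divisor is the given one.\<close>

lemma \<delta>_trivial:
	assumes D: "D : L" and tr: "\<delta> D = \<one>\<^bsub>XQ\<^esub>"
	shows "D : PV"
proof -
	obtain f where f: "f : OV D" "f : VN.Kx" using VN.sections_nonzero[OF L_weil[OF D]] .
	have "phi D f : B0" using \<delta>(2)[OF D f(1)] tr ws_one by simp
	then obtain c where c: "c : regs V" "pull c = phi D f" using pull_surj by auto
	have fi: "inv\<^sub>L f : VN.Kx" "f *\<^sub>L inv\<^sub>L f = 1\<^sub>L" using VN.Kx_inv f(2) by blast+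
	define w where "w = rV c *\<^sub>L inv\<^sub>L f"
	have car: "rV c : carrier KV" "f : carrier KV" "inv\<^sub>L f : carrier KV" "inc f : carrier KZ"
			"H D : carrier KZ" "w : carrier KV" using VN.rat_closed[OF c(1)] f(2) fi(1) H_Kx[OF D] by (auto simp: w_def)
	have "inc w = (inc f *\<^sub>K H D) *\<^sub>K inc (inv\<^sub>L f)"
		unfolding w_def using car inc_rat[OF c(1)] c(2) phi(2)[OF D f(1)] by simp
	also have "\<dots> = inc (f *\<^sub>L inv\<^sub>L f) *\<^sub>K H D" using car by (simp add: ZN.K.m_ac)
	also have "\<dots> = H D" unfolding fi(2) using car by simp
	finally have wH: "inc w = H D" .
	have "w ~= 0\<^sub>L" using wH H_Kx[OF D] inc_zero_iff[OF car(6)] by auto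
	hence wK: "w : VN.Kx" using car(6) by simp
	have "div_of V w = D"
	proof (rule VN.divisor_of_generator[OF L_weil[OF D] wK])
		fix s assume s: "s : OV D"
		have sc: "s : carrier KV" using VN.sections_carrier[OF s] .
		have "inc (s *\<^sub>L w) : RZ" using multipliersD(3)[OF H[OF D] s] sc car wH by simp
		thus "s *\<^sub>L w : rV ` regs V" using sc car by (intro inc_regular) simp_all
	next
		fix s assume s: "s : OV (- D)"
		have sc: "s : carrier KV" "inv\<^sub>L w : carrier KV" using VN.sections_carrier[OF s] VN.Kx_inv(1)[OF wK] by auto
		have "inc (s *\<^sub>L inv\<^sub>L w) : RZ" using multipliersD(4)[OF H[OF D] s] sc inc_inv[OF wK] wH by simp
		thus "s *\<^sub>L inv\<^sub>L w : rV ` regs V" using sc by (intro inc_regular) simp_all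
	qed
	thus ?thesis unfolding principal_iff using wK by auto
qed

lemma \<delta>_uminus:
	assumes "D : L"
	shows "\<delta> D \<otimes>\<^bsub>XQ\<^esub> \<delta> (- D) = \<one>\<^bsub>XQ\<^esub>"
	using \<delta>_add[OF assms L_closed(3)[OF assms]] \<delta>_principal[OF L_closed(1) principal_closed(1)] by simp

lemma \<delta>_eq_iff:
	assumes D: "D : L" "E : L"
	shows "\<delta> D = \<delta> E \<longleftrightarrow> D - E : PV"
proof
	assume "\<delta> D = \<delta> E"
	hence "\<delta> (D + - E) = \<one>\<^bsub>XQ\<^esub>" using \<delta>_add[OF D(1) L_closed(3)[OF D(2)]] \<delta>_uminus[OF D(2)] by simp
	thus "D - E : PV" using \<delta>_trivial[OF L_closed(4)[OF D]] by simp
next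
	interpret C: comm_group "XQ" by (rule QG.character_comm_group)
	assume P: "D - E : PV"
	have "\<delta> D = \<delta> (D - E) \<otimes>\<^bsub>XQ\<^esub> \<delta> E" using \<delta>_add[OF L_closed(4)[OF D] D(2)] by simp
	thus "\<delta> D = \<delta> E" using \<delta>_principal[OF L_closed(4)[OF D] P] \<delta>(1)[OF D(2)] by simp
qed

end

section \<open>The divisor algebra and its map to the functions on the covering variety\<close>

text \<open>The sum of the coefficients is multiplicative: it is the augmentation of a monoid algebra.\<close>

definition total :: "('a \<Rightarrow>\<^sub>0 'b::comm_monoid_add) => 'b" where
	"total f = (\<Sum>k\<in>pkeys f. lkp f k)"

lemma total_superset: "finite A ==> pkeys f \<subseteq> A ==> total f = (\<Sum>k\<in>A. lkp f k)"
	unfolding total_def by (rule sum.mono_neutral_left) (auto simp: in_keys_iff)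

lemma total_add: "total (f + g) = total f + total g"
proof -
	let ?A = "pkeys f \<union> pkeys g"
	have "total (f + g) = (\<Sum>k\<in>?A. lkp (f + g) k)" by (rule total_superset) (auto simp: Poly_Mapping.keys_add)
	moreover have "total f = (\<Sum>k\<in>?A. lkp f k)" "total g = (\<Sum>k\<in>?A. lkp g k)" by (rule total_superset; simp)+
	ultimately show ?thesis by (simp add: lookup_add sum.distrib)
qed

lemma total_zero: "total 0 = 0" by (simp add: total_def)

lemma total_single: "total (psingle k v) = v" by (subst total_superset[of "{k}"]) auto

lemma total_sum: "total (\<Sum>i\<in>I. f i) = (\<Sum>i\<in>I. total (f i))"
	by (induction I rule: infinite_finite_induct) (auto simp: total_add total_zero)

lemma sum_of_singles: "(\<Sum>k\<in>pkeys f. psingle k (lkp f k)) = f"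
proof (rule poly_mapping_eqI)
	fix k
	have "(\<Sum>l\<in>pkeys f. lkp f l when l = k) = lkp f k" by (simp add: when_def sum.delta in_keys_iff)
	thus "lkp (\<Sum>k\<in>pkeys f. psingle k (lkp f k)) k = lkp f k" by (simp add: lookup_sum lookup_single)
qed

lemma total_mult:
	fixes f g :: "'a::comm_monoid_add \<Rightarrow>\<^sub>0 'b::comm_ring_1"
	shows "total (f * g) = total f * total g"
proof -
	have "f * g = (\<Sum>k\<in>pkeys f. psingle k (lkp f k)) *
			(\<Sum>l\<in>pkeys g. psingle l (lkp g l))" by (simp only: sum_of_singles)
	also have "\<dots> = (\<Sum>k\<in>pkeys f. \<Sum>l\<in>pkeys g.
			psingle (k + l) (lkp f k * lkp g l))" by (simp only: sum_product mult_single)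
	finally have "total (f * g) = total (\<Sum>k\<in>pkeys f. \<Sum>l\<in>pkeys g.
			psingle (k + l) (lkp f k * lkp g l))" by (rule arg_cong)
	thus ?thesis unfolding total_sum total_single by (simp only: total_def sum_product)
qed

context cox_multipliers begin

abbreviation T where "T == divisor_algebra V L"
abbreviation T_mult (infixl "*\<^sub>T" 70) where "s *\<^sub>T t == s \<otimes>\<^bsub>T\<^esub> t"
abbreviation T_plus (infixl "+\<^sub>T" 65) where "s +\<^sub>T t == s \<oplus>\<^bsub>T\<^esub> t"
abbreviation T_unit ("1\<^sub>T") where "1\<^sub>T == \<one>\<^bsub>T\<^esub>"
abbreviation T_null ("0\<^sub>T") where "0\<^sub>T == \<zero>\<^bsub>T\<^esub>"
abbreviation T_scale (infixr "\<odot>\<^sub>T" 70) where "c \<odot>\<^sub>T s == c \<odot>\<^bsub>T\<^esub> s"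
abbreviation supp :: "((('z => 'k) => 'k) divisor => (('z => 'k) => 'k, 'k) rat_fun) => (('z => 'k) => 'k) divisor set" where
	"supp s == {D. s D ~= 0\<^sub>L}"

lemma T_carrier: "s : carrier T \<longleftrightarrow>
		(ALL D:L. s D : OV D) & (ALL D. D \<notin> L --> s D = 0\<^sub>L) & finite (supp s)" by (simp add: divisor_algebra_def)

lemma T_simps:
	"(s *\<^sub>T t) D = (\<Oplus>\<^bsub>KV\<^esub>E\<in>{E. s E ~= 0\<^sub>L & t (D - E) ~= 0\<^sub>L}. s E *\<^sub>L t (D - E))"
	"1\<^sub>T = indeg 0 1\<^sub>L" "0\<^sub>T = (%D. 0\<^sub>L)" "(s +\<^sub>T t) D = s D +\<^sub>L t D"
	"(c \<odot>\<^sub>T s) D = c \<odot>\<^bsub>KV\<^esub> s D" by (simp_all add: divisor_algebra_def in_degree_def)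

lemma T_D:
	assumes "s : carrier T"
	shows "D : L ==> s D : OV D" "D \<notin> L ==> s D = 0\<^sub>L" "finite (supp s)" "s D ~= 0\<^sub>L ==> D : L" "s D : carrier KV"
proof -
	show a: "D : L ==> s D : OV D" "D \<notin> L ==> s D = 0\<^sub>L" "finite (supp s)" "s D ~= 0\<^sub>L ==> D : L"
		using assms unfolding T_carrier by blast+
	show "s D : carrier KV" using a(1,2) VN.sections_carrier VN.K.zero_closed by (cases "D : L") auto
qed

lemma in_degree_closed: "D : L ==> f : OV D ==> indeg D f : carrier T"
	unfolding T_carrier in_degree_def using VN.sections_zero by auto

lemma phi_inj:
	assumes "D : L" "f : OV D" "g : OV D" "phi D f = phi D g"
	shows "f = g"
proof -
	have car: "f : carrier KV" "g : carrier KV" "inc f : carrier KZ" "inc g : carrier KZ" "H D : carrier KZ" "H D ~= 0\<^sub>K"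
		using VN.sections_carrier assms H_Kx by auto
	have "inc f *\<^sub>K H D = inc g *\<^sub>K H D" using phi(2) assms by metis
	hence "inc f = inc g" using ZN.K.m_rcancel[of "H D" "inc f" "inc g"] car by simp
	thus ?thesis using inc_inj car by simp
qed

lemma phi_0: "D : L ==> phi D 0\<^sub>L = 0\<^sub>Z" using phi_zero_iff VN.sections_zero by simp

text \<open>Finitely supported families of functions form a commutative ring under convolution. The divisor algebra
	embeds into it, which yields its ring axioms.\<close>

definition Psi :: "((('z => 'k) => 'k) divisor => (('z => 'k) => 'k, 'k) rat_fun) =>
		(('z => 'k) => 'k) divisor \<Rightarrow>\<^sub>0 ('z => 'k)" where
	"Psi s = (\<Sum>D\<in>supp s. psingle D (ZN.extend (phi D (s D))))"

lemma lookup_Psi: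
	assumes s: "s : carrier T"
	shows "lkp (Psi s) D = (if D : L then ZN.extend (phi D (s D)) else 0)"
proof -
	have "lkp (Psi s) D = (\<Sum>E\<in>supp s. if E = D then ZN.extend (phi E (s E)) else 0)"
		by (simp add: Psi_def lookup_sum lookup_single when_def)
	also have "\<dots> = (if D : supp s then ZN.extend (phi D (s D)) else 0)" using T_D(3)[OF s] by simp
	also have "\<dots> = (if D : L then ZN.extend (phi D (s D)) else 0)"
		using T_D(4)[OF s, of D] phi_0[of D] ZN.extend_zero by auto
	finally show ?thesis .
qed

lemma Psi_inj:
	assumes s: "s : carrier T" "t : carrier T" and eq: "Psi s = Psi t"
	shows "s = t"
proof
	fix D
	show "s D = t D"
	proof (cases "D : L")
		case True
		hence "ZN.extend (phi D (s D)) = ZN.extend (phi D (t D))"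
			using lookup_Psi[OF s(1), of D] lookup_Psi[OF s(2), of D] eq by simp
		hence "phi D (s D) = phi D (t D)"
			using ZN.extend_inj phi(1)[OF True] T_D(1)[OF s(1) True] T_D(1)[OF s(2) True] by simp
		thus ?thesis using phi_inj[OF True] T_D(1)[OF s(1) True] T_D(1)[OF s(2) True] by simp
	next
		case False
		thus ?thesis using T_D(2)[OF s(1)] T_D(2)[OF s(2)] by simp
	qed
qed

lemma T_add_closed:
	assumes s: "s : carrier T" "t : carrier T"
	shows "s +\<^sub>T t : carrier T" unfolding T_carrier
proof (intro conjI ballI allI impI)
	have "supp (s +\<^sub>T t) \<subseteq> supp s \<union> supp t" by (auto simp: T_simps)
	thus "finite (supp (s +\<^sub>T t))" using T_D(3) s by (meson finite_UnI finite_subset)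
qed (use VN.sections_add T_D(1)[OF s(1)] T_D(1)[OF s(2)] T_D(2)[OF s(1)] T_D(2)[OF s(2)] in \<open>simp_all add: T_simps\<close>)

lemma Psi_add:
	assumes s: "s : carrier T" "t : carrier T"
	shows "Psi (s +\<^sub>T t) = Psi s + Psi t"
proof (rule poly_mapping_eqI)
	fix D
	show "lkp (Psi (s +\<^sub>T t)) D = lkp (Psi s + Psi t) D"
		using phi_add[of D "s D" "t D"] T_D(1)[OF s(1), of D] T_D(1)[OF s(2), of D]
			by (simp add: lookup_add lookup_Psi s T_add_closed T_simps ZN.extend_add)
qed

lemma sections_finsum:
	assumes "finite S" "D : L" "!!E. E : S ==> x E : OV D"
	shows "(\<Oplus>\<^bsub>KV\<^esub>E\<in>S. x E) : OV D & ZN.extend (phi D (\<Oplus>\<^bsub>KV\<^esub>E\<in>S. x E)) = (\<Sum>E\<in>S. ZN.extend (phi D (x E)))" using assms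
proof (induction S)
	case empty
	thus ?case by (simp add: VN.sections_zero phi_0 ZN.extend_zero)
next
	case (insert E S)
	have x: "x : insert E S \<rightarrow> carrier KV" using insert.prems(2) VN.sections_carrier by auto
	have "(\<Oplus>\<^bsub>KV\<^esub>E\<in>insert E S. x E) = x E +\<^sub>L (\<Oplus>\<^bsub>KV\<^esub>E\<in>S. x E)" using insert.hyps x by (intro VN.K.finsum_insert) auto
	moreover have IH: "(\<Oplus>\<^bsub>KV\<^esub>E\<in>S. x E) : OV D"
			"ZN.extend (phi D (\<Oplus>\<^bsub>KV\<^esub>E\<in>S. x E)) = (\<Sum>E\<in>S. ZN.extend (phi D (x E)))" using insert.IH insert.prems by auto
	moreover have "x E : OV D" using insert.prems(2) by simp
	ultimately show ?case using VN.sections_add phi_add[OF insert.prems(1)] insert.hyps by (simp add: ZN.extend_add)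
qed

lemma conv_sections:
	assumes "s : carrier T" "t : carrier T" "D : L" "s E ~= 0\<^sub>L"
	shows "s E *\<^sub>L t (D - E) : OV D"
		"ZN.extend (phi D (s E *\<^sub>L t (D - E))) = ZN.extend (phi E (s E)) * ZN.extend (phi (D - E) (t (D - E)))"
proof -
	have E: "E : L" "D - E : L" using T_D(4)[OF assms(1,4)] L_closed(4) assms(3) by blast+
	note r = T_D(1)[OF assms(1) E(1)] T_D(1)[OF assms(2) E(2)]
	show "s E *\<^sub>L t (D - E) : OV D" using VN.sections_mult[OF r] by simp
	show "ZN.extend (phi D (s E *\<^sub>L t (D - E))) = ZN.extend (phi E (s E)) * ZN.extend (phi (D - E) (t (D - E)))"
		using phi_mult[OF E r] by (simp add: ZN.extend_mult)
qed

lemma conv_outside: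
	assumes "s : carrier T" "t : carrier T" "D \<notin> L"
	shows "{E. s E ~= 0\<^sub>L & t (D - E) ~= 0\<^sub>L} = {}"
proof (intro equals0I)
	fix E assume "E : {E. s E ~= 0\<^sub>L & t (D - E) ~= 0\<^sub>L}"
	hence "E : L" "D - E : L" using T_D(4) assms by blast+
	thus False using L_closed(2)[of E "D - E"] assms(3) by simp
qed

lemma conv_finite: "s : carrier T ==> finite {E. s E ~= 0\<^sub>L & t (D - E) ~= 0\<^sub>L}"
	using T_D(3)[of s] by (rule rev_finite_subset) auto

lemma T_mult_closed:
	assumes s: "s : carrier T" "t : carrier T"
	shows "s *\<^sub>T t : carrier T" unfolding T_carrier
proof (intro conjI ballI allI impI)
	show "(s *\<^sub>T t) D : OV D" if "D : L" for D
		unfolding T_simps by (rule conjunct1[OF sections_finsum[OF conv_finite[OF s(1)] that]])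
			(use conv_sections(1)[OF s that] in simp)
	show out: "(s *\<^sub>T t) D = 0\<^sub>L" if "D \<notin> L" for D unfolding T_simps conv_outside[OF s that] by simp
	have "D : (\<lambda>(E, E'). E + E') ` (supp s \<times> supp t)" if D: "(s *\<^sub>T t) D ~= 0\<^sub>L" for D
	proof (rule ccontr)
		assume no: "D \<notin> (\<lambda>(E, E'). E + E') ` (supp s \<times> supp t)"
		have "{E. s E ~= 0\<^sub>L & t (D - E) ~= 0\<^sub>L} = {}"
		proof (intro equals0I)
			fix E assume "E : {E. s E ~= 0\<^sub>L & t (D - E) ~= 0\<^sub>L}"
			hence "(E, D - E) : supp s \<times> supp t" by simp
			hence "(\<lambda>(E, E'). E + E') (E, D - E) : (\<lambda>(E, E'). E + E') ` (supp s \<times> supp t)" by (rule imageI)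
			thus False using no by simp
		qed
		hence "(s *\<^sub>T t) D = 0\<^sub>L" unfolding T_simps by (simp only: VN.K.finsum_empty)
		thus False using D by simp
	qed
	hence "supp (s *\<^sub>T t) \<subseteq> (\<lambda>(E, E'). E + E') ` (supp s \<times> supp t)" by blast
	thus "finite (supp (s *\<^sub>T t))"
		using T_D(3)[OF s(1)] T_D(3)[OF s(2)] by (meson finite_SigmaI finite_imageI finite_subset)
qed

lemma Psi_mult:
	assumes s: "s : carrier T" "t : carrier T"
	shows "Psi (s *\<^sub>T t) = Psi s * Psi t"
proof (rule poly_mapping_eqI)
	fix D
	let ?a = "%E. ZN.extend (phi E (s E))" and ?b = "%E. ZN.extend (phi E (t E))"
	let ?S = "{E. s E ~= 0\<^sub>L & t (D - E) ~= 0\<^sub>L}"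
	have "lkp (Psi s * Psi t) D = (\<Sum>E\<in>supp s. \<Sum>E'\<in>supp t. if E + E' = D then ?a E * ?b E' else 0)"
		unfolding Psi_def sum_product by (simp add: mult_single lookup_sum lookup_single when_def)
	also have "\<dots> = (\<Sum>E\<in>supp s. if t (D - E) ~= 0\<^sub>L then ?a E * ?b (D - E) else 0)"
	proof (rule sum.cong[OF refl])
		fix E
		have "(\<Sum>E'\<in>supp t. if E + E' = D then ?a E * ?b E' else 0) = (\<Sum>E'\<in>supp t. if E' = D - E then ?a E * ?b E' else 0)"
			by (rule sum.cong[OF refl]) (auto simp: algebra_simps)
		also have "\<dots> = (if D - E : supp t then ?a E * ?b (D - E) else 0)" using T_D(3)[OF s(2)] by simp
		finally show "(\<Sum>E'\<in>supp t. if E + E' = D then ?a E * ?b E' else 0) = (if t (D - E) ~= 0\<^sub>L then ?a E * ?b (D - E) else 0)"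
			by simp
	qed
	also have "\<dots> = (\<Sum>E\<in>{E : supp s. t (D - E) ~= 0\<^sub>L}. ?a E * ?b (D - E))"
		by (rule sum.inter_filter[symmetric]) (rule T_D(3)[OF s(1)])
	also have "{E : supp s. t (D - E) ~= 0\<^sub>L} = ?S" by blast
	finally have R: "lkp (Psi s * Psi t) D = (\<Sum>E\<in>?S. ?a E * ?b (D - E))" .
	show "lkp (Psi (s *\<^sub>T t)) D = lkp (Psi s * Psi t) D"
	proof (cases "D : L")
		case True
		have "ZN.extend (phi D ((s *\<^sub>T t) D)) = (\<Sum>E\<in>?S. ZN.extend (phi D (s E *\<^sub>L t (D - E))))"
			unfolding T_simps by (rule conjunct2[OF sections_finsum[OF conv_finite[OF s(1)] True]])
				(use conv_sections(1)[OF s True] in simp)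
		also have "\<dots> = (\<Sum>E\<in>?S. ?a E * ?b (D - E))" using conv_sections(2)[OF s True] by (intro sum.cong) auto
		finally show ?thesis using True R by (simp add: lookup_Psi T_mult_closed s)
	next
		case False
		thus ?thesis unfolding R conv_outside[OF s False] by (simp add: lookup_Psi T_mult_closed s)
	qed
qed

lemma T_zero_closed: "0\<^sub>T : carrier T" unfolding T_carrier T_simps using VN.sections_zero by auto

lemma Psi_zero: "Psi 0\<^sub>T = 0" by (simp add: Psi_def T_simps)

lemma one_section: "1\<^sub>L : OV 0" "phi 0 1\<^sub>L = 1\<^sub>Z"
proof -
	have "rV 1\<^sub>V = 1\<^sub>L" "1\<^sub>V : regs V" using VN.FR.one_closed by auto
	thus "1\<^sub>L : OV 0" "phi 0 1\<^sub>L = 1\<^sub>Z" using VN.sections_rat[of "1\<^sub>V"] phi_rat[of "1\<^sub>V"] by (simp_all add: pull_hom(3))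
qed

lemma T_one_closed: "1\<^sub>T : carrier T" unfolding T_simps using in_degree_closed[OF L_closed(1) one_section(1)] .

lemma Psi_in_degree: "D : L ==> f : OV D ==> Psi (indeg D f) = psingle D (ZN.extend (phi D f))"
proof (rule poly_mapping_eqI)
	fix E assume D: "D : L" "f : OV D"
	show "lkp (Psi (indeg D f)) E = lkp (psingle D (ZN.extend (phi D f))) E"
		unfolding lookup_Psi[OF in_degree_closed[OF D]] lookup_single when_def
		using D phi_0[of E] by (auto simp: in_degree_def ZN.extend_zero)
qed

lemma Psi_one: "Psi 1\<^sub>T = 1"
	unfolding T_simps Psi_in_degree[OF L_closed(1) one_section(1)] one_section(2) ZN.extend_one by simp

lemma T_uminus_closed:
	assumes s: "s : carrier T"
	shows "(%D. \<ominus>\<^bsub>KV\<^esub> s D) : carrier T" "(%D. \<ominus>\<^bsub>KV\<^esub> s D) +\<^sub>T s = 0\<^sub>T"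
proof -
	have z: "\<ominus>\<^bsub>KV\<^esub> s D = 0\<^sub>L \<longleftrightarrow> s D = 0\<^sub>L" for D using T_D(5)[OF s, of D] by simp
	show "(%D. \<ominus>\<^bsub>KV\<^esub> s D) : carrier T" unfolding T_carrier z using T_D(1-3)[OF s] VN.sections_uminus by simp
	show "(%D. \<ominus>\<^bsub>KV\<^esub> s D) +\<^sub>T s = 0\<^sub>T" using T_D(5)[OF s] VN.K.l_neg by (intro ext) (simp add: T_simps)
qed

lemma cring_T: "cring T"
proof (rule cringI)
	show "abelian_group T"
	proof (rule abelian_groupI)
		fix s t r assume s: "s : carrier T"
		show "EX t:carrier T. t +\<^sub>T s = 0\<^sub>T" using T_uminus_closed[OF s] by auto
		show "0\<^sub>T +\<^sub>T s = s" using s by (intro Psi_inj) (simp_all add: Psi_add Psi_zero T_zero_closed T_add_closed)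
		assume t: "t : carrier T"
		show "s +\<^sub>T t : carrier T" by (rule T_add_closed[OF s t])
		show "s +\<^sub>T t = t +\<^sub>T s" using s t by (intro Psi_inj) (simp_all add: Psi_add T_add_closed add.commute)
		assume "r : carrier T"
		thus "s +\<^sub>T t +\<^sub>T r = s +\<^sub>T (t +\<^sub>T r)" using s t by (intro Psi_inj) (simp_all add: Psi_add T_add_closed add.assoc)
	qed (rule T_zero_closed)
	show "comm_monoid T"
	proof (rule comm_monoidI)
		fix s t r assume s: "s : carrier T"
		show "1\<^sub>T *\<^sub>T s = s" using s by (intro Psi_inj) (simp_all add: Psi_mult Psi_one T_one_closed T_mult_closed)
		assume t: "t : carrier T"
		show "s *\<^sub>T t : carrier T" by (rule T_mult_closed[OF s t])
		show "s *\<^sub>T t = t *\<^sub>T s" using s t by (intro Psi_inj) (simp_all add: Psi_mult T_mult_closed mult.commute)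
		assume "r : carrier T"
		thus "s *\<^sub>T t *\<^sub>T r = s *\<^sub>T (t *\<^sub>T r)"
			using s t by (intro Psi_inj) (simp_all add: Psi_mult T_mult_closed mult.assoc)
	qed (rule T_one_closed)
	fix s t r assume "s : carrier T" "t : carrier T" "r : carrier T"
	thus "(s +\<^sub>T t) *\<^sub>T r = s *\<^sub>T r +\<^sub>T t *\<^sub>T r"
		by (intro Psi_inj) (simp_all add: Psi_mult Psi_add T_add_closed T_mult_closed distrib_right)
qed

sublocale T: cring T by (rule cring_T)

lemma T_uminus: "s : carrier T ==> \<ominus>\<^bsub>T\<^esub> s = (%D. \<ominus>\<^bsub>KV\<^esub> s D)" using T_uminus_closed T.minus_equality by simp

lemma T_minus: "s : carrier T ==> t : carrier T ==> (s \<ominus>\<^bsub>T\<^esub> t) D = s D \<ominus>\<^bsub>KV\<^esub> t D"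
	by (simp add: a_minus_def T_uminus T_simps)

text \<open>The divisor algebra is spanned by its homogeneous elements.\<close>

lemma T_induct [consumes 1, case_names zero in_degree add]:
	assumes "s : carrier T" and zero: "P 0\<^sub>T"
		and deg: "!!D f. D : L ==> f : OV D ==> P (indeg D f)"
		and add: "!!s t. s : carrier T ==> t : carrier T ==> P s ==> P t ==> P (s +\<^sub>T t)"
	shows "P s" using assms(1)
proof (induction "card (supp s)" arbitrary: s)
	case 0
	hence "s = 0\<^sub>T" using T_D(3)[OF 0(2)] by (auto simp: T_simps)
	thus ?case using zero by simp
next
	case (Suc n)
	have fin: "finite (supp s)" using T_D(3)[OF Suc.prems] .
	then obtain D where D: "s D ~= 0\<^sub>L"
		using Suc.hyps(2) by (metis (mono_tags, lifting) card_eq_0_iff empty_Collect_eq nat.distinct(1))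
	have DL: "D : L" "s D : OV D" using T_D(4)[OF Suc.prems D] T_D(1)[OF Suc.prems] by blast+
	define t where "t = s(D := 0\<^sub>L)"
	have st: "supp t = supp s - {D}" by (auto simp: t_def)
	have tT: "t : carrier T" unfolding T_carrier st using T_D[OF Suc.prems] VN.sections_zero by (auto simp: t_def)
	have "card (supp t) = n" unfolding st using D Suc.hyps(2) by simp
	hence "P t" using Suc.hyps(1) tT by simp
	moreover have "s = indeg D (s D) +\<^sub>T t"
		using T_D(5)[OF Suc.prems] by (intro ext) (simp add: T_simps in_degree_def t_def)
	ultimately show ?case using add[OF in_degree_closed[OF DL] tT deg[OF DL]] by simp
qed

definition Phi :: "((('z => 'k) => 'k) divisor => (('z => 'k) => 'k, 'k) rat_fun) => 'z => 'k" where
	"Phi s = (\<lambda>z\<in>points Z. \<Sum>D\<in>supp s. phi D (s D) z)"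

lemma phi_supp: "s : carrier T ==> D : supp s ==> phi D (s D) : regs Z" using phi(1) T_D(1,4) by simp

lemma Phi_regs: "s : carrier T ==> Phi s : regs Z" unfolding Phi_def by (intro ZN.reg_sum) (rule phi_supp)

lemma Phi_apply: "z : points Z ==> Phi s z = (\<Sum>D\<in>supp s. phi D (s D) z)" by (simp add: Phi_def)

lemma Phi_total:
	assumes "s : carrier T" "z : points Z"
	shows "Phi s z = total (Psi s) z"
proof -
	have app: "(\<Sum>D\<in>S. g D) z = (\<Sum>D\<in>S. g D z)" for S and g :: "(('z => 'k) => 'k) divisor => 'z => 'k"
		by (induction S rule: infinite_finite_induct) auto
	show ?thesis using assms by (simp add: Phi_apply Psi_def total_sum total_single app ZN.extend_apply)
qed

lemma Phi_add: "s : carrier T ==> t : carrier T ==> Phi (s +\<^sub>T t) = Phi s +\<^sub>Z Phi t"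
	using Phi_regs T_add_closed ZN.FR.a_closed[of "Phi s" "Phi t"]
	by (intro ZN.reg_eqI) (simp_all add: Phi_total Psi_add total_add)

lemma Phi_mult: "s : carrier T ==> t : carrier T ==> Phi (s *\<^sub>T t) = Phi s *\<^sub>Z Phi t"
	using Phi_regs T_mult_closed ZN.FR.m_closed[of "Phi s" "Phi t"]
	by (intro ZN.reg_eqI) (simp_all add: Phi_total Psi_mult total_mult)

lemma Phi_in_degree: "D : L ==> f : OV D ==> Phi (indeg D f) = phi D f"
	using Phi_regs[OF in_degree_closed] phi(1) in_degree_closed
	by (intro ZN.reg_eqI) (simp_all add: Phi_total Psi_in_degree total_single ZN.extend_apply)

lemma Phi_one: "Phi 1\<^sub>T = 1\<^sub>Z" unfolding T_simps Phi_in_degree[OF L_closed(1) one_section(1)] by (rule one_section(2))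

lemma Phi_hom: "Phi : ring_hom T AZ" using Phi_regs Phi_add Phi_mult Phi_one by (intro ring_hom_memI) simp_all

sublocale Phi: ring_hom_cring T AZ Phi
	by (intro ring_hom_cring.intro ring_hom_cring_axioms.intro cring_T ZN.FR.is_cring Phi_hom)

section \<open>The Cox ring\<close>

abbreviation I where "I == cox_ideal V L F"

definition relation where
	"relation D E f = indeg D f \<ominus>\<^bsub>T\<^esub> indeg E (F (D - E) *\<^sub>L f)"

lemma relation_closed:
	assumes "D : L" "E : L" "D - E : PV" "f : OV D"
	shows "relation D E f : carrier T" "Phi (relation D E f) = 0\<^sub>Z"
proof -
	note c = in_degree_closed[OF assms(1,4)] in_degree_closed[OF assms(2) phi_shift(1)[OF assms]]
	show "relation D E f : carrier T" unfolding relation_def using c by simp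
	have "Phi (relation D E f) = phi D f \<ominus>\<^bsub>AZ\<^esub> phi D f"
		unfolding relation_def a_minus_def using c Phi_in_degree[OF assms(1,4)] Phi_in_degree[OF assms(2) phi_shift(1)[OF assms]] phi_shift(2)[OF assms]
			by simp
	thus "Phi (relation D E f) = 0\<^sub>Z" using phi(1)[OF assms(1,4)] by simp
qed

lemma cox_ideal_eq: "I = Idl\<^bsub>T\<^esub> {relation D E f | D E f. D : L & E : L & D - E : PV & f : OV D}"
	unfolding cox_ideal_def relation_def ..

lemma relations_closed: "{relation D E f | D E f. D : L & E : L & D - E : PV & f : OV D} \<subseteq> carrier T"
	using relation_closed(1) by auto

lemma ideal_I: "ideal I T" unfolding cox_ideal_eq by (rule T.genideal_ideal[OF relations_closed])

sublocale I: ideal I T by (rule ideal_I)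

lemma relation_I: "D : L ==> E : L ==> D - E : PV ==> f : OV D ==> relation D E f : I"
	unfolding cox_ideal_eq using T.genideal_self[OF relations_closed] by auto

lemma I_kernel: "s : I ==> s : carrier T & Phi s = 0\<^sub>Z"
proof -
	have "ideal (a_kernel T AZ Phi) T"
		by (rule ring_hom_ring.kernel_is_ideal[OF ring_hom_ringI2[OF T.ring_axioms ZN.FR.ring_axioms Phi_hom]])
	moreover have "{relation D E f | D E f. D : L & E : L & D - E : PV & f : OV D} \<subseteq> a_kernel T AZ Phi"
		using relation_closed unfolding a_kernel_def' by blast
	ultimately have "I \<subseteq> a_kernel T AZ Phi" unfolding cox_ideal_eq by (rule T.genideal_minimal)
	thus "s : I ==> s : carrier T & Phi s = 0\<^sub>Z" unfolding a_kernel_def' by blast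
qed

text \<open>Modulo the relations, an element has at most one component in every divisor class. Components in
	different classes have different weights, so they are independent.\<close>

lemma kernel_I:
	assumes "s : carrier T" "Phi s = 0\<^sub>Z"
	shows "s : I" using assms
proof (induction "card (supp s)" arbitrary: s rule: less_induct)
	case less
	note sT = less.prems(1)
	have fin: "finite (supp s)" using T_D(3)[OF sT] .
	show ?case
	proof (cases "inj_on \<delta> (supp s)")
		case False
		then obtain D E where DE: "s D ~= 0\<^sub>L" "s E ~= 0\<^sub>L" "D ~= E" "\<delta> D = \<delta> E" by (auto simp: inj_on_def)
		have L: "D : L" "E : L" using T_D(4)[OF sT] DE by blast+
		have P: "D - E : PV" using \<delta>_eq_iff[OF L] DE(4) by simp
		have f: "s D : OV D" using T_D(1)[OF sT L(1)] .
		note r = relation_closed[OF L P f] and rI = relation_I[OF L P f]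
		note c = in_degree_closed[OF L(1) f] in_degree_closed[OF L(2) phi_shift(1)[OF L P f]]
		define t where "t = s \<ominus>\<^bsub>T\<^esub> relation D E (s D)"
		have tT: "t : carrier T" unfolding t_def using sT r(1) by simp
		have "t D' = 0\<^sub>L" if "D' \<notin> supp s - {D}" for D'
		proof -
			have "t D' = s D' \<ominus>\<^bsub>KV\<^esub> (indeg D (s D) D' \<ominus>\<^bsub>KV\<^esub> indeg E (F (D - E) *\<^sub>L s D) D')"
				unfolding t_def T_minus[OF sT r(1)] by (simp add: relation_def T_minus[OF c])
			also have "\<dots> = 0\<^sub>L"
			proof (cases "D' = D")
				case True
				thus ?thesis using DE(3) T_D(5)[OF sT, of D] by (simp add: in_degree_def a_minus_def VN.K.r_neg)
			next
				case False
				moreover have "s D' = 0\<^sub>L" using that False by simp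
				moreover have "D' ~= E" using DE(2) \<open>s D' = 0\<^sub>L\<close> by auto
				ultimately show ?thesis by (simp add: in_degree_def a_minus_def)
			qed
			finally show ?thesis .
		qed
		hence "supp t \<subseteq> supp s - {D}" by blast
		moreover have "D : supp s" using DE(1) by simp
		ultimately have "supp t \<subset> supp s" by blast
		hence "card (supp t) < card (supp s)" by (rule psubset_card_mono[OF fin])
		moreover have "Phi t = 0\<^sub>Z" unfolding t_def a_minus_def using sT r less.prems(2) by (simp del: ZN.A_simps(1))
		ultimately have "t : I" using less.hyps tT by blast
		moreover have "s = t +\<^sub>T relation D E (s D)"
			unfolding t_def a_minus_def using sT r(1) by (simp add: T.a_assoc T.l_neg)
		ultimately show ?thesis using rI I.a_closed by metis
	next
		case True
		have chars: "\<delta> ` supp s \<subseteq> chars" using \<delta>(1) T_D(4)[OF sT] by auto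
		have "phi D (s D) z = 0" if D: "D : supp s" and z: "z : points Z" for D z
		proof -
			define c where "c chi = phi (inv_into (supp s) \<delta> chi) (s (inv_into (supp s) \<delta> chi)) z" for chi
			have c: "c (\<delta> E) = phi E (s E) z" if "E : supp s" for E unfolding c_def using inv_into_f_f[OF True that] by simp
			have "(\<Sum>chi\<in>\<delta> ` supp s. c chi * chi g) = 0" if g: "g : carrier Q" for g
			proof -
				have "(\<Sum>chi\<in>\<delta> ` supp s. c chi * chi g) = (\<Sum>E\<in>supp s. phi E (s E) z * \<delta> E g)"
					using True c by (simp add: sum.reindex)
				also have "\<dots> = (\<Sum>E\<in>supp s. phi E (s E) (rho g z))"
				proof (rule sum.cong[OF refl])
					fix E assume "E : supp s"
					hence "phi E (s E) : ws (\<delta> E)" using \<delta>(2) T_D(1,4)[OF sT] by simp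
					thus "phi E (s E) z * \<delta> E g = phi E (s E) (rho g z)" using wsD(2)[OF _ g z, of "phi E (s E)" "\<delta> E"] by simp
				qed
				also have "\<dots> = 0" using Phi_apply[OF action_closed[OF g z], of s] less.prems(2) action_closed[OF g z] by simp
				finally show ?thesis .
			qed
			hence "c (\<delta> D) = 0" using QG.characters_independent[OF finite_imageI[OF fin] chars, of c "\<delta> D"] D by simp
			thus ?thesis using c[OF D] by simp
		qed
		hence "phi D (s D) = 0\<^sub>Z" if "D : supp s" for D
			using phi_supp[OF sT that] that ZN.FR.zero_closed by (intro ZN.reg_eqI) simp_all
		hence "s D = 0\<^sub>L" for D using phi_zero_iff[of D "s D"] T_D(1,4)[OF sT] by auto
		hence "s = 0\<^sub>T" by (intro ext) (simp add: T_simps)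
		thus ?thesis by simp
	qed
qed

end

context cox_multipliers begin

abbreviation R where "R == cox_ring V L F"
abbreviation cl where "cl s == I +>\<^bsub>T\<^esub> s"

lemma R_carrier: "xi : carrier R \<longleftrightarrow> (EX s:carrier T. xi = cl s)"
	by (auto simp: cox_ring_def quotient_algebra_def FactRing_def A_RCOSETS_def')

lemma R_carrierE:
	assumes "xi : carrier R"
	obtains s where "s : carrier T" "xi = cl s" using assms unfolding R_carrier by auto

lemma cl_closed: "s : carrier T ==> cl s : carrier R" unfolding R_carrier by blast

lemma R_ops:
	assumes "s : carrier T" "t : carrier T"
	shows "cl s \<otimes>\<^bsub>R\<^esub> cl t = cl (s *\<^sub>T t)" "cl s \<oplus>\<^bsub>R\<^esub> cl t = cl (s +\<^sub>T t)" "\<one>\<^bsub>R\<^esub> = cl 1\<^sub>T"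
	using I.rcoset_mult_add[OF assms] I.a_rcos_sum[OF assms]
			by (simp_all add: cox_ring_def quotient_algebra_def FactRing_def)

lemma cl_eq_iff:
	assumes s: "s : carrier T" "t : carrier T"
	shows "cl s = cl t \<longleftrightarrow> Phi s = Phi t"
proof
	have mem: "x : cl y \<longleftrightarrow> (EX i:I. x = i +\<^sub>T y)" for x y by (auto simp: a_r_coset_def')
	{
		assume "cl s = cl t"
		moreover have "s : cl s" unfolding mem using I.zero_closed s by (intro bexI[of _ "0\<^sub>T"]) simp_all
		ultimately obtain i where i: "i : I" "s = i +\<^sub>T t" using mem by auto
		have "Phi s = 0\<^sub>Z +\<^sub>Z Phi t" using I_kernel[OF i(1)] s(2) i(2) by simp
		thus "Phi s = Phi t" using Phi_regs[OF s(2)] by simp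
	}
	assume eq: "Phi s = Phi t"
	have "Phi (s \<ominus>\<^bsub>T\<^esub> t) = 0\<^sub>Z" unfolding a_minus_def using s eq Phi_regs[OF s(2)] ZN.FR.r_neg[of "Phi t"] by simp
	hence "s \<ominus>\<^bsub>T\<^esub> t : I" using kernel_I s by simp
	moreover have "s = (s \<ominus>\<^bsub>T\<^esub> t) +\<^sub>T t" using s by (simp add: a_minus_def T.a_assoc T.l_neg)
	ultimately have "s : cl t" unfolding mem by blast
	thus "cl s = cl t" using T.a_repr_independence[OF _ s(2) I.a_subgroup] by simp
qed

lemma smult_zero: "c \<odot>\<^bsub>KV\<^esub> 0\<^sub>L = 0\<^sub>L"
	using VN.smult_rat[of "0\<^sub>L" c] VN.rat_closed[OF VN.reg_smult[of "1\<^sub>V" c]] VN.FR.one_closed by simp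

lemma supp_smult: "supp (c \<odot>\<^sub>T s) \<subseteq> supp s"
proof
	fix D assume "D : supp (c \<odot>\<^sub>T s)"
	thus "D : supp s" using smult_zero[of c] unfolding T_simps mem_Collect_eq by metis
qed

lemma T_smult_in_degree: "f : carrier KV ==> c \<odot>\<^sub>T indeg D f = indeg D (c \<odot>\<^bsub>KV\<^esub> f)"
proof
	fix E assume f: "f : carrier KV"
	show "(c \<odot>\<^sub>T indeg D f) E = indeg D (c \<odot>\<^bsub>KV\<^esub> f) E" by (simp add: T_simps in_degree_def smult_zero)
qed

lemma phi_smult:
	assumes "D : L" "f : OV D" "z : points Z"
	shows "phi D (c \<odot>\<^bsub>KV\<^esub> f) z = c * phi D f z"
proof -
	have c: "c \<odot>\<^bsub>AV\<^esub> 1\<^sub>V : regs V" using VN.reg_smult[of "1\<^sub>V" c] VN.FR.one_closed by simp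
	have "phi D (c \<odot>\<^bsub>KV\<^esub> f) = phi 0 (rV (c \<odot>\<^bsub>AV\<^esub> 1\<^sub>V)) *\<^sub>Z phi D f"
		using phi_mult[OF L_closed(1) assms(1) VN.sections_rat[OF c] assms(2)] VN.smult_rat[OF VN.sections_carrier[OF assms(2)]] by simp
	thus ?thesis using phi_rat[OF c] assms(3) by (simp add: pull_hom)
qed

lemma T_smult_closed:
	assumes s: "s : carrier T"
	shows "c \<odot>\<^sub>T s : carrier T"
proof -
	have "finite (supp (c \<odot>\<^sub>T s))" using supp_smult T_D(3)[OF s] by (rule finite_subset)
	thus ?thesis unfolding T_carrier using T_D(1,2)[OF s] VN.sections_smult smult_zero by (simp add: T_simps)
qed

lemma Phi_smult:
	assumes s: "s : carrier T" and z: "z : points Z"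
	shows "Phi (c \<odot>\<^sub>T s) z = c * Phi s z"
proof -
	have "(\<Sum>D\<in>supp s. phi D ((c \<odot>\<^sub>T s) D) z) = (\<Sum>D\<in>supp s. c * phi D (s D) z)"
		using T_D(1,4)[OF s] z phi_smult by (intro sum.cong) (simp_all add: T_simps)
	moreover have "(\<Sum>D\<in>supp s. phi D ((c \<odot>\<^sub>T s) D) z) = (\<Sum>D\<in>supp (c \<odot>\<^sub>T s). phi D ((c \<odot>\<^sub>T s) D) z)"
	proof (rule sum.mono_neutral_right)
		show "supp (c \<odot>\<^sub>T s) \<subseteq> supp s" by (rule supp_smult)
		show "ALL D:supp s - supp (c \<odot>\<^sub>T s). phi D ((c \<odot>\<^sub>T s) D) z = 0" using T_D(4)[OF s] phi_0 z by simp
	qed (rule T_D(3)[OF s])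
	ultimately show ?thesis using z by (simp add: Phi_apply sum_distrib_left)
qed

lemma R_smult:
	assumes s: "s : carrier T"
	shows "c \<odot>\<^bsub>R\<^esub> cl s = cl (c \<odot>\<^sub>T s)"
proof -
	have "cl (c \<odot>\<^sub>T a) = cl (c \<odot>\<^sub>T s)" if a: "a : cl s" for a
	proof -
		have aT: "a : carrier T" by (rule I.a_elemrcos_carrier[OF s a])
		have "cl a = cl s" using T.a_repr_independence[OF a s I.a_subgroup] by simp
		hence "Phi a = Phi s" using cl_eq_iff[OF aT s] by simp
		hence "Phi (c \<odot>\<^sub>T a) = Phi (c \<odot>\<^sub>T s)"
			using Phi_regs T_smult_closed aT s by (intro ZN.reg_eqI) (simp_all add: Phi_smult)
		thus ?thesis using cl_eq_iff[OF T_smult_closed[OF aT] T_smult_closed[OF s]] by simp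
	qed
	moreover have "cl s ~= {}" unfolding a_r_coset_def' using I.zero_closed by blast
	ultimately have "(\<Union>a\<in>cl s. cl (c \<odot>\<^sub>T a)) = cl (c \<odot>\<^sub>T s)" by blast
	thus ?thesis by (simp add: cox_ring_def quotient_algebra_def)
qed

lemma alg_homs_R:
	assumes x: "x : alg_homs R" and s: "s : carrier T"
	shows "t : carrier T ==> x (cl (s +\<^sub>T t)) = x (cl s) + x (cl t)"
		"t : carrier T ==> x (cl (s *\<^sub>T t)) = x (cl s) * x (cl t)"
		"x (cl 1\<^sub>T) = 1" "x (cl (c \<odot>\<^sub>T s)) = c * x (cl s)"
proof -
	have h: "x : ring_hom R ring_of_type_algebra" and sm: "!!c a. a : carrier R ==> x (c \<odot>\<^bsub>R\<^esub> a) = c * x a"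
		using x by (auto simp: alg_homs_def)
	show "t : carrier T ==> x (cl (s +\<^sub>T t)) = x (cl s) + x (cl t)"
		using ring_hom_add[OF h cl_closed[OF s] cl_closed[of t]] by (simp add: R_ops s ring_of_type_algebra_def)
	show "t : carrier T ==> x (cl (s *\<^sub>T t)) = x (cl s) * x (cl t)"
		using ring_hom_mult[OF h cl_closed[OF s] cl_closed[of t]] by (simp add: R_ops s ring_of_type_algebra_def)
	show "x (cl 1\<^sub>T) = 1" using ring_hom_one[OF h] R_ops(3)[OF s s] by (simp add: ring_of_type_algebra_def)
	show "x (cl (c \<odot>\<^sub>T s)) = c * x (cl s)" using sm[OF cl_closed[OF s], of c] by (simp add: R_smult s)
qed

lemma alg_homs_R_zero: "x : alg_homs R ==> x (cl 0\<^sub>T) = 0" using alg_homs_R(1)[of x "0\<^sub>T" "0\<^sub>T"] by simp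

lemma alg_homs_R_eqI:
	assumes x: "x : alg_homs R" "y : alg_homs R"
		and eq: "!!D f. D : L ==> f : OV D ==> x (cl (indeg D f)) = y (cl (indeg D f))"
	shows "x = y"
proof (rule extensionalityI[of _ "carrier R"])
	show "x : extensional (carrier R)" "y : extensional (carrier R)" using x by (auto simp: alg_homs_def)
	fix xi assume "xi : carrier R"
	then obtain s where s: "s : carrier T" "xi = cl s" unfolding R_carrier by blast
	from s(1) have "x (cl s) = y (cl s)"
	proof (induction rule: T_induct)
		case (add s t)
		thus ?case by (simp add: alg_homs_R(1)[OF x(1)] alg_homs_R(1)[OF x(2)])
	qed (simp_all add: alg_homs_R_zero x eq)
	thus "x xi = y xi" using s(2) by simp
qed

lemma in_degree_mult:
	assumes "D : L" "E : L" "f : OV D" "g : OV E"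
	shows "indeg D f *\<^sub>T indeg E g = indeg (D + E) (f *\<^sub>L g)"
proof (rule Psi_inj)
	note c = in_degree_closed[OF assms(1,3)] in_degree_closed[OF assms(2,4)]
	have DE: "D + E : L" "f *\<^sub>L g : OV (D + E)"
		using L_closed(2)[OF assms(1,2)] VN.sections_mult[OF assms(3,4)] by blast+
	show "indeg D f *\<^sub>T indeg E g : carrier T" "indeg (D + E) (f *\<^sub>L g) : carrier T"
		using c in_degree_closed[OF DE] by auto
	show "Psi (indeg D f *\<^sub>T indeg E g) = Psi (indeg (D + E) (f *\<^sub>L g))"
		unfolding Psi_mult[OF c] Psi_in_degree[OF DE] Psi_in_degree[OF assms(1,3)] Psi_in_degree[OF assms(2,4)] phi_mult[OF assms]
		by (simp add: mult_single ZN.extend_mult)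
qed

lemma in_degree_add:
	"indeg D f +\<^sub>T indeg D g = indeg D (f +\<^sub>L g)" by (intro ext) (simp add: T_simps in_degree_def)

section \<open>The covering map\<close>

definition nu :: "'z => (('z => 'k) => 'k, 'k) cox_point" where
	"nu z = (\<lambda>xi\<in>carrier R. Phi (SOME s. s : carrier T & cl s = xi) z)"

lemma nu_cl:
	assumes s: "s : carrier T"
	shows "nu z (cl s) = Phi s z"
proof -
	define t where "t = (SOME t. t : carrier T & cl t = cl s)"
	have "t : carrier T & cl t = cl s"
		unfolding t_def using s by (intro someI[of "%t. t : carrier T & cl t = cl s" s]) simp
	hence "Phi t = Phi s" using cl_eq_iff[of t s] s by simp
	thus ?thesis using cl_closed[OF s] by (simp add: nu_def t_def)
qed

lemma nu_point:
	assumes z: "z : points Z"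
	shows "nu z : alg_homs R"
proof -
	have "nu z : ring_hom R ring_of_type_algebra"
	proof (rule ring_hom_memI)
		fix xi eta assume "xi : carrier R" "eta : carrier R"
		then obtain s t where s: "s : carrier T" "xi = cl s" "t : carrier T" "eta = cl t" unfolding R_carrier by blast
		show "nu z xi : carrier ring_of_type_algebra" by (simp add: ring_of_type_algebra_def)
		show "nu z (xi \<otimes>\<^bsub>R\<^esub> eta) = nu z xi \<otimes>\<^bsub>ring_of_type_algebra\<^esub> nu z eta"
			"nu z (xi \<oplus>\<^bsub>R\<^esub> eta) = nu z xi \<oplus>\<^bsub>ring_of_type_algebra\<^esub> nu z eta"
			unfolding s(2,4) R_ops[OF s(1,3)] using s(1,3) z by (simp_all add: nu_cl Phi_mult Phi_add ring_of_type_algebra_def)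
	next
		show "nu z \<one>\<^bsub>R\<^esub> = \<one>\<^bsub>ring_of_type_algebra\<^esub>"
			unfolding R_ops(3)[OF T_one_closed T_one_closed] using z by (simp add: nu_cl Phi_one ring_of_type_algebra_def)
	qed
	moreover have "nu z : extensional (carrier R)" by (simp add: nu_def)
	moreover have "nu z (c \<odot>\<^bsub>R\<^esub> xi) = c * nu z xi" if xi: "xi : carrier R" for c xi
	proof -
		obtain s where s: "s : carrier T" "xi = cl s" by (rule R_carrierE[OF xi])
		show ?thesis unfolding s(2) R_smult[OF s(1)] using s(1) z by (simp add: nu_cl T_smult_closed Phi_smult)
	qed
	ultimately show ?thesis by (simp add: alg_homs_def)
qed

lemma cox_space_simps: "points (cox_space V L F) = alg_homs R" "regs (cox_space V L F) = spec_function R ` carrier R"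
	by (simp_all add: cox_space_def spec_def)

lemma cox_space_regsE:
	assumes "f : spec_function R ` carrier R"
	obtains s where "s : carrier T" "f = spec_function R (cl s)" using assms by (elim imageE R_carrierE) simp

lemma nu_morphism: "morphism Z (cox_space V L F) nu" unfolding morphism_def cox_space_simps
proof (intro conjI ballI funcsetI)
	fix f assume "f : spec_function R ` carrier R"
	then obtain s where s: "s : carrier T" "f = spec_function R (cl s)" by (rule cox_space_regsE)
	have "(\<lambda>z\<in>points Z. f (nu z)) = (\<lambda>z\<in>points Z. Phi s z)"
		using nu_point nu_cl[OF s(1)] by (intro restrict_ext) (simp add: s(2) spec_function_def)
	thus "(\<lambda>z\<in>points Z. f (nu z)) : regs Z" using ZN.reg_restrict[OF Phi_regs[OF s(1)]] Phi_regs[OF s(1)] by simp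
qed (rule nu_point)

text \<open>A function on the spectrum that vanishes on the image has zero image under the embedding of the Cox
	ring.\<close>

lemma nu_dominant: "dominant Z (cox_space V L F) nu"
proof -
	let ?W = "cox_space V L F"
	have mult: "(\<lambda>p\<in>points ?W. f p * g p) : regs ?W" if fg: "f : regs ?W" "g : regs ?W" for f g
	proof -
		obtain s where s: "s : carrier T" "f = spec_function R (cl s)"
			using fg(1) unfolding cox_space_simps by (rule cox_space_regsE)
		obtain t where t: "t : carrier T" "g = spec_function R (cl t)"
			using fg(2) unfolding cox_space_simps by (rule cox_space_regsE)
		have "(\<lambda>p\<in>alg_homs R. f p * g p) = spec_function R (cl (s *\<^sub>T t))"
			unfolding spec_function_def s(2) t(2) by (intro restrict_ext) (simp add: alg_homs_R(2) s(1) t(1))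
		thus ?thesis
			unfolding cox_space_simps using imageI[OF cl_closed[OF T_mult_closed[OF s(1) t(1)]], of "spec_function R"] by simp
	qed
	have openin: "openin (zariski ?W) U \<longleftrightarrow> (\<exists>S\<subseteq>regs ?W. U = {p : points ?W. EX f:S. f p ~= 0})" for U
		by (rule openin_zariski_if_mult_closed) (rule mult)
	have one: "spec_function R (cl 1\<^sub>T) : regs ?W" unfolding cox_space_simps using cl_closed[OF T_one_closed] by simp
	have "spec_function R (cl 1\<^sub>T) p ~= 0" if "p : points ?W" for p
		using alg_homs_R(3)[OF _ T_one_closed, of p] that by (simp add: spec_function_def cox_space_simps)
	hence "points ?W = {p : points ?W. EX f:{spec_function R (cl 1\<^sub>T)}. f p ~= 0}" by blast
	hence "openin (zariski ?W) (points ?W)"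
		using one by (intro openin[THEN iffD2] exI[of _ "{spec_function R (cl 1\<^sub>T)}"]) simp
	moreover have "U \<subseteq> points ?W" if "openin (zariski ?W) U" for U using that unfolding openin by blast
	ultimately have top: "topspace (zariski ?W) = points ?W" unfolding topspace_def by blast
	have "p : zariski ?W closure_of (nu ` points Z)" if p: "p : points ?W" for p unfolding in_closure_of top
	proof (intro conjI allI impI)
		fix U assume U: "p : U & openin (zariski ?W) U"
		then obtain S where S: "S \<subseteq> regs ?W" "U = {p : points ?W. EX f:S. f p ~= 0}" unfolding openin by blast
		then obtain f where f: "f : S" "f p ~= 0" using U by auto
		have "f : spec_function R ` carrier R" using S(1) f(1) unfolding cox_space_simps by (rule subsetD)
		then obtain s where s: "s : carrier T" "f = spec_function R (cl s)" by (rule cox_space_regsE)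
		have "Phi s ~= 0\<^sub>Z"
		proof
			assume "Phi s = 0\<^sub>Z"
			hence "cl s = cl 0\<^sub>T" using cl_eq_iff[OF s(1) T_zero_closed] by simp
			thus False using f(2) p alg_homs_R_zero[of p] by (simp add: s(2) spec_function_def cox_space_simps)
		qed
		then obtain z where z: "z : points Z" "Phi s z ~= 0"
			using ZN.reg_eqI[OF Phi_regs[OF s(1)], of "0\<^sub>Z"] ZN.FR.zero_closed by auto
		have "nu z : U" unfolding S(2) cox_space_simps using nu_point[OF z(1)] f(1) z(2) nu_cl[OF s(1)]
			by (auto simp: s(2) spec_function_def intro!: bexI[of _ f])
		thus "EX y. y : nu ` points Z & y : U" using z(1) by auto
	qed (rule p)
	hence "points ?W \<subseteq> zariski ?W closure_of (nu ` points Z)" by blast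
	moreover have "zariski ?W closure_of (nu ` points Z) \<subseteq> points ?W"
		using closure_of_subset_topspace[of "zariski ?W"] unfolding top by blast
	ultimately show ?thesis unfolding dominant_def by blast
qed

lemma cox_of_reg_eq: "cox_of_reg V L F a = cl (indeg 0 (rV a))" by (simp add: cox_of_reg_def)

lemma eval_at_inj: "inj_on (eval_at V) (points V)" using V_affine(1) by (simp add: affine_variety_def bij_betw_def)

lemma nu_realization:
	assumes z: "z : points Z"
	shows "cox_realization V L F (nu z) = pi z"
proof -
	have "(\<lambda>f\<in>regs V. nu z (cox_of_reg V L F f)) = eval_at V (pi z)" unfolding eval_at_def cox_of_reg_eq
	proof (rule restrict_ext)
		fix f assume f: "f : regs V"
		show "nu z (cl (indeg 0 (rV f))) = f (pi z)"
			using nu_cl[OF in_degree_closed[OF L_closed(1) VN.sections_rat[OF f]]] Phi_in_degree[OF L_closed(1) VN.sections_rat[OF f]] phi_rat[OF f] z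
			by simp
	qed
	thus ?thesis unfolding cox_realization_def using inv_into_f_f[OF eval_at_inj pi_point[OF z]] by simp
qed

abbreviation kappa where "kappa D == PV #>\<^bsub>weil_divisors V\<^esub> D"

lemma principal_normal: "PV \<lhd> weil_divisors V"
proof -
	interpret W: comm_group "weil_divisors V" by (rule weil_comm_group)
	have sub: "PV \<subseteq> carrier (weil_divisors V)"
	proof
		fix D assume "D : PV"
		then obtain w where "w : VN.Kx" "D = div_of V w" unfolding principal_iff by auto
		thus "D : carrier (weil_divisors V)" using VN.div_weil[of w] by simp
	qed
	have "subgroup PV (weil_divisors V)"
	proof (rule W.subgroupI)
		show "PV ~= {}" using principal_closed(1) by auto
		fix a b assume a: "a : PV" "b : PV"
		show "a \<otimes>\<^bsub>weil_divisors V\<^esub> b : PV" unfolding VN.weil_mult by (rule principal_closed(2)[OF a])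
	next
		fix a assume a: "a : PV"
		thus "inv\<^bsub>weil_divisors V\<^esub> a : PV" using weil_inv[of a] sub principal_closed(3)[OF a] by auto
	qed (rule sub)
	thus ?thesis by (rule W.subgroup_imp_normal)
qed

lemma kappa:
	shows "D : L ==> kappa D : carrier (class_group V)"
		"D : L ==> E : L ==> kappa (D + E) = kappa D \<otimes>\<^bsub>class_group V\<^esub> kappa E"
		"D : L ==> kappa D = \<one>\<^bsub>class_group V\<^esub> \<longleftrightarrow> D : PV" "D : L ==> D : kappa D"
		"u : carrier (class_group V) ==> EX D:L. u = kappa D"
proof -
	interpret W: comm_group "weil_divisors V" by (rule weil_comm_group)
	interpret P: normal PV "weil_divisors V" by (rule principal_normal)
	have im: "(%D. kappa D) ` L = carrier (class_group V)" using presenting by (simp add: presenting_subgroup_def)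
	show "D : L ==> kappa D : carrier (class_group V)" using im by auto
	show "u : carrier (class_group V) ==> EX D:L. u = kappa D" using im by auto
	show "D : L ==> E : L ==> kappa (D + E) = kappa D \<otimes>\<^bsub>class_group V\<^esub> kappa E"
		using P.rcos_sum[OF L_weil L_weil, of D E] by (simp add: class_group_def FactGroup_def VN.weil_mult)
	show "D : L ==> kappa D = \<one>\<^bsub>class_group V\<^esub> \<longleftrightarrow> D : PV"
		using W.coset_join1[OF _ L_weil P.is_subgroup, of D] W.coset_join2[OF L_weil P.is_subgroup, of D]
			by (auto simp: class_group_def FactGroup_def)
	show "D : L ==> D : kappa D" using W.rcos_self[OF L_weil P.is_subgroup, of D] .
qed

abbreviation LG where "LG == (weil_divisors V)\<lparr>carrier := L\<rparr>"

lemma LG: "comm_group LG" "carrier LG = L" "D \<otimes>\<^bsub>LG\<^esub> E = D + E"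
proof -
	interpret W: comm_group "weil_divisors V" by (rule weil_comm_group)
	interpret G: group LG by (rule subgroup.subgroup_is_group[OF L_subgroup W.is_group])
	show "comm_group LG" by (rule G.group_comm_groupI) (simp add: VN.weil_mult add.commute)
qed (simp_all add: VN.weil_mult)

lemma \<delta>_hom: "\<delta> : hom LG XQ" using \<delta>(1) \<delta>_add by (intro homI) (simp_all add: VN.weil_mult)

end

locale cox_covering = cox_multipliers Z Q rho V L F H + NG: quasitorus_group N
	for Z :: "('z, 'k::{alg_closed_field, field_char_0}) variety" and Q :: "('g, 'k) alg_group"
		and rho :: "'g => 'z => 'z" and V :: "(('z => 'k) => 'k, 'k) variety"
		and L :: "(('z => 'k) => 'k) divisor set"
		and F :: "(('z => 'k) => 'k) divisor => (('z => 'k) => 'k, 'k) rat_fun"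
		and H :: "(('z => 'k) => 'k) divisor => ('z, 'k) rat_fun"
		and N :: "('n, 'k) alg_group" +
	fixes iota :: "(('z => 'k) => 'k) divisor set => 'n => 'k"
		and tau :: "'n => (('z => 'k) => 'k, 'k) cox_point => (('z => 'k) => 'k, 'k) cox_point"
	assumes neron_severi: "neron_severi_quasitorus V L F N iota tau"
begin

abbreviation ch where "ch D == iota (kappa D)"

lemma iota_iso: "iota : iso (class_group V) (character_group N)"
	using neron_severi by (simp add: neron_severi_quasitorus_def)

lemma ch_closed: "D : L ==> ch D : carrier (character_group N)"
	using iota_iso kappa(1) by (auto simp: iso_def hom_def)

lemma ch_add: "D : L ==> E : L ==> ch (D + E) = ch D \<otimes>\<^bsub>character_group N\<^esub> ch E"
	using iota_iso kappa(1)[of D] kappa(1)[of E] by (auto simp: iso_def hom_def kappa(2))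

lemma ch_surj: "chi : carrier (character_group N) ==> EX D:L. chi = ch D"
proof -
	assume "chi : carrier (character_group N)"
	then obtain u where "u : carrier (class_group V)" "chi = iota u" using iota_iso by (auto simp: iso_def bij_betw_def)
	thus ?thesis using kappa(5) by auto
qed

lemma ch_hom: "ch : hom LG (character_group N)" using ch_closed ch_add by (intro homI) (simp_all add: VN.weil_mult)

lemma ch_trivial_iff:
	assumes D: "D : L"
	shows "ch D = \<one>\<^bsub>character_group N\<^esub> \<longleftrightarrow> D : PV"
proof -
	interpret C: comm_group "character_group N" by (rule NG.character_comm_group)
	have "ch 0 \<otimes>\<^bsub>character_group N\<^esub> ch 0 = ch 0" using ch_add[OF L_closed(1) L_closed(1)] by simp
	hence one: "ch 0 = \<one>\<^bsub>character_group N\<^esub>" using ch_closed[OF L_closed(1)] by auto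
	have "inj_on iota (carrier (class_group V))" using iota_iso by (simp add: iso_def bij_betw_def)
	hence "ch D = ch 0 \<longleftrightarrow> kappa D = kappa 0" using inj_on_eq_iff kappa(1) D L_closed(1) by metis
	also have "\<dots> \<longleftrightarrow> kappa D = \<one>\<^bsub>class_group V\<^esub>" using kappa(3)[OF L_closed(1)] principal_closed(1) by simp
	finally show ?thesis using kappa(3)[OF D] one by simp
qed

lemma ch_nonzero: "D : L ==> n : carrier N ==> ch D n ~= 0"
	and ch_group_mult: "D : L ==> n : carrier N ==> m : carrier N ==> ch D (n \<otimes>\<^bsub>N\<^esub> m) = ch D n * ch D m"
	using ch_closed NG.character_iff unfolding multiplicative_def by blast+

lemma \<delta>_nonzero: "D : L ==> g : carrier Q ==> \<delta> D g ~= 0"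
	and \<delta>_group_mult: "D : L ==> g : carrier Q ==> h : carrier Q ==> \<delta> D (g \<otimes>\<^bsub>Q\<^esub> h) = \<delta> D g * \<delta> D h"
	using \<delta>(1) QG.character_iff unfolding multiplicative_def by blast+

lemma N_separate:
	assumes "n : carrier N" "m : carrier N" "!!D. D : L ==> ch D n = ch D m"
	shows "n = m" using NG.characters_separate[OF assms(1,2)] ch_surj assms(3) by auto

text \<open>Both \<open>\<delta>\<close> and \<open>ch\<close> have the principal divisors as kernel, so by duality points of one
	quasitorus give points of the other.\<close>

lemma N_point:
	assumes g: "g : carrier Q"
	obtains n where "n : carrier N" "!!D. D : L ==> ch D n = \<delta> D g"
proof -
	have "multiplicative LG (%D. \<delta> D g)"
		unfolding multiplicative_def LG using \<delta>_nonzero[OF _ g] \<delta>_add g by (simp add: QG.character_mult)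
	then obtain theta where theta: "multiplicative (character_group N) theta" "!!D. D : carrier LG ==> theta (ch D) = \<delta> D g"
	proof (rule extend_multiplicative[OF NG.character_comm_group LG(1) ch_hom])
		show "\<delta> D g = 1" if "D : carrier LG" "ch D = \<one>\<^bsub>character_group N\<^esub>" for D
			using that ch_trivial_iff \<delta>_principal g by (simp add: LG QG.character_one)
	qed blast
	obtain n where "n : carrier N" "!!chi. chi : carrier (character_group N) ==> chi n = theta chi"
		using NG.point_of_characters[OF theta(1)] by auto
	thus ?thesis using that theta(2) ch_closed by simp
qed

text \<open>A multiplicative function on \<open>L\<close> that is trivial on principal divisors factors through the weights, and
	extends from the weights to all characters.\<close>

lemma Q_point:
	assumes b: "!!D. D : L ==> b D ~= 0" "!!D E. D : L ==> E : L ==> b (D + E) = b D * b E"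
		"!!D. D : L ==> D : PV ==> b D = 1"
	obtains g where "g : carrier Q" "!!D. D : L ==> \<delta> D g = b D"
proof -
	have "multiplicative LG b" unfolding multiplicative_def LG using b(1,2) by simp
	then obtain theta where theta: "multiplicative XQ theta" "!!D. D : carrier LG ==> theta (\<delta> D) = b D"
	proof (rule extend_multiplicative[OF QG.character_comm_group LG(1) \<delta>_hom])
		show "b D = 1" if "D : carrier LG" "\<delta> D = \<one>\<^bsub>XQ\<^esub>" for D using that \<delta>_trivial b(3) by simp
	qed blast
	obtain g where "g : carrier Q" "!!chi. chi : chars ==> chi g = theta chi"
		using QG.point_of_characters[OF theta(1)] by auto
	thus ?thesis using that theta(2) \<delta>(1) by simp
qed

definition mu :: "'g => 'n" where
	"mu g = (SOME n. n : carrier N & (ALL D:L. ch D n = \<delta> D g))"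

lemma mu: assumes "g : carrier Q" shows "mu g : carrier N" "!!D. D : L ==> ch D (mu g) = \<delta> D g"
proof -
	have "EX n. n : carrier N & (ALL D:L. ch D n = \<delta> D g)" using N_point[OF assms] by metis
	hence "mu g : carrier N & (ALL D:L. ch D (mu g) = \<delta> D g)" unfolding mu_def by (rule someI_ex)
	thus "mu g : carrier N" "!!D. D : L ==> ch D (mu g) = \<delta> D g" by blast+
qed

lemma mu_alg_group_hom: "alg_group_hom Q N mu" unfolding alg_group_hom_def
proof
	show "mu : hom Q N"
	proof (rule homI)
		show "mu g : carrier N" if "g : carrier Q" for g by (rule mu(1)[OF that])
		show "mu (g \<otimes>\<^bsub>Q\<^esub> h) = mu g \<otimes>\<^bsub>N\<^esub> mu h" if "g : carrier Q" "h : carrier Q" for g h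
			using that by (intro N_separate) (simp_all add: mu ch_group_mult \<delta>_group_mult)
	qed
	have comb: "(\<lambda>g\<in>carrier Q. combination xs (mu g)) : regular Q" if "snd ` set xs \<subseteq> carrier (character_group N)" for xs
		using that
	proof (induction xs)
		case Nil
		have eq: "(\<lambda>g\<in>carrier Q. combination [] (mu g)) = (\<lambda>g\<in>carrier Q. 0)"
			by (intro restrict_ext) (rule combination_simps(1))
		show ?case unfolding eq by (rule QG.GV.reg_zero[unfolded QG.GV_simps])
	next
		case (Cons a xs)
		obtain c chi where a: "a = (c, chi)" by (cases a)
		obtain D where D: "D : L" "chi = ch D" using ch_surj Cons.prems a by auto
		have \<delta>D: "\<delta> D : regular Q" using \<delta>(1)[OF D(1)] QG.character_iff by simp
		have IH: "(\<lambda>g\<in>carrier Q. combination xs (mu g)) : regular Q" using Cons.prems by (intro Cons.IH) simp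
		note scale = QG.GV.reg_scale[of "\<delta> D" c, unfolded QG.GV_simps, OF \<delta>D]
		have eq: "(\<lambda>g\<in>carrier Q. combination (a # xs) (mu g)) =
				(\<lambda>g\<in>carrier Q. (\<lambda>g\<in>carrier Q. c * \<delta> D g) g + (\<lambda>g\<in>carrier Q. combination xs (mu g)) g)"
			using mu(2)[OF _ D(1)] by (intro restrict_ext) (simp add: a D(2))
		show ?case unfolding eq by (rule QG.GV.reg_add[unfolded QG.GV_simps, OF scale IH])
	qed
	show "morphism (group_variety Q) (group_variety N) mu" unfolding morphism_def
	proof (intro conjI ballI funcsetI)
		show "mu g : points (group_variety N)" if "g : points (group_variety Q)" for g using that mu(1) by simp
		fix f assume "f : regs (group_variety N)"
		then obtain xs where xs: "snd ` set xs \<subseteq> carrier (character_group N)" "ALL n:carrier N. f n = combination xs n"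
			using NG.characters_span[of f] by (auto simp: span_on_def)
		have "(\<lambda>g\<in>carrier Q. f (mu g)) = (\<lambda>g\<in>carrier Q. combination xs (mu g))"
			using xs(2) mu(1) by (intro restrict_ext) simp
		thus "(\<lambda>g\<in>points (group_variety Q). f (mu g)) : regs (group_variety Q)" using comb[OF xs(1)] by simp
	qed
qed

lemma mu_surj: "mu ` carrier Q = carrier N"
proof
	show "mu ` carrier Q \<subseteq> carrier N" using mu(1) by auto
	show "carrier N \<subseteq> mu ` carrier Q"
	proof
		fix n assume n: "n : carrier N"
		obtain g where g: "g : carrier Q" "!!D. D : L ==> \<delta> D g = ch D n"
		proof (rule Q_point[of "%D. ch D n"])
			show "ch D n ~= 0" if "D : L" for D by (rule ch_nonzero[OF that n])
			show "ch (D + E) n = ch D n * ch E n" if "D : L" "E : L" for D E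
				using ch_add[OF that] n by (simp add: NG.character_mult)
			show "ch D n = 1" if "D : L" "D : PV" for D
				using ch_trivial_iff[OF that(1)] that(2) n by (simp add: NG.character_one)
		qed blast
		have "mu g = n" using g n mu[OF g(1)] by (intro N_separate) simp_all
		thus "n : mu ` carrier Q" using g(1) by auto
	qed
qed

lemma tau_in_degree:
	assumes n: "n : carrier N" and p: "p : alg_homs R" and D: "D : L" and f: "f : OV D"
	shows "tau n p : alg_homs R" "tau n p (cl (indeg D f)) = ch D n * p (cl (indeg D f))"
proof -
	have "group_action N (points (cox_space V L F)) tau"
		using neron_severi by (simp add: neron_severi_quasitorus_def regular_action_def)
	thus taup: "tau n p : alg_homs R"
		using group_action.element_image[of N "points (cox_space V L F)" tau n p] n p by (simp add: cox_space_simps)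
	have "{E. indeg D f E ~= 0\<^sub>L} \<subseteq> kappa D" using kappa(4)[OF D] by (auto simp: in_degree_def)
	hence "cl (indeg D f) : cox_component V L F (kappa D)"
		unfolding cox_component_def using in_degree_closed[OF D f] by auto
	hence "spec_function R (cl (indeg D f)) : weight_space N (cox_space V L F) tau (ch D)"
		using neron_severi kappa(1)[OF D] by (simp add: neron_severi_quasitorus_def)
	hence "spec_function R (cl (indeg D f)) (tau n p) = ch D n * spec_function R (cl (indeg D f)) p"
		using n p by (simp add: weight_space_def cox_space_simps)
	thus "tau n p (cl (indeg D f)) = ch D n * p (cl (indeg D f))" using taup p by (simp add: spec_function_def)
qed

lemma nu_in_degree: "D : L ==> f : OV D ==> nu z (cl (indeg D f)) = phi D f z"
	using nu_cl[OF in_degree_closed] Phi_in_degree by simp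

lemma zero_section: "0 : L & 0\<^sub>L : OV 0" using L_closed(1) VN.sections_zero by simp

theorem cox_lift_exists: "cox_lift Z Q rho pi V L F N tau mu nu" unfolding cox_lift_def
proof (intro conjI ballI)
	fix g z assume g: "g : carrier Q" and z: "z : points Z"
	note p = nu_point[OF z] nu_point[OF action_closed[OF g z]]
	show "nu (rho g z) = tau (mu g) (nu z)"
	proof (rule alg_homs_R_eqI[OF p(2)])
		show "tau (mu g) (nu z) : alg_homs R" using tau_in_degree(1)[OF mu(1)[OF g] p(1)] zero_section by auto
		fix D f assume D: "D : L" "f : OV D"
		show "nu (rho g z) (cl (indeg D f)) = tau (mu g) (nu z) (cl (indeg D f))"
			using tau_in_degree(2)[OF mu(1)[OF g] p(1) D] wsD(2)[OF \<delta>(2)[OF D] g z] mu(2)[OF g D(1)] D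
			by (simp add: nu_in_degree)
	qed
qed (use mu_alg_group_hom mu_surj nu_morphism nu_dominant nu_realization in simp_all)

section \<open>Uniqueness\<close>

text \<open>Any other lift multiplies every graded piece by a constant: the functions that it assigns to the
	sections of \<open>D\<close> have another multiplier of \<open>D\<close> in common.\<close>

lemma cox_lift_unique:
	assumes lift: "cox_lift Z Q rho pi V L F N tau mu' nu'"
	shows "ALL g:carrier Q. mu' g = mu g" "EX g:carrier Q. ALL z:points Z. nu' z = nu (rho g z)"
proof -
	have hom: "alg_group_hom Q N mu'" and mor: "morphism Z (cox_space V L F) nu'"
		and eqv: "!!g z. g : carrier Q ==> z : points Z ==> nu' (rho g z) = tau (mu' g) (nu' z)"
		and real: "!!z. z : points Z ==> cox_realization V L F (nu' z) = pi z" using lift by (auto simp: cox_lift_def)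
	have mu'N: "mu' g : carrier N" if "g : carrier Q" for g using hom that by (auto simp: alg_group_hom_def hom_def)
	have pt: "nu' z : alg_homs R" if "z : points Z" for z using mor that by (auto simp: morphism_def cox_space_simps)
	define alpha where "alpha s = (\<lambda>z\<in>points Z. nu' z (cl s))" for s
	have alpha_apply: "alpha s z = nu' z (cl s)" if "z : points Z" for s z using that by (simp add: alpha_def)
	have alpha_regs: "alpha s : regs Z" if s: "s : carrier T" for s
	proof -
		have "spec_function R (cl s) : regs (cox_space V L F)" unfolding cox_space_simps using cl_closed[OF s] by simp
		hence "(\<lambda>z\<in>points Z. spec_function R (cl s) (nu' z)) : regs Z" using mor by (simp add: morphism_def)
		moreover have "(\<lambda>z\<in>points Z. spec_function R (cl s) (nu' z)) = alpha s"
			unfolding alpha_def using pt by (intro restrict_ext) (simp add: spec_function_def)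
		ultimately show ?thesis by simp
	qed
	define psi where "psi D f = alpha (indeg D f)" for D f
	have psi_regs: "psi D f : regs Z" if "D : L" "f : OV D" for D f
		unfolding psi_def by (rule alpha_regs[OF in_degree_closed[OF that]])
	have psi_mult: "psi (D + E) (f *\<^sub>L g) = psi D f *\<^sub>Z psi E g"
		if D: "D : L" "E : L" "f : OV D" "g : OV E" for D E f g
	proof (rule ZN.reg_eqI)
		show "psi (D + E) (f *\<^sub>L g) : regs Z" by (rule psi_regs[OF L_closed(2)[OF D(1,2)] VN.sections_mult[OF D(3,4)]])
		show "psi D f *\<^sub>Z psi E g : regs Z" using ZN.FR.m_closed[of "psi D f" "psi E g"] psi_regs D by simp
		fix z assume z: "z : points Z"
		show "psi (D + E) (f *\<^sub>L g) z = (psi D f *\<^sub>Z psi E g) z"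
			using alg_homs_R(2)[OF pt[OF z] in_degree_closed[OF D(1,3)] in_degree_closed[OF D(2,4)]] z
			by (simp add: psi_def alpha_apply in_degree_mult[OF D])
	qed
	have psi_rat: "psi 0 (rV a) = pull a" if a: "a : regs V" for a
	proof (rule ZN.reg_eqI[OF psi_regs[OF L_closed(1) VN.sections_rat[OF a]] pull_regs[OF a]])
		fix z assume z: "z : points Z"
		let ?x = "%f. nu' z (cl (indeg 0 (rV f)))"
		note x = alg_homs_R[OF pt[OF z]]
		have c: "indeg 0 (rV f) : carrier T" if "f : regs V" for f
			by (rule in_degree_closed[OF L_closed(1) VN.sections_rat[OF that]])
		obtain p where p: "p : points V" "!!f. f : regs V ==> ?x f = f p"
		proof (rule VN.alg_homsI[of ?x])
			fix f g assume fg: "f : regs V" "g : regs V"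
			have "rV (f *\<^sub>V g) = rV f *\<^sub>L rV g"
				"rV (f +\<^sub>V g) = rV f +\<^sub>L rV g" using fg by auto
			hence "indeg 0 (rV (f *\<^sub>V g)) = indeg 0 (rV f) *\<^sub>T indeg 0 (rV g)"
				"indeg 0 (rV (f +\<^sub>V g)) = indeg 0 (rV f) +\<^sub>T indeg 0 (rV g)"
				using in_degree_mult[OF L_closed(1) L_closed(1) VN.sections_rat[OF fg(1)] VN.sections_rat[OF fg(2)]]
			by (simp_all add: in_degree_add)
			thus "?x (f *\<^sub>V g) = ?x f * ?x g" "?x (f +\<^sub>V g) = ?x f + ?x g" using x(1,2)[OF c[OF fg(1)] c[OF fg(2)]] by auto
		next
			have "indeg 0 (rV 1\<^sub>V) = 1\<^sub>T" unfolding VN.rat.hom_one T_simps ..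
			thus "?x 1\<^sub>V = 1" using x(3)[OF T_one_closed] by simp
		next
			fix k f assume f: "f : regs V"
			have "k \<odot>\<^bsub>KV\<^esub> rV f = rV (k \<odot>\<^bsub>AV\<^esub> f)" unfolding rat_of_reg_def by (rule VN.quot_smult[OF f VN.nzs_one])
			hence "indeg 0 (rV (k \<odot>\<^bsub>AV\<^esub> f)) = k \<odot>\<^sub>T indeg 0 (rV f)"
				using T_smult_in_degree[OF VN.rat_closed[OF f], of k 0] by simp
			thus "?x (k \<odot>\<^bsub>AV\<^esub> f) = k * ?x f" using x(4)[OF c[OF f], of k] by simp
		qed blast
		have "(\<lambda>f\<in>regs V. nu' z (cox_of_reg V L F f)) = eval_at V p"
			unfolding eval_at_def cox_of_reg_eq using p(2) by (intro restrict_ext) simp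
		hence "pi z = p" using real[OF z] inv_into_f_f[OF eval_at_inj p(1)] by (simp add: cox_realization_def)
		thus "psi 0 (rV a) z = pull a z" using p(2)[OF a] z by (simp add: psi_def alpha_apply)
	qed
	define chi where "chi D = (\<lambda>g\<in>carrier Q. ch D (mu' g))" for D
	have chi: "chi D : chars" if D: "D : L" for D
	proof -
		have "morphism (group_variety Q) (group_variety N) mu'" and m: "!!g h. g : carrier Q ==> h : carrier Q ==> mu' (g \<otimes>\<^bsub>Q\<^esub> h) = mu' g \<otimes>\<^bsub>N\<^esub> mu' h"
			using hom by (auto simp: alg_group_hom_def hom_def)
		hence "chi D : regular Q" using ch_closed[OF D] NG.character_iff unfolding chi_def morphism_def by simp
		moreover have "multiplicative Q (chi D)"
			unfolding multiplicative_def chi_def using ch_nonzero[OF D mu'N] ch_group_mult[OF D mu'N mu'N] m by simp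
		ultimately show ?thesis using QG.character_iff by simp
	qed
	have psi_ws: "psi D f : ws (chi D)" if D: "D : L" "f : OV D" for D f
	proof (rule wsI[OF psi_regs[OF D]])
		fix g z assume g: "g : carrier Q" and z: "z : points Z"
		show "psi D f (rho g z) = chi D g * psi D f z"
			using tau_in_degree(2)[OF mu'N[OF g] pt[OF z] D] g z action_closed[OF g z]
			by (simp add: psi_def alpha_apply eqv chi_def)
	qed
	let ?r = "rZ"
	have pair: "?r (psi D f) *\<^sub>K ?r (psi (- D) f') = inc f *\<^sub>K inc f'"
		if D: "D : L" "f : OV D" "f' : OV (- D)" for D f f'
	proof -
		have "f *\<^sub>L f' : OV 0" using VN.sections_mult[OF D(2,3)] by simp
		then obtain c where c: "c : regs V" "f *\<^sub>L f' = rV c" unfolding VN.sections_0 by blast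
		note r = psi_regs[OF D(1,2)] psi_regs[OF L_closed(3)[OF D(1)] D(3)]
		have "?r (psi D f) *\<^sub>K ?r (psi (- D) f') = ?r (psi D f *\<^sub>Z psi (- D) f')" using r by simp
		also have "psi D f *\<^sub>Z psi (- D) f' = psi 0 (f *\<^sub>L f')"
			using psi_mult[OF D(1) L_closed(3)[OF D(1)] D(2,3)] by simp
		also have "?r (psi 0 (f *\<^sub>L f')) = inc (f *\<^sub>L f')"
			unfolding c(2) psi_rat[OF c(1)] by (rule inc_rat[OF c(1), symmetric])
		finally show ?thesis using VN.sections_carrier[OF D(2)] VN.sections_carrier[OF D(3)] by simp
	qed
	have const: "EX c. c ~= 0 & (ALL f:OV D. ALL z:points Z. psi D f z = c * phi D f z)" if D: "D : L" for D
	proof -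
		have mD: "- D : L" by (rule L_closed(3)[OF D])
		obtain s where s: "s : OV D" "s : VN.Kx" using VN.sections_nonzero[OF L_weil[OF D]] .
		obtain s' where s': "s' : OV (- D)" "s' : VN.Kx" using VN.sections_nonzero[OF L_weil[OF mD]] .
		define x where "x = ?r (psi D s)"
		define y where "y = ?r (psi (- D) s')"
		have car: "x : carrier KZ" "y : carrier KZ" "inc s : ZN.Kx" "inc s' : ZN.Kx"
			using psi_regs D mD s s' inc_Kx by (auto simp: x_def y_def)
		have xy: "x *\<^sub>K y = inc s *\<^sub>K inc s'" unfolding x_def y_def by (rule pair[OF D s(1) s'(1)])
		have "inc s *\<^sub>K inc s' ~= 0\<^sub>K" using ZN.Kx_mult[OF car(3,4)] by simp
		hence nz: "x ~= 0\<^sub>K" "y ~= 0\<^sub>K" unfolding xy[symmetric] using car by auto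
		have yK: "y : ZN.Kx" using car nz by simp
		have yi: "inv\<^sub>K y : carrier KZ" "y *\<^sub>K inv\<^sub>K y = 1\<^sub>K" using ZN.Kx_inv[OF yK] by auto
		define h where "h = inc s' *\<^sub>K inv\<^sub>K y"
		have "psi (- D) s' ~= 0\<^sub>Z" using nz(2) ZN.rat_zero_iff[OF psi_regs[OF mD s'(1)]] by (simp add: y_def)
		hence "psi (- D) s' : homs"
			unfolding homs_def ZN.FR_nonzero[symmetric] using psi_regs[OF mD s'(1)] psi_ws[OF mD s'(1)] chi[OF mD] by auto
		hence yh: "y : hfracs" unfolding y_def by (rule rat_hom_fraction)
		have hh: "h : hfracs"
			unfolding h_def using hfracs_mult hfracs_inv[OF yh] multipliersD(1)[OF inc_multiplier[OF s'(2)]] by simp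
		have hK: "h : ZN.Kx" using hfracs_Kx[OF hh] .
		have pos: "inc f *\<^sub>K h = ?r (psi D f)" if f: "f : OV D" for f
		proof -
			have c: "inc f : carrier KZ" "?r (psi D f) : carrier KZ" "inc s' : carrier KZ"
				using sections_inc[OF f] ZN.rat_closed[OF psi_regs[OF D f]] car(4) by auto
			have "inc f *\<^sub>K h = (inc f *\<^sub>K inc s') *\<^sub>K inv\<^sub>K y" unfolding h_def using c yi(1) by (simp add: ZN.K.m_assoc)
			also have "\<dots> = (?r (psi D f) *\<^sub>K y) *\<^sub>K inv\<^sub>K y" using pair[OF D f s'(1)] by (simp add: y_def)
			also have "\<dots> = ?r (psi D f)" using c car(2) yi by (simp add: ZN.K.m_assoc)
			finally show ?thesis .
		qed
		have neg: "inc f' *\<^sub>K inv\<^sub>K h = ?r (psi (- D) f')" if f': "f' : OV (- D)" for f'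
		proof -
			have c: "inc f' : carrier KZ" "?r (psi (- D) f') : carrier KZ" "inc s' : carrier KZ" "inc s : carrier KZ"
				using sections_inc[OF f'] ZN.rat_closed[OF psi_regs[OF mD f']] car(3,4) by auto
			have hc: "h : carrier KZ" "inv\<^sub>K h : carrier KZ" "h *\<^sub>K inv\<^sub>K h = 1\<^sub>K" using ZN.Kx_inv[OF hK] hK by auto
			have "x *\<^sub>K ?r (psi (- D) f') = inc s *\<^sub>K inc f'" unfolding x_def by (rule pair[OF D s(1) f'])
			also have "\<dots> = (inc s *\<^sub>K h) *\<^sub>K (inc f' *\<^sub>K inv\<^sub>K h)"
				unfolding ZN.K.rearrange(3)[OF c(4) hc(1) c(1) hc(2)] hc(3) using c by simp
			also have "inc s *\<^sub>K h = x" unfolding x_def by (rule pos[OF s(1)])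
			finally show ?thesis
				using ZN.K.m_lcancel[OF nz(1) car(1), of "?r (psi (- D) f')" "inc f' *\<^sub>K inv\<^sub>K h"] c hc by simp
		qed
		have "h : multipliers D" unfolding multipliers_def using hh pos neg psi_regs[OF D] psi_regs[OF mD] by simp
		then obtain c where c: "c ~= 0" "h = scalar c *\<^sub>K H D" using multipliers_unique[OF L_weil[OF D] H[OF D]] by auto
		have "psi D f z = c * phi D f z" if f: "f : OV D" and z: "z : points Z" for f z
		proof -
			note r = phi[OF D f]
			have "?r (psi D f) = scalar c *\<^sub>K (inc f *\<^sub>K H D)"
				unfolding pos[OF f, symmetric] c(2) using sections_inc[OF f] scalar_closed[of c] H_Kx[OF D] ZN.K.m_lcomm by simp
			also have "\<dots> = ?r ((c \<odot>\<^bsub>AZ\<^esub> 1\<^sub>Z) *\<^sub>Z phi D f)" unfolding r(2)[symmetric] using const_regs r(1) by simp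
			finally have "psi D f = (c \<odot>\<^bsub>AZ\<^esub> 1\<^sub>Z) *\<^sub>Z phi D f"
				using ZN.rat_eq_iff[OF psi_regs[OF D f], of "(c \<odot>\<^bsub>AZ\<^esub> 1\<^sub>Z) *\<^sub>Z phi D f"] ZN.FR.m_closed[of "c \<odot>\<^bsub>AZ\<^esub> 1\<^sub>Z" "phi D f"] const_regs r(1)
			by simp
			thus ?thesis using z by simp
		qed
		thus ?thesis using c(1) by auto
	qed
	then obtain b where b: "!!D. D : L ==> b D ~= 0"
			"!!D f z. D : L ==> f : OV D ==> z : points Z ==> psi D f z = b D * phi D f z" by metis
	have witness: "EX f:OV D. f : VN.Kx & phi D f : ZN.nzs" if D: "D : L" for D
		using VN.sections_nonzero[OF L_weil[OF D]] phi_nonzero[OF D] by metis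
	have chi\<delta>: "chi D = \<delta> D" if D: "D : L" for D
	proof -
		obtain f where f: "f : OV D" "f : VN.Kx" using witness[OF D] by auto
		have "phi D f : ws (chi D)"
		proof (rule wsI[OF phi(1)[OF D f(1)]])
			fix g z assume g: "g : carrier Q" and z: "z : points Z"
			have "b D * phi D f (rho g z) = b D * (chi D g * phi D f z)"
				using wsD(2)[OF psi_ws[OF D f(1)] g z] b(2)[OF D f(1) z] b(2)[OF D f(1) action_closed[OF g z]] by simp
			thus "phi D f (rho g z) = chi D g * phi D f z" using b(1)[OF D] by simp
		qed
		thus ?thesis using \<delta>_eqI[OF D f _ chi[OF D]] by simp
	qed
	show "ALL g:carrier Q. mu' g = mu g"
	proof
		fix g assume g: "g : carrier Q"
		show "mu' g = mu g"
		proof (rule N_separate[OF mu'N[OF g] mu(1)[OF g]])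
			fix D assume D: "D : L"
			show "ch D (mu' g) = ch D (mu g)" using fun_cong[OF chi\<delta>[OF D], of g] mu(2)[OF g D] g by (simp add: chi_def)
		qed
	qed
	obtain g where g: "g : carrier Q" "!!D. D : L ==> \<delta> D g = b D"
	proof (rule Q_point[of b])
		show "b (D + E) = b D * b E" if D: "D : L" "E : L" for D E
		proof -
			obtain f where f: "f : OV D" "phi D f : ZN.nzs" using witness[OF D(1)] by auto
			obtain f' where f': "f' : OV E" "phi E f' : ZN.nzs" using witness[OF D(2)] by auto
			obtain z where z: "z : points Z" "(phi D f *\<^sub>Z phi E f') z ~= 0"
				using ZN.nzs_mult[OF f(2) f'(2)] by (auto simp: ZN.nzs_def)
			have "b (D + E) * (phi D f *\<^sub>Z phi E f') z = psi (D + E) (f *\<^sub>L f') z"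
				using b(2)[OF L_closed(2)[OF D] VN.sections_mult[OF f(1) f'(1)] z(1)] phi_mult[OF D f(1) f'(1)] by simp
			also have "\<dots> = (b D * phi D f z) * (b E * phi E f' z)"
				unfolding psi_mult[OF D f(1) f'(1)] using b(2)[OF D(1) f(1) z(1)] b(2)[OF D(2) f'(1) z(1)] z(1) by simp
			also have "\<dots> = (b D * b E) * (phi D f *\<^sub>Z phi E f') z" using z(1) by simp
			finally show ?thesis using z(2) by simp
		qed
		show "b D = 1" if D: "D : L" "D : PV" for D
		proof -
			obtain f where f: "f : OV D" "phi D f : ZN.nzs" using witness[OF D(1)] by auto
			obtain z where z: "z : points Z" "phi D f z ~= 0" using f(2) by (auto simp: ZN.nzs_def)
			have D0: "D - 0 : PV" using D(2) by simp
			define f' where "f' = F (D - 0) *\<^sub>L f"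
			have f': "f' : OV 0" "phi 0 f' = phi D f"
				unfolding f'_def using phi_shift[OF D(1) L_closed(1) D0 f(1)] by blast+
			have "cl (indeg D f) = cl (indeg 0 f')"
				using cl_eq_iff[OF in_degree_closed[OF D(1) f(1)] in_degree_closed[OF L_closed(1) f'(1)]] Phi_in_degree[OF D(1) f(1)] Phi_in_degree[OF L_closed(1) f'(1)] f'(2)
			by simp
			hence "psi D f = psi 0 f'" by (simp add: psi_def alpha_def)
			moreover obtain c where "c : regs V" "f' = rV c" using f'(1) unfolding VN.sections_0 by blast
			ultimately have "psi D f = phi D f" using psi_rat phi_rat f'(2) by simp
			thus ?thesis using b(2)[OF D(1) f(1) z(1)] z(2) by simp
		qed
	qed (use b(1) in blast)+
	have "nu' z = nu (rho g z)" if z: "z : points Z" for z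
	proof (rule alg_homs_R_eqI[OF pt[OF z] nu_point[OF action_closed[OF g(1) z]]])
		fix D f assume D: "D : L" "f : OV D"
		have "nu' z (cl (indeg D f)) = b D * phi D f z" using b(2)[OF D z] z by (simp add: psi_def alpha_apply)
		also have "\<dots> = phi D f (rho g z)" using wsD(2)[OF \<delta>(2)[OF D] g(1) z] g(2)[OF D(1)] by simp
		finally show "nu' z (cl (indeg D f)) = nu (rho g z) (cl (indeg D f))" using nu_in_degree[OF D] by simp
	qed
	thus "EX g:carrier Q. ALL z:points Z. nu' z = nu (rho g z)" using g(1) by auto
qed

end

section \<open>Existence and uniqueness of the lift\<close>

theorem theorem4p1:
	fixes Z :: "('z, 'k::{alg_closed_field, field_char_0}) variety"
		and Q :: "('g, 'k) alg_group" and \<rho> :: "'g \<Rightarrow> 'z \<Rightarrow> 'z"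
		and V :: "(('z \<Rightarrow> 'k) \<Rightarrow> 'k, 'k) variety" and \<pi> :: "'z \<Rightarrow> ('z \<Rightarrow> 'k) \<Rightarrow> 'k"
		and L :: "(('z \<Rightarrow> 'k) \<Rightarrow> 'k) divisor set"
		and F :: "(('z \<Rightarrow> 'k) \<Rightarrow> 'k) divisor \<Rightarrow> (('z \<Rightarrow> 'k) \<Rightarrow> 'k, 'k) rat_fun"
		and N :: "('n, 'k) alg_group"
		and \<iota> :: "(('z \<Rightarrow> 'k) \<Rightarrow> 'k) divisor set \<Rightarrow> 'n \<Rightarrow> 'k"
		and \<tau> :: "'n \<Rightarrow> (('z \<Rightarrow> 'k) \<Rightarrow> 'k, 'k) cox_point \<Rightarrow> (('z \<Rightarrow> 'k) \<Rightarrow> 'k, 'k) cox_point"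
	assumes Z: "affine_variety Z" "irreducible_variety Z" "normal_variety Z"
		and Q: "quasitorus Q" "regular_action Q Z \<rho>" "uncontracting Q Z \<rho>"
		and graded: "factorially_graded_variety Q Z \<rho>"
		and quotient: "V = affine_quotient Q Z \<rho>" "\<pi> = quotient_morphism Q Z \<rho>"
		and LF: "presenting_subgroup V L" "coherent V L F"
		and cox: "has_cox_realization V L F"
		and N: "neron_severi_quasitorus V L F N \<iota> \<tau>"
	shows "(\<exists>\<mu> \<nu>. cox_lift Z Q \<rho> \<pi> V L F N \<tau> \<mu> \<nu>) \<and>
		(\<forall>\<mu> \<nu> \<mu>' \<nu>'. cox_lift Z Q \<rho> \<pi> V L F N \<tau> \<mu> \<nu> \<and> cox_lift Z Q \<rho> \<pi> V L F N \<tau> \<mu>' \<nu>' \<longrightarrow>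
			 (\<forall>g\<in>carrier Q. \<mu>' g = \<mu> g) \<and>
			 (\<exists>g\<in>carrier Q. \<forall>z\<in>points Z. \<nu>' z = \<nu> (\<rho> g z)))"
proof -
	have V: "affine_variety V" "normal_variety V"
		using cox by (auto simp: has_cox_realization_def)
	interpret CQ: cox_quotient Z Q \<rho> V L F
		using Z Q V graded quotient(1) LF by unfold_locales
	obtain H where H: "\<And>D. D \<in> L \<Longrightarrow> H D \<in> CQ.multipliers D"
		"\<And>D E. D \<in> L \<Longrightarrow> E \<in> L \<Longrightarrow> H (D + E) = H D \<otimes>\<^bsub>rat_funs Z\<^esub> H E"
		"\<And>D. D \<in> L \<Longrightarrow> D \<in> principal_divisors V \<Longrightarrow> H D = CQ.inc (F D)"
		using CQ.multiplicative_choice by blast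
	have "quasitorus N" using N by (simp add: neron_severi_quasitorus_def)
	then interpret C: cox_covering Z Q \<rho> V L F H N \<iota> \<tau>
		using H N by unfold_locales
	note \<pi> = quotient(2)
	show ?thesis
	proof (intro conjI allI impI)
		show "\<exists>\<mu> \<nu>. cox_lift Z Q \<rho> \<pi> V L F N \<tau> \<mu> \<nu>"
			unfolding \<pi> using C.cox_lift_exists by auto
	next
		fix \<mu> \<nu> \<mu>' \<nu>'
		assume lifts: "cox_lift Z Q \<rho> \<pi> V L F N \<tau> \<mu> \<nu> \<and> cox_lift Z Q \<rho> \<pi> V L F N \<tau> \<mu>' \<nu>'"
		note l = conjunct1[OF lifts, unfolded \<pi>] and l' = conjunct2[OF lifts, unfolded \<pi>]
		show "\<forall>g\<in>carrier Q. \<mu>' g = \<mu> g"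
			using C.cox_lift_unique(1)[OF l] C.cox_lift_unique(1)[OF l'] by simp
		obtain g where g: "g \<in> carrier Q" "\<And>z. z \<in> points Z \<Longrightarrow> \<nu> z = C.nu (\<rho> g z)"
			using C.cox_lift_unique(2)[OF l] by auto
		obtain g' where g': "g' \<in> carrier Q" "\<And>z. z \<in> points Z \<Longrightarrow> \<nu>' z = C.nu (\<rho> g' z)"
			using C.cox_lift_unique(2)[OF l'] by auto
		define h where "h = inv\<^bsub>Q\<^esub> g \<otimes>\<^bsub>Q\<^esub> g'"
		have h: "h \<in> carrier Q" "g \<otimes>\<^bsub>Q\<^esub> h = g'"
			using g(1) g'(1) by (simp_all add: h_def CQ.QG.m_assoc[symmetric])
		have "\<nu>' z = \<nu> (\<rho> h z)" if z: "z \<in> points Z" for z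
			using g(2)[OF CQ.action_closed[OF h(1) z]] g'(2)[OF z] CQ.action_mult[OF g(1) h(1) z] h(2) by simp
		then show "\<exists>g\<in>carrier Q. \<forall>z\<in>points Z. \<nu>' z = \<nu> (\<rho> g z)"
			using h(1) by auto
	qed
qed

end
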